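(* Let $K$ be a field of characteristic zero, let $m,n\ge 1$, and let $\mathbb{X}$ be a (nonempty finite) set of $s$ distinct points in $\mathbb{P}^m\times\mathbb{P}^n$ over $K$. Then the following statements are equivalent. (a) $\mathbb{X}=CI(d_1,\dots,d_m,d'_1,\dots,d'_n)$ for some positive integers $d_i,d'_j\ge 1$. (b) $\mathbb{X}=\mathbb{X}_1\times\mathbb{X}_2$, and (for some positive integers $d_i,d'_j\geq 1$) $\mathbb{X}_1\subseteq\mathbb{P}^m$ is a complete intersection of type $(d_1,\dots,d_m)$ and $\mathbb{X}_2\subseteq\mathbb{P}^n$ is a complete intersection of type $(d'_1,\dots,d'_n)$. (c) $\mathbb{X}=\mathbb{X}_1\times\mathbb{X}_2$, $\mathbb{X}$ has the Cayley-Bacharach property, and $\operatorname{HF}_{\vartheta_{\mathbb{X}}}(r_{\mathbb{X}_1},r_{\mathbb{X}_2})\neq 0$.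
   Context: $S=K[X_0,\dots,X_m,Y_0,\dots,Y_n]$ is $\mathbb{Z}^2$-graded by $\deg X_i=(1,0)$, $\deg Y_j=(0,1)$. Points of $\mathbb{P}^m\times\mathbb{P}^n$ have coordinates in $K$. $I_{\mathbb{X}}\subseteq S$ is the bihomogeneous vanishing ideal of $\mathbb{X}$, $R_{\mathbb{X}}=S/I_{\mathbb{X}}$, and $x_i,y_j$ are the images of $X_i,Y_j$ in $R_{\mathbb{X}}$. For a bigraded module $M$, $\operatorname{HF}_M(i,j)=\dim_K M_{i,j}$; $\operatorname{HF}_{\mathbb{X}}:=\operatorname{HF}_{R_{\mathbb{X}}}$. $\pi_1,\pi_2$ are the projections of $\mathbb{P}^m\times\mathbb{P}^n$ to $\mathbb{P}^m$ and $\mathbb{P}^n$; $\mathbb{X}_k=\pi_k(\mathbb{X})$. $\operatorname{HF}_{\mathbb{X}_k}$ is the Hilbert function of the homogeneous coordinate ring of $\mathbb{X}_k$, and its regularity index $r_{\mathbb{X}_k}$ is the least integer $i_0$ with $\operatorname{HF}_{\mathbb{X}_k}(i)=|\mathbb{X}_k|$ for all $i\ge i_0$. A finite set of points in $\mathbb{P}^m$ is a complete intersection of type $(d_1,\dots,d_m)$ if its homogeneous vanishing ideal is generated by a homogeneous regular sequence of degrees $d_1,\dots,d_m$. $\mathbb{X}=CI(d_1,\dots,d_m,d'_1,\dots,d'_n)$ means that $I_{\mathbb{X}}$ is generated by a bihomogeneous regular sequence $F_1,\dots,F_m,G_1,\dots,G_n$ with $\deg F_i=(d_i,0)$ and $\deg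 G_j=(0,d'_j)$. $\mathbb{X}$ has the Cayley-Bacharach property if the Hilbert function of $\mathbb{X}\setminus\{p\}$ is independent of the choice of $p\in\mathbb{X}$. $\mathbb{X}$ is arithmetically Cohen-Macaulay (ACM) if $R_{\mathbb{X}}$ is Cohen-Macaulay (equivalently $\operatorname{depth}R_{\mathbb{X}}=2$). Every $\mathbb{X}$ with $\mathbb{X}=\mathbb{X}_1\times\mathbb{X}_2$ is ACM. For ACM $\mathbb{X}$ the coordinates are always assumed to be chosen (by linear changes of the $X_i$ and of the $Y_j$) so that $x_0,y_0$ is a regular sequence in $R_{\mathbb{X}}$. Then the Kähler different $\vartheta_{\mathbb{X}}$ is the bihomogeneous ideal of $R_{\mathbb{X}}$ generated by the images of all $(m+n)$-minors of the Jacobian matrix with rows $\left(\frac{\partial F_k}{\partial X_1},\dots,\frac{\partial F_k}{\partial X_m},\frac{\partial F_k}{\partial Y_1},\dots,\frac{\partial F_k}{\partial Y_n}\right)$, where $\{F_k\}$ is a finite bihomogeneous system of generators of $I_{\mathbb{X}}$ (the initial Fitting ideal of $\Omega^1_{R_{\mathbb{X}}/K[x_0,y_0]}$; independent of the generators). *)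

theory Defs
  imports
    "HOL-Library.Poly_Mapping"
    "HOL-Analysis.Determinants"
    "HOL-Algebra.Embedded_Algebras"
    "HOL-Algebra.QuotRing"
begin

text \<open>
  The numbers \<open>m, n \<ge> 1\<close> are the cardinalities of finite types \<open>'m\<close>, \<open>'n\<close> (types are nonempty).
  The coordinates of \<open>P\<^sup>m\<close> are indexed by \<open>'m option\<close>: \<open>None\<close> is the index \<open>0\<close> and the
  \<open>Some i\<close> are the indices \<open>1, \<dots>, m\<close>; similarly for \<open>P\<^sup>n\<close>. Hence \<open>S\<close> is the whole type
  \<open>('m option + 'n option, 'k) mpolynomial\<close>, where \<open>Inl\<close> marks the \<open>X\<^sub>i\<close> and \<open>Inr\<close> the \<open>Y\<^sub>j\<close>.
\<close>

section \<open>Polynomials\<close>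

type_synonym ('v, 'k) mpolynomial = "('v \<Rightarrow>\<^sub>0 nat) \<Rightarrow>\<^sub>0 'k"

definition Const :: "'k::zero \<Rightarrow> ('v, 'k) mpolynomial" where
  "Const c = Poly_Mapping.single 0 c"

definition Var :: "'v \<Rightarrow> ('v, 'k::zero_neq_one) mpolynomial" where
  "Var x = Poly_Mapping.single (Poly_Mapping.single x 1) 1"

definition eval_poly :: "('v::finite \<Rightarrow> 'k::comm_semiring_1) \<Rightarrow> ('v, 'k) mpolynomial \<Rightarrow> 'k" where
  "eval_poly a f =
    (\<Sum>t\<in>Poly_Mapping.keys f. Poly_Mapping.lookup f t * (\<Prod>x\<in>UNIV. a x ^ Poly_Mapping.lookup t x))"

text \<open>
  If \<open>x\<close> does not occur in the monomial \<open>t\<close>, the truncated difference of exponents is harmless,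
  because the coefficient is then \<open>0\<close>.
\<close>

definition partial_deriv :: "'v \<Rightarrow> ('v, 'k::comm_semiring_1) mpolynomial \<Rightarrow> ('v, 'k) mpolynomial" where
  "partial_deriv x f =
    (\<Sum>t\<in>Poly_Mapping.keys f.
       Poly_Mapping.single (t - Poly_Mapping.single x 1)
         (of_nat (Poly_Mapping.lookup t x) * Poly_Mapping.lookup f t))"

definition poly_ring :: "('v, 'k::comm_ring_1) mpolynomial ring" where
  "poly_ring = \<lparr>carrier = UNIV, mult = (*), one = 1, zero = 0, add = (+)\<rparr>"

definition hom_part :: "nat \<Rightarrow> ('v::finite, 'k::zero) mpolynomial set" where
  "hom_part d = {f. \<forall>t\<in>Poly_Mapping.keys f. (\<Sum>x\<in>UNIV. Poly_Mapping.lookup t x) = d}"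

definition bihom_part :: "nat \<Rightarrow> nat \<Rightarrow> ('a::finite + 'b::finite, 'k::zero) mpolynomial set" where
  "bihom_part i j = {f. \<forall>t\<in>Poly_Mapping.keys f.
     (\<Sum>x\<in>UNIV. Poly_Mapping.lookup t (Inl x)) = i \<and> (\<Sum>y\<in>UNIV. Poly_Mapping.lookup t (Inr y)) = j}"


section \<open>Regular sequences, depth and graded pieces of quotients\<close>

definition regular_sequence :: "('r, 's) ring_scheme \<Rightarrow> 'r list \<Rightarrow> bool" where
  "regular_sequence R fs \<longleftrightarrow>
     set fs \<subseteq> carrier R \<and>
     (\<forall>i<length fs. \<forall>a\<in>carrier R.
        a \<otimes>\<^bsub>R\<^esub> (fs ! i) \<in> genideal R (set (take i fs)) \<longrightarrow> a \<in> genideal R (set (take i fs))) \<and>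
     genideal R (set fs) \<noteq> carrier R"

definition depth :: "('r, 's) ring_scheme \<Rightarrow> 'r set \<Rightarrow> nat" where
  "depth R \<mm> = (GREATEST k. \<exists>fs. length fs = k \<and> set fs \<subseteq> \<mm> \<and> regular_sequence R fs)"

definition residue ::
  "('v, 'k::comm_ring_1) mpolynomial set \<Rightarrow> ('v, 'k) mpolynomial \<Rightarrow> ('v, 'k) mpolynomial set" where
  "residue I f = I +>\<^bsub>poly_ring\<^esub> f"

text \<open>
  For a homogeneous ideal \<open>M\<close> of the quotient ring by \<open>I\<close>, and \<open>V\<close> a graded piece of the
  polynomial ring: the dimension over the field of constants of the corresponding piece of \<open>M\<close>.
\<close>

definition piece_dim ::
  "('v, 'k::comm_ring_1) mpolynomial set \<Rightarrow> ('v, 'k) mpolynomial set set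
     \<Rightarrow> ('v, 'k) mpolynomial set \<Rightarrow> nat" where
  "piece_dim I M V = ring.dim (poly_ring Quot I) (residue I ` range Const) (M \<inter> residue I ` V)"


section \<open>Points in projective space\<close>

definition projective_space :: "('k::field, 'v::finite) vec set set" where
  "projective_space = {v. v \<noteq> 0} // {(v, w). v \<noteq> 0 \<and> (\<exists>c. c \<noteq> 0 \<and> w = c *s v)}"

definition proj_vanishing_ideal ::
  "('k::field, 'v::finite) vec set set \<Rightarrow> ('v, 'k) mpolynomial set" where
  "proj_vanishing_ideal Z = genideal poly_ring
     {f. (\<exists>d. f \<in> hom_part d) \<and> (\<forall>P\<in>Z. \<forall>v\<in>P. eval_poly (($) v) f = 0)}"

definition proj_HF :: "('k::field, 'v::finite) vec set set \<Rightarrow> nat \<Rightarrow> nat" where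
  "proj_HF Z i = piece_dim (proj_vanishing_ideal Z)
     (carrier (poly_ring Quot proj_vanishing_ideal Z)) (hom_part i)"

text \<open>
  The Hilbert function of a nonempty \<open>Z\<close> vanishes in negative degrees, so that the least such
  integer is the least such natural number.
\<close>

definition regularity_index :: "('k::field, 'v::finite) vec set set \<Rightarrow> nat" where
  "regularity_index Z = (LEAST i\<^sub>0. \<forall>i\<ge>i\<^sub>0. proj_HF Z i = card Z)"

definition complete_intersection ::
  "('k::field, 'm::finite option) vec set set \<Rightarrow> nat list \<Rightarrow> bool" where
  "complete_intersection Z ds \<longleftrightarrow>
     length ds = CARD('m) \<and>
     (\<exists>Fs. list_all2 (\<lambda>F d. F \<in> hom_part d) Fs ds \<and>
           regular_sequence poly_ring Fs \<and>
           proj_vanishing_ideal Z = genideal poly_ring (set Fs))"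


section \<open>Points in a product of two projective spaces\<close>

type_synonym ('k, 'a, 'b) bipoint = "('k, 'a) vec set \<times> ('k, 'b) vec set"

definition bi_vanishing_ideal ::
  "('k::field, 'a::finite, 'b::finite) bipoint set \<Rightarrow> ('a + 'b, 'k) mpolynomial set" where
  "bi_vanishing_ideal X = genideal poly_ring
     {f. (\<exists>i j. f \<in> bihom_part i j) \<and>
         (\<forall>(P, Q)\<in>X. \<forall>v\<in>P. \<forall>w\<in>Q. eval_poly (case_sum (($) v) (($) w)) f = 0)}"

definition coord_ring ::
  "('k::field, 'a::finite, 'b::finite) bipoint set \<Rightarrow> ('a + 'b, 'k) mpolynomial set ring" where
  "coord_ring X = poly_ring Quot bi_vanishing_ideal X"

definition coord_residue ::
  "('k::field, 'a::finite, 'b::finite) bipoint set \<Rightarrow> ('a + 'b, 'k) mpolynomial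
     \<Rightarrow> ('a + 'b, 'k) mpolynomial set" where
  "coord_residue X = residue (bi_vanishing_ideal X)"

definition ideal_HF ::
  "('k::field, 'a::finite, 'b::finite) bipoint set \<Rightarrow> ('a + 'b, 'k) mpolynomial set set
     \<Rightarrow> nat \<Rightarrow> nat \<Rightarrow> nat" where
  "ideal_HF X M i j = piece_dim (bi_vanishing_ideal X) M (bihom_part i j)"

definition HF :: "('k::field, 'a::finite, 'b::finite) bipoint set \<Rightarrow> nat \<Rightarrow> nat \<Rightarrow> nat" where
  "HF X = ideal_HF X (carrier (coord_ring X))"

definition bi_complete_intersection ::
  "('k::field, 'm::finite option, 'n::finite option) bipoint set \<Rightarrow> nat list \<Rightarrow> nat list \<Rightarrow> bool" where
  "bi_complete_intersection X ds ds' \<longleftrightarrow>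
     length ds = CARD('m) \<and> length ds' = CARD('n) \<and>
     (\<exists>Fs Gs. list_all2 (\<lambda>F d. F \<in> bihom_part d 0) Fs ds \<and>
              list_all2 (\<lambda>G d. G \<in> bihom_part 0 d) Gs ds' \<and>
              regular_sequence poly_ring (Fs @ Gs) \<and>
              bi_vanishing_ideal X = genideal poly_ring (set (Fs @ Gs)))"

definition Cayley_Bacharach :: "('k::field, 'a::finite, 'b::finite) bipoint set \<Rightarrow> bool" where
  "Cayley_Bacharach X \<longleftrightarrow> (\<forall>p\<in>X. \<forall>q\<in>X. HF (X - {p}) = HF (X - {q}))"

text \<open>
  The coordinate ring has dimension \<open>2\<close>, so it is Cohen-Macaulay iff its depth with respect to the
  maximal ideal generated by the residues of all variables is \<open>2\<close>.
\<close>

definition ACM :: "('k::field, 'a::finite, 'b::finite) bipoint set \<Rightarrow> bool" where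
  "ACM X \<longleftrightarrow> depth (coord_ring X) (genideal (coord_ring X) (range (\<lambda>z. coord_residue X (Var z)))) = 2"

definition bihom_generators ::
  "('k::field, 'a::finite, 'b::finite) bipoint set \<Rightarrow> ('a + 'b, 'k) mpolynomial set \<Rightarrow> bool" where
  "bihom_generators X B \<longleftrightarrow>
     finite B \<and> (\<forall>f\<in>B. \<exists>i j. f \<in> bihom_part i j) \<and> genideal poly_ring B = bi_vanishing_ideal X"

text \<open>
  The maximal minors of the Jacobian matrix of \<open>B\<close> without the columns of \<open>X\<^sub>0\<close> and \<open>Y\<^sub>0\<close>. The map
  \<open>r\<close> selects the \<open>m + n\<close> rows; the order of the rows only affects the sign. If \<open>B\<close> has fewer than
  \<open>m + n\<close> elements, there are no minors.
\<close>

definition jacobian_minors ::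
  "('m::finite option + 'n::finite option, 'k::comm_ring_1) mpolynomial set
     \<Rightarrow> ('m option + 'n option, 'k) mpolynomial set" where
  "jacobian_minors B =
     {det (\<chi> k c. partial_deriv (map_sum Some Some c) (r k)) |
        r :: 'm + 'n \<Rightarrow> ('m option + 'n option, 'k) mpolynomial. inj r \<and> range r \<subseteq> B}"

text \<open>
  The ideal does not depend on the system of generators that is chosen.
\<close>

definition kaehler_different ::
  "('k::field, 'm::finite option, 'n::finite option) bipoint set
     \<Rightarrow> ('m option + 'n option, 'k) mpolynomial set set" where
  "kaehler_different X =
     genideal (coord_ring X) (coord_residue X ` jacobian_minors (SOME B. bihom_generators X B))"

end

theory Submission
  imports Defs "HOL-Computational_Algebra.Polynomial" "HOL-Computational_Algebra.Formal_Power_Series"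
begin

text \<open>
  The proof rests on three reductions.

  \<^emph>\<open>From the product to its factors.\<close> If the ideal of \<open>X\<close> is generated by forms in the \<open>X\<^sub>i\<close> alone and forms
  in the \<open>Y\<^sub>j\<close> alone, then the points that these forms cut out form a product, and they are the points
  of \<open>X\<close> because a point outside \<open>X\<close> is separated from \<open>X\<close> by a product of linear forms
  (\<open>product_of_split_generators\<close>). Conversely the ideal of a product is the sum of the extended ideals of
  the factors (\<open>bivanishing_product\<close>). Regular sequences pass from a factor to \<open>S\<close> because \<open>S\<close> is free over
  the polynomial ring of one group of variables (\<open>regular_list_product\<close>), and back by setting the other
  variables to zero (\<open>regular_list_restrict\<close>). This settles the equivalence of the first two conditions.

  \<^emph>\<open>From Hilbert functions to separators.\<close> A separator of \<open>p\<close> is a form that is \<open>1\<close> at \<open>p\<close> and \<open>0\<close> at all other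
  points. Deleting \<open>p\<close> lowers the Hilbert function by one exactly in the degrees in which \<open>p\<close> has a separator
  (\<open>piece_dim_delete\<close>), and a point of a product has a separator in bidegree \<open>(i, j)\<close> iff
  its two components have separators in the degrees \<open>i\<close> and \<open>j\<close> (\<open>biseparator_product_iff\<close>).
  So a product has the Cayley-Bacharach property iff in each factor the separators of all points start in
  one common degree, and that degree is the regularity index of the factor.

  \<^emph>\<open>One factor.\<close> Let \<open>P\<^sub>1, \<dots>, P\<^sub>m\<close> be forms of degrees \<open>a\<^sub>i\<close> that vanish on the finite set \<open>V\<close>, whose points are
  represented with \<open>X\<^sub>0 = 1\<close>; let
  \<open>\<rho> = \<Sum>(a\<^sub>i - 1)\<close>, and let \<open>\<Delta>(q)\<close> be the Jacobian determinant at \<open>q\<close>. Writing the \<open>P\<^sub>i\<close> as combinations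
  of the linear forms that vanish at \<open>q\<close> gives a square matrix of forms. Its determinant \<open>b\<^sub>q\<close>, the Bezoutian, has
  degree \<open>\<rho>\<close>, takes the value \<open>\<Delta>(q)\<close> at \<open>q\<close>, and vanishes on the rest of \<open>V\<close>. If a functional \<open>\<tau>\<close> on the
  functions on \<open>V\<close> annihilates all forms of degree less than \<open>\<rho>\<close>, then \<open>\<Sum> \<tau>\<^sub>q b\<^sub>q = \<kappa> X\<^sub>0\<^sup>\<rho>\<close> for a
  constant \<open>\<kappa>\<close>, hence \<open>\<tau>\<^sub>p \<Delta>(p) = \<kappa>\<close> for all \<open>p\<close>, and Cramer's rule shows that \<open>\<kappa>\<close> times the ideal of
  \<open>V\<close> lies in the ideal of the \<open>P\<^sub>i\<close> (\<open>residue_functional\<close>). This takes the place of residue duality.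
  For a complete intersection, \<open>\<Delta>\<close> vanishes nowhere, and the Hilbert series provides some \<open>\<tau> \<noteq> 0\<close>; then no
  \<open>\<tau>\<^sub>p\<close> is zero, so that all separators have degree at least \<open>\<rho>\<close> (\<open>separator_degrees_of_ci\<close>). In the other
  direction, if all separators have degree at least \<open>r \<ge> \<rho>\<close> and \<open>\<Delta>(p) \<noteq> 0\<close> for one \<open>p\<close>, then there is
  a \<open>\<tau>\<close> with \<open>\<tau>\<^sub>p \<noteq> 0\<close>, so \<open>\<kappa> \<noteq> 0\<close> and the \<open>P\<^sub>i\<close> generate the ideal of \<open>V\<close>
  (\<open>ci_of_separator_degrees\<close>). That they form a regular sequence follows from the uniqueness of expansions
  in powers of the \<open>P\<^sub>i\<close>, a statement about orders of vanishing at the points (\<open>unique_expansions\<close>).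

  The Kaehler different links the reductions. For a complete intersection, the Jacobian
  determinant of the generators lies in it, has bidegree \<open>(\<rho>\<^sub>1, \<rho>\<^sub>2)\<close>, which are the regularity indices, and
  vanishes at no point (\<open>kaehler_different_of_ci\<close>). Conversely, a nonzero element of that bidegree yields a maximal
  minor of at most that bidegree that is nonzero at some point \<open>(p, q)\<close>. Some \<open>m\<close> of its rows have
  independent \<open>X\<close>-gradients there; substituting \<open>q\<close> for the \<open>Y\<^sub>j\<close> in these rows gives the forms
  \<open>P\<^sub>1, \<dots>, P\<^sub>m\<close> for the first factor, and the second factor is treated alike (\<open>ci_of_kaehler_different\<close>).

  That the points of a product can be represented with \<open>X\<^sub>0 = Y\<^sub>0 = 1\<close> comes from the assumption on coordinates: a
  product is arithmetically Cohen-Macaulay (\<open>product_ACM\<close>), so that the residues of \<open>X\<^sub>0, Y\<^sub>0\<close> form a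
  regular sequence, and this forces \<open>X\<^sub>0\<close> and \<open>Y\<^sub>0\<close> to be nonzero at all points
  (\<open>normalized_representatives\<close>).
\<close>

section \<open>Polynomials and substitution\<close>

abbreviation lookup where "lookup \<equiv> Poly_Mapping.lookup"
abbreviation keys where "keys \<equiv> Poly_Mapping.keys"
abbreviation single where "single \<equiv> Poly_Mapping.single"

lemma sum_of_terms: "(\<Sum>t\<in>keys f. single t (lookup f t)) = (f :: 'a \<Rightarrow>\<^sub>0 'b::comm_monoid_add)"
proof (rule poly_mapping_eqI)
  fix t
  have "lookup (\<Sum>t\<in>keys f. single t (lookup f t)) t = (\<Sum>s\<in>keys f. if t = s then lookup f t else 0)"
    by (auto simp: lookup_sum lookup_single when_def intro!: sum.cong)
  also have "\<dots> = lookup f t" by (auto simp: in_keys_iff)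
  finally show "lookup (\<Sum>t\<in>keys f. single t (lookup f t)) t = lookup f t" .
qed

lemma mpolynomial_induct_terms [case_names zero single add]:
  fixes f :: "'a \<Rightarrow>\<^sub>0 'b::comm_monoid_add"
  assumes "P 0" and "\<And>t c. P (single t c)" and "\<And>f g. P f \<Longrightarrow> P g \<Longrightarrow> P (f + g)"
  shows "P f"
proof -
  have "P (\<Sum>t\<in>A. single t (lookup f t))" if "finite A" for A
    using that by (induction A rule: finite_induct) (auto intro: assms)
  from this[OF finite_keys[of f]] show ?thesis by (simp only: sum_of_terms)
qed

lemma monomial_induct [case_names zero step]:
  fixes t :: "'v::finite \<Rightarrow>\<^sub>0 nat"
  assumes "P 0" and "\<And>t x. P t \<Longrightarrow> P (t + single x 1)"
  shows "P t"
proof (induction "\<Sum>x\<in>UNIV. lookup t x" arbitrary: t)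
  case 0
  then have "t = 0" by (intro poly_mapping_eqI) auto
  then show ?case using assms by simp
next
  case (Suc n)
  then obtain x where x: "lookup t x \<noteq> 0" by (metis nat.distinct(1) sum.neutral)
  define s where "s = t - single x 1"
  have st: "t = s + single x 1"
    using x by (intro poly_mapping_eqI) (auto simp: s_def lookup_add lookup_minus lookup_single when_def)
  have "(\<Sum>x\<in>UNIV. lookup t x) = (\<Sum>x\<in>UNIV. lookup s x) + 1"
    unfolding st by (simp add: lookup_add lookup_single sum.distrib when_def)
  with Suc have "P s" by simp
  then show ?case unfolding st by (rule assms)
qed

lemma Const_add: "Const (a + b) = Const a + Const (b :: 'k::comm_semiring_1)"
  by (simp add: Const_def single_add)
lemma Const_mult: "Const (a * b) = Const a * Const (b :: 'k::comm_semiring_1)"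
  by (simp add: Const_def mult_single)
lemma Const_0 [simp]: "Const 0 = 0" by (simp add: Const_def)
lemma Const_1 [simp]: "Const 1 = 1" by (simp add: Const_def)
lemma Const_uminus: "Const (- a) = - Const (a :: 'k::comm_ring_1)"
  by (simp add: Const_def single_uminus)
lemma Const_power: "Const (a ^ n) = Const (a :: 'k::comm_semiring_1) ^ n"
  by (induction n) (auto simp: Const_mult)
lemma Const_sum: "Const (sum f A) = (\<Sum>i\<in>A. Const (f i :: 'k::comm_semiring_1))"
  by (induction A rule: infinite_finite_induct) (auto simp: Const_add)

lemma lookup_Const_mult: "lookup (Const c * f) t = c * lookup f t"
  for f :: "('v, 'k::comm_semiring_1) mpolynomial"
proof (induction f rule: mpolynomial_induct_terms)
  case (single s d)
  show ?case by (auto simp: Const_def mult_single lookup_single when_def)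
qed (auto simp: distrib_left lookup_add)

lemma keys_Const_mult: "keys (Const c * f) \<subseteq> keys f"
  for f :: "('v, 'k::comm_semiring_1) mpolynomial"
  by (auto simp: in_keys_iff lookup_Const_mult)

lemma single_mult_Var: "single t c * Var x = single (t + single x 1) (c :: 'k::comm_semiring_1)"
  by (simp add: Var_def mult_single)

lemma mpolynomial_induct [case_names Const add Var]:
  fixes f :: "('v::finite, 'k::comm_semiring_1) mpolynomial"
  assumes C: "\<And>c. P (Const c)" and A: "\<And>f g. P f \<Longrightarrow> P g \<Longrightarrow> P (f + g)"
    and V: "\<And>f x. P f \<Longrightarrow> P (f * Var x)"
  shows "P f"
proof (induction f rule: mpolynomial_induct_terms)
  case zero show ?case using C[of 0] by simp
next
  case (single t c)
  show ?case
  proof (induction t rule: monomial_induct)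
    case zero then show ?case using C[of c] by (simp add: Const_def)
  next
    case (step t x)
    then have "P (single t c * Var x)" by (rule V)
    then show ?case by (simp only: single_mult_Var)
  qed
qed (fact A)

text \<open>
  A predicate on functions between type-class rings: evaluation, substitution, embeddings and
  specializations are all of this kind, and a determinant can be moved through any of them.
\<close>

definition ring_morphism :: "('a::comm_semiring_1 \<Rightarrow> 'b::comm_semiring_1) \<Rightarrow> bool" where
  "ring_morphism h \<longleftrightarrow> h 0 = 0 \<and> h 1 = 1 \<and> (\<forall>x y. h (x + y) = h x + h y) \<and> (\<forall>x y. h (x * y) = h x * h y)"

lemma ring_morphismD:
  assumes "ring_morphism h"
  shows "h 0 = 0" "h 1 = 1" "h (x + y) = h x + h y" "h (x * y) = h x * h y"
  using assms by (auto simp: ring_morphism_def)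

lemma ring_morphism_power: "ring_morphism h \<Longrightarrow> h (x ^ n) = h x ^ n"
  by (induction n) (auto simp: ring_morphismD)

lemma ring_morphism_sum: "ring_morphism h \<Longrightarrow> h (sum f A) = (\<Sum>i\<in>A. h (f i))"
  by (induction A rule: infinite_finite_induct) (auto simp: ring_morphismD)

lemma ring_morphism_prod: "ring_morphism h \<Longrightarrow> h (prod f A) = (\<Prod>i\<in>A. h (f i))"
  by (induction A rule: infinite_finite_induct) (auto simp: ring_morphismD)

lemma ring_morphism_uminus:
  fixes h :: "'a::comm_ring_1 \<Rightarrow> 'b::comm_ring_1"
  shows "ring_morphism h \<Longrightarrow> h (- x) = - h x"
  by (metis add.inverse_unique add.right_inverse ring_morphismD(1) ring_morphismD(3))

lemma ring_morphism_diff: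
  fixes h :: "'a::comm_ring_1 \<Rightarrow> 'b::comm_ring_1"
  shows "ring_morphism h \<Longrightarrow> h (x - y) = h x - h y"
  by (metis diff_conv_add_uminus ring_morphismD(3) ring_morphism_uminus)

lemma ring_morphism_id [simp]: "ring_morphism (\<lambda>x. x)"
  by (simp add: ring_morphism_def)

lemma ring_morphism_Const [simp]: "ring_morphism Const"
  by (simp add: ring_morphism_def Const_add Const_mult)

lemma ring_morphism_comp: "ring_morphism g \<Longrightarrow> ring_morphism h \<Longrightarrow> ring_morphism (\<lambda>x. g (h x))"
  by (simp add: ring_morphism_def)

lemma ring_morphism_det:
  fixes h :: "'a::comm_ring_1 \<Rightarrow> 'b::comm_ring_1" and A :: "'a^'n^'n"
  assumes "ring_morphism h"
  shows "h (det A) = det (\<chi> i j. h (A $ i $ j))"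
proof -
  have "h (of_int z) = of_int z" for z
  proof (cases z rule: int_cases2)
    case (nonneg n)
    have "h (of_nat n) = of_nat n" by (induction n) (auto simp: ring_morphismD[OF assms])
    with nonneg show ?thesis by simp
  next
    case (nonpos n)
    have "h (of_nat n) = of_nat n" by (induction n) (auto simp: ring_morphismD[OF assms])
    with nonpos show ?thesis by (simp add: ring_morphism_uminus[OF assms])
  qed
  then show ?thesis
    by (simp add: det_def ring_morphism_sum[OF assms] ring_morphism_prod[OF assms] ring_morphismD[OF assms])
qed

text \<open>
  The ring homomorphism that extends \<open>h\<close> and sends the variable \<open>x\<close> to \<open>a x\<close>. Evaluation is the case
  \<open>h = id\<close>, substitution of polynomials the case \<open>h = Const\<close>.
\<close>

definition insertion ::
  "('k \<Rightarrow> 'b) \<Rightarrow> ('v \<Rightarrow> 'b) \<Rightarrow> ('v::finite, 'k::comm_semiring_1) mpolynomial \<Rightarrow> 'b::comm_semiring_1" where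
  "insertion h a f = (\<Sum>t\<in>keys f. h (lookup f t) * (\<Prod>x\<in>UNIV. a x ^ lookup t x))"

lemma eval_poly_eq_insertion: "eval_poly a = insertion (\<lambda>x. x) a"
  by (rule ext) (simp add: eval_poly_def insertion_def)

context
  fixes h :: "'k::comm_semiring_1 \<Rightarrow> 'b::comm_semiring_1"
  assumes h: "ring_morphism h"
begin

lemma insertion_superset:
  assumes "finite A" "keys f \<subseteq> A"
  shows "insertion h a f = (\<Sum>t\<in>A. h (lookup f t) * (\<Prod>x\<in>UNIV. a x ^ lookup t x))"
  unfolding insertion_def
  by (rule sum.mono_neutral_left) (use assms in \<open>auto simp: in_keys_iff ring_morphismD[OF h]\<close>)

lemma insertion_add: "insertion h a (f + g) = insertion h a f + insertion h a g"
  by (subst (1 2 3) insertion_superset[of "keys f \<union> keys g"])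
     (use keys_add[of f g] in \<open>auto simp: lookup_add ring_morphismD[OF h] distrib_right sum.distrib\<close>)

lemma insertion_single: "insertion h a (single t c) = h c * (\<Prod>x\<in>UNIV. a x ^ lookup t x)"
  by (subst insertion_superset[of "{t}"]) auto

lemma insertion_zero: "insertion h a 0 = 0" by (simp add: insertion_def)

lemma insertion_Const: "insertion h a (Const c) = h c"
  by (simp add: Const_def insertion_single)

lemma insertion_Var: "insertion h a (Var x) = a x"
proof -
  have "(\<Prod>y\<in>UNIV. a y ^ lookup (single x 1) y) = (\<Prod>y\<in>UNIV. if y = x then a y else 1)"
    by (intro prod.cong) (auto simp: lookup_single when_def)
  then show ?thesis by (simp add: Var_def insertion_single ring_morphismD[OF h])
qed

lemma insertion_mult: "insertion h a (f * g) = insertion h a f * insertion h a g"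
proof (induction f rule: mpolynomial_induct_terms)
  case (single t c)
  show ?case
  proof (induction g rule: mpolynomial_induct_terms)
    case (single s d)
    show ?case
      by (simp add: mult_single insertion_single ring_morphismD[OF h] lookup_add power_add prod.distrib mult_ac)
  qed (auto simp: insertion_zero distrib_left insertion_add)
qed (auto simp: insertion_zero distrib_right insertion_add)

lemma ring_morphism_insertion: "ring_morphism (insertion h a)"
  using insertion_Const[of a 1]
  by (simp add: ring_morphism_def insertion_zero insertion_add insertion_mult ring_morphismD[OF h])

end

lemma ring_morphism_eqI:
  fixes g h :: "('v::finite, 'k::comm_semiring_1) mpolynomial \<Rightarrow> 'b::comm_semiring_1"
  assumes "ring_morphism g" "ring_morphism h"
    and "\<And>c. g (Const c) = h (Const c)" and "\<And>x. g (Var x) = h (Var x)"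
  shows "g f = h f"
  by (induction f rule: mpolynomial_induct) (auto simp: assms ring_morphismD[OF assms(1)] ring_morphismD[OF assms(2)])

lemma morphism_insertion:
  assumes "ring_morphism h" "ring_morphism g"
  shows "g (insertion h a f) = insertion (\<lambda>c. g (h c)) (\<lambda>x. g (a x)) f"
  by (rule ring_morphism_eqI)
     (auto simp: assms ring_morphism_comp ring_morphism_insertion insertion_Const insertion_Var)

lemma insertion_Const_Var [simp]: "insertion Const Var f = f"
  by (rule ring_morphism_eqI) (auto simp: ring_morphism_insertion insertion_Const insertion_Var)

lemma ring_morphism_eval: "ring_morphism (eval_poly a)"
  by (simp add: eval_poly_eq_insertion ring_morphism_insertion)

lemma eval_Const [simp]: "eval_poly a (Const c) = c"
  by (simp add: eval_poly_eq_insertion insertion_Const)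
lemma eval_Var [simp]: "eval_poly a (Var x) = a x"
  by (simp add: eval_poly_eq_insertion insertion_Var)
lemma eval_0 [simp]: "eval_poly a 0 = 0" by (rule ring_morphismD[OF ring_morphism_eval])
lemma eval_1 [simp]: "eval_poly a 1 = 1" by (rule ring_morphismD[OF ring_morphism_eval])
lemma eval_add [simp]: "eval_poly a (f + g) = eval_poly a f + eval_poly a g"
  by (rule ring_morphismD[OF ring_morphism_eval])
lemma eval_mult [simp]: "eval_poly a (f * g) = eval_poly a f * eval_poly a g"
  by (rule ring_morphismD[OF ring_morphism_eval])
lemma eval_power [simp]: "eval_poly a (f ^ n) = eval_poly a f ^ n"
  by (rule ring_morphism_power[OF ring_morphism_eval])
lemma eval_sum [simp]: "eval_poly a (sum f A) = (\<Sum>i\<in>A. eval_poly a (f i))"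
  by (rule ring_morphism_sum[OF ring_morphism_eval])
lemma eval_prod [simp]: "eval_poly a (prod f A) = (\<Prod>i\<in>A. eval_poly a (f i))"
  by (rule ring_morphism_prod[OF ring_morphism_eval])
lemma eval_diff [simp]:
  "eval_poly a (f - g) = eval_poly a f - eval_poly a (g :: ('v::finite, 'k::comm_ring_1) mpolynomial)"
  by (rule ring_morphism_diff[OF ring_morphism_eval])

lemma eval_insertion_Const: "eval_poly b (insertion Const a f) = eval_poly (\<lambda>x. eval_poly b (a x)) f"
  by (simp add: morphism_insertion[OF ring_morphism_Const ring_morphism_eval] eval_poly_eq_insertion[of "\<lambda>x. insertion (\<lambda>x. x) b (a x)"])
     (simp add: eval_poly_eq_insertion)


section \<open>Partial derivatives\<close>

lemma partial_deriv_superset: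
  fixes f :: "('v, 'k::comm_semiring_1) mpolynomial"
  assumes "finite A" "keys f \<subseteq> A"
  shows "partial_deriv x f = (\<Sum>t\<in>A. single (t - single x 1) (of_nat (lookup t x) * lookup f t))"
  unfolding partial_deriv_def
  by (rule sum.mono_neutral_left) (use assms in \<open>auto simp: in_keys_iff\<close>)

lemma partial_deriv_add: "partial_deriv x (f + g) = partial_deriv x f + partial_deriv x g"
  by (subst (1 2 3) partial_deriv_superset[of "keys f \<union> keys g"])
     (use keys_add[of f g] in \<open>auto simp: lookup_add distrib_left sum.distrib single_add\<close>)

lemma partial_deriv_single:
  "partial_deriv x (single t c) = single (t - single x 1) (of_nat (lookup t x) * c)"
  by (subst partial_deriv_superset[of "{t}"]) auto

lemma partial_deriv_0 [simp]: "partial_deriv x 0 = 0" by (simp add: partial_deriv_def)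

lemma partial_deriv_Const [simp]: "partial_deriv x (Const c) = 0"
  by (simp add: Const_def partial_deriv_single)

lemma partial_deriv_Var: "partial_deriv x (Var y) = (if x = y then 1 else 0)"
  by (auto simp: Var_def partial_deriv_single lookup_single when_def)

text \<open>
  The truncated exponent in the definition of the derivative makes the case distinction
  between a monomial with and without \<open>x\<close> necessary; induction on polynomials then needs only this
  special case of the product rule.
\<close>

lemma partial_deriv_mult_Var:
  fixes f :: "('v, 'k::comm_semiring_1) mpolynomial"
  shows "partial_deriv x (f * Var y) = partial_deriv x f * Var y + (if x = y then f else 0)"
proof (induction f rule: mpolynomial_induct_terms)
  case (single t c)
  show ?case
  proof (cases "x = y")
    case False
    then have "t + single y 1 - single x 1 = t - single x 1 + single y 1" if "lookup t x \<noteq> 0"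
      using that by (intro poly_mapping_eqI) (auto simp: lookup_add lookup_minus lookup_single when_def)
    with False show ?thesis
      by (cases "lookup t x = 0") (auto simp: single_mult_Var partial_deriv_single lookup_add lookup_single)
  next
    case True
    have [simp]: "t + single y 1 - single y 1 = t"
      by (intro poly_mapping_eqI) (auto simp: lookup_add lookup_minus)
    have "t - single y 1 + single y 1 = t" if "lookup t y \<noteq> 0"
      using that by (intro poly_mapping_eqI) (auto simp: lookup_add lookup_minus lookup_single when_def)
    then have "single (t - single y 1 + single y 1) (of_nat (lookup t y) * c) = single t (of_nat (lookup t y) * c)"
      by (cases "lookup t y = 0") auto
    with True show ?thesis
      by (simp add: single_mult_Var partial_deriv_single lookup_add distrib_right single_add add.commute)
  qed
qed (auto simp: distrib_right partial_deriv_add add_ac)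

lemma partial_deriv_mult:
  fixes f :: "('v::finite, 'k::comm_semiring_1) mpolynomial"
  shows "partial_deriv x (f * g) = partial_deriv x f * g + f * partial_deriv x g"
proof (induction g rule: mpolynomial_induct)
  case (Const c)
  have "partial_deriv x (f * Const c) = partial_deriv x f * Const c"
  proof (induction f rule: mpolynomial_induct_terms)
    case (single t d) show ?case by (simp add: Const_def mult_single partial_deriv_single mult_ac)
  qed (auto simp: distrib_right partial_deriv_add)
  then show ?case by simp
next
  case (add g1 g2) then show ?case by (simp add: distrib_left partial_deriv_add add_ac)
next
  case (Var g y)
  then show ?case
    by (simp only: mult.assoc[symmetric] partial_deriv_mult_Var) (simp add: algebra_simps)
qed

lemma partial_deriv_sum: "partial_deriv x (sum f A) = (\<Sum>i\<in>A. partial_deriv x (f i))"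
  by (induction A rule: infinite_finite_induct) (auto simp: partial_deriv_add)

lemma partial_deriv_uminus:
  "partial_deriv x (- f) = - partial_deriv x (f :: ('v, 'k::comm_ring_1) mpolynomial)"
  by (metis add.inverse_unique add.right_inverse partial_deriv_0 partial_deriv_add)

lemma partial_deriv_diff:
  "partial_deriv x (f - g) = partial_deriv x f - partial_deriv x (g :: ('v, 'k::comm_ring_1) mpolynomial)"
  by (metis diff_conv_add_uminus partial_deriv_add partial_deriv_uminus)


section \<open>Weight gradings\<close>

text \<open>
  Both gradings of the theorem come from weights of the variables: the constant weight \<open>1\<close> gives the total
  degree, and the weights \<open>wX\<close>, \<open>wY\<close> give the two components of the bidegree.
\<close>

definition wdeg :: "('v::finite \<Rightarrow> nat) \<Rightarrow> ('v \<Rightarrow>\<^sub>0 nat) \<Rightarrow> nat" where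
  "wdeg w t = (\<Sum>x\<in>UNIV. lookup t x * w x)"

definition part :: "('v::finite \<Rightarrow> nat) \<Rightarrow> nat \<Rightarrow> ('v, 'k::zero) mpolynomial set" where
  "part w d = {f. \<forall>t\<in>keys f. wdeg w t = d}"

definition component :: "('v::finite \<Rightarrow> nat) \<Rightarrow> nat \<Rightarrow> ('v, 'k::zero) mpolynomial \<Rightarrow> ('v, 'k) mpolynomial" where
  "component w d f = Poly_Mapping.mapp (\<lambda>t c. if wdeg w t = d then c else 0) f"

lemma wdeg_0 [simp]: "wdeg w 0 = 0" by (simp add: wdeg_def)

lemma wdeg_add: "wdeg w (s + t) = wdeg w s + wdeg w t"
  by (simp add: wdeg_def lookup_add sum.distrib distrib_right)

lemma wdeg_single: "wdeg w (single x n) = n * w x"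
proof -
  have "wdeg w (single x n) = (\<Sum>y\<in>UNIV. if y = x then n * w x else 0)"
    unfolding wdeg_def by (intro sum.cong) (auto simp: lookup_single when_def)
  then show ?thesis by simp
qed

lemma hom_part_eq: "hom_part d = part (\<lambda>_. 1) d"
  by (simp add: hom_part_def part_def wdeg_def)

abbreviation wX :: "'a + 'b \<Rightarrow> nat" where "wX \<equiv> case_sum (\<lambda>_. 1) (\<lambda>_. 0)"
abbreviation wY :: "'a + 'b \<Rightarrow> nat" where "wY \<equiv> case_sum (\<lambda>_. 0) (\<lambda>_. 1)"

lemma sum_UNIV_Plus:
  "(\<Sum>z\<in>(UNIV :: ('a::finite + 'b::finite) set). f z) = (\<Sum>x\<in>UNIV. f (Inl x)) + (\<Sum>y\<in>UNIV. f (Inr y))"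
  by (simp add: UNIV_Plus_UNIV[symmetric] sum.Plus del: UNIV_Plus_UNIV)

lemma bihom_part_eq: "bihom_part i j = part wX i \<inter> part wY j"
  by (auto simp: bihom_part_def part_def wdeg_def sum_UNIV_Plus)

lemma part_0 [simp]: "0 \<in> part w d" by (simp add: part_def)

lemma part_add: "f \<in> part w d \<Longrightarrow> g \<in> part w d \<Longrightarrow> f + g \<in> part w d"
  for f :: "('v::finite, 'k::comm_semiring_1) mpolynomial"
  using keys_add[of f g] by (auto simp: part_def)

lemma part_sum: "(\<And>i. i \<in> A \<Longrightarrow> f i \<in> part w d) \<Longrightarrow> sum f A \<in> part w d"
  for f :: "'i \<Rightarrow> ('v::finite, 'k::comm_semiring_1) mpolynomial"
  by (induction A rule: infinite_finite_induct) (auto intro: part_add)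

lemma part_uminus: "f \<in> part w d \<Longrightarrow> - f \<in> part w d"
  for f :: "('v::finite, 'k::comm_ring_1) mpolynomial"
  by (auto simp: part_def in_keys_iff)

lemma part_diff: "f \<in> part w d \<Longrightarrow> g \<in> part w d \<Longrightarrow> f - g \<in> part w d"
  for f :: "('v::finite, 'k::comm_ring_1) mpolynomial"
  by (metis diff_conv_add_uminus part_add part_uminus)

lemma part_mult: "f \<in> part w d \<Longrightarrow> g \<in> part w e \<Longrightarrow> f * g \<in> part w (d + e)"
  for f :: "('v::finite, 'k::comm_semiring_1) mpolynomial"
  using keys_mult[of f g] by (auto simp: part_def wdeg_add)

lemma part_single: "wdeg w t = d \<Longrightarrow> single t c \<in> part w d"
  by (auto simp: part_def)

lemma part_Const [simp]: "Const c \<in> part w 0"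
  by (auto simp: Const_def intro: part_single)

lemma part_1 [simp]: "(1 :: ('v::finite, 'k::comm_semiring_1) mpolynomial) \<in> part w 0"
  using part_Const[of "1::'k" w] by simp

lemma part_Var: "Var x \<in> part w (w x)"
  by (auto simp: Var_def wdeg_single intro: part_single)

lemma part_Const_mult: "f \<in> part w d \<Longrightarrow> Const c * f \<in> part w d"
  for f :: "('v::finite, 'k::comm_semiring_1) mpolynomial"
  using part_mult[OF part_Const, of f w d c] by simp

lemma part_power: "f \<in> part w d \<Longrightarrow> f ^ n \<in> part w (n * d)"
  for f :: "('v::finite, 'k::comm_semiring_1) mpolynomial"
  by (induction n) (auto dest: part_mult)

lemma part_prod: "(\<And>i. i \<in> A \<Longrightarrow> f i \<in> part w (d i)) \<Longrightarrow> prod f A \<in> part w (sum d A)"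
  for f :: "'i \<Rightarrow> ('v::finite, 'k::comm_semiring_1) mpolynomial"
  by (induction A rule: infinite_finite_induct) (auto intro: part_mult)

lemma lookup_component: "lookup (component w d f) t = (if wdeg w t = d then lookup f t else 0)"
  by (auto simp: component_def lookup_mapp when_def in_keys_iff)

lemma component_in_part: "component w d f \<in> part w d"
  by (auto simp: part_def in_keys_iff lookup_component split: if_splits)

lemma component_other_part: "f \<in> part v e \<Longrightarrow> component w d f \<in> part v e"
  by (auto simp: part_def in_keys_iff lookup_component split: if_splits)

lemma component_add: "component w d (f + g) = component w d f + component w d g"
  by (rule poly_mapping_eqI) (simp add: lookup_component lookup_add)

lemma component_0 [simp]: "component w d 0 = 0"
  by (rule poly_mapping_eqI) (simp add: lookup_component)

lemma component_sum: "component w d (sum f A) = (\<Sum>i\<in>A. component w d (f i))"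
  by (induction A rule: infinite_finite_induct) (auto simp: component_add)

lemma component_Const_mult: "component w d (Const c * f) = Const c * component w d f"
  for f :: "('v::finite, 'k::comm_semiring_1) mpolynomial"
  by (rule poly_mapping_eqI) (simp add: lookup_component lookup_Const_mult)

lemma component_part: "f \<in> part w d \<Longrightarrow> component w e f = (if e = d then f else 0)"
  by (rule poly_mapping_eqI) (auto simp: lookup_component part_def in_keys_iff)

text \<open>
  Multiplication by a form shifts degrees; this is how coefficients of an ideal membership are
  replaced by homogeneous ones.
\<close>

lemma component_mult_part:
  fixes f F :: "('v::finite, 'k::comm_semiring_1) mpolynomial"
  assumes F: "F \<in> part w d"
  shows "component w e (f * F) = (if d \<le> e then component w (e - d) f * F else 0)"
proof (induction f rule: mpolynomial_induct_terms)
  case (single t c)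
  have t: "single t c \<in> part w (wdeg w t)" by (simp add: part_single)
  show ?case
    by (auto simp: component_part[OF part_mult[OF t F]] component_part[OF t])
qed (auto simp: distrib_right component_add)

lemma sum_components:
  fixes f :: "('v::finite, 'k::comm_semiring_1) mpolynomial"
  assumes "finite D" "wdeg w ` keys f \<subseteq> D"
  shows "(\<Sum>d\<in>D. component w d f) = f"
proof (rule poly_mapping_eqI)
  fix t
  show "lookup (\<Sum>d\<in>D. component w d f) t = lookup f t"
  proof (cases "t \<in> keys f")
    case True
    then show ?thesis using assms by (auto simp: lookup_sum lookup_component)
  next
    case False
    then have "lookup f t = 0" by (simp add: in_keys_iff)
    then show ?thesis by (simp add: lookup_sum lookup_component sum.neutral)
  qed
qed

lemma components_eqI:
  fixes f g :: "('v::finite, 'k::comm_semiring_1) mpolynomial"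
  assumes "\<And>d. component w d f = component w d g"
  shows "f = g"
proof (rule poly_mapping_eqI)
  fix t
  show "lookup f t = lookup g t"
    using arg_cong[OF assms[of "wdeg w t"], of "\<lambda>p. lookup p t"] by (simp add: lookup_component)
qed

lemma eval_scaled_part:
  fixes f :: "('v::finite, 'k::comm_semiring_1) mpolynomial"
  assumes "f \<in> part w d"
  shows "eval_poly (\<lambda>x. c ^ w x * a x) f = c ^ d * eval_poly a f"
proof -
  have "(\<Prod>x\<in>UNIV. (c ^ w x * a x) ^ lookup t x) = c ^ d * (\<Prod>x\<in>UNIV. a x ^ lookup t x)" if "t \<in> keys f" for t
  proof -
    have "(\<Prod>x\<in>UNIV. (c ^ w x * a x) ^ lookup t x) = (\<Prod>x\<in>UNIV. c ^ (lookup t x * w x)) * (\<Prod>x\<in>UNIV. a x ^ lookup t x)"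
      by (simp add: power_mult_distrib prod.distrib mult.commute flip: power_mult)
    also have "(\<Prod>x\<in>UNIV. c ^ (lookup t x * w x)) = c ^ wdeg w t"
      by (simp add: wdeg_def power_sum)
    finally show ?thesis using that assms by (simp add: part_def)
  qed
  then show ?thesis
    by (simp add: eval_poly_def sum_distrib_left mult_ac)
qed

text \<open>
  If \<open>f\<close> vanishes along the orbit of \<open>a\<close> under the torus action of the grading, then the values of its components at
  \<open>a\<close> are the coefficients of a polynomial in \<open>c\<close> with infinitely many roots.
\<close>

lemma eval_component_eq_0:
  fixes f :: "('v::finite, 'k::field_char_0) mpolynomial"
  assumes "\<And>c. c \<noteq> 0 \<Longrightarrow> eval_poly (\<lambda>x. c ^ w x * a x) f = 0"
  shows "eval_poly a (component w d f) = 0"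
proof -
  define D where "D = wdeg w ` keys f"
  define p where "p = (\<Sum>d\<in>D. monom (eval_poly a (component w d f)) d)"
  have D: "finite D" "wdeg w ` keys f \<subseteq> D" by (auto simp: D_def)
  have "poly p c = 0" if "c \<noteq> 0" for c
  proof -
    have "poly p c = (\<Sum>d\<in>D. eval_poly (\<lambda>x. c ^ w x * a x) (component w d f))"
      by (simp add: p_def poly_sum poly_monom eval_scaled_part[OF component_in_part] mult.commute[of _ "c ^ _"])
    also have "\<dots> = eval_poly (\<lambda>x. c ^ w x * a x) (\<Sum>d\<in>D. component w d f)" by simp
    also have "\<dots> = 0" unfolding sum_components[OF D] by (rule assms[OF that])
    finally show ?thesis .
  qed
  then have "UNIV - {0} \<subseteq> {c. poly p c = 0}" by auto
  moreover have "infinite (UNIV - {0 :: 'k})" by (simp add: infinite_UNIV_char_0)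
  ultimately have "infinite {c. poly p c = 0}" using finite_subset by blast
  then have "p = 0" using poly_roots_finite[of p] by blast
  then have "coeff p d = 0" by simp
  then have 1: "(\<Sum>e\<in>D. if e = d then eval_poly a (component w e f) else 0) = 0"
    by (simp add: p_def coeff_sum)
  show ?thesis
  proof (cases "d \<in> D")
    case True
    then show ?thesis using 1 D by simp
  next
    case False
    then have "component w d f = 0"
      by (intro poly_mapping_eqI) (auto simp: lookup_component D_def in_keys_iff)
    then show ?thesis by simp
  qed
qed

text \<open>
  Degrees are natural numbers, so the case in which \<open>x\<close> is too heavy to occur is stated separately:
  the derivative is then zero, while \<open>a - w x\<close> is truncated.
\<close>

lemma partial_deriv_part:
  fixes f :: "('v::finite, 'k::comm_semiring_1) mpolynomial"
  assumes "f \<in> part w a"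
  shows "partial_deriv x f \<in> part w (a - w x)" and "a < w x \<Longrightarrow> partial_deriv x f = 0"
proof -
  have *: "single (t - single x 1) (of_nat (lookup t x) * lookup f t) \<in> part w (a - w x) \<and>
        (a < w x \<longrightarrow> single (t - single x 1) (of_nat (lookup t x) * lookup f t) = 0)" if "t \<in> keys f" for t
  proof (cases "lookup t x = 0")
    case False
    then have t: "t = (t - single x 1) + single x 1"
      by (intro poly_mapping_eqI) (auto simp: lookup_add lookup_minus lookup_single when_def)
    have "wdeg w t = a" using that assms by (simp add: part_def)
    moreover have "wdeg w t = wdeg w (t - single x 1) + w x"
      by (subst t) (simp add: wdeg_add wdeg_single)
    ultimately show ?thesis by (auto intro!: part_single)
  qed auto
  show "partial_deriv x f \<in> part w (a - w x)"
    unfolding partial_deriv_def by (intro part_sum) (use * in blast)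
  show "partial_deriv x f = 0" if "a < w x"
    unfolding partial_deriv_def by (intro sum.neutral) (use * that in blast)
qed

text \<open>
  Row weights \<open>a\<close> and column weights \<open>b\<close>: every nonzero term of the expansion has degree \<open>\<Sum>a - \<Sum>b\<close>. The second
  assumption says that an entry is zero whenever the truncated difference would be wrong.
\<close>

lemma det_part:
  fixes A :: "('v::finite, 'k::comm_ring_1) mpolynomial^'i^'i"
  assumes *: "\<And>i j. A $ i $ j \<in> part w (a i - b j)" and **: "\<And>i j. a i < b j \<Longrightarrow> A $ i $ j = 0"
  shows "det A \<in> part w (sum a UNIV - sum b UNIV)"
proof -
  have "of_int (sign p) * (\<Prod>i\<in>UNIV. A $ i $ p i) \<in> part w (sum a UNIV - sum b UNIV)"
    if p: "p permutes (UNIV :: 'i set)" for p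
  proof (cases "\<exists>i. a i < b (p i)")
    case True
    then obtain i where "A $ i $ p i = 0" using ** by blast
    then have "(\<Prod>i\<in>UNIV. A $ i $ p i) = 0" by (intro prod_zero) auto
    then show ?thesis by (metis mult_zero_right part_0)
  next
    case False
    have "(\<Sum>i\<in>UNIV. a i - b (p i)) = sum a UNIV - (\<Sum>i\<in>UNIV. b (p i))"
      using False by (subst sum_subtractf_nat) (auto simp: not_less)
    also have "(\<Sum>i\<in>UNIV. b (p i)) = sum b UNIV"
      using sum.permute[OF p, of b] by (simp add: o_def)
    finally have "(\<Prod>i\<in>UNIV. A $ i $ p i) \<in> part w (sum a UNIV - sum b UNIV)"
      using part_prod[of UNIV "\<lambda>i. A $ i $ p i" w "\<lambda>i. a i - b (p i)"] * by simp
    then show ?thesis by (cases p rule: sign_cases) (auto intro: part_uminus)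
  qed
  then show ?thesis unfolding det_def by (intro part_sum) auto
qed

text \<open>
  Induction along the degree, which lets degrees be tracked without reference to monomials.
\<close>

lemma hom_part_induct [consumes 1, case_names zero Const add Var]:
  fixes f :: "('v::finite, 'k::comm_semiring_1) mpolynomial"
  assumes f: "f \<in> hom_part d"
    and Z: "\<And>d. P d 0" and C: "\<And>c. P 0 (Const c)"
    and A: "\<And>d f g. f \<in> hom_part d \<Longrightarrow> g \<in> hom_part d \<Longrightarrow> P d f \<Longrightarrow> P d g \<Longrightarrow> P d (f + g)"
    and V: "\<And>d f x. f \<in> hom_part d \<Longrightarrow> P d f \<Longrightarrow> P (Suc d) (f * Var x)"
  shows "P d f"
proof -
  have 1: "P (wdeg (\<lambda>_. 1) t) (single t c)" for t c
  proof (induction t rule: monomial_induct)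
    case zero then show ?case using C[of c] by (simp add: Const_def)
  next
    case (step t x)
    have "single t c \<in> hom_part (wdeg (\<lambda>_. 1) t)" by (simp add: hom_part_eq part_single)
    from V[OF this step] show ?case
      by (simp add: single_mult_Var wdeg_add wdeg_single)
  qed
  have "P d (\<Sum>t\<in>A. single t (lookup f t)) \<and> (\<Sum>t\<in>A. single t (lookup f t)) \<in> hom_part d"
    if "A \<subseteq> keys f" for A
    using finite_subset[OF that finite_keys] that
  proof (induction A rule: finite_induct)
    case (insert t A)
    then have t: "wdeg (\<lambda>_. 1) t = d" using f by (auto simp: hom_part_eq part_def)
    then have "single t (lookup f t) \<in> hom_part d" by (simp add: hom_part_eq part_single)
    moreover have "P d (single t (lookup f t))" using 1[of t "lookup f t"] t by simp
    ultimately show ?case using insert A part_add by (auto simp: hom_part_eq)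
  qed (auto simp: Z hom_part_eq)
  from this[of "keys f"] show ?thesis by (simp add: sum_of_terms)
qed


section \<open>Ideals of the polynomial ring and of its quotients\<close>

interpretation idl: Modules.module "(*) :: 'a::comm_ring_1 \<Rightarrow> 'a \<Rightarrow> 'a"
  by standard (auto simp: algebra_simps)

declare idl.scale_scale [simp del]

lemma poly_ring_simps [simp]:
  "carrier poly_ring = UNIV" "mult poly_ring = (*)" "one poly_ring = 1"
  "zero poly_ring = 0" "add poly_ring = (+)"
  by (auto simp: poly_ring_def)

lemma cring_poly_ring: "cring (poly_ring :: ('v, 'k::comm_ring_1) mpolynomial ring)"
proof (rule cringI)
  show "abelian_group (poly_ring :: ('v, 'k) mpolynomial ring)"
  proof (rule abelian_groupI)
    fix x :: "('v, 'k) mpolynomial"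
    show "\<exists>y\<in>carrier poly_ring. y \<oplus>\<^bsub>poly_ring\<^esub> x = \<zero>\<^bsub>poly_ring\<^esub>"
      by (rule bexI[of _ "- x"]) auto
  qed (simp_all add: add_ac)
  show "comm_monoid (poly_ring :: ('v, 'k) mpolynomial ring)"
  proof (rule comm_monoidI)
    fix x y z :: "('v, 'k) mpolynomial"
    show "x \<otimes>\<^bsub>poly_ring\<^esub> y = y \<otimes>\<^bsub>poly_ring\<^esub> x"
      unfolding poly_ring_simps by (rule mult.commute)
    show "x \<otimes>\<^bsub>poly_ring\<^esub> y \<otimes>\<^bsub>poly_ring\<^esub> z = x \<otimes>\<^bsub>poly_ring\<^esub> (y \<otimes>\<^bsub>poly_ring\<^esub> z)"
      unfolding poly_ring_simps by (rule mult.assoc)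
    show "\<one>\<^bsub>poly_ring\<^esub> \<otimes>\<^bsub>poly_ring\<^esub> x = x"
      unfolding poly_ring_simps by (rule mult_1)
  qed simp_all
  fix x y z :: "('v, 'k) mpolynomial"
  show "(x \<oplus>\<^bsub>poly_ring\<^esub> y) \<otimes>\<^bsub>poly_ring\<^esub> z = x \<otimes>\<^bsub>poly_ring\<^esub> z \<oplus>\<^bsub>poly_ring\<^esub> y \<otimes>\<^bsub>poly_ring\<^esub> z"
    unfolding poly_ring_simps by (rule distrib_right)
qed

lemmas ring_poly_ring = cring.axioms(1)[OF cring_poly_ring]

lemma a_inv_poly_ring: "\<ominus>\<^bsub>poly_ring\<^esub> x = - (x :: ('v, 'k::comm_ring_1) mpolynomial)"
proof -
  have 1: "- x \<oplus>\<^bsub>poly_ring\<^esub> x = \<zero>\<^bsub>poly_ring\<^esub>" and 2: "x \<in> carrier poly_ring" "- x \<in> carrier poly_ring"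
    by (simp_all add: poly_ring_def)
  show ?thesis
    using abelian_group.minus_equality[OF ring.is_abelian_group[OF ring_poly_ring] 1 2] .
qed

text \<open>
  Ideals are the submodules of the ring over itself. This gives access to spans and their
  algebra in place of the carrier-based ideals.
\<close>

lemma ideal_poly_ring_iff: "ideal I poly_ring \<longleftrightarrow> idl.subspace (I :: ('v, 'k::comm_ring_1) mpolynomial set)"
proof
  assume "ideal I poly_ring"
  note I = this
  show "idl.subspace I"
    using additive_subgroup.zero_closed[OF ideal.axioms(1)[OF I]] additive_subgroup.a_closed[OF ideal.axioms(1)[OF I]]
      ideal.I_l_closed[OF I] by (auto simp: idl.subspace_def)
next
  assume I: "idl.subspace I"
  show "ideal I poly_ring"
  proof (rule idealI[OF ring_poly_ring])
    show "subgroup I (add_monoid poly_ring)"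
    proof
      fix x assume "x \<in> I"
      then show "inv\<^bsub>add_monoid poly_ring\<^esub> x \<in> I"
        using a_inv_poly_ring[of x] idl.subspace_neg[OF I] by (simp add: a_inv_def)
    qed (use I in \<open>auto simp: idl.subspace_def\<close>)
  next
    fix a x :: "('v, 'k) mpolynomial" assume "a \<in> I"
    then have "x * a \<in> I" using I by (simp add: idl.subspace_def)
    then show "x \<otimes>\<^bsub>poly_ring\<^esub> a \<in> I" "a \<otimes>\<^bsub>poly_ring\<^esub> x \<in> I"
      by (simp_all add: mult.commute)
  qed
qed

lemma genideal_poly_ring: "genideal poly_ring S = idl.span (S :: ('v, 'k::comm_ring_1) mpolynomial set)"
proof
  show "genideal poly_ring S \<subseteq> idl.span S"
    unfolding genideal_def using idl.span_superset[of S] idl.subspace_span[of S] by (auto simp: ideal_poly_ring_iff)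
  show "idl.span S \<subseteq> genideal poly_ring S"
    unfolding genideal_def by (auto simp: ideal_poly_ring_iff dest: idl.span_minimal)
qed

text \<open>
  The regularity half of a regular sequence in the polynomial ring, without properness of the ideal.
\<close>

definition regular_list :: "'a::comm_ring_1 list \<Rightarrow> bool" where
  "regular_list fs \<longleftrightarrow>
    (\<forall>i<length fs. \<forall>a. a * fs ! i \<in> idl.span (set (take i fs)) \<longrightarrow> a \<in> idl.span (set (take i fs)))"

lemma regular_listD:
  "regular_list fs \<Longrightarrow> i < length fs \<Longrightarrow> a * fs ! i \<in> idl.span (set (take i fs)) \<Longrightarrow> a \<in> idl.span (set (take i fs))"
  by (simp add: regular_list_def)

lemma regular_list_append1:
  assumes "regular_list (fs @ gs)"
  shows "regular_list fs"
  unfolding regular_list_def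
proof (intro allI impI)
  fix i a assume i: "i < length fs" and a: "a * fs ! i \<in> idl.span (set (take i fs))"
  show "a \<in> idl.span (set (take i fs))" using regular_listD[OF assms, of i a] i a by (simp add: nth_append)
qed

lemma regular_sequence_iff:
  "regular_sequence poly_ring fs \<longleftrightarrow> regular_list fs \<and> idl.span (set fs) \<noteq> (UNIV :: ('v, 'k::comm_ring_1) mpolynomial set)"
  unfolding regular_sequence_def genideal_poly_ring regular_list_def by simp

context
  fixes I :: "('v, 'k::comm_ring_1) mpolynomial set"
  assumes I: "idl.subspace I"
begin

lemma ideal_I: "ideal I poly_ring" using I by (simp add: ideal_poly_ring_iff)

lemma cring_Quot: "cring (poly_ring Quot I)"
  by (rule ideal.quotient_is_cring[OF ideal_I cring_poly_ring])

lemma residue_hom: "residue I \<in> ring_hom poly_ring (poly_ring Quot I)"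
  using ideal.rcos_ring_hom[OF ideal_I] unfolding residue_def[abs_def] .

lemma carrier_Quot: "carrier (poly_ring Quot I) = range (residue I)"
  by (auto simp: FactRing_def A_RCOSETS_def' residue_def)

lemma residue_simps:
  "residue I f \<otimes>\<^bsub>poly_ring Quot I\<^esub> residue I g = residue I (f * g)"
  "residue I f \<oplus>\<^bsub>poly_ring Quot I\<^esub> residue I g = residue I (f + g)"
  "\<one>\<^bsub>poly_ring Quot I\<^esub> = residue I 1"
  using ring_hom_mult[OF residue_hom, of f g] ring_hom_add[OF residue_hom, of f g]
    ring_hom_one[OF residue_hom] by auto

lemma residue_eq_iff: "residue I f = residue I g \<longleftrightarrow> f - g \<in> I"
proof -
  have 1: "residue I f = (\<lambda>h. h + f) ` I" for f
    by (auto simp: residue_def a_r_coset_def r_coset_def)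
  show ?thesis
  proof
    assume "residue I f = residue I g"
    then have "0 + f \<in> (\<lambda>h. h + g) ` I" unfolding 1 using idl.subspace_0[OF I] by blast
    then show "f - g \<in> I" by auto
  next
    assume *: "f - g \<in> I"
    have "h + f \<in> (\<lambda>h. h + g) ` I" if "h \<in> I" for h
      using idl.subspace_add[OF I that *] by (auto intro!: image_eqI[of _ _ "h + (f - g)"])
    moreover have "h + g \<in> (\<lambda>h. h + f) ` I" if "h \<in> I" for h
      using idl.subspace_diff[OF I that *] by (auto intro!: image_eqI[of _ _ "h - (f - g)"])
    ultimately show "residue I f = residue I g" unfolding 1 by blast
  qed
qed

lemma zero_Quot: "\<zero>\<^bsub>poly_ring Quot I\<^esub> = residue I 0"
proof -
  have "residue I 0 = I" by (auto simp: residue_def a_r_coset_def r_coset_def)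
  then show ?thesis by (simp add: FactRing_def)
qed

lemma residue_in_image_iff:
  assumes "idl.subspace J" "I \<subseteq> J"
  shows "residue I f \<in> residue I ` J \<longleftrightarrow> f \<in> J"
proof
  assume "residue I f \<in> residue I ` J"
  then obtain g where "g \<in> J" "f - g \<in> J" using assms by (auto simp: residue_eq_iff)
  then show "f \<in> J" using idl.subspace_add[OF assms(1)] by fastforce
qed auto

text \<open>
  Ideals of the quotient ring are images of ideals containing \<open>I\<close>, so that all computations
  in the coordinate ring can be carried out in the polynomial ring.
\<close>

lemma genideal_Quot: "genideal (poly_ring Quot I) (residue I ` G) = residue I ` idl.span (I \<union> G)"
proof
  interpret Q: cring "poly_ring Quot I" by (rule cring_Quot)
  have "ideal (residue I ` idl.span (I \<union> G)) (poly_ring Quot I)"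
  proof (rule idealI[OF Q.ring_axioms])
    show "subgroup (residue I ` idl.span (I \<union> G)) (add_monoid (poly_ring Quot I))"
    proof (rule subgroup.intro)
      fix x assume "x \<in> residue I ` idl.span (I \<union> G)"
      then obtain f where f: "f \<in> idl.span (I \<union> G)" "x = residue I f" by auto
      have "residue I (- f) \<oplus>\<^bsub>poly_ring Quot I\<^esub> x = \<zero>\<^bsub>poly_ring Quot I\<^esub>"
        unfolding f residue_simps zero_Quot by simp
      then have "\<ominus>\<^bsub>poly_ring Quot I\<^esub> x = residue I (- f)"
        using Q.minus_equality f by (auto simp: carrier_Quot)
      then have "inv\<^bsub>add_monoid (poly_ring Quot I)\<^esub> x = residue I (- f)"
        by (simp add: a_inv_def)
      then show "inv\<^bsub>add_monoid (poly_ring Quot I)\<^esub> x \<in> residue I ` idl.span (I \<union> G)"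
        using idl.span_neg[OF f(1)] by auto
    qed (auto simp: carrier_Quot residue_simps zero_Quot intro!: imageI idl.span_add idl.span_zero)
  next
    fix a x assume a: "a \<in> residue I ` idl.span (I \<union> G)" and x: "x \<in> carrier (poly_ring Quot I)"
    then obtain f g where f: "f \<in> idl.span (I \<union> G)" "a = residue I f" "x = residue I g"
      by (auto simp: carrier_Quot)
    have "residue I (g * f) \<in> residue I ` idl.span (I \<union> G)"
      using idl.span_scale[OF f(1)] by blast
    then show "x \<otimes>\<^bsub>poly_ring Quot I\<^esub> a \<in> residue I ` idl.span (I \<union> G)"
      "a \<otimes>\<^bsub>poly_ring Quot I\<^esub> x \<in> residue I ` idl.span (I \<union> G)"
      unfolding f residue_simps by (simp_all add: mult.commute)
  qed
  then show "genideal (poly_ring Quot I) (residue I ` G) \<subseteq> residue I ` idl.span (I \<union> G)"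
    unfolding genideal_def using idl.span_superset[of "I \<union> G"] by blast
  have "residue I ` idl.span (I \<union> G) \<subseteq> J"
    if J: "ideal J (poly_ring Quot I)" "residue I ` G \<subseteq> J" for J
  proof -
    have 0: "residue I 0 \<in> J"
      using additive_subgroup.zero_closed[OF ideal.axioms(1)[OF J(1)]] by (simp add: zero_Quot)
    have "idl.subspace {f. residue I f \<in> J}"
    proof (rule idl.subspaceI)
      show "0 \<in> {f. residue I f \<in> J}" using 0 by simp
    next
      fix f g assume "f \<in> {f. residue I f \<in> J}" "g \<in> {f. residue I f \<in> J}"
      then show "f + g \<in> {f. residue I f \<in> J}"
        using additive_subgroup.a_closed[OF ideal.axioms(1)[OF J(1)]] by (simp flip: residue_simps)
    next
      fix c f assume "f \<in> {f. residue I f \<in> J}"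
      then show "c * f \<in> {f. residue I f \<in> J}"
        using ideal.I_l_closed[OF J(1), of "residue I f" "residue I c"]
        by (simp add: carrier_Quot residue_simps)
    qed
    moreover have "I \<union> G \<subseteq> {f. residue I f \<in> J}"
    proof -
      have "residue I f = residue I 0" if "f \<in> I" for f using that by (simp add: residue_eq_iff)
      then show ?thesis using 0 J by auto
    qed
    ultimately show ?thesis using idl.span_minimal[of "I \<union> G" "{f. residue I f \<in> J}"] by auto
  qed
  then show "residue I ` idl.span (I \<union> G) \<subseteq> genideal (poly_ring Quot I) (residue I ` G)"
    unfolding genideal_def by blast
qed

lemma regular_sequence_Quot:
  "regular_sequence (poly_ring Quot I) (map (residue I) fs) \<longleftrightarrow>
     (\<forall>i<length fs. \<forall>a. a * fs ! i \<in> idl.span (I \<union> set (take i fs)) \<longrightarrow> a \<in> idl.span (I \<union> set (take i fs))) \<and>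
     idl.span (I \<union> set fs) \<noteq> UNIV"
proof -
  have 1: "residue I f \<in> residue I ` idl.span (I \<union> G) \<longleftrightarrow> f \<in> idl.span (I \<union> G)" for f G
    using idl.span_superset[of "I \<union> G"] by (intro residue_in_image_iff) (auto simp: idl.subspace_span)
  have 2: "residue I ` idl.span (I \<union> G) = range (residue I) \<longleftrightarrow> idl.span (I \<union> G) = UNIV" for G
  proof
    assume *: "residue I ` idl.span (I \<union> G) = range (residue I)"
    have "f \<in> idl.span (I \<union> G)" for f unfolding 1[symmetric] * by (rule rangeI)
    then show "idl.span (I \<union> G) = UNIV" by auto
  qed simp
  have 3: "genideal (poly_ring Quot I) (set (take i (map (residue I) fs))) = residue I ` idl.span (I \<union> set (take i fs))" for i
    unfolding genideal_Quot[symmetric] take_map by simp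
  have 4: "genideal (poly_ring Quot I) (set (map (residue I) fs)) = residue I ` idl.span (I \<union> set fs)"
    unfolding genideal_Quot[symmetric] by simp
  have 5: "(\<forall>a\<in>range (residue I). a \<otimes>\<^bsub>poly_ring Quot I\<^esub> (map (residue I) fs ! i) \<in> residue I ` idl.span (I \<union> set (take i fs))
      \<longrightarrow> a \<in> residue I ` idl.span (I \<union> set (take i fs))) \<longleftrightarrow>
     (\<forall>a. a * fs ! i \<in> idl.span (I \<union> set (take i fs)) \<longrightarrow> a \<in> idl.span (I \<union> set (take i fs)))"
    if "i < length fs" for i
    unfolding ball_simps nth_map[OF that] residue_simps 1 by (rule refl)
  have 6: "set (map (residue I) fs) \<subseteq> range (residue I)" by auto
  show ?thesis
    unfolding regular_sequence_def carrier_Quot 3 4 2 length_map by (simp only: 5 6 simp_thms cong: imp_cong)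
qed

end


section \<open>Dual points and dimensions of graded pieces\<close>

interpretation pv: vector_space "\<lambda>(c::'k::field) (f::('v, 'k) mpolynomial). Const c * f"
  by standard (auto simp: algebra_simps Const_add Const_mult)

declare pv.scale_scale [simp del]

lemma idl_subspace_pv: "idl.subspace I \<Longrightarrow> pv.subspace (I :: ('v, 'k::field) mpolynomial set)"
  by (auto simp: idl.subspace_def pv.subspace_def)

lemma pv_subspace_part: "pv.subspace (part w d :: ('v::finite, 'k::field) mpolynomial set)"
  by (auto simp: pv.subspace_def part_add part_Const_mult)

text \<open>
  Row reduction of the evaluation map \<open>U \<rightarrow> K\<^sup>Z\<close>: some subset \<open>Q\<close> of the points carries a dual basis of the space of
  values, and the values at \<open>Q\<close> determine those at all of \<open>Z\<close>. All dimensions of graded pieces are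
  computed from such a \<open>Q\<close>.
\<close>

lemma dual_points:
  fixes U :: "('v, 'k::field) mpolynomial set" and ev :: "'z \<Rightarrow> ('v, 'k) mpolynomial \<Rightarrow> 'k"
  assumes "finite Z" and U: "pv.subspace U"
    and add: "\<And>z f g. ev z (f + g) = ev z f + ev z g" and scale: "\<And>z c f. ev z (Const c * f) = c * ev z f"
  shows "\<exists>Q b. Q \<subseteq> Z \<and> (\<forall>q\<in>Q. b q \<in> U) \<and>
    (\<forall>q\<in>Q. \<forall>q'\<in>Q. ev q' (b q) = (if q = q' then 1 else 0)) \<and>
    (\<forall>f\<in>U. \<forall>z\<in>Z. ev z f = (\<Sum>q\<in>Q. ev q f * ev z (b q)))"
  using assms(1)
proof (induction Z rule: finite_induct)
  case empty then show ?case by simp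
next
  case (insert p Z)
  have ev0: "ev z 0 = 0" for z using scale[of z 0 0] by simp
  have evsum: "ev z (\<Sum>q\<in>Q. Const (c q) * b q) = (\<Sum>q\<in>Q. c q * ev z (b q))" for z Q c b
    by (induction Q rule: infinite_finite_induct) (auto simp: ev0 add scale)
  have evdiff: "ev z (f - g) = ev z f - ev z g" for z f g
    using add[of z "f - g" g] by simp
  obtain Q b where Q: "Q \<subseteq> Z" and b: "\<forall>q\<in>Q. b q \<in> U"
    and dual: "\<forall>q\<in>Q. \<forall>q'\<in>Q. ev q' (b q) = (if q = q' then 1 else 0)"
    and exp: "\<forall>f\<in>U. \<forall>z\<in>Z. ev z f = (\<Sum>q\<in>Q. ev q f * ev z (b q))"
    using insert.IH by blast
  have finQ: "finite Q" using Q insert finite_subset by blast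
  have sumU: "(\<Sum>q\<in>Q. Const (c q) * b q) \<in> U" for c
    using b by (intro pv.subspace_sum[OF U] pv.subspace_scale[OF U]) auto
  show ?case
  proof (cases "\<forall>f\<in>U. ev p f = (\<Sum>q\<in>Q. ev q f * ev p (b q))")
    case True
    then show ?thesis using Q b dual exp by (intro exI[of _ Q] exI[of _ b]) auto
  next
    case False
    then obtain f0 where f0: "f0 \<in> U" "ev p f0 \<noteq> (\<Sum>q\<in>Q. ev q f0 * ev p (b q))" by blast
    \<comment> \<open>Clear the values on \<open>Q\<close>: \<open>f1\<close> vanishes on all of \<open>Z\<close> but not at \<open>p\<close>, so \<open>p\<close> becomes a new pivot.\<close>
    define f1 where "f1 = f0 - (\<Sum>q\<in>Q. Const (ev q f0) * b q)"
    have f1U: "f1 \<in> U" unfolding f1_def by (intro pv.subspace_diff[OF U] f0 sumU)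
    have f1p: "ev p f1 \<noteq> 0" using f0 by (simp add: f1_def evdiff evsum)
    have f1Z: "ev z f1 = 0" if "z \<in> Z" for z using exp f0(1) that by (simp add: f1_def evdiff evsum)
    define d where "d = Const (1 / ev p f1) * f1"
    have dU: "d \<in> U" unfolding d_def by (rule pv.subspace_scale[OF U f1U])
    have dp: "ev p d = 1" using f1p by (simp add: d_def scale)
    have dZ: "ev z d = 0" if "z \<in> Z" for z using f1Z[OF that] by (simp add: d_def scale)
    define b' where "b' q = (if q = p then d else b q - Const (ev p (b q)) * d)" for q
    have pQ: "p \<notin> Q" using Q insert by blast
    show ?thesis
    proof (intro exI[of _ "insert p Q"] exI[of _ b'] conjI ballI)
      show "insert p Q \<subseteq> insert p Z" using Q by auto
      show "b' q \<in> U" if "q \<in> insert p Q" for q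
        using that b dU unfolding b'_def by (auto intro!: pv.subspace_diff[OF U] pv.subspace_scale[OF U])
      show "ev q' (b' q) = (if q = q' then 1 else 0)" if "q \<in> insert p Q" "q' \<in> insert p Q" for q q'
      proof (cases "q = p")
        case True
        then show ?thesis using that Q dp dZ by (auto simp: b'_def)
      next
        case q: False
        show ?thesis
        proof (cases "q' = p")
          case True
          then show ?thesis using q by (auto simp: b'_def evdiff scale dp)
        next
          case False
          then have "q \<in> Q" "q' \<in> Q" using that q by auto
          then show ?thesis using q dual dZ[of q'] Q by (auto simp: b'_def evdiff scale)
        qed
      qed
      show "ev z f = (\<Sum>q\<in>insert p Q. ev q f * ev z (b' q))" if f: "f \<in> U" and z: "z \<in> insert p Z" for f z
      proof -
        have "(\<Sum>q\<in>insert p Q. ev q f * ev z (b' q)) =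
            ev p f * ev z d + (\<Sum>q\<in>Q. ev q f * (ev z (b q) - ev p (b q) * ev z d))"
        proof -
          have "(\<Sum>q\<in>Q. ev q f * ev z (b' q)) = (\<Sum>q\<in>Q. ev q f * (ev z (b q) - ev p (b q) * ev z d))"
            using pQ by (intro sum.cong) (auto simp: b'_def evdiff scale)
          then show ?thesis using pQ finQ by (simp add: b'_def)
        qed
        also have "\<dots> = ev p f * ev z d + (\<Sum>q\<in>Q. ev q f * ev z (b q)) - (\<Sum>q\<in>Q. ev q f * ev p (b q)) * ev z d"
          by (simp add: right_diff_distrib sum_subtractf sum_distrib_right mult.assoc)
        also have "\<dots> = ev z f"
          using z dp dZ[of z] exp f by auto
        finally show ?thesis by simp
      qed
    qed
  qed
qed

lemma subfield_constants:
  fixes I :: "('v, 'k::field) mpolynomial set"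
  assumes I: "idl.subspace I" and "I \<noteq> UNIV"
  shows "subfield (residue I ` range Const) (poly_ring Quot I)"
proof -
  interpret Q: cring "poly_ring Quot I" by (rule cring_Quot[OF I])
  note simps = residue_simps[OF I] zero_Quot[OF I] carrier_Quot[OF I]
  have neg: "\<ominus>\<^bsub>poly_ring Quot I\<^esub> residue I f = residue I (- f)" for f
    by (rule Q.minus_equality) (simp_all add: simps)
  have one: "(1 :: ('v, 'k) mpolynomial) \<notin> I"
    using assms idl.subspace_scale[OF I, of 1] by auto
  have "subring (residue I ` range Const) (poly_ring Quot I)"
  proof (rule Q.subringI)
    show "\<one>\<^bsub>poly_ring Quot I\<^esub> \<in> residue I ` range Const"
      unfolding simps Const_1[symmetric] by blast
  qed (auto simp: simps neg simp flip: Const_add Const_mult Const_uminus)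
  then have sub: "subcring (residue I ` range Const) (poly_ring Quot I)"
    by (rule Q.subcringI')
  show ?thesis
  proof (rule Q.subfieldI[OF sub], intro equalityI subsetI)
    fix x assume "x \<in> Units ((poly_ring Quot I)\<lparr>carrier := residue I ` range Const\<rparr>)"
    then obtain y where y: "x \<in> residue I ` range Const" "y \<in> residue I ` range Const"
      "x \<otimes>\<^bsub>poly_ring Quot I\<^esub> y = \<one>\<^bsub>poly_ring Quot I\<^esub>"
      by (auto simp: Units_def)
    have "x \<noteq> residue I 0"
    proof
      assume "x = residue I 0"
      with y have "residue I 0 = residue I 1" by (auto simp: simps)
      then have "0 - 1 \<in> I" by (simp only: residue_eq_iff[OF I])
      then show False using one idl.subspace_neg[OF I, of "0 - 1"] by simp
    qed
    with y show "x \<in> residue I ` range Const - {\<zero>\<^bsub>poly_ring Quot I\<^esub>}" by (simp add: simps)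
  next
    fix x assume "x \<in> residue I ` range Const - {\<zero>\<^bsub>poly_ring Quot I\<^esub>}"
    then obtain c where c: "x = residue I (Const c)" and "x \<noteq> residue I 0" unfolding simps by blast
    then have c0: "c \<noteq> 0" by auto
    have "residue I (Const c) \<otimes>\<^bsub>poly_ring Quot I\<^esub> residue I (Const (1 / c)) = \<one>\<^bsub>poly_ring Quot I\<^esub>"
      "residue I (Const (1 / c)) \<otimes>\<^bsub>poly_ring Quot I\<^esub> residue I (Const c) = \<one>\<^bsub>poly_ring Quot I\<^esub>"
      unfolding simps Const_mult[symmetric] using c0 by simp_all
    then have "residue I (Const c) \<in> Units ((poly_ring Quot I)\<lparr>carrier := residue I ` range Const\<rparr>)"
      unfolding Units_def mem_Collect_eq partial_object.simps monoid.simps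
      by (intro conjI bexI[of _ "residue I (Const (1 / c))"] imageI rangeI) simp_all
    then show "x \<in> Units ((poly_ring Quot I)\<lparr>carrier := residue I ` range Const\<rparr>)"
      using c by simp
  qed
qed

text \<open>
  The residues of a dual basis form a basis of the piece: they are independent because evaluations
  factor through the quotient, and they span because an element of \<open>U\<close> without values on \<open>Q\<close> lies in \<open>I\<close>.
\<close>

lemma piece_dim_eq_card:
  fixes I :: "('v, 'k::field) mpolynomial set" and ev :: "'z \<Rightarrow> ('v, 'k) mpolynomial \<Rightarrow> 'k"
  assumes I: "idl.subspace I" and I1: "I \<noteq> UNIV" and U: "pv.subspace U"
    and MV: "M \<inter> residue I ` V = residue I ` U"
    and add: "\<And>z f g. ev z (f + g) = ev z f + ev z g" and scale: "\<And>z c f. ev z (Const c * f) = c * ev z f"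
    and Q: "finite Q" and b: "\<And>q. q \<in> Q \<Longrightarrow> b q \<in> U"
    and dual: "\<And>q q'. q \<in> Q \<Longrightarrow> q' \<in> Q \<Longrightarrow> ev q' (b q) = (if q = q' then 1 else 0)"
    and ker: "\<And>f. f \<in> U \<Longrightarrow> f \<in> I \<longleftrightarrow> (\<forall>q\<in>Q. ev q f = 0)"
  shows "piece_dim I M V = card Q"
proof -
  interpret Q: cring "poly_ring Quot I" by (rule cring_Quot[OF I])
  let ?R = "poly_ring Quot I" and ?K = "residue I ` range Const"
  note simps = residue_simps[OF I] zero_Quot[OF I] carrier_Quot[OF I]
  have ev0: "ev z 0 = 0" for z using scale[of z 0 0] by simp
  have evsum: "ev z (\<Sum>q\<in>A. Const (c q) * b q) = (\<Sum>q\<in>A. c q * ev z (b q))" for z A c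
    by (induction A rule: infinite_finite_induct) (auto simp: ev0 add scale)
  have evdiff: "ev z (f - g) = ev z f - ev z g" for z f g
    using add[of z "f - g" g] by simp
  have sumU: "(\<Sum>q\<in>A. Const (c q) * b q) \<in> U" if "A \<subseteq> Q" for c A
    using b that by (intro pv.subspace_sum[OF U] pv.subspace_scale[OF U]) auto
  obtain qs where qs: "set qs = Q" "distinct qs" using finite_distinct_list[OF Q] by blast
  define E where "E A = {\<Sum>q\<in>A. Const (c q) * b q | c. True}" for A
  have main: "Q.independent ?K (map (residue I \<circ> b) ps) \<and>
      Q.Span ?K (map (residue I \<circ> b) ps) = residue I ` E (set ps)"
    if "distinct ps" "set ps \<subseteq> Q" for ps
    using that
  proof (induction ps)
    case Nil
    show ?case by (auto simp: E_def simps)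
  next
    case (Cons p ps)
    then have IH: "Q.independent ?K (map (residue I \<circ> b) ps)"
      "Q.Span ?K (map (residue I \<circ> b) ps) = residue I ` E (set ps)"
      unfolding distinct.simps list.set insert_subset by blast+
    have p: "p \<in> Q" "p \<notin> set ps" "set ps \<subseteq> Q" using Cons.prems by auto
    have notin: "residue I (b p) \<notin> residue I ` E (set ps)"
    proof
      assume "residue I (b p) \<in> residue I ` E (set ps)"
      then obtain c where c: "b p - (\<Sum>q\<in>set ps. Const (c q) * b q) \<in> I"
        by (auto simp: E_def residue_eq_iff[OF I])
      have "b p - (\<Sum>q\<in>set ps. Const (c q) * b q) \<in> U"
        using p by (intro pv.subspace_diff[OF U] b sumU)
      with c p have "ev p (b p - (\<Sum>q\<in>set ps. Const (c q) * b q)) = 0" using ker by blast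
      moreover have "(\<Sum>q\<in>set ps. c q * ev p (b q)) = 0"
        using p dual by (intro sum.neutral) (auto, metis subsetD)
      ultimately show False using p dual by (simp add: evdiff evsum)
    qed
    have ext: "Q.line_extension ?K (residue I (b p)) (residue I ` E (set ps)) = residue I ` E (set (p # ps))"
    proof (intro equalityI subsetI)
      fix u assume "u \<in> Q.line_extension ?K (residue I (b p)) (residue I ` E (set ps))"
      then obtain c d where u: "u = residue I (Const d * b p + (\<Sum>q\<in>set ps. Const (c q) * b q))"
        by (auto simp: Q.line_extension_mem_iff E_def simps)
      have "Const d * b p + (\<Sum>q\<in>set ps. Const (c q) * b q) =
          (\<Sum>q\<in>set (p # ps). Const ((c(p := d)) q) * b q)"
        using p by simp (rule sum.cong, auto)
      then show "u \<in> residue I ` E (set (p # ps))" unfolding u E_def by blast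
    next
      fix u assume "u \<in> residue I ` E (set (p # ps))"
      then obtain c where "u = residue I (\<Sum>q\<in>set (p # ps). Const (c q) * b q)"
        by (auto simp: E_def)
      then have "u = residue I (Const (c p)) \<otimes>\<^bsub>?R\<^esub> residue I (b p) \<oplus>\<^bsub>?R\<^esub>
          residue I (\<Sum>q\<in>set ps. Const (c q) * b q)"
        using p by (simp add: simps)
      moreover have "residue I (\<Sum>q\<in>set ps. Const (c q) * b q) \<in> residue I ` E (set ps)"
        unfolding E_def by blast
      ultimately show "u \<in> Q.line_extension ?K (residue I (b p)) (residue I ` E (set ps))"
        unfolding Q.line_extension_mem_iff by blast
    qed
    have "Q.Span ?K (map (residue I \<circ> b) (p # ps)) =
        Q.line_extension ?K (residue I (b p)) (Q.Span ?K (map (residue I \<circ> b) ps))" by (simp add: comp_def)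
    moreover have "Q.independent ?K (residue I (b p) # map (residue I \<circ> b) ps)"
      by (rule Q.li_Cons) (use IH notin in \<open>auto simp: carrier_Quot[OF I] simp del: Q.Span.simps\<close>)
    ultimately show ?case using IH ext by (simp del: Q.Span.simps add: comp_def)
  qed
  have "residue I ` E Q = residue I ` U"
  proof (intro equalityI subsetI)
    fix u assume "u \<in> residue I ` E Q"
    then obtain c where "u = residue I (\<Sum>q\<in>Q. Const (c q) * b q)" unfolding E_def by blast
    then show "u \<in> residue I ` U" using sumU[of Q c] by blast
  next
    fix u assume "u \<in> residue I ` U"
    then obtain f where f: "f \<in> U" "u = residue I f" by blast
    let ?g = "\<Sum>q\<in>Q. Const (ev q f) * b q"
    have 0: "ev p (f - ?g) = 0" if "p \<in> Q" for p
    proof -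
      have "(\<Sum>q\<in>Q. ev q f * ev p (b q)) = (\<Sum>q\<in>Q. if q = p then ev q f else 0)"
        using that dual by (intro sum.cong) auto
      then show ?thesis using that Q by (simp add: evdiff evsum)
    qed
    have "f - ?g \<in> U" by (rule pv.subspace_diff[OF U f(1) sumU[OF order_refl]])
    then have "f - ?g \<in> I" by (rule iffD2[OF ker]) (intro ballI 0)
    then have "u = residue I ?g" by (simp only: f(2) residue_eq_iff[OF I])
    moreover have "?g \<in> E Q" unfolding E_def by (intro CollectI exI[of _ "\<lambda>q. ev q f"] conjI refl TrueI)
    ultimately show "u \<in> residue I ` E Q" by (simp only: imageI)
  qed
  then have "Q.Span ?K (map (residue I \<circ> b) qs) = M \<inter> residue I ` V"
    using main[of qs] qs MV by (simp del: Q.Span.simps)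
  moreover have "Q.dimension (length (map (residue I \<circ> b) qs)) ?K (Q.Span ?K (map (residue I \<circ> b) qs))"
    using main[of qs] qs by (intro Q.dimension_independent) (auto simp del: Q.Span.simps)
  ultimately have "Q.dimension (card Q) ?K (M \<inter> residue I ` V)"
    using distinct_card[OF qs(2)] qs(1) by (simp del: Q.Span.simps)
  from Q.dimI[OF subfield_constants[OF I I1] this] show ?thesis
    by (simp add: piece_dim_def over_def)
qed


section \<open>The Bezoutian of a square system vanishing on a finite set of points\<close>

definition linear_form :: "('m option \<Rightarrow> 'k::comm_ring_1) \<Rightarrow> 'm \<Rightarrow> ('m option, 'k) mpolynomial" where
  "linear_form q j = Var (Some j) - Const (q (Some j)) * Var None"

text \<open>
  The derivative with respect to the coordinate of index \<open>None\<close> is left out, as in the Kaehler different.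
\<close>

definition jacobian_at ::
  "('m::finite \<Rightarrow> ('m option, 'k::comm_ring_1) mpolynomial) \<Rightarrow> ('m option \<Rightarrow> 'k) \<Rightarrow> 'k" where
  "jacobian_at P u = det (\<chi> i j. eval_poly u (partial_deriv (Some j) (P i)))"

text \<open>
  Families of polynomials \<open>G q\<close> that depend on \<open>q\<close> polynomially and in such a way that each
  coordinate of \<open>q\<close> comes with a factor \<open>Var None\<close>. With \<open>q\<close> homogeneous, these are the polynomials in two
  groups of variables in which \<open>q\<^sub>x\<close> occurs only as \<open>q\<^sub>x T\<close>, where \<open>T = Var None\<close>.
\<close>

inductive_set families ::
  "(('m option \<Rightarrow> 'k::comm_ring_1) \<Rightarrow> ('m option, 'k) mpolynomial) set" where
  families_const: "(\<lambda>q. g) \<in> families"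
| families_point: "G \<in> families \<Longrightarrow> (\<lambda>q. Const (q x) * Var None * G q) \<in> families"
| families_add: "G \<in> families \<Longrightarrow> H \<in> families \<Longrightarrow> (\<lambda>q. G q + H q) \<in> families"

lemma families_mult_left: "G \<in> families \<Longrightarrow> (\<lambda>q. g * G q) \<in> families"
proof (induction rule: families.induct)
  case (families_point G x)
  have "(\<lambda>q. g * (Const (q x) * Var None * G q)) = (\<lambda>q. Const (q x) * Var None * (g * G q))"
    by (simp add: mult_ac)
  with families.families_point[OF families_point.IH, of x] show ?case by (simp only:)
qed (auto simp: distrib_left intro: families.intros)

lemma families_mult: "G \<in> families \<Longrightarrow> H \<in> families \<Longrightarrow> (\<lambda>q. G q * H q) \<in> families"
proof (induction rule: families.induct)
  case (families_point G x)
  have "(\<lambda>q. Const (q x) * Var None * G q * H q) = (\<lambda>q. Const (q x) * Var None * (G q * H q))"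
    by (simp add: mult_ac)
  with families.families_point[OF families_point.IH[OF families_point.prems], of x] show ?case by (simp only:)
qed (auto simp: distrib_right intro: families.intros families_mult_left)

lemma families_sum: "(\<And>i. i \<in> A \<Longrightarrow> G i \<in> families) \<Longrightarrow> (\<lambda>q. \<Sum>i\<in>A. G i q) \<in> families"
  by (induction A rule: infinite_finite_induct) (auto intro: families.intros)

lemma families_prod: "(\<And>i. i \<in> A \<Longrightarrow> G i \<in> families) \<Longrightarrow> (\<lambda>q. \<Prod>i\<in>A. G i q) \<in> families"
  by (induction A rule: infinite_finite_induct) (auto intro: families.intros families_mult)

lemma families_det:
  "(\<And>i j. (\<lambda>q. A q $ i $ j) \<in> families) \<Longrightarrow> (\<lambda>q. det (A q)) \<in> families"
  unfolding det_def by (intro families_sum families_mult_left families_prod)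

text \<open>
  Expand \<open>G\<close> in powers of the coordinates of \<open>q\<close>. A monomial of degree \<open>e\<close> in these coordinates comes with \<open>T\<^sup>e\<close>;
  it is killed by \<open>\<tau>\<close> if \<open>e < \<rho>\<close>, and \<open>T\<^sup>\<rho>\<close> divides it otherwise.
\<close>

lemma families_functional:
  fixes \<tau> :: "('m::finite option \<Rightarrow> 'k::field) \<Rightarrow> 'k"
  assumes \<tau>: "\<forall>e<\<rho>. \<forall>g\<in>hom_part e. (\<Sum>q\<in>V. \<tau> q * eval_poly q g) = 0"
    and G: "G \<in> families"
  shows "\<exists>H. (\<Sum>q\<in>V. Const (\<tau> q) * G q) = Var None ^ \<rho> * H"
proof -
  \<comment> \<open>The induction needs the general statement with an extra form \<open>u\<close> of degree \<open>e\<close> in the coordinates of \<open>q\<close>.\<close>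
  have "\<exists>H. (\<Sum>q\<in>V. Const (\<tau> q * eval_poly q u) * Var None ^ e * G q) = Var None ^ \<rho> * H"
    if "u \<in> hom_part e" for e u
    using G that
  proof (induction arbitrary: e u rule: families.induct)
    case (families_const g)
    have eq: "(\<Sum>q\<in>V. Const (\<tau> q * eval_poly q u) * Var None ^ e * g) =
        Const (\<Sum>q\<in>V. \<tau> q * eval_poly q u) * Var None ^ e * g"
      by (simp add: Const_sum sum_distrib_right)
    show ?case
    proof (cases "e < \<rho>")
      case True
      then show ?thesis unfolding eq using \<tau> True families_const by (intro exI[of _ 0]) simp
    next
      case False
      then have "Var None ^ e = (Var None ^ \<rho> * Var None ^ (e - \<rho>) :: ('m option, 'k) mpolynomial)"
        by (simp flip: power_add)
      then show ?thesis unfolding eq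
        by (intro exI[of _ "Const (\<Sum>q\<in>V. \<tau> q * eval_poly q u) * Var None ^ (e - \<rho>) * g"])
           (simp add: mult_ac)
    qed
  next
    case (families_point G x)
    have "u * Var x \<in> hom_part (Suc e)"
      using part_mult[of u "\<lambda>_. 1" e "Var x" 1] part_Var[of x "\<lambda>_. 1"] families_point.prems
      by (simp add: hom_part_eq)
    from families_point.IH[OF this] show ?case
      by (simp add: Const_mult mult_ac)
  next
    case (families_add G H)
    from families_add.IH(1)[OF families_add.prems] families_add.IH(2)[OF families_add.prems]
    obtain H1 H2 where "(\<Sum>q\<in>V. Const (\<tau> q * eval_poly q u) * Var None ^ e * G q) = Var None ^ \<rho> * H1"
      "(\<Sum>q\<in>V. Const (\<tau> q * eval_poly q u) * Var None ^ e * H q) = Var None ^ \<rho> * H2" by blast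
    then show ?case
      by (intro exI[of _ "H1 + H2"]) (simp add: distrib_left sum.distrib)
  qed
  from this[of 1 0] show ?thesis by (simp add: hom_part_eq)
qed

text \<open>
  Division of \<open>P\<close> by the linear forms through \<open>q\<close>, with quotients that depend on \<open>q\<close> as a family.
  In degree \<open>0\<close> the quotients have to vanish, since \<open>a - 1\<close> is truncated there.
\<close>

definition taylor_quotients ::
  "nat \<Rightarrow> ('m::finite option, 'k::comm_ring_1) mpolynomial \<Rightarrow>
    (('m option \<Rightarrow> 'k) \<Rightarrow> 'm \<Rightarrow> ('m option, 'k) mpolynomial) \<Rightarrow> bool" where
  "taylor_quotients a P M \<longleftrightarrow>
    (\<forall>j. (\<lambda>q. M q j) \<in> families) \<and>
    (\<forall>q. q None = 1 \<longrightarrow> P = Const (eval_poly q P) * Var None ^ a + (\<Sum>j\<in>UNIV. M q j * linear_form q j)) \<and>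
    (\<forall>q j. M q j \<in> hom_part (a - 1)) \<and> (a = 0 \<longrightarrow> (\<forall>q j. M q j = 0))"

lemma taylor_quotientsD:
  assumes "taylor_quotients a P M"
  shows "(\<lambda>q. M q j) \<in> families"
    and "q None = 1 \<Longrightarrow> P = Const (eval_poly q P) * Var None ^ a + (\<Sum>j\<in>UNIV. M q j * linear_form q j)"
    and "M q j \<in> hom_part (a - 1)" and "a = 0 \<Longrightarrow> M q j = 0"
proof -
  note * = assms[unfolded taylor_quotients_def]
  show "(\<lambda>q. M q j) \<in> families" by (rule spec[OF conjunct1[OF *]])
  have "q None = 1 \<longrightarrow> P = Const (eval_poly q P) * Var None ^ a + (\<Sum>j\<in>UNIV. M q j * linear_form q j)"
    by (rule spec[OF conjunct1[OF conjunct2[OF *]]])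
  then show "P = Const (eval_poly q P) * Var None ^ a + (\<Sum>j\<in>UNIV. M q j * linear_form q j)" if "q None = 1"
    using that by (rule mp)
  show "M q j \<in> hom_part (a - 1)"
    by (rule conjunct1[OF conjunct2[OF conjunct2[OF *]], rule_format])
  show "M q j = 0" if "a = 0"
    by (rule conjunct2[OF conjunct2[OF conjunct2[OF *]], rule_format, OF that])
qed

lemma taylor_division:
  fixes P :: "('m::finite option, 'k::comm_ring_1) mpolynomial"
  assumes "P \<in> hom_part a"
  shows "\<exists>M. taylor_quotients a P M"
  using assms
proof (induction rule: hom_part_induct)
  case (zero d)
  show ?case by (rule exI[of _ "\<lambda>_ _. 0"]) (auto simp: taylor_quotients_def hom_part_eq intro: families.intros)
next
  case (Const c)
  show ?case by (rule exI[of _ "\<lambda>_ _. 0"]) (auto simp: taylor_quotients_def hom_part_eq intro: families.intros)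
next
  case (add d f g)
  then obtain M N where "taylor_quotients d f M" "taylor_quotients d g N" by blast
  note M = taylor_quotientsD[OF this(1)] and N = taylor_quotientsD[OF this(2)]
  show ?case
  proof (unfold taylor_quotients_def, intro exI[of _ "\<lambda>q j. M q j + N q j"] conjI allI impI)
    fix q :: "'m option \<Rightarrow> 'k" assume q: "q None = 1"
    have "f + g = (Const (eval_poly q f) * Var None ^ d + (\<Sum>j\<in>UNIV. M q j * linear_form q j)) +
       (Const (eval_poly q g) * Var None ^ d + (\<Sum>j\<in>UNIV. N q j * linear_form q j))"
      using M(2)[of q, OF q] N(2)[of q, OF q] by (rule arg_cong2)
    also have "\<dots> = Const (eval_poly q (f + g)) * Var None ^ d + (\<Sum>j\<in>UNIV. (M q j + N q j) * linear_form q j)"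
      by (simp add: Const_add distrib_right sum.distrib add_ac)
    finally show "f + g = Const (eval_poly q (f + g)) * Var None ^ d + (\<Sum>j\<in>UNIV. (M q j + N q j) * linear_form q j)" .
  qed (use M N in \<open>auto intro: families.intros simp: hom_part_eq part_add\<close>)
next
  case (Var d f x)
  then obtain M where "taylor_quotients d f M" by blast
  note M = taylor_quotientsD[OF this]
  have MT: "Var None * M q j \<in> part (\<lambda>_. 1) d" for q j
  proof (cases "d = 0")
    case False
    then show ?thesis
      using part_mult[OF part_Var[of None "\<lambda>_. 1"], of "M q j" "d - 1"] M(3)[of q j] by (simp add: hom_part_eq)
  qed (simp add: M(4))
  show ?case
  proof (cases x)
    case None
    show ?thesis
    proof (unfold taylor_quotients_def, intro exI[of _ "\<lambda>q j. Var None * M q j"] conjI allI impI)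
      fix q :: "'m option \<Rightarrow> 'k" assume q: "q None = 1"
      have "f * Var x = (Const (eval_poly q f) * Var None ^ d + (\<Sum>j\<in>UNIV. M q j * linear_form q j)) * Var x"
        using M(2)[of q, OF q] by (rule arg_cong)
      also have "\<dots> = Const (eval_poly q (f * Var x)) * Var None ^ Suc d + (\<Sum>j\<in>UNIV. Var None * M q j * linear_form q j)"
        using q None by (simp add: distrib_left distrib_right sum_distrib_left mult_ac)
      finally show "f * Var x = Const (eval_poly q (f * Var x)) * Var None ^ Suc d + (\<Sum>j\<in>UNIV. Var None * M q j * linear_form q j)" .
    qed (use M MT in \<open>auto intro: families_mult_left simp: hom_part_eq\<close>)
  next
    case (Some i)
    show ?thesis
    proof (unfold taylor_quotients_def, intro exI[of _ "\<lambda>q j. Const (q x) * Var None * M q j + (if j = i then f else 0)"] conjI allI impI)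
      fix q :: "'m option \<Rightarrow> 'k" assume q: "q None = 1"
      have "f * Var x = f * linear_form q i + Const (q x) * Var None * f"
        by (simp add: linear_form_def Some algebra_simps)
      also have "Const (q x) * Var None * f = Const (q x) * Var None *
          (Const (eval_poly q f) * Var None ^ d + (\<Sum>j\<in>UNIV. M q j * linear_form q j))"
        using M(2)[of q, OF q] by (rule arg_cong)
      also have "\<dots> = Const (eval_poly q (f * Var x)) * Var None ^ Suc d +
          (\<Sum>j\<in>UNIV. Const (q x) * Var None * M q j * linear_form q j)"
        by (simp add: distrib_left sum_distrib_left mult_ac Const_mult)
      also have "f * linear_form q i = (\<Sum>j\<in>UNIV. (if j = i then f else 0) * linear_form q j)"
        by (simp add: if_distrib[of "\<lambda>y. y * _"] cong: if_cong)
      finally show "f * Var x = Const (eval_poly q (f * Var x)) * Var None ^ Suc d +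
          (\<Sum>j\<in>UNIV. (Const (q x) * Var None * M q j + (if j = i then f else 0)) * linear_form q j)"
        unfolding distrib_right sum.distrib by (simp only: add_ac)
    next
      fix j
      show "(\<lambda>q. Const (q x) * Var None * M q j + (if j = i then f else 0)) \<in> families"
        by (intro families_add families_point families_const M(1))
    next
      fix q j
      have "Const (q x) * (Var None * M q j) \<in> part (\<lambda>_. 1) d" by (rule part_Const_mult[OF MT])
      then show "Const (q x) * Var None * M q j + (if j = i then f else 0) \<in> hom_part (Suc d - 1)"
        using Var(1) by (auto simp: hom_part_eq mult.assoc intro: part_add)
    qed auto
  qed
qed

text \<open>
  Cramer's rule over a commutative ring, where the solution cannot be divided by the determinant: \<open>x j * det A\<close> is a
  combination of the entries of \<open>A x\<close>.
\<close>

lemma cramer_ring: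
  fixes A :: "'a::comm_ring_1^'n^'n"
  shows "x j * det A =
    (\<Sum>l\<in>UNIV. (\<Sum>k\<in>UNIV. A $ l $ k * x k) * det (\<chi> k. if k = j then axis l 1 else column k A))"
proof -
  \<comment> \<open>\<open>R v\<close> is the determinant of \<open>A\<close> with column \<open>j\<close> replaced by \<open>v\<close>; evaluate it at \<open>A x\<close> in two ways.\<close>
  define R where "R v = det (\<chi> k. if k = j then v else column k A)" for v
  have lin: "R (\<Sum>l\<in>UNIV. c l *s v l) = (\<Sum>l\<in>UNIV. c l * R (v l))" for c :: "'n \<Rightarrow> 'a" and v
    unfolding R_def
    by (subst det_linear_row_sum[of UNIV j "\<lambda>_ l. c l *s v l", simplified]) (simp add: det_row_mul)
  have col: "R (column k A) = (if k = j then det A else 0)" for k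
  proof (cases "k = j")
    case True
    have "(\<chi> k. if k = j then column j A else column k A) = transpose A"
      by (simp add: vec_eq_iff column_def transpose_def)
    then show ?thesis using True by (simp add: R_def)
  next
    case False
    then have "R (column k A) = 0" unfolding R_def
      by (intro det_identical_rows[of j k]) (auto simp: row_def vec_eq_iff)
    then show ?thesis using False by simp
  qed
  have "(\<Sum>k\<in>UNIV. x k *s column k A) = (\<Sum>l\<in>UNIV. (\<Sum>k\<in>UNIV. A $ l $ k * x k) *s axis l 1)"
    by (simp add: vec_eq_iff column_def axis_def if_distrib[of "\<lambda>y. _ * y"] if_distrib[of "\<lambda>y. y * _"] mult.commute cong: if_cong)
  then have "R (\<Sum>k\<in>UNIV. x k *s column k A) = R (\<Sum>l\<in>UNIV. (\<Sum>k\<in>UNIV. A $ l $ k * x k) *s axis l 1)"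
    by simp
  then show ?thesis unfolding lin
    by (simp add: col if_distrib[of "\<lambda>y. _ * y"] cong: if_cong) (simp add: R_def)
qed

lemma det_eq_0_if_kernel:
  fixes N :: "'k::field^'n^'n"
  assumes "N *v x = 0" "x \<noteq> 0"
  shows "det N = 0"
proof (rule ccontr)
  assume "det N \<noteq> 0"
  then obtain B where "B ** N = mat 1" using invertible_det_nz[of N] by (auto simp: invertible_def)
  then have "x = B *v (N *v x)" by (simp add: matrix_vector_mul_assoc)
  then show False using assms by simp
qed

text \<open>
  At \<open>q\<close> itself the division matrix of \<open>P\<close> is the Jacobian matrix. At another point \<open>p\<close> of \<open>V\<close> it has the kernel
  vector \<open>p - q\<close>, because all \<open>P i\<close> vanish at \<open>p\<close>; so the determinant is zero there. Cramer's rule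
  applied to this matrix turns \<open>b q\<close> times a combination of the linear forms through \<open>q\<close> into a combination
  of the \<open>P i\<close>.
\<close>

lemma bezoutian_exists:
  fixes P :: "'m::finite \<Rightarrow> ('m option, 'k::field) mpolynomial"
  assumes "\<forall>q\<in>V. q None = 1" and "\<forall>i. P i \<in> hom_part (a i)" and "\<forall>i. \<forall>q\<in>V. eval_poly q (P i) = 0"
  shows "\<exists>b. b \<in> families \<and> (\<forall>q. b q \<in> hom_part (sum a UNIV - CARD('m))) \<and>
    (\<forall>p\<in>V. \<forall>q\<in>V. eval_poly p (b q) = (if p = q then jacobian_at P q else 0)) \<and>
    (\<forall>e h. h \<in> hom_part e \<longrightarrow> (\<forall>q\<in>V. eval_poly q h = 0) \<longrightarrow>
      (\<exists>G. (\<forall>i. (\<lambda>q. G q i) \<in> families) \<and> (\<forall>q\<in>V. b q * h = (\<Sum>i\<in>UNIV. G q i * P i))))"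
proof -
  have V: "q None = 1" if "q \<in> V" for q using assms(1) that by blast
  have P: "P i \<in> hom_part (a i)" for i using assms(2) by blast
  have PV: "eval_poly q (P i) = 0" if "q \<in> V" for i q using assms(3) that by blast
  have "\<exists>M. \<forall>i. taylor_quotients (a i) (P i) (M i)"
    by (intro choice allI taylor_division P)
  then obtain M where "\<And>i. taylor_quotients (a i) (P i) (M i)" by blast
  note M = taylor_quotientsD[OF this]
  have M2: "P i = Const (eval_poly q (P i)) * Var None ^ a i + (\<Sum>j\<in>UNIV. M i q j * linear_form q j)"
    if "q None = 1" for q i
    using that by (rule M(2))
  define B where "B q = (\<chi> i j. M i q j)" for q
  have PB: "P i = (\<Sum>j\<in>UNIV. B q $ i $ j * linear_form q j)" if "q \<in> V" for i q
    using M2[of q i, OF V[OF that]] PV[OF that, of i] by (simp add: B_def)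
  have Bhom: "det (B q) \<in> hom_part (sum a UNIV - CARD('m))" for q
    using det_part[of "B q" "\<lambda>_. 1" a "\<lambda>_. 1"] M(3,4) by (simp add: B_def hom_part_eq)
  have Bfam: "(\<lambda>q. B q $ i $ j) \<in> families" for i j by (simp add: B_def M(1))
  have ev: "eval_poly p (linear_form q j) = p (Some j) - q (Some j)" if "p \<in> V" for p q j
    using V[OF that] by (simp add: linear_form_def)
  have evB: "eval_poly p (det (B q)) = det (\<chi> i j. eval_poly p (B q $ i $ j))" for p q
    by (rule ring_morphism_det[OF ring_morphism_eval])
  have diag: "eval_poly q (det (B q)) = jacobian_at P q" if q: "q \<in> V" for q
  proof -
    have "eval_poly q (partial_deriv (Some k) (P i)) = eval_poly q (B q $ i $ k)" for i k
    proof -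
      have "partial_deriv (Some k) (linear_form q j) = (if j = k then 1 else 0)" for j
        by (simp add: linear_form_def partial_deriv_diff partial_deriv_mult partial_deriv_Var)
      then show ?thesis
        by (subst PB[OF q])
           (simp add: partial_deriv_sum partial_deriv_mult ev[OF q] if_distrib[of "\<lambda>y. _ * y"]
             if_distrib[of "eval_poly q"] cong: if_cong)
    qed
    then show ?thesis by (simp add: evB jacobian_at_def)
  qed
  have off: "eval_poly p (det (B q)) = 0" if p: "p \<in> V" and q: "q \<in> V" and "p \<noteq> q" for p q
  proof -
    let ?x = "\<chi> j. p (Some j) - q (Some j)"
    have "?x \<noteq> 0"
    proof
      assume 0: "?x = 0"
      have "p z = q z" for z
        using 0 V[OF p] V[OF q] by (cases z) (auto simp: vec_eq_iff)
      with \<open>p \<noteq> q\<close> show False by blast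
    qed
    moreover have "(\<chi> i j. eval_poly p (B q $ i $ j)) *v ?x = 0"
    proof -
      have "(\<Sum>j\<in>UNIV. eval_poly p (B q $ i $ j) * (p (Some j) - q (Some j))) = eval_poly p (P i)" for i
        by (subst PB[OF q]) (simp add: ev[OF p])
      then show ?thesis by (simp add: vec_eq_iff matrix_vector_mult_def PV[OF p])
    qed
    ultimately show ?thesis unfolding evB by (intro det_eq_0_if_kernel)
  qed
  have div: "\<exists>G. (\<forall>i. (\<lambda>q. G q i) \<in> families) \<and> (\<forall>q\<in>V. det (B q) * h = (\<Sum>i\<in>UNIV. G q i * P i))"
    if h: "h \<in> hom_part e" and hV: "\<forall>q\<in>V. eval_poly q h = 0" for e h
  proof -
    obtain H where "taylor_quotients e h H" using taylor_division[OF h] by blast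
    note H = taylor_quotientsD[OF this]
    \<comment> \<open>The cofactors of Cramer's rule; they are determinants of families and hence families.\<close>
    define D where "D q j i = det (\<chi> k. if k = j then axis i 1 else column k (B q))" for q j i
    have Dfam: "(\<lambda>q. D q j i) \<in> families" for j i
      unfolding D_def
    proof (rule families_det)
      fix k l
      show "(\<lambda>q. (\<chi> k. if k = j then axis i 1 else column k (B q)) $ k $ l) \<in> families"
        by (cases "k = j") (auto simp: column_def intro: families_const Bfam)
    qed
    show ?thesis
    proof (intro exI[of _ "\<lambda>q i. \<Sum>j\<in>UNIV. H q j * D q j i"] conjI allI ballI)
      fix i show "(\<lambda>q. \<Sum>j\<in>UNIV. H q j * D q j i) \<in> families"
        by (intro families_sum families_mult H Dfam)
    next
      fix q assume q: "q \<in> V"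
      have lf: "linear_form q j * det (B q) = (\<Sum>i\<in>UNIV. P i * D q j i)" for j
        using cramer_ring[of "linear_form q" j "B q"] by (simp add: D_def flip: PB[OF q])
      have "h = (\<Sum>j\<in>UNIV. H q j * linear_form q j)"
        using H(2)[of q, OF V[OF q]] hV q by simp
      then have "det (B q) * h = (\<Sum>j\<in>UNIV. H q j * (linear_form q j * det (B q)))"
        by (simp add: sum_distrib_left mult_ac)
      also have "\<dots> = (\<Sum>j\<in>UNIV. \<Sum>i\<in>UNIV. H q j * D q j i * P i)"
        unfolding lf by (simp add: sum_distrib_left mult_ac)
      also have "\<dots> = (\<Sum>i\<in>UNIV. (\<Sum>j\<in>UNIV. H q j * D q j i) * P i)"
        by (subst sum.swap) (simp add: sum_distrib_right)
      finally show "det (B q) * h = (\<Sum>i\<in>UNIV. (\<Sum>j\<in>UNIV. H q j * D q j i) * P i)" .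
    qed
  qed
  show ?thesis
    by (rule exI[of _ "\<lambda>q. det (B q)"]) (use Bhom diag off div families_det[OF Bfam] in auto)
qed

lemma lookup_mult_Var: "lookup (f * Var x) (t + single x 1) = lookup f t"
  for f :: "('v, 'k::comm_ring_1) mpolynomial"
proof (induction f rule: mpolynomial_induct_terms)
  case (single s c)
  show ?case by (simp only: single_mult_Var lookup_single add_right_cancel)
qed (auto simp: distrib_right lookup_add)

lemma mult_Var_cancel:
  fixes f g :: "('v, 'k::comm_ring_1) mpolynomial"
  assumes "f * Var x = g * Var x"
  shows "f = g"
proof (rule poly_mapping_eqI)
  fix t
  from lookup_mult_Var[of f x t] lookup_mult_Var[of g x t]
  show "lookup f t = lookup g t" unfolding assms by (rule trans[OF sym])
qed

lemma mult_Var_power_cancel: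
  fixes f g :: "('v::finite, 'k::comm_ring_1) mpolynomial"
  shows "f * Var x ^ n = g * Var x ^ n \<Longrightarrow> f = g"
proof (induction n)
  case (Suc n)
  then have "(f * Var x ^ n) * Var x = (g * Var x ^ n) * Var x" by (simp add: mult_ac)
  from Suc.IH[OF mult_Var_cancel[OF this]] show ?case .
qed simp

lemma hom_part_0_Const: "f \<in> hom_part 0 \<Longrightarrow> \<exists>c. f = Const c"
proof -
  assume f: "f \<in> hom_part 0"
  have "t = 0" if "t \<in> keys f" for t
    using f that by (intro poly_mapping_eqI) (auto simp: hom_part_def)
  then have "f = Const (lookup f 0)"
    by (intro poly_mapping_eqI) (auto simp: Const_def lookup_single when_def in_keys_iff)
  then show ?thesis by blast
qed

text \<open>
  Up to the factor \<open>\<Delta>(q)\<close>, the Bezoutian at \<open>q\<close> is a separator of \<open>q\<close>.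
\<close>

lemma separator_of_jacobian:
  fixes P :: "'m::finite \<Rightarrow> ('m option, 'k::field) mpolynomial"
  assumes V': "\<forall>q\<in>V. q None = 1" and P': "\<forall>i. P i \<in> hom_part (a i)" and PV': "\<forall>i. \<forall>q\<in>V. eval_poly q (P i) = 0"
    and q: "q \<in> V"
  shows "\<exists>g\<in>hom_part (sum a UNIV - CARD('m)). eval_poly q g = jacobian_at P q \<and>
    (\<forall>p\<in>V - {q}. eval_poly p g = 0)"
proof -
  obtain b where "\<forall>q. b q \<in> hom_part (sum a UNIV - CARD('m))"
    "\<forall>p\<in>V. \<forall>q\<in>V. eval_poly p (b q) = (if p = q then jacobian_at P q else 0)"
    using bezoutian_exists[OF V' P' PV'] by blast
  then show ?thesis using q by (intro bexI[of _ "b q"]) auto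
qed

text \<open>
  The sum \<open>\<Sum> \<tau>\<^sub>q b\<^sub>q\<close> is a form of degree \<open>\<rho>\<close> and divisible by \<open>T\<^sup>\<rho>\<close>, so it is \<open>\<kappa> T\<^sup>\<rho>\<close>. Evaluating at \<open>p\<close>
  gives the first claim. For the second, multiply by \<open>h\<close> and use the division of \<open>b\<^sub>q h\<close> by the \<open>P i\<close>: the coefficients
  are families as well, so that \<open>T\<^sup>\<rho>\<close> can be cancelled.
\<close>

lemma residue_functional:
  fixes P :: "'m::finite \<Rightarrow> ('m option, 'k::field) mpolynomial" and a :: "'m \<Rightarrow> nat"
  defines "\<rho> \<equiv> sum a UNIV - CARD('m)"
  assumes finV: "finite V" and V': "\<forall>q\<in>V. q None = 1"
    and P': "\<forall>i. P i \<in> hom_part (a i)" and PV': "\<forall>i. \<forall>q\<in>V. eval_poly q (P i) = 0"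
    and \<tau>: "\<forall>e<\<rho>. \<forall>g\<in>hom_part e. (\<Sum>q\<in>V. \<tau> q * eval_poly q g) = 0"
  shows "\<exists>\<kappa>. (\<forall>p\<in>V. \<tau> p * jacobian_at P p = \<kappa>) \<and>
    (\<forall>e h. h \<in> hom_part e \<longrightarrow> (\<forall>q\<in>V. eval_poly q h = 0) \<longrightarrow> Const \<kappa> * h \<in> idl.span (range P))"
proof -
  have V: "q None = 1" if "q \<in> V" for q using V' that by blast
  obtain b where b: "b \<in> families" "\<And>q. b q \<in> hom_part \<rho>"
    "\<And>p q. p \<in> V \<Longrightarrow> q \<in> V \<Longrightarrow> eval_poly p (b q) = (if p = q then jacobian_at P q else 0)"
    and div: "\<And>e h. h \<in> hom_part e \<Longrightarrow> (\<forall>q\<in>V. eval_poly q h = 0) \<Longrightarrow>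
      (\<exists>G. (\<forall>i. (\<lambda>q. G q i) \<in> families) \<and> (\<forall>q\<in>V. b q * h = (\<Sum>i\<in>UNIV. G q i * P i)))"
    using bezoutian_exists[OF V' P' PV'] unfolding \<rho>_def by blast
  obtain H where H: "(\<Sum>q\<in>V. Const (\<tau> q) * b q) = Var None ^ \<rho> * H"
    using families_functional[OF \<tau> b(1)] by blast
  have Tpow: "(Var None ^ \<rho> :: ('m option, 'k) mpolynomial) \<in> part (\<lambda>_. 1) \<rho>"
    using part_power[OF part_Var[of None "\<lambda>_. 1"], of \<rho>] by simp
  obtain \<kappa> where \<kappa>: "component (\<lambda>_. 1) 0 H = Const \<kappa>"
    using hom_part_0_Const[of "component (\<lambda>_. 1) 0 H"] component_in_part by (auto simp: hom_part_eq)
  have sum: "(\<Sum>q\<in>V. Const (\<tau> q) * b q) = Const \<kappa> * Var None ^ \<rho>"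
  proof -
    have "(\<Sum>q\<in>V. Const (\<tau> q) * b q) \<in> part (\<lambda>_. 1) \<rho>"
      using b(2) by (intro part_sum part_Const_mult) (simp add: hom_part_eq)
    then have "(\<Sum>q\<in>V. Const (\<tau> q) * b q) = component (\<lambda>_. 1) \<rho> (\<Sum>q\<in>V. Const (\<tau> q) * b q)"
      by (simp add: component_part)
    also have "\<dots> = component (\<lambda>_. 1) \<rho> (H * Var None ^ \<rho>)" unfolding H by (simp add: mult.commute)
    also have "\<dots> = Const \<kappa> * Var None ^ \<rho>" by (simp only: component_mult_part[OF Tpow] order_refl if_True diff_self_eq_0 \<kappa>)
    finally show ?thesis .
  qed
  have 1: "\<tau> p * jacobian_at P p = \<kappa>" if p: "p \<in> V" for p
  proof -
    have "\<tau> p * jacobian_at P p = (\<Sum>q\<in>V. if q = p then \<tau> q * jacobian_at P q else 0)"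
      using finV p by simp
    also have "\<dots> = (\<Sum>q\<in>V. \<tau> q * eval_poly p (b q))"
      using b(3)[OF p] by (intro sum.cong) auto
    also have "\<dots> = eval_poly p (\<Sum>q\<in>V. Const (\<tau> q) * b q)" by simp
    also have "\<dots> = \<kappa>" unfolding sum using V[OF p] by simp
    finally show ?thesis .
  qed
  have 2: "Const \<kappa> * h \<in> idl.span (range P)" if h: "h \<in> hom_part e" "\<forall>q\<in>V. eval_poly q h = 0" for e h
  proof -
    obtain G where G: "\<And>i. (\<lambda>q. G q i) \<in> families" "\<And>q. q \<in> V \<Longrightarrow> b q * h = (\<Sum>i\<in>UNIV. G q i * P i)"
      using div[OF h] by blast
    have "\<forall>i. \<exists>H. (\<Sum>q\<in>V. Const (\<tau> q) * G q i) = Var None ^ \<rho> * H"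
      using families_functional[OF \<tau> G(1)] by blast
    then obtain K where K: "\<And>i. (\<Sum>q\<in>V. Const (\<tau> q) * G q i) = Var None ^ \<rho> * K i" by metis
    have "Const \<kappa> * h * Var None ^ \<rho> = (\<Sum>q\<in>V. Const (\<tau> q) * b q) * h"
      unfolding sum by (simp add: mult_ac)
    also have "\<dots> = (\<Sum>q\<in>V. Const (\<tau> q) * (b q * h))" by (simp add: sum_distrib_right mult.assoc)
    also have "\<dots> = (\<Sum>q\<in>V. \<Sum>i\<in>UNIV. Const (\<tau> q) * G q i * P i)"
      using G(2) by (intro sum.cong) (auto simp: sum_distrib_left mult.assoc)
    also have "\<dots> = (\<Sum>i\<in>UNIV. (\<Sum>q\<in>V. Const (\<tau> q) * G q i) * P i)"
      by (subst sum.swap) (simp add: sum_distrib_right)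
    also have "\<dots> = (\<Sum>i\<in>UNIV. K i * P i) * Var None ^ \<rho>"
      unfolding K by (subst mult.commute) (simp add: sum_distrib_left mult_ac)
    finally have "Const \<kappa> * h = (\<Sum>i\<in>UNIV. K i * P i)" by (rule mult_Var_power_cancel)
    also have "\<dots> \<in> idl.span (range P)"
      by (intro idl.span_sum idl.span_scale idl.span_base) auto
    finally show ?thesis .
  qed
  show ?thesis using 1 2 by blast
qed


section \<open>Hilbert series of homogeneous regular sequences\<close>

lemma homogeneous_system_solvable:
  fixes a :: "'i \<Rightarrow> 'j \<Rightarrow> 'k::field"
  assumes "finite J" "finite I" "card J < card I"
  shows "\<exists>x. (\<exists>i\<in>I. x i \<noteq> 0) \<and> (\<forall>j\<in>J. (\<Sum>i\<in>I. x i * a i j) = 0)"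
  using assms
proof (induction J arbitrary: I a rule: finite_induct)
  case empty
  then obtain i where "i \<in> I" by fastforce
  then show ?case by (intro exI[of _ "\<lambda>_. 1"]) auto
next
  case (insert j J)
  show ?case
  proof (cases "\<forall>i\<in>I. a i j = 0")
    case True
    obtain x where "\<exists>i\<in>I. x i \<noteq> 0" "\<forall>j\<in>J. (\<Sum>i\<in>I. x i * a i j) = 0"
      using insert.IH[of I a] insert.prems insert.hyps by auto
    then show ?thesis using True by (intro exI[of _ x]) auto
  next
    case False
    then obtain p where p: "p \<in> I" "a p j \<noteq> 0" by blast
    define I' where "I' = I - {p}"
    define a' where "a' i j' = a i j' - a i j / a p j * a p j'" for i j'
    have "card J < card I'" using insert.prems insert.hyps p by (simp add: I'_def)
    moreover have fin: "finite I'" using insert.prems by (simp add: I'_def)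
    ultimately obtain x where x: "\<exists>i\<in>I'. x i \<noteq> 0" "\<forall>j\<in>J. (\<Sum>i\<in>I'. x i * a' i j) = 0"
      using insert.IH[of I' a'] by blast
    define y where "y i = (if i = p then - (\<Sum>i\<in>I'. x i * a i j) / a p j else x i)" for i
    have I: "I = insert p I'" "p \<notin> I'" using p by (auto simp: I'_def)
    have sum: "(\<Sum>i\<in>I. y i * b i) = (\<Sum>i\<in>I'. x i * b i) - (\<Sum>i\<in>I'. x i * a i j) / a p j * b p" for b
    proof -
      have "(\<Sum>i\<in>I'. y i * b i) = (\<Sum>i\<in>I'. x i * b i)" using I by (intro sum.cong) (auto simp: y_def)
      then show ?thesis using I fin by (simp add: y_def)
    qed
    have "(\<Sum>i\<in>I. y i * a i j') = 0" if "j' \<in> J" for j'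
    proof -
      have "(\<Sum>i\<in>I. y i * a i j') = (\<Sum>i\<in>I'. x i * a' i j')"
        unfolding sum by (simp add: a'_def right_diff_distrib sum_subtractf sum_distrib_right sum_divide_distrib mult.assoc)
      then show ?thesis using x that by simp
    qed
    moreover have "(\<Sum>i\<in>I. y i * a i j) = 0" unfolding sum using p by simp
    moreover have "\<exists>i\<in>I. y i \<noteq> 0" using x I by (auto simp: y_def)
    ultimately show ?thesis by blast
  qed
qed

text \<open>
  \<open>b 0, \<dots>, b (n - 1)\<close> is a basis of \<open>W\<close> modulo \<open>J\<close>. A self-contained dimension count for the
  quotients by ideals that need not be vanishing ideals of points.
\<close>

definition quotient_basis ::
  "('v, 'k::field) mpolynomial set \<Rightarrow> ('v, 'k) mpolynomial set \<Rightarrow> (nat \<Rightarrow> ('v, 'k) mpolynomial) \<Rightarrow> nat \<Rightarrow> bool" where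
  "quotient_basis J W b n \<longleftrightarrow> (\<forall>i<n. b i \<in> W) \<and>
     (\<forall>k. (\<Sum>i<n. Const (k i) * b i) \<in> J \<longrightarrow> (\<forall>i<n. k i = 0)) \<and>
     (\<forall>f\<in>W. \<exists>k. f - (\<Sum>i<n. Const (k i) * b i) \<in> J)"

lemma quotient_basis_le:
  assumes J: "idl.subspace J" and b: "quotient_basis J W b n" and c: "quotient_basis J W c m"
  shows "m \<le> n"
proof (rule ccontr)
  assume "\<not> m \<le> n"
  have "\<forall>i. \<exists>k. i < m \<longrightarrow> c i - (\<Sum>j<n. Const (k j) * b j) \<in> J"
    using b c unfolding quotient_basis_def by blast
  then obtain a where a: "\<And>i. i < m \<Longrightarrow> c i - (\<Sum>j<n. Const (a i j) * b j) \<in> J" by metis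
  obtain x where x: "\<exists>i\<in>{..<m}. x i \<noteq> 0" "\<forall>j\<in>{..<n}. (\<Sum>i\<in>{..<m}. x i * a i j) = 0"
    using homogeneous_system_solvable[of "{..<n}" "{..<m}" a] \<open>\<not> m \<le> n\<close> by auto
  have "(\<Sum>i<m. Const (x i) * (c i - (\<Sum>j<n. Const (a i j) * b j))) \<in> J"
    using a by (intro idl.subspace_sum[OF J] idl.subspace_scale[OF J]) auto
  also have "(\<Sum>i<m. Const (x i) * (c i - (\<Sum>j<n. Const (a i j) * b j))) =
      (\<Sum>i<m. Const (x i) * c i) - (\<Sum>j<n. Const (\<Sum>i<m. x i * a i j) * b j)"
    by (simp add: right_diff_distrib sum_subtractf sum_distrib_left sum_distrib_right Const_sum Const_mult mult.assoc
        sum.swap[of _ "{..<m}"])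
  also have "(\<Sum>j<n. Const (\<Sum>i<m. x i * a i j) * b j) = 0"
    using x(2) by (intro sum.neutral) auto
  finally have "(\<Sum>i<m. Const (x i) * c i) \<in> J" by simp
  with c x(1) show False unfolding quotient_basis_def by blast
qed

lemma quotient_basis_unique:
  assumes "idl.subspace J" "quotient_basis J W b n" "quotient_basis J W c m"
  shows "m = n"
  using quotient_basis_le[OF assms] quotient_basis_le[OF assms(1,3,2)] by simp

lemma finite_monomials: "finite {t :: 'v::finite \<Rightarrow>\<^sub>0 nat. wdeg (\<lambda>_. 1) t = e}"
proof (rule finite_imageD[of lookup])
  have "lookup ` {t :: 'v \<Rightarrow>\<^sub>0 nat. wdeg (\<lambda>_. 1) t = e} \<subseteq> {f. \<forall>x. f x \<in> {..e}}"
  proof clarsimp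
    fix t :: "'v \<Rightarrow>\<^sub>0 nat" and x assume "e = wdeg (\<lambda>_. Suc 0) t"
    then show "lookup t x \<le> wdeg (\<lambda>_. Suc 0) t"
      by (auto simp: wdeg_def intro: member_le_sum)
  qed
  moreover have "finite {f :: 'v \<Rightarrow> nat. \<forall>x. f x \<in> {..e}}"
    using finite_PiE[of "UNIV :: 'v set" "\<lambda>_. {..e}"] by (simp add: PiE_UNIV_domain Pi_def)
  ultimately show "finite (lookup ` {t :: 'v \<Rightarrow>\<^sub>0 nat. wdeg (\<lambda>_. 1) t = e})" by (rule finite_subset)
next
  show "inj_on lookup {t :: 'v \<Rightarrow>\<^sub>0 nat. wdeg (\<lambda>_. 1) t = e}"
    by (rule inj_onI) (simp only: poly_mapping_eq_iff)
qed

lemma quotient_basis_hom_part_exists: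
  fixes J :: "('v::finite, 'k::field) mpolynomial set"
  assumes J: "idl.subspace J"
  shows "\<exists>b n. quotient_basis J (hom_part e) b n"
proof -
  \<comment> \<open>Add one monomial at a time; it extends the basis unless it is dependent modulo \<open>J\<close>.\<close>
  have "\<exists>b n. quotient_basis J {f. keys f \<subseteq> A} b n" if "finite A" for A :: "('v \<Rightarrow>\<^sub>0 nat) set"
    using that
  proof (induction A rule: finite_induct)
    case empty
    show ?case using idl.subspace_0[OF J]
      by (intro exI[of _ "\<lambda>_. 0"] exI[of _ 0]) (auto simp: quotient_basis_def)
  next
    case (insert t A)
    then obtain b n where bb: "quotient_basis J {f. keys f \<subseteq> A} b n" by blast
    have b1: "keys (b i) \<subseteq> A" if "i < n" for i
      using bb that by (simp add: quotient_basis_def)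
    have b2: "k i = 0" if "(\<Sum>i<n. Const (k i) * b i) \<in> J" "i < n" for k i
      using bb that unfolding quotient_basis_def by blast
    have b3: "\<exists>k. f - (\<Sum>i<n. Const (k i) * b i) \<in> J" if "keys f \<subseteq> A" for f
      using bb that unfolding quotient_basis_def by blast
    have split: "\<exists>g. keys g \<subseteq> A \<and> f = g + Const (lookup f t) * single t 1" if "keys f \<subseteq> insert t A" for f :: "('v, 'k) mpolynomial"
    proof (intro exI conjI)
      show "f = (f - Const (lookup f t) * single t 1) + Const (lookup f t) * single t 1" by simp
      show "keys (f - Const (lookup f t) * single t 1) \<subseteq> A"
        using that by (auto simp: in_keys_iff lookup_minus lookup_Const_mult lookup_single when_def split: if_splits)
    qed
    show ?case
    proof (cases "\<exists>k. single t 1 - (\<Sum>i<n. Const (k i) * b i) \<in> J")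
      case True
      then obtain k0 where k0: "single t 1 - (\<Sum>i<n. Const (k0 i) * b i) \<in> J" by blast
      have "\<exists>k. f - (\<Sum>i<n. Const (k i) * b i) \<in> J" if f: "keys f \<subseteq> insert t A" for f
      proof -
        obtain g l where g: "keys g \<subseteq> A" "f = g + Const l * single t 1" using split[OF f] by blast
        obtain k where k: "g - (\<Sum>i<n. Const (k i) * b i) \<in> J" using b3[OF g(1)] by blast
        have "(g - (\<Sum>i<n. Const (k i) * b i)) + Const l * (single t 1 - (\<Sum>i<n. Const (k0 i) * b i)) \<in> J"
          by (intro idl.subspace_add[OF J] idl.subspace_scale[OF J] k k0)
        also have "(g - (\<Sum>i<n. Const (k i) * b i)) + Const l * (single t 1 - (\<Sum>i<n. Const (k0 i) * b i)) =
           f - (\<Sum>i<n. Const (k i + l * k0 i) * b i)"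
          unfolding g(2) by (simp add: right_diff_distrib sum_distrib_left Const_add Const_mult distrib_right sum.distrib mult.assoc)
        finally show ?thesis by (rule exI[of _ "\<lambda>i. k i + l * k0 i"])
      qed
      then show ?thesis using bb unfolding quotient_basis_def by (intro exI[of _ b] exI[of _ n]) blast
    next
      case False
      define b' where "b' i = (if i = n then single t 1 else b i)" for i
      have sum: "(\<Sum>i<Suc n. Const (k i) * b' i) = (\<Sum>i<n. Const (k i) * b i) + Const (k n) * single t 1" for k
        by (simp add: b'_def)
      have "quotient_basis J {f. keys f \<subseteq> insert t A} b' (Suc n)"
        unfolding quotient_basis_def
      proof (intro conjI allI impI ballI)
        fix i assume "i < Suc n"
        then show "b' i \<in> {f. keys f \<subseteq> insert t A}" using b1[of i] by (auto simp: b'_def)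
      next
        fix k i assume k: "(\<Sum>i<Suc n. Const (k i) * b' i) \<in> J" and i: "i < Suc n"
        have kn: "k n = 0"
        proof (rule ccontr)
          assume n: "k n \<noteq> 0"
          have "Const (1 / k n) * (\<Sum>i<Suc n. Const (k i) * b' i) \<in> J"
            by (rule idl.subspace_scale[OF J k])
          also have "Const (1 / k n) * (\<Sum>i<Suc n. Const (k i) * b' i) =
             single t 1 - (\<Sum>i<n. Const (- (k i / k n)) * b i)"
            unfolding sum using n by (simp add: distrib_left sum_distrib_left Const_uminus sum_negf flip: mult.assoc Const_mult)
          finally have "\<exists>k. single t 1 - (\<Sum>i<n. Const (k i) * b i) \<in> J"
            by (rule exI[of _ "\<lambda>i. - (k i / k n)"])
          then show False using False by (rule notE[rotated])
        qed
        with k have "(\<Sum>i<n. Const (k i) * b i) \<in> J" unfolding sum by simp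
        then show "k i = 0" using b2[of k i] kn i by (cases "i = n") auto
      next
        fix f :: "('v, 'k) mpolynomial" assume "f \<in> {f. keys f \<subseteq> insert t A}"
        then obtain g l where g: "keys g \<subseteq> A" "f = g + Const l * single t 1" using split[of f] by blast
        obtain k where k: "g - (\<Sum>i<n. Const (k i) * b i) \<in> J" using b3[OF g(1)] by blast
        have "f - (\<Sum>i<Suc n. Const ((k(n := l)) i) * b' i) = g - (\<Sum>i<n. Const (k i) * b i)"
          unfolding g(2) sum by simp
        with k have "f - (\<Sum>i<Suc n. Const ((k(n := l)) i) * b' i) \<in> J" by (simp only:)
        then show "\<exists>k. f - (\<Sum>i<Suc n. Const (k i) * b' i) \<in> J" by (rule exI[of _ "k(n := l)"])
      qed
      then show ?thesis by blast
    qed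
  qed
  from this[OF finite_monomials[of e]] show ?thesis
    by (simp add: hom_part_eq part_def subset_iff Ball_def)
qed

definition hilbert_function :: "('v::finite, 'k::field) mpolynomial set \<Rightarrow> nat \<Rightarrow> nat" where
  "hilbert_function J e = (THE n. \<exists>b. quotient_basis J (hom_part e) b n)"

lemma hilbert_function_eq:
  assumes "idl.subspace J" "quotient_basis J (hom_part e) b n"
  shows "hilbert_function J e = n"
  unfolding hilbert_function_def using assms quotient_basis_unique[OF assms(1)] by blast

lemma span_component:
  fixes G :: "('v::finite, 'k::comm_ring_1) mpolynomial set"
  assumes G: "\<And>g. g \<in> G \<Longrightarrow> \<exists>d. g \<in> part w d" and f: "f \<in> idl.span G"
  shows "component w e f \<in> idl.span G"
  using f
proof (induction rule: idl.span_induct_alt)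
  case base
  then show ?case by (simp add: idl.span_zero)
next
  case (step c g f)
  obtain d where d: "g \<in> part w d" using G step by blast
  have "component w e (c * g) \<in> idl.span G"
    using step by (simp add: component_mult_part[OF d] idl.span_zero idl.span_scale idl.span_base)
  then show ?case using step by (simp add: component_add idl.span_add)
qed

text \<open>
  The exact sequence \<open>0 \<rightarrow> (A / J)(-d) \<rightarrow> A / J \<rightarrow> A / (J + F A) \<rightarrow> 0\<close> in degree \<open>e\<close>, on the level of bases: \<open>F\<close> times a basis
  in degree \<open>e - d\<close> together with a lifted basis of the quotient is a basis in degree \<open>e\<close>.
\<close>

lemma hilbert_function_step:
  fixes G :: "('v::finite, 'k::field) mpolynomial set"
  assumes G: "\<And>g. g \<in> G \<Longrightarrow> \<exists>d. g \<in> hom_part d" and F: "F \<in> hom_part d"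
    and nzd: "\<And>a. a * F \<in> idl.span G \<Longrightarrow> a \<in> idl.span G"
  shows "hilbert_function (idl.span G) e =
    hilbert_function (idl.span (insert F G)) e + (if d \<le> e then hilbert_function (idl.span G) (e - d) else 0)"
proof -
  let ?J = "idl.span G" and ?J' = "idl.span (insert F G)"
  have J: "idl.subspace ?J" and J': "idl.subspace ?J'" by (simp_all add: idl.subspace_span)
  have sub: "?J \<subseteq> ?J'" by (intro idl.span_mono) auto
  have hom: "component (\<lambda>_. 1) e f \<in> ?J" if "f \<in> ?J" for f e
    using span_component[of G "\<lambda>_. 1" f e] G that by (auto simp: hom_part_eq)
  have dec: "\<exists>a. g - (if d \<le> e then a * F else 0) \<in> ?J \<and> (d \<le> e \<longrightarrow> a \<in> hom_part (e - d))"
    if g: "g \<in> ?J'" "g \<in> hom_part e" for g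
  proof -
    obtain a where "g - a * F \<in> ?J" using g idl.span_breakdown_eq by blast
    then have "component (\<lambda>_. 1) e (g - a * F) \<in> ?J" by (rule hom)
    moreover have "component (\<lambda>_. 1) e (g - a * F) = g - (if d \<le> e then component (\<lambda>_. 1) (e - d) a * F else 0)"
    proof -
      have "component (\<lambda>_. 1) e (g - a * F) = component (\<lambda>_. 1) e g - component (\<lambda>_. 1) e (a * F)"
        by (rule poly_mapping_eqI) (simp add: lookup_component lookup_minus)
      also have "component (\<lambda>_. 1) e g = g"
        using component_part[of g "\<lambda>_. 1" e e] g(2) by (simp add: hom_part_eq)
      finally show ?thesis using component_mult_part[of F "\<lambda>_. 1" d e a] F by (simp add: hom_part_eq)
    qed
    ultimately show ?thesis
      by (intro exI[of _ "component (\<lambda>_. 1) (e - d) a"]) (simp add: hom_part_eq component_in_part)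
  qed
  obtain b' n' where b': "quotient_basis ?J' (hom_part e) b' n'"
    using quotient_basis_hom_part_exists[OF J'] by blast
  then have b'1: "\<And>i. i < n' \<Longrightarrow> b' i \<in> hom_part e"
    and b'2: "\<And>k i. (\<Sum>i<n'. Const (k i) * b' i) \<in> ?J' \<Longrightarrow> i < n' \<Longrightarrow> k i = 0"
    and b'3: "\<And>f. f \<in> hom_part e \<Longrightarrow> \<exists>k. f - (\<Sum>i<n'. Const (k i) * b' i) \<in> ?J'"
    unfolding quotient_basis_def by blast+
  have b'hom: "(\<Sum>i<n'. Const (k i) * b' i) \<in> hom_part e" for k
    using b'1 by (auto simp: hom_part_eq intro!: part_sum part_Const_mult)
  show ?thesis
  proof (cases "d \<le> e")
    case False
    have "quotient_basis ?J (hom_part e) b' n'"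
      unfolding quotient_basis_def
    proof (intro conjI allI impI ballI)
      fix f :: "('v, 'k) mpolynomial" assume f: "f \<in> hom_part e"
      then obtain k where "f - (\<Sum>i<n'. Const (k i) * b' i) \<in> ?J'" using b'3 by blast
      with dec[of "f - (\<Sum>i<n'. Const (k i) * b' i)"] f b'hom[of k] False
      show "\<exists>k. f - (\<Sum>i<n'. Const (k i) * b' i) \<in> ?J"
        by (auto simp: hom_part_eq part_diff)
    qed (use b'1 b'2 sub in blast)+
    with b' False show ?thesis by (simp add: hilbert_function_eq J J')
  next
    case True
    obtain b n where b: "quotient_basis ?J (hom_part (e - d)) b n"
      using quotient_basis_hom_part_exists[OF J] by blast
    then have b1: "\<And>i. i < n \<Longrightarrow> b i \<in> hom_part (e - d)"
      and b2: "\<And>k i. (\<Sum>i<n. Const (k i) * b i) \<in> ?J \<Longrightarrow> i < n \<Longrightarrow> k i = 0"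
      and b3: "\<And>f. f \<in> hom_part (e - d) \<Longrightarrow> \<exists>k. f - (\<Sum>i<n. Const (k i) * b i) \<in> ?J"
      unfolding quotient_basis_def by blast+
    define c where "c i = (if i < n then b i * F else b' (i - n))" for i
    have sum: "(\<Sum>i<n + n'. Const (k i) * c i) =
        (\<Sum>i<n. Const (k i) * b i) * F + (\<Sum>i<n'. Const (k (n + i)) * b' i)" for k
    proof -
      have "(\<Sum>i<n + n'. Const (k i) * c i) = (\<Sum>i<n. Const (k i) * c i) + (\<Sum>i<n'. Const (k (n + i)) * c (n + i))"
        by (induction n') (simp_all add: add.assoc)
      also have "(\<Sum>i<n. Const (k i) * c i) = (\<Sum>i<n. Const (k i) * b i) * F"
        by (simp add: c_def sum_distrib_right mult.assoc)
      finally show ?thesis by (simp add: c_def)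
    qed
    have "quotient_basis ?J (hom_part e) c (n + n')"
      unfolding quotient_basis_def
    proof (intro conjI allI impI ballI)
      fix i assume "i < n + n'"
      then show "c i \<in> hom_part e"
        using b1[of i] b'1[of "i - n"] F True part_mult[of "b i" "\<lambda>_. 1" "e - d" F d]
        by (auto simp: c_def hom_part_eq)
    next
      fix k i assume k: "(\<Sum>i<n + n'. Const (k i) * c i) \<in> ?J" and i: "i < n + n'"
      have "(\<Sum>i<n. Const (k i) * b i) * F \<in> ?J'" by (intro idl.span_scale idl.span_base) auto
      then have "(\<Sum>i<n + n'. Const (k i) * c i) - (\<Sum>i<n. Const (k i) * b i) * F \<in> ?J'"
        using k sub by (intro idl.span_diff) auto
      then have "(\<Sum>i<n'. Const (k (n + i)) * b' i) \<in> ?J'" by (simp add: sum)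
      then have 1: "k (n + j) = 0" if "j < n'" for j using b'2[of "\<lambda>j. k (n + j)" j] that by blast
      then have "(\<Sum>i<n'. Const (k (n + i)) * b' i) = 0" by (intro sum.neutral) auto
      with k have "(\<Sum>i<n. Const (k i) * b i) * F \<in> ?J" by (simp add: sum)
      then have "(\<Sum>i<n. Const (k i) * b i) \<in> ?J" by (rule nzd)
      then show "k i = 0" using b2[of k i] 1[of "i - n"] i by (cases "i < n") auto
    next
      fix f :: "('v, 'k) mpolynomial" assume f: "f \<in> hom_part e"
      then obtain k' where k': "f - (\<Sum>i<n'. Const (k' i) * b' i) \<in> ?J'" using b'3 by blast
      then obtain a where a: "f - (\<Sum>i<n'. Const (k' i) * b' i) - a * F \<in> ?J" "a \<in> hom_part (e - d)"
        using dec[of "f - (\<Sum>i<n'. Const (k' i) * b' i)"] f b'hom[of k'] True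
        by (auto simp: hom_part_eq part_diff)
      obtain k where k: "a - (\<Sum>i<n. Const (k i) * b i) \<in> ?J" using b3[OF a(2)] by blast
      define k'' where "k'' i = (if i < n then k i else k' (i - n))" for i
      have "F * (a - (\<Sum>i<n. Const (k i) * b i)) \<in> ?J" by (rule idl.span_scale[OF k])
      then have "(f - (\<Sum>i<n'. Const (k' i) * b' i) - a * F) + F * (a - (\<Sum>i<n. Const (k i) * b i)) \<in> ?J"
        using a(1) by (intro idl.span_add)
      also have "(f - (\<Sum>i<n'. Const (k' i) * b' i) - a * F) + F * (a - (\<Sum>i<n. Const (k i) * b i)) =
          f - (\<Sum>i<n + n'. Const (k'' i) * c i)"
        unfolding sum by (simp add: k''_def algebra_simps)
      finally show "\<exists>k. f - (\<Sum>i<n + n'. Const (k i) * c i) \<in> ?J" by blast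
    qed
    with b b' True show ?thesis by (simp add: hilbert_function_eq J J')
  qed
qed

definition hilbert_series :: "('v::finite, 'k::field) mpolynomial set \<Rightarrow> int fps" where
  "hilbert_series J = Abs_fps (\<lambda>e. int (hilbert_function J e))"

lemma hilbert_series_regular:
  fixes fs :: "('v::finite, 'k::field) mpolynomial list"
  assumes "list_all2 (\<lambda>f d. f \<in> hom_part d) fs ds"
    and "regular_list fs"
  shows "hilbert_series (idl.span (set fs)) = hilbert_series (idl.span ({} :: ('v, 'k) mpolynomial set)) * (\<Prod>d\<leftarrow>ds. 1 - fps_X ^ d)"
  using assms
proof (induction fs arbitrary: ds rule: rev_induct)
  case Nil
  then show ?case by simp
next
  case (snoc f fs)
  then obtain ds' d where ds: "ds = ds' @ [d]" and fs: "list_all2 (\<lambda>f d. f \<in> hom_part d) fs ds'" and f: "f \<in> hom_part d"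
    by (auto simp: list_all2_append1 list_all2_Cons1)
  note IH = snoc.IH[OF fs regular_list_append1[OF snoc.prems(2)]]
  have nzd: "a * f \<in> idl.span (set fs) \<Longrightarrow> a \<in> idl.span (set fs)" for a
    using regular_listD[OF snoc.prems(2), of "length fs" a] by simp
  have G: "\<exists>d. g \<in> hom_part d" if "g \<in> set fs" for g
    using fs that by (auto simp: list_all2_conv_all_nth in_set_conv_nth)
  have "hilbert_series (idl.span (set (fs @ [f]))) = hilbert_series (idl.span (set fs)) * (1 - fps_X ^ d)"
  proof (rule fps_ext)
    fix e
    show "fps_nth (hilbert_series (idl.span (set (fs @ [f])))) e = fps_nth (hilbert_series (idl.span (set fs)) * (1 - fps_X ^ d)) e"
      using hilbert_function_step[OF G f nzd, of e]
      by (simp add: hilbert_series_def right_diff_distrib fps_X_power_mult_right_nth)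
  qed
  then show ?case by (simp add: ds IH mult.assoc)
qed

lemma span_variables_iff:
  "f \<in> idl.span (Var ` S) \<longleftrightarrow> (\<forall>t\<in>keys f. \<exists>y\<in>S. lookup t y \<noteq> 0)"
  for f :: "('v::finite, 'k::comm_ring_1) mpolynomial"
proof
  assume "f \<in> idl.span (Var ` S)"
  then show "\<forall>t\<in>keys f. \<exists>y\<in>S. lookup t y \<noteq> 0"
  proof (induction rule: idl.span_induct_alt)
    case (step c x f)
    then obtain y where y: "y \<in> S" "x = Var y" by blast
    have "\<exists>y\<in>S. lookup t y \<noteq> 0" if tk: "t \<in> keys (c * x)" for t
    proof -
      obtain s u where "t = s + u" "u \<in> keys x" using subsetD[OF keys_mult tk] by blast
      then have "lookup t y \<noteq> 0"
        by (auto simp: y Var_def lookup_add split: if_splits)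
      with y show ?thesis by blast
    qed
    then show ?case using step keys_add[of "c * x" f] by blast
  qed simp
next
  assume *: "\<forall>t\<in>keys f. \<exists>y\<in>S. lookup t y \<noteq> 0"
  have "single t (lookup f t) \<in> idl.span (Var ` S)" if t: "t \<in> keys f" for t
  proof -
    obtain y where y: "y \<in> S" "lookup t y \<noteq> 0" using * t by blast
    have "t = (t - single y 1) + single y 1"
      using y by (intro poly_mapping_eqI) (auto simp: lookup_add lookup_minus lookup_single when_def)
    then have "single t (lookup f t) = single (t - single y 1) (lookup f t) * Var y"
      by (metis single_mult_Var)
    then show ?thesis using y by (metis idl.span_scale idl.span_base imageI)
  qed
  then have "(\<Sum>t\<in>keys f. single t (lookup f t)) \<in> idl.span (Var ` S)" by (intro idl.span_sum)
  then show "f \<in> idl.span (Var ` S)" by (simp add: sum_of_terms)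
qed

lemma variable_nonzerodivisor:
  fixes a :: "('v::finite, 'k::comm_ring_1) mpolynomial"
  assumes "a * Var x \<in> idl.span (Var ` S)" "x \<notin> S"
  shows "a \<in> idl.span (Var ` S)"
  unfolding span_variables_iff
proof
  fix t assume "t \<in> keys a"
  then have "t + single x 1 \<in> keys (a * Var x)" using lookup_mult_Var[of a x t] by (simp add: in_keys_iff)
  then obtain y where "y \<in> S" "lookup (t + single x 1) y \<noteq> 0" using assms span_variables_iff by blast
  then show "\<exists>y\<in>S. lookup t y \<noteq> 0" using assms(2) by (auto simp: lookup_add lookup_single when_def split: if_splits)
qed

text \<open>
  The variables themselves form a regular sequence, and the quotient is the field.
\<close>

lemma hilbert_series_polynomial_ring:
  "hilbert_series (idl.span ({} :: ('v::finite, 'k::field) mpolynomial set)) * (1 - fps_X) ^ CARD('v) = 1"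
proof -
  obtain xs :: "'v list" where xs: "set xs = UNIV" "distinct xs" using finite_distinct_list[OF finite] by blast
  have len: "length xs = CARD('v)" using distinct_card[OF xs(2)] xs(1) by simp
  let ?fs = "map Var xs :: ('v, 'k) mpolynomial list"
  have "(Var x :: ('v, 'k) mpolynomial) \<in> hom_part 1" for x using part_Var[of x "\<lambda>_. 1"] by (simp add: hom_part_eq)
  then have 1: "list_all2 (\<lambda>f d. f \<in> hom_part d) ?fs (replicate (length xs) 1)"
    by (auto simp: list_all2_conv_all_nth)
  have 2: "regular_list ?fs"
    unfolding regular_list_def
  proof (intro allI impI)
    fix i and a :: "('v, 'k) mpolynomial" assume i: "i < length ?fs" and a: "a * ?fs ! i \<in> idl.span (set (take i ?fs))"
    have eq: "set (take i ?fs) = Var ` set (take i xs)" by (simp add: take_map)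
    have "xs ! i \<notin> set (take i xs)"
      using i xs(2) by (auto simp: in_set_conv_nth nth_eq_iff_index_eq)
    moreover have "a * Var (xs ! i) \<in> idl.span (Var ` set (take i xs))"
      using a i by (simp only: eq nth_map length_map)
    ultimately show "a \<in> idl.span (set (take i ?fs))"
      unfolding eq by (rule variable_nonzerodivisor[rotated])
  qed
  have "hilbert_series (idl.span (set ?fs)) = 1"
  proof (rule fps_ext)
    fix e
    let ?J = "idl.span (set ?fs)"
    have J: "f \<in> idl.span (Var ` set xs) \<longleftrightarrow> (\<forall>t\<in>keys f. t \<noteq> 0)" for f :: "('v, 'k) mpolynomial"
      by (auto simp: xs span_variables_iff poly_mapping_eq_iff fun_eq_iff)
    have "quotient_basis ?J (hom_part e) (\<lambda>_. 1) (if e = 0 then 1 else 0)"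
    proof (cases "e = 0")
      case True
      have "k i = 0" if "(\<Sum>i<Suc 0. Const (k i) * 1) \<in> ?J" "i < Suc 0" for k :: "nat \<Rightarrow> 'k" and i
        using that by (auto simp: J Const_def split: if_splits)
      moreover have "\<exists>k. f - (\<Sum>i<Suc 0. Const (k i) * 1) \<in> ?J" for f
        by (intro exI[of _ "\<lambda>_. lookup f 0"]) (auto simp: J Const_def in_keys_iff lookup_minus)
      ultimately show ?thesis using True part_1[of "\<lambda>_. 1"] by (auto simp: quotient_basis_def hom_part_eq)
    next
      case False
      have "t \<noteq> 0" if "f \<in> hom_part e" "t \<in> keys f" for f :: "('v, 'k) mpolynomial" and t
        using that False by (auto simp: hom_part_def)
      then show ?thesis using False by (auto simp: quotient_basis_def J)
    qed
    from hilbert_function_eq[OF idl.subspace_span this]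
    show "fps_nth (hilbert_series ?J) e = fps_nth 1 e" by (simp add: hilbert_series_def)
  qed
  with hilbert_series_regular[OF 1 2] show ?thesis by (simp add: len prod_list_replicate)
qed

lemma top_coefficient_geometric_product:
  "(\<forall>d\<in>set ds. 1 \<le> d) \<Longrightarrow>
    fps_nth (\<Prod>d\<leftarrow>ds. \<Sum>j<d. fps_X ^ j) (\<Sum>d\<leftarrow>ds. d - 1) = (1 :: int) \<and>
    (\<forall>e > (\<Sum>d\<leftarrow>ds. d - 1). fps_nth (\<Prod>d\<leftarrow>ds. \<Sum>j<d. fps_X ^ j :: int fps) e = 0)"
proof (induction ds)
  case Nil
  then show ?case by simp
next
  case (Cons d ds)
  let ?A = "\<Sum>j<d. fps_X ^ j :: int fps" and ?B = "\<Prod>d\<leftarrow>ds. \<Sum>j<d. fps_X ^ j :: int fps" and ?r = "\<Sum>d\<leftarrow>ds. d - 1"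
  have A: "fps_nth ?A i = (if i < d then 1 else 0)" for i
  proof -
    have "fps_nth ?A i = (\<Sum>j<d. if i = j then 1 else 0)" by (simp add: fps_sum_nth fps_X_power_nth)
    then show ?thesis by simp
  qed
  have IH: "fps_nth ?B ?r = 1" "\<And>e. e > ?r \<Longrightarrow> fps_nth ?B e = 0" using Cons by auto
  have d: "1 \<le> d" using Cons by simp
  have 0: "fps_nth (?A * ?B) e = (\<Sum>i=0..e. (if i < d then 1 else 0) * fps_nth ?B (e - i))" for e
    by (simp add: fps_mult_nth A)
  have "fps_nth (?A * ?B) (d - 1 + ?r) = (\<Sum>i=0..d - 1 + ?r. if i = d - 1 then 1 else 0)"
    unfolding 0
  proof (intro sum.cong refl)
    fix i assume "i \<in> {0..d - 1 + ?r}"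
    then show "(if i < d then 1 else 0) * fps_nth ?B (d - 1 + ?r - i) = (if i = d - 1 then 1 else 0)"
      using IH d by (cases "i < d - 1"; cases "i = d - 1") auto
  qed
  then have 1: "fps_nth (?A * ?B) (d - 1 + ?r) = 1" by simp
  have 2: "fps_nth (?A * ?B) e = 0" if "e > d - 1 + ?r" for e
    unfolding 0
  proof (intro sum.neutral ballI)
    fix i
    show "(if i < d then 1 else 0) * fps_nth ?B (e - i) = 0" using that IH(2)[of "e - i"] by auto
  qed
  show ?case using 1 2 by simp
qed

text \<open>
  The Hilbert series of the quotient is \<open>\<Prod>(1 + t + \<dots> + t\<^sup>d\<^sup>-\<^sup>1)\<close>, a polynomial with leading
  coefficient \<open>1\<close> in degree \<open>\<Sum>(d - 1)\<close>; so the quotient is nonzero in this degree.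
\<close>

lemma regular_sequence_top_degree:
  fixes fs :: "('v::finite, 'k::field) mpolynomial list"
  assumes hom: "list_all2 (\<lambda>f d. f \<in> hom_part d) fs ds"
    and reg: "regular_list fs"
    and len: "length fs = CARD('v)" and ds: "\<forall>d\<in>set ds. 1 \<le> d"
  shows "\<exists>f\<in>hom_part (\<Sum>d\<leftarrow>ds. d - 1). f \<notin> idl.span (set fs)"
proof (rule ccontr)
  let ?\<rho> = "\<Sum>d\<leftarrow>ds. d - 1"
  assume "\<not> ?thesis"
  then have "quotient_basis (idl.span (set fs)) (hom_part ?\<rho>) (\<lambda>_. 0) 0" by (auto simp: quotient_basis_def)
  then have 0: "hilbert_function (idl.span (set fs)) ?\<rho> = 0" by (rule hilbert_function_eq[OF idl.subspace_span])
  have geo: "(\<Prod>d\<leftarrow>ds. 1 - fps_X ^ d) = (1 - fps_X) ^ length ds * (\<Prod>d\<leftarrow>ds. \<Sum>j<d. fps_X ^ j :: int fps)"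
    by (induction ds) (simp_all add: one_diff_power_eq mult_ac)
  have "length ds = CARD('v)" using hom len by (auto dest: list_all2_lengthD)
  then have "hilbert_series (idl.span (set fs)) =
      (hilbert_series (idl.span ({} :: ('v, 'k) mpolynomial set)) * (1 - fps_X) ^ CARD('v)) * (\<Prod>d\<leftarrow>ds. \<Sum>j<d. fps_X ^ j)"
    unfolding hilbert_series_regular[OF hom reg] geo by (simp add: mult.assoc)
  then have "hilbert_series (idl.span (set fs)) = (\<Prod>d\<leftarrow>ds. \<Sum>j<d. fps_X ^ j)"
    by (simp only: hilbert_series_polynomial_ring mult_1)
  then have "fps_nth (hilbert_series (idl.span (set fs))) ?\<rho> = 1"
    using top_coefficient_geometric_product[OF ds] by simp
  with 0 show False by (simp add: hilbert_series_def)
qed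


section \<open>Orders of vanishing\<close>

lemma span_image_finite:
  assumes "finite S" "f \<in> idl.span (P ` S)"
  shows "\<exists>c. f = (\<Sum>i\<in>S. c i * P i)"
  using assms(2)
proof (induction rule: idl.span_induct_alt)
  case base
  show ?case by (rule exI[of _ "\<lambda>_. 0"]) simp
next
  case (step k x g)
  then obtain c i where c: "g = (\<Sum>i\<in>S. c i * P i)" and i: "i \<in> S" "x = P i" by blast
  have "k * x + g = (\<Sum>j\<in>S. (if j = i then k else 0) * P j) + (\<Sum>j\<in>S. c j * P j)"
    using assms(1) i c by (simp add: if_distrib[of "\<lambda>y. y * _"] cong: if_cong)
  then show ?case
    by (intro exI[of _ "\<lambda>j. (if j = i then k else 0) + c j"]) (simp add: distrib_right sum.distrib)
qed

text \<open>
  The functions that vanish on the punctured cone over \<open>V\<close>. Over an infinite field this is the ideal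
  generated by the forms that vanish on \<open>V\<close>, and it does not depend on how the vectors are scaled.
\<close>

definition vanishing :: "('v::finite \<Rightarrow> 'k::field) set \<Rightarrow> ('v, 'k) mpolynomial set" where
  "vanishing V = {f. \<forall>v\<in>V. \<forall>c. c \<noteq> 0 \<longrightarrow> eval_poly (\<lambda>x. c * v x) f = 0}"

lemma subspace_vanishing: "idl.subspace (vanishing V)"
  by (auto simp: idl.subspace_def vanishing_def)

lemma eval_scaled_hom: "f \<in> hom_part d \<Longrightarrow> eval_poly (\<lambda>x. c * a x) f = c ^ d * eval_poly a f"
  for f :: "('v::finite, 'k::comm_semiring_1) mpolynomial"
  using eval_scaled_part[of f "\<lambda>_. 1" d c a] by (simp add: hom_part_eq)

lemma vanishing_hom_iff:
  "f \<in> hom_part d \<Longrightarrow> f \<in> vanishing V \<longleftrightarrow> (\<forall>v\<in>V. eval_poly v f = 0)"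
proof
  assume f: "f \<in> hom_part d" and "f \<in> vanishing V"
  then have *: "\<forall>v\<in>V. \<forall>c. c \<noteq> 0 \<longrightarrow> eval_poly (\<lambda>x. c * v x) f = 0"
    by (simp add: vanishing_def)
  show "\<forall>v\<in>V. eval_poly v f = 0"
  proof
    fix v assume "v \<in> V"
    from *[rule_format, OF this, of 1] show "eval_poly v f = 0" by simp
  qed
next
  assume f: "f \<in> hom_part d" and "\<forall>v\<in>V. eval_poly v f = 0"
  then show "f \<in> vanishing V" by (simp add: vanishing_def eval_scaled_hom)
qed

lemma vanishing_component:
  fixes f :: "('v::finite, 'k::field_char_0) mpolynomial"
  assumes "f \<in> vanishing V"
  shows "component (\<lambda>_. 1) d f \<in> vanishing V"
  unfolding vanishing_def
proof (intro CollectI ballI allI impI)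
  fix v and c :: 'k assume v: "v \<in> V" and c: "c \<noteq> 0"
  show "eval_poly (\<lambda>x. c * v x) (component (\<lambda>_. 1) d f) = 0"
  proof (rule eval_component_eq_0)
    fix c' :: 'k assume "c' \<noteq> 0"
    then have "c' * c \<noteq> 0" using c by simp
    then have "eval_poly (\<lambda>x. (c' * c) * v x) f = 0" using assms v by (simp add: vanishing_def)
    then show "eval_poly (\<lambda>x. c' ^ 1 * (c * v x)) f = 0" by (simp add: mult.assoc)
  qed
qed

text \<open>
  Order of vanishing at \<open>u\<close> in characteristic zero: all derivatives of order less than \<open>k\<close> are zero at \<open>u\<close>.
\<close>

primrec order_at_least :: "('v::finite \<Rightarrow> 'k::comm_ring_1) \<Rightarrow> nat \<Rightarrow> ('v, 'k) mpolynomial set" where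
  "order_at_least u 0 = UNIV"
| "order_at_least u (Suc k) = {f. eval_poly u f = 0 \<and> (\<forall>x. partial_deriv x f \<in> order_at_least u k)}"

lemma order_0 [simp]: "0 \<in> order_at_least u k"
  by (induction k) auto

lemma order_add: "f \<in> order_at_least u k \<Longrightarrow> g \<in> order_at_least u k \<Longrightarrow> f + g \<in> order_at_least u k"
  by (induction k arbitrary: f g) (auto simp: partial_deriv_add)

lemma order_sum: "(\<And>i. i \<in> A \<Longrightarrow> f i \<in> order_at_least u k) \<Longrightarrow> sum f A \<in> order_at_least u k"
  by (induction A rule: infinite_finite_induct) (auto intro: order_add)

lemma order_Suc: "f \<in> order_at_least u (Suc k) \<Longrightarrow> f \<in> order_at_least u k"
  by (induction k arbitrary: f) auto

lemma order_mono: "k \<le> l \<Longrightarrow> f \<in> order_at_least u l \<Longrightarrow> f \<in> order_at_least u k"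
proof (induction l)
  case (Suc l)
  then show ?case using order_Suc[of f u l] by (cases "k = Suc l") auto
qed auto

lemma order_mult:
  "f \<in> order_at_least u k \<Longrightarrow> g \<in> order_at_least u l \<Longrightarrow> f * g \<in> order_at_least u (k + l)"
proof (induction "k + l" arbitrary: k l f g)
  case 0 then show ?case by simp
next
  case (Suc n)
  have ev: "eval_poly u (f * g) = 0"
    using Suc by (cases k; cases l) auto
  have "partial_deriv x f * g \<in> order_at_least u n" for x
  proof (cases k)
    case 0
    then obtain l' where l: "l = Suc l'" "n = 0 + l'" using Suc by (cases l) auto
    have "g \<in> order_at_least u l'" using Suc.prems(2) order_Suc l by blast
    from Suc.hyps(1)[OF l(2) _ this, of "partial_deriv x f"] show ?thesis using l by simp
  next
    case (Suc k')
    then have n: "n = k' + l" and "partial_deriv x f \<in> order_at_least u k'" using Suc.hyps Suc.prems by auto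
    from Suc.hyps(1)[OF n this(2) Suc.prems(2)] show ?thesis using n by simp
  qed
  moreover have "f * partial_deriv x g \<in> order_at_least u n" for x
  proof (cases l)
    case 0
    then obtain k' where k: "k = Suc k'" "n = k' + 0" using Suc by (cases k) auto
    have "f \<in> order_at_least u k'" using Suc.prems(1) order_Suc k by blast
    from Suc.hyps(1)[OF k(2) this, of "partial_deriv x g"] show ?thesis using k by simp
  next
    case (Suc l')
    then have n: "n = k + l'" and "partial_deriv x g \<in> order_at_least u l'" using Suc.hyps Suc.prems by auto
    from Suc.hyps(1)[OF n Suc.prems(1) this(2)] show ?thesis using n by simp
  qed
  ultimately have "f * g \<in> order_at_least u (Suc n)"
    using ev by (simp add: partial_deriv_mult order_add)
  then show ?case using Suc.hyps(2) by simp
qed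

lemma order_diff: "f \<in> order_at_least u k \<Longrightarrow> g \<in> order_at_least u k \<Longrightarrow> f - g \<in> order_at_least u k"
  using order_add[of f u k "(- 1) * g"] order_mult[of "- 1" u 0 g k] by simp

lemma order_1: "eval_poly u f = 0 \<Longrightarrow> f \<in> order_at_least u (Suc 0)"
  by simp

lemma order_eval_hom:
  fixes P :: "'i::finite \<Rightarrow> ('v::finite, 'k::comm_ring_1) mpolynomial"
  assumes P: "\<And>i. eval_poly u (P i) = 0" and "\<Phi> \<in> hom_part d"
  shows "eval_poly P \<Phi> \<in> order_at_least u d"
  using assms(2)
proof (induction rule: hom_part_induct)
  case (Var d f x)
  have "eval_poly P f * P x \<in> order_at_least u (d + Suc 0)"
    using Var(2) order_1[OF P] by (rule order_mult)
  then show ?case by simp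
qed (auto intro: order_add)

text \<open>
  The coefficients of \<open>\<Phi>\<close> are polynomials themselves, and the chain rule ignores their derivatives. These contribute
  terms that still contain all \<open>d\<close> factors from the \<open>P i\<close>, which is the error allowed here.
\<close>

lemma order_chain_rule:
  fixes P :: "'i::finite \<Rightarrow> ('v::finite, 'k::comm_ring_1) mpolynomial"
  assumes P: "\<And>i. eval_poly u (P i) = 0" and "\<Phi> \<in> hom_part d"
  shows "partial_deriv x (eval_poly P \<Phi>) - (\<Sum>k\<in>UNIV. partial_deriv x (P k) * eval_poly P (partial_deriv k \<Phi>)) \<in> order_at_least u d"
  using assms(2)
proof (induction rule: hom_part_induct)
  case (zero d)
  show ?case by simp
next
  case (Const c)
  show ?case by simp
next
  case (add d f g)
  from order_add[OF add(3,4)] show ?case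
    by (simp add: partial_deriv_add distrib_left sum.distrib algebra_simps)
next
  case (Var d f l)
  let ?E = "\<lambda>f. partial_deriv x (eval_poly P f) - (\<Sum>k\<in>UNIV. partial_deriv x (P k) * eval_poly P (partial_deriv k f))"
  have "(\<Sum>k\<in>UNIV. partial_deriv x (P k) * eval_poly P (partial_deriv k (f * Var l))) =
     (\<Sum>k\<in>UNIV. partial_deriv x (P k) * eval_poly P (partial_deriv k f)) * P l +
     (\<Sum>k\<in>UNIV. if k = l then partial_deriv x (P k) * eval_poly P f else 0)"
    by (simp only: partial_deriv_mult_Var eval_add eval_mult eval_Var distrib_left sum.distrib sum_distrib_right mult.assoc)
       (simp add: if_distrib[of "eval_poly P"] if_distrib[of "\<lambda>y. _ * y"] cong: if_cong)
  then have "?E (f * Var l) = ?E f * P l"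
    by (simp add: partial_deriv_mult algebra_simps)
  then show ?case using order_mult[OF Var(2) order_1[OF P[of l]]] by simp
qed

lemma lookup_partial_deriv:
  "lookup (partial_deriv x f) t = of_nat (lookup t x + 1) * lookup f (t + single x 1)"
  for f :: "('v, 'k::comm_semiring_1) mpolynomial"
proof (induction f rule: mpolynomial_induct_terms)
  case (single s c)
  show ?case
  proof (cases "lookup s x = 0")
    case True
    have "s \<noteq> t + single x 1"
    proof
      assume "s = t + single x 1"
      then have "lookup s x = lookup t x + 1" by (simp add: lookup_add)
      with True show False by simp
    qed
    with True show ?thesis by (simp add: partial_deriv_single lookup_single)
  next
    case False
    then have s: "s = (s - single x 1) + single x 1"
      by (intro poly_mapping_eqI) (auto simp: lookup_add lookup_minus lookup_single when_def)
    have "s - single x 1 = t \<longleftrightarrow> s = t + single x 1" by (metis s add_right_cancel)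
    moreover have "lookup s x = lookup t x + 1" if "s = t + single x 1" using that by (simp add: lookup_add)
    ultimately show ?thesis by (auto simp: partial_deriv_single lookup_single when_def)
  qed
qed (auto simp: partial_deriv_add lookup_add distrib_left)

lemma eval_of_nat: "eval_poly u (of_nat n) = of_nat n"
  by (induction n) simp_all

text \<open>
  Near a point where all \<open>P i\<close> vanish and their gradients are independent, the \<open>P i\<close> behave like local
  coordinates: a form of degree \<open>d\<close> in them can vanish to order greater than \<open>d\<close> only if all its coefficients vanish at the point.
  The induction replaces \<open>\<Phi>\<close> by its derivatives; characteristic zero is needed to recover the
  coefficients of \<open>\<Phi>\<close> from those of its derivatives.
\<close>

lemma leading_coefficients_vanish:
  fixes P :: "'i::finite \<Rightarrow> ('v::finite, 'k::field_char_0) mpolynomial"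
  assumes P: "\<And>i. eval_poly u (P i) = 0"
    and det: "det (\<chi> i j. eval_poly u (partial_deriv (\<kappa> j) (P i)) :: 'k^'i^'i) \<noteq> 0"
    and "\<Phi> \<in> hom_part d" and "eval_poly P \<Phi> \<in> order_at_least u (Suc d)"
  shows "eval_poly u (lookup \<Phi> \<alpha>) = 0"
  using assms(3,4)
proof (induction d arbitrary: \<Phi> \<alpha>)
  case 0
  then obtain n where "\<Phi> = Const n" using hom_part_0_Const by blast
  moreover from this 0 have "eval_poly u n = 0" by simp
  ultimately show ?case by (cases "\<alpha> = 0") (auto simp: Const_def lookup_single)
next
  case (Suc d)
  let ?J = "\<chi> i j. eval_poly u (partial_deriv (\<kappa> j) (P i)) :: 'k^'i^'i"
  obtain C where C: "?J ** C = mat 1" using det invertible_det_nz[of ?J] by (auto simp: invertible_def)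
  have coeff: "eval_poly u (lookup (partial_deriv i \<Phi>) \<beta>) = 0" for i \<beta>
  proof (rule Suc.IH)
    show hom: "partial_deriv i \<Phi> \<in> hom_part d" for i
      using partial_deriv_part(1)[of \<Phi> "\<lambda>_. 1" "Suc d" i] Suc.prems(1) by (simp add: hom_part_eq)
    \<comment> \<open>\<open>D\<close> is a combination of derivatives with \<open>D (P k) = \<delta> k\<close> at \<open>u\<close>: on polynomials in the \<open>P k\<close> it acts to
      leading order as the derivative with respect to the variable \<open>i\<close>.\<close>
    define D where "D f = (\<Sum>j\<in>UNIV. Const (C $ j $ i) * partial_deriv (\<kappa> j) f)" for f
    define \<delta> where "\<delta> k = (if k = i then 1 else 0 :: 'k)" for k
    have "eval_poly u (D (P k) - Const (\<delta> k)) = 0" for k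
    proof -
      have "eval_poly u (D (P k)) = (?J ** C) $ k $ i"
        by (simp add: D_def matrix_matrix_mult_def mult.commute)
      then show ?thesis unfolding C by (simp add: mat_def \<delta>_def)
    qed
    then have 1: "(D (P k) - Const (\<delta> k)) * eval_poly P (partial_deriv k \<Phi>) \<in> order_at_least u (Suc d)" for k
      using order_mult[OF order_1 order_eval_hom[OF P hom[of k]]] by simp
    have "D (eval_poly P \<Phi>) - (\<Sum>k\<in>UNIV. D (P k) * eval_poly P (partial_deriv k \<Phi>)) =
       (\<Sum>j\<in>UNIV. Const (C $ j $ i) * (partial_deriv (\<kappa> j) (eval_poly P \<Phi>) -
          (\<Sum>k\<in>UNIV. partial_deriv (\<kappa> j) (P k) * eval_poly P (partial_deriv k \<Phi>))))"
      unfolding D_def by (simp add: right_diff_distrib sum_subtractf sum_distrib_left sum_distrib_right mult.assoc)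
         (rule sum.swap)
    also have "\<dots> \<in> order_at_least u (Suc d)"
    proof (rule order_sum)
      fix j
      show "Const (C $ j $ i) * (partial_deriv (\<kappa> j) (eval_poly P \<Phi>) -
          (\<Sum>k\<in>UNIV. partial_deriv (\<kappa> j) (P k) * eval_poly P (partial_deriv k \<Phi>))) \<in> order_at_least u (Suc d)"
        using order_mult[of "Const (C $ j $ i)" u 0, OF _ order_chain_rule[of u P \<Phi> "Suc d" "\<kappa> j", OF P Suc.prems(1)]]
        by simp
    qed
    finally have 2: "D (eval_poly P \<Phi>) - (\<Sum>k\<in>UNIV. D (P k) * eval_poly P (partial_deriv k \<Phi>)) \<in> order_at_least u (Suc d)" .
    have 3: "D (eval_poly P \<Phi>) \<in> order_at_least u (Suc d)"
      unfolding D_def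
    proof (rule order_sum)
      fix j
      have "partial_deriv (\<kappa> j) (eval_poly P \<Phi>) \<in> order_at_least u (Suc d)" using Suc.prems(2) by simp
      then show "Const (C $ j $ i) * partial_deriv (\<kappa> j) (eval_poly P \<Phi>) \<in> order_at_least u (Suc d)"
        using order_mult[of "Const (C $ j $ i)" u 0 "partial_deriv (\<kappa> j) (eval_poly P \<Phi>)" "Suc d"] by simp
    qed
    have "eval_poly P (partial_deriv i \<Phi>) = (\<Sum>k\<in>UNIV. Const (\<delta> k) * eval_poly P (partial_deriv k \<Phi>))"
      by (simp add: \<delta>_def if_distrib[of Const] if_distrib[of "\<lambda>y. y * _"] cong: if_cong)
    also have "\<dots> = D (eval_poly P \<Phi>) -
        (D (eval_poly P \<Phi>) - (\<Sum>k\<in>UNIV. D (P k) * eval_poly P (partial_deriv k \<Phi>))) -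
        (\<Sum>k\<in>UNIV. (D (P k) - Const (\<delta> k)) * eval_poly P (partial_deriv k \<Phi>))"
      by (simp add: left_diff_distrib sum_subtractf)
    also have "\<dots> \<in> order_at_least u (Suc d)"
      by (rule order_diff[OF order_diff[OF 3 2] order_sum[OF 1]])
    finally show "eval_poly P (partial_deriv i \<Phi>) \<in> order_at_least u (Suc d)" .
  qed
  show ?case
  proof (cases "\<alpha> \<in> keys \<Phi>")
    case False
    then show ?thesis by (simp add: in_keys_iff)
  next
    case True
    then have "(\<Sum>x\<in>UNIV. lookup \<alpha> x) = Suc d" using Suc.prems(1) by (simp add: hom_part_def)
    then obtain i where i: "lookup \<alpha> i \<noteq> 0" by (metis nat.distinct(1) sum.neutral)
    then have \<alpha>: "\<alpha> = (\<alpha> - single i 1) + single i 1"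
      by (intro poly_mapping_eqI) (auto simp: lookup_add lookup_minus lookup_single when_def)
    have "of_nat (Suc n) * eval_poly u f = eval_poly u (of_nat (Suc n) * f)" for n f
      by (simp only: eval_mult eval_of_nat)
    then show ?thesis
      using coeff[of i "\<alpha> - single i 1"] unfolding lookup_partial_deriv
      by (metis \<alpha> Suc_eq_plus1 mult_eq_0_iff of_nat_eq_0_iff nat.distinct(1))
  qed
qed


section \<open>Regularity of a system with nonvanishing Jacobian\<close>

lemma lookup_mult_Var_iff:
  "lookup (f * Var x) t = (if lookup t x = 0 then 0 else lookup f (t - single x 1))"
  for f :: "('v, 'k::comm_ring_1) mpolynomial"
proof (cases "lookup t x = 0")
  case True
  have "lookup (f * Var x) t = 0"
  proof (induction f rule: mpolynomial_induct_terms)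
    case (single s c)
    have "s + single x 1 \<noteq> t"
    proof
      assume "s + single x 1 = t"
      then have "lookup t x = lookup s x + 1" by (auto simp: lookup_add)
      with True show False by simp
    qed
    then show ?case by (simp only: single_mult_Var lookup_single when_def if_False)
  qed (auto simp: distrib_right lookup_add)
  with True show ?thesis by simp
next
  case False
  then have "t = (t - single x 1) + single x 1"
    by (intro poly_mapping_eqI) (auto simp: lookup_add lookup_minus lookup_single when_def)
  then show ?thesis using False lookup_mult_Var[of f x "t - single x 1"] by simp
qed

text \<open>
  Dual bases in all degrees span a graded complement of the vanishing ideal.
\<close>

lemma graded_complement_exists:
  fixes V :: "('v::finite \<Rightarrow> 'k::field_char_0) set"
  assumes V: "finite V"
  shows "\<exists>N. pv.subspace N \<and> (\<forall>f\<in>N. f \<in> vanishing V \<longrightarrow> f = 0) \<and>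
    (\<forall>e. \<forall>f\<in>hom_part e. \<exists>n\<in>N. n \<in> hom_part e \<and> f - n \<in> vanishing V)"
proof -
  have sub: "pv.subspace (hom_part e :: ('v, 'k) mpolynomial set)" for e
    by (simp add: hom_part_eq pv_subspace_part)
  define dual_basis where "dual_basis e Q b \<longleftrightarrow> Q \<subseteq> V \<and> (\<forall>q\<in>Q. b q \<in> hom_part e) \<and>
    (\<forall>q\<in>Q. \<forall>q'\<in>Q. eval_poly q' (b q) = (if q = q' then 1 else 0)) \<and>
    (\<forall>f\<in>hom_part e. \<forall>z\<in>V. eval_poly z f = (\<Sum>q\<in>Q. eval_poly q f * eval_poly z (b q)))" for e Q b
  have "\<forall>e. \<exists>Q b. dual_basis e Q b"
    unfolding dual_basis_def by (intro allI dual_points V sub) simp_all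
  then obtain Q b where Qb: "\<And>e. dual_basis e (Q e) (b e)" by metis
  have Q: "Q e \<subseteq> V" for e using Qb unfolding dual_basis_def by blast
  have b: "b e q \<in> hom_part e" if "q \<in> Q e" for e q using Qb that unfolding dual_basis_def by blast
  have dual: "eval_poly q' (b e q) = (if q = q' then 1 else 0)" if "q \<in> Q e" "q' \<in> Q e" for e q q'
    using Qb[of e] that unfolding dual_basis_def by simp
  have ex: "eval_poly z f = (\<Sum>q\<in>Q e. eval_poly q f * eval_poly z (b e q))" if "f \<in> hom_part e" "z \<in> V" for e f z
  proof -
    note * = Qb[of e, unfolded dual_basis_def, THEN conjunct2, THEN conjunct2, THEN conjunct2]
    show ?thesis by (rule bspec[OF bspec[OF * that(1)] that(2)])
  qed
  have finQ: "finite (Q e)" for e using Q V finite_subset by blast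
  have sumhom: "(\<Sum>q\<in>Q e. Const (c q) * b e q) \<in> hom_part e" for c e
    using b by (auto simp: hom_part_eq intro!: part_sum part_Const_mult)
  define N where "N = {f. \<forall>e. \<exists>c. component (\<lambda>_. 1) e f = (\<Sum>q\<in>Q e. Const (c q) * b e q)}"
  have "pv.subspace N"
    unfolding pv.subspace_def
  proof (intro conjI ballI allI)
    have "\<exists>c. component (\<lambda>_. 1) e 0 = (\<Sum>q\<in>Q e. Const (c q) * b e q)" for e
      by (intro exI[of _ "\<lambda>_. 0"]) simp
    then show "0 \<in> N" unfolding N_def by simp
  next
    fix f g assume f: "f \<in> N" and g: "g \<in> N"
    have "\<exists>c. component (\<lambda>_. 1) e (f + g) = (\<Sum>q\<in>Q e. Const (c q) * b e q)" for e
    proof -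
      obtain c d where "component (\<lambda>_. 1) e f = (\<Sum>q\<in>Q e. Const (c q) * b e q)"
        "component (\<lambda>_. 1) e g = (\<Sum>q\<in>Q e. Const (d q) * b e q)" using f g unfolding N_def by blast
      then show ?thesis by (intro exI[of _ "\<lambda>q. c q + d q"]) (simp add: component_add Const_add distrib_right sum.distrib)
    qed
    then show "f + g \<in> N" unfolding N_def by blast
  next
    fix k f assume f: "f \<in> N"
    have "\<exists>c. component (\<lambda>_. 1) e (Const k * f) = (\<Sum>q\<in>Q e. Const (c q) * b e q)" for e
    proof -
      obtain c where "component (\<lambda>_. 1) e f = (\<Sum>q\<in>Q e. Const (c q) * b e q)" using f unfolding N_def by blast
      then show ?thesis
        by (intro exI[of _ "\<lambda>q. k * c q"]) (simp add: component_Const_mult Const_mult sum_distrib_left mult.assoc)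
    qed
    then show "Const k * f \<in> N" unfolding N_def by blast
  qed
  moreover have "f = 0" if f: "f \<in> N" "f \<in> vanishing V" for f
  proof (rule components_eqI[of "\<lambda>_. 1"])
    fix e
    obtain c where c: "component (\<lambda>_. 1) e f = (\<Sum>q\<in>Q e. Const (c q) * b e q)" using f unfolding N_def by blast
    have "(\<Sum>q\<in>Q e. Const (c q) * b e q) \<in> vanishing V" using vanishing_component[OF f(2), of e] c by simp
    then have 0: "eval_poly p (\<Sum>q\<in>Q e. Const (c q) * b e q) = 0" if "p \<in> V" for p
      using vanishing_hom_iff[OF sumhom] that by blast
    have "c p = 0" if p: "p \<in> Q e" for p
    proof -
      have "eval_poly p (\<Sum>q\<in>Q e. Const (c q) * b e q) = (\<Sum>q\<in>Q e. if q = p then c q else 0)"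
        using p dual by simp (intro sum.cong, auto)
      then show ?thesis using 0[of p] p Q finQ by auto
    qed
    then show "component (\<lambda>_. 1) e f = component (\<lambda>_. 1) e 0" unfolding c by simp
  qed
  moreover have "\<exists>n\<in>N. n \<in> hom_part e \<and> f - n \<in> vanishing V" if f: "f \<in> hom_part e" for e f
  proof (intro bexI conjI)
    let ?n = "\<Sum>q\<in>Q e. Const (eval_poly q f) * b e q"
    show n: "?n \<in> hom_part e" by (rule sumhom)
    have "f - ?n \<in> hom_part e" using f n by (simp add: hom_part_eq part_diff)
    then show "f - ?n \<in> vanishing V"
      using ex[OF f] by (simp add: vanishing_hom_iff)
    have "\<exists>c. component (\<lambda>_. 1) d ?n = (\<Sum>q\<in>Q d. Const (c q) * b d q)" for d
    proof (cases "d = e")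
      case True
      then show ?thesis using component_part[of ?n "\<lambda>_. 1" e d] n by (auto simp: hom_part_eq)
    next
      case False
      then show ?thesis using component_part[of ?n "\<lambda>_. 1" e d] n
        by (intro exI[of _ "\<lambda>_. 0"]) (auto simp: hom_part_eq)
    qed
    then show "?n \<in> N" unfolding N_def by blast
  qed
  ultimately show ?thesis by blast
qed

lemma jacobian_at_scaled:
  fixes P :: "'m::finite \<Rightarrow> ('m option, 'k::field) mpolynomial"
  assumes P: "\<And>i. P i \<in> hom_part (a i)"
  shows "jacobian_at P (\<lambda>x. c * p x) = (\<Prod>i\<in>UNIV. c ^ (a i - 1)) * jacobian_at P p"
proof -
  have "partial_deriv x (P i) \<in> hom_part (a i - 1)" for x i
    using partial_deriv_part(1)[of "P i" "\<lambda>_. 1" "a i" x] P by (simp add: hom_part_eq)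
  note scaled = eval_scaled_hom[OF this, of c p]
  have "jacobian_at P (\<lambda>x. c * p x) =
      det (\<chi> i. c ^ (a i - 1) *s (\<chi> j. eval_poly p (partial_deriv (Some j) (P i))))"
    by (simp add: jacobian_at_def scaled vector_scalar_mult_def)
  then show ?thesis unfolding det_rows_mul by (simp add: jacobian_at_def)
qed

context
  fixes V :: "('m::finite option \<Rightarrow> 'k::field_char_0) set"
    and P :: "'m \<Rightarrow> ('m option, 'k) mpolynomial" and a :: "'m \<Rightarrow> nat"
  assumes finV: "finite V" and P: "\<And>i. P i \<in> hom_part (a i)" and a: "\<And>i. 1 \<le> a i"
    and gen: "idl.span (range P) = vanishing V" and jac: "\<And>p. p \<in> V \<Longrightarrow> jacobian_at P p \<noteq> 0"
begin

text \<open>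
  Every polynomial is a polynomial in the \<open>P i\<close> with coefficients in a graded complement \<open>N\<close> of the ideal: reduce
  modulo the ideal and expand the coefficients with which the difference is a combination of the \<open>P i\<close>, which have smaller degree. The expansion is
  unique: by \<open>leading_coefficients_vanish\<close> the coefficients of lowest degree of an expansion of \<open>0\<close> vanish at all points of the
  cone, and they lie in \<open>N\<close>.
\<close>

lemma unique_expansions:
  obtains N where "pv.subspace N"
    and "\<And>f. \<exists>\<Phi>. (\<forall>\<alpha>. lookup \<Phi> \<alpha> \<in> N) \<and> eval_poly P \<Phi> = f"
    and "\<And>\<Phi>. (\<forall>\<alpha>. lookup \<Phi> \<alpha> \<in> N) \<Longrightarrow> eval_poly P \<Phi> = 0 \<Longrightarrow> \<Phi> = 0"
proof -
  obtain N where N: "pv.subspace N" and N0: "\<And>f. f \<in> N \<Longrightarrow> f \<in> vanishing V \<Longrightarrow> f = 0"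
    and dec: "\<And>e f. f \<in> hom_part e \<Longrightarrow> \<exists>n\<in>N. n \<in> hom_part e \<and> f - n \<in> vanishing V"
    using graded_complement_exists[OF finV] by blast
  have PV: "P i \<in> vanishing V" for i unfolding gen[symmetric] by (intro idl.span_base) auto
  have exh: "\<exists>\<Phi>. (\<forall>\<alpha>. lookup \<Phi> \<alpha> \<in> N) \<and> eval_poly P \<Phi> = f" if "f \<in> hom_part e" for e f
    using that
  proof (induction e arbitrary: f rule: less_induct)
    case (less e)
    obtain n where n: "n \<in> N" "n \<in> hom_part e" "f - n \<in> vanishing V" using dec[OF less.prems] by blast
    then obtain c where c: "f - n = (\<Sum>i\<in>UNIV. c i * P i)"
      using span_image_finite[of UNIV "f - n" P] by (auto simp: gen)
    define d where "d i = (if a i \<le> e then component (\<lambda>_. 1) (e - a i) (c i) else 0)" for i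
    have "f - n = component (\<lambda>_. 1) e (f - n)"
      using less.prems n(2) by (simp add: component_part[of _ _ e] hom_part_eq part_diff)
    also have "\<dots> = (\<Sum>i\<in>UNIV. component (\<lambda>_. 1) e (c i * P i))" unfolding c by (rule component_sum)
    also have "\<dots> = (\<Sum>i\<in>UNIV. d i * P i)"
    proof (rule sum.cong[OF refl])
      fix i
      show "component (\<lambda>_. 1) e (c i * P i) = d i * P i"
        using component_mult_part[of "P i" "\<lambda>_. 1" "a i" e "c i"] P[of i] by (simp add: d_def hom_part_eq)
    qed
    finally have fn: "f - n = (\<Sum>i\<in>UNIV. d i * P i)" .
    have "\<exists>\<Phi>. (\<forall>\<alpha>. lookup \<Phi> \<alpha> \<in> N) \<and> eval_poly P \<Phi> = d i" for i
    proof (cases "a i \<le> e")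
      case True
      have "e - a i < e" using a[of i] True by simp
      moreover have "d i \<in> hom_part (e - a i)" using True by (simp add: d_def hom_part_eq component_in_part)
      ultimately show ?thesis by (rule less.IH)
    next
      case False
      then show ?thesis using pv.subspace_0[OF N] by (intro exI[of _ 0]) (simp add: d_def)
    qed
    then obtain \<Psi> where \<Psi>: "\<And>i \<alpha>. lookup (\<Psi> i) \<alpha> \<in> N" "\<And>i. eval_poly P (\<Psi> i) = d i" by metis
    show ?case
    proof (intro exI conjI allI)
      fix \<alpha> :: "'m \<Rightarrow>\<^sub>0 nat"
      have "lookup (Const n) \<alpha> \<in> N"
        using n pv.subspace_0[OF N] by (simp add: Const_def lookup_single when_def)
      moreover have "(\<Sum>i\<in>UNIV. lookup (\<Psi> i * Var i) \<alpha>) \<in> N"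
        using \<Psi> pv.subspace_0[OF N] by (intro pv.subspace_sum[OF N]) (simp add: lookup_mult_Var_iff)
      ultimately show "lookup (Const n + (\<Sum>i\<in>UNIV. \<Psi> i * Var i)) \<alpha> \<in> N"
        unfolding lookup_add lookup_sum by (rule pv.subspace_add[OF N])
    next
      have "f = n + (f - n)" by simp
      then show "eval_poly P (Const n + (\<Sum>i\<in>UNIV. \<Psi> i * Var i)) = f"
        unfolding fn by (simp add: \<Psi>)
    qed
  qed
  have ex: "\<exists>\<Phi>. (\<forall>\<alpha>. lookup \<Phi> \<alpha> \<in> N) \<and> eval_poly P \<Phi> = f" for f
  proof -
    have "\<forall>e. \<exists>\<Phi>. (\<forall>\<alpha>. lookup \<Phi> \<alpha> \<in> N) \<and> eval_poly P \<Phi> = component (\<lambda>_. 1) e f"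
      using exh component_in_part by (metis hom_part_eq)
    then obtain \<Psi> where \<Psi>: "\<And>e \<alpha>. lookup (\<Psi> e) \<alpha> \<in> N" "\<And>e. eval_poly P (\<Psi> e) = component (\<lambda>_. 1) e f" by metis
    define D where "D = wdeg (\<lambda>_. 1) ` keys f"
    show ?thesis
    proof (intro exI[of _ "\<Sum>e\<in>D. \<Psi> e"] conjI allI)
      show "lookup (\<Sum>e\<in>D. \<Psi> e) \<alpha> \<in> N" for \<alpha>
        unfolding lookup_sum using \<Psi> by (intro pv.subspace_sum[OF N])
      show "eval_poly P (\<Sum>e\<in>D. \<Psi> e) = f"
        using sum_components[of D "\<lambda>_. 1" f] by (simp add: \<Psi> D_def)
    qed
  qed
  have uniq: "\<Phi> = 0" if \<Phi>: "\<forall>\<alpha>. lookup \<Phi> \<alpha> \<in> N" "eval_poly P \<Phi> = 0" for \<Phi>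
  proof (rule ccontr)
    assume "\<Phi> \<noteq> 0"
    define D where "D = wdeg (\<lambda>_. 1) ` keys \<Phi>"
    have D: "finite D" "D \<noteq> {}" using \<open>\<Phi> \<noteq> 0\<close> by (auto simp: D_def)
    define d where "d = Min D"
    obtain \<alpha> where \<alpha>: "\<alpha> \<in> keys \<Phi>" "wdeg (\<lambda>_. 1) \<alpha> = d" using Min_in[OF D] unfolding d_def D_def by auto
    have "lookup \<Phi> \<alpha> \<in> vanishing V"
      unfolding vanishing_def
    proof (intro CollectI ballI allI impI)
      fix p and c :: 'k assume p: "p \<in> V" and c: "c \<noteq> 0"
      let ?u = "\<lambda>x. c * p x"
      have Pu: "eval_poly ?u (P i) = 0" for i using PV[of i] p c by (simp add: vanishing_def)
      have "jacobian_at P ?u \<noteq> 0" using jac[OF p] c by (simp add: jacobian_at_scaled[of P a, OF P])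
      then have det: "det (\<chi> i j. eval_poly ?u (partial_deriv (Some j) (P i))) \<noteq> 0" by (simp add: jacobian_at_def)
      have "(\<Sum>e\<in>D. component (\<lambda>_. 1) e \<Phi>) = \<Phi>" by (rule sum_components) (auto simp: D_def)
      then have "component (\<lambda>_. 1) d \<Phi> = \<Phi> - (\<Sum>e\<in>D - {d}. component (\<lambda>_. 1) e \<Phi>)"
        using sum.remove[of D d "\<lambda>e. component (\<lambda>_. 1) e \<Phi>"] D Min_in[OF D] by (simp add: d_def algebra_simps)
      then have "eval_poly P (component (\<lambda>_. 1) d \<Phi>) = 0 - (\<Sum>e\<in>D - {d}. eval_poly P (component (\<lambda>_. 1) e \<Phi>))"
        using \<Phi>(2) by simp
      also have "\<dots> \<in> order_at_least ?u (Suc d)"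
      proof (intro order_diff order_0 order_sum)
        fix e assume e: "e \<in> D - {d}"
        then have "d \<le> e" "e \<noteq> d" using D Min_le[of D e] by (simp_all add: d_def)
        then have "Suc d \<le> e" by linarith
        moreover have "eval_poly P (component (\<lambda>_. 1) e \<Phi>) \<in> order_at_least ?u e"
          using order_eval_hom[of ?u P, OF Pu] component_in_part by (metis hom_part_eq)
        ultimately show "eval_poly P (component (\<lambda>_. 1) e \<Phi>) \<in> order_at_least ?u (Suc d)" by (rule order_mono)
      qed
      finally have ord: "eval_poly P (component (\<lambda>_. 1) d \<Phi>) \<in> order_at_least ?u (Suc d)" .
      have hom: "component (\<lambda>_. 1) d \<Phi> \<in> hom_part d" by (simp add: hom_part_eq component_in_part)
      have "eval_poly ?u (lookup (component (\<lambda>_. 1) d \<Phi>) \<alpha>) = 0"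
        by (rule leading_coefficients_vanish[of ?u P Some, OF Pu det hom ord])
      then show "eval_poly ?u (lookup \<Phi> \<alpha>) = 0" using \<alpha> by (simp add: lookup_component)
    qed
    then have "lookup \<Phi> \<alpha> = 0" using N0 \<Phi>(1) by blast
    with \<alpha> show False by (simp add: in_keys_iff)
  qed
  show thesis by (rule that[OF N ex uniq])
qed

text \<open>
  Compare the expansions of the two sides of \<open>f P\<^sub>k = \<Sum> c\<^sub>i P\<^sub>i\<close>: every monomial of the expansion of \<open>f\<close>, times the
  variable \<open>k\<close>, occurs on the right and hence involves some \<open>i \<in> S\<close>, which is different from \<open>k\<close>.
\<close>

lemma nonzerodivisor_of_expansions:
  assumes "k \<notin> S" and f: "f * P k \<in> idl.span (P ` S)"
  shows "f \<in> idl.span (P ` S)"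
proof -
  obtain N where N: "pv.subspace N"
    and ex: "\<And>f. \<exists>\<Phi>. (\<forall>\<alpha>. lookup \<Phi> \<alpha> \<in> N) \<and> eval_poly P \<Phi> = f"
    and uniq: "\<And>\<Phi>. (\<forall>\<alpha>. lookup \<Phi> \<alpha> \<in> N) \<Longrightarrow> eval_poly P \<Phi> = 0 \<Longrightarrow> \<Phi> = 0"
    using unique_expansions by metis
  obtain c where c: "f * P k = (\<Sum>i\<in>S. c i * P i)" using span_image_finite[OF finite f] by blast
  obtain \<Phi> where \<Phi>: "\<forall>\<alpha>. lookup \<Phi> \<alpha> \<in> N" "eval_poly P \<Phi> = f" using ex by blast
  have "\<forall>i. \<exists>\<Psi>. (\<forall>\<alpha>. lookup \<Psi> \<alpha> \<in> N) \<and> eval_poly P \<Psi> = c i" using ex by blast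
  then obtain \<Psi> where \<Psi>: "\<And>i \<alpha>. lookup (\<Psi> i) \<alpha> \<in> N" "\<And>i. eval_poly P (\<Psi> i) = c i" by metis
  have coeff: "lookup (h * Var i) \<alpha> \<in> N" if "\<forall>\<alpha>. lookup h \<alpha> \<in> N" for h i \<alpha>
    using that pv.subspace_0[OF N] by (simp add: lookup_mult_Var_iff)
  have "\<Phi> * Var k - (\<Sum>i\<in>S. \<Psi> i * Var i) = 0"
  proof (rule uniq)
    show "\<forall>\<alpha>. lookup (\<Phi> * Var k - (\<Sum>i\<in>S. \<Psi> i * Var i)) \<alpha> \<in> N"
      unfolding lookup_minus lookup_sum using \<Phi> \<Psi>
      by (intro allI pv.subspace_diff[OF N] pv.subspace_sum[OF N] coeff) auto
    show "eval_poly P (\<Phi> * Var k - (\<Sum>i\<in>S. \<Psi> i * Var i)) = 0" by (simp add: \<Phi> \<Psi> c)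
  qed
  then have eq: "\<Phi> * Var k = (\<Sum>i\<in>S. \<Psi> i * Var i)" by simp
  have "lookup \<Phi> \<alpha> * (\<Prod>i\<in>UNIV. P i ^ lookup \<alpha> i) \<in> idl.span (P ` S)" if \<alpha>: "\<alpha> \<in> keys \<Phi>" for \<alpha>
  proof -
    have "lookup (\<Sum>i\<in>S. \<Psi> i * Var i) (\<alpha> + single k 1) \<noteq> 0"
      unfolding eq[symmetric] lookup_mult_Var using \<alpha> by (simp add: in_keys_iff)
    then obtain i where i: "i \<in> S" "lookup (\<Psi> i * Var i) (\<alpha> + single k 1) \<noteq> 0"
      unfolding lookup_sum by (meson sum.neutral)
    then have "lookup (\<alpha> + single k 1) i \<noteq> 0" unfolding lookup_mult_Var_iff by meson
    then have "lookup \<alpha> i \<noteq> 0" using i assms(1) by (auto simp: lookup_add lookup_single when_def split: if_splits)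
    then have "P i dvd P i ^ lookup \<alpha> i" by (simp add: dvd_power)
    also have "\<dots> dvd (\<Prod>i\<in>UNIV. P i ^ lookup \<alpha> i)" by (rule dvd_prodI) auto
    finally obtain g where "(\<Prod>i\<in>UNIV. P i ^ lookup \<alpha> i) = P i * g" by (elim dvdE)
    then have "lookup \<Phi> \<alpha> * (\<Prod>i\<in>UNIV. P i ^ lookup \<alpha> i) = (lookup \<Phi> \<alpha> * g) * P i" by (simp add: mult_ac)
    then show ?thesis using i by (metis idl.span_scale idl.span_base imageI)
  qed
  then have "eval_poly P \<Phi> \<in> idl.span (P ` S)" unfolding eval_poly_def by (intro idl.span_sum)
  then show ?thesis by (simp add: \<Phi>)
qed

lemma regular_of_expansions:
  assumes "distinct ms"
  shows "regular_list (map P ms)"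
  unfolding regular_list_def
proof (intro allI impI)
  fix i f assume i: "i < length (map P ms)" and f: "f * map P ms ! i \<in> idl.span (set (take i (map P ms)))"
  have eq: "set (take i (map P ms)) = P ` set (take i ms)" by (simp add: take_map)
  have "ms ! i \<notin> set (take i ms)"
    using i assms by (auto simp: in_set_conv_nth nth_eq_iff_index_eq)
  then show "f \<in> idl.span (set (take i (map P ms)))"
    using f unfolding eq nth_map[OF i[unfolded length_map]] by (rule nonzerodivisor_of_expansions)
qed

end


section \<open>Separators of complete intersections\<close>

definition separator :: "('v::finite \<Rightarrow> 'k::field) set \<Rightarrow> ('v \<Rightarrow> 'k) \<Rightarrow> nat \<Rightarrow> ('v, 'k) mpolynomial \<Rightarrow> bool" where
  "separator V p e g \<longleftrightarrow> g \<in> hom_part e \<and> eval_poly p g = 1 \<and> (\<forall>q\<in>V - {p}. eval_poly q g = 0)"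

lemma separator_mult_Var:
  fixes g :: "('m::finite option, 'k::field) mpolynomial"
  assumes "separator V p e g" "p None = 1"
  shows "separator V p (e + n) (g * Var None ^ n)"
proof -
  have "(Var None ^ n :: ('m option, 'k) mpolynomial) \<in> part (\<lambda>_. 1) n"
    using part_power[OF part_Var[of None "\<lambda>_. 1"], of n] by simp
  then show ?thesis using assms part_mult[of g "\<lambda>_. 1" e _ n] by (auto simp: separator_def hom_part_eq)
qed

lemma separator_scaled:
  assumes "g \<in> hom_part e" "eval_poly p g \<noteq> 0" "\<forall>q\<in>V - {p}. eval_poly q g = 0"
  shows "separator V p e (Const (1 / eval_poly p g) * g)"
  using assms part_Const_mult by (auto simp: separator_def hom_part_eq)

lemma separator_exists:
  fixes V :: "('m::finite option \<Rightarrow> 'k::field) set"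
  assumes "finite V" and "\<forall>q\<in>V. q None = 1" and p: "p None = 1"
  shows "\<exists>e g. separator V p e g"
  using assms(1,2)
proof (induction V rule: finite_induct)
  case empty
  show ?case
    by (intro exI[of _ 0] exI[of _ 1]) (simp add: separator_def hom_part_eq)
next
  case (insert q V)
  then obtain e g where g: "separator V p e g" by blast
  have q1: "q None = 1" using insert.prems by blast
  show ?case
  proof (cases "q = p")
    case True
    then show ?thesis using g by (auto simp: separator_def)
  next
    case False
    then obtain x where "q x \<noteq> p x" by (auto simp: fun_eq_iff)
    then obtain j where j: "q (Some j) \<noteq> p (Some j)" using p q1 by (cases x) auto
    have lin: "linear_form q j \<in> part (\<lambda>_. 1) 1"
      using part_Var[of "Some j" "\<lambda>_. 1"] part_Var[of None "\<lambda>_. 1"]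
      unfolding linear_form_def by (intro part_diff part_Const_mult) auto
    have evp: "eval_poly p (linear_form q j) = p (Some j) - q (Some j)" by (simp add: linear_form_def p)
    have evq: "eval_poly q (linear_form q j) = 0" using q1 by (simp add: linear_form_def)
    have "g \<in> part (\<lambda>_. 1) e" using g by (simp add: separator_def hom_part_eq)
    from part_mult[OF this lin] have "g * linear_form q j \<in> hom_part (e + 1)" unfolding hom_part_eq .
    then have "separator (insert q V) p (e + 1) (Const (1 / eval_poly p (g * linear_form q j)) * (g * linear_form q j))"
      using g j evq by (intro separator_scaled) (auto simp: separator_def evp)
    then show ?thesis by blast
  qed
qed

text \<open>
  The functionals \<open>\<tau> z\<close> express that the value at a point outside of the dual points \<open>Q\<close> is
  determined by the values at \<open>Q\<close>. They generate all relations, and one of them involves \<open>p\<close> unless \<open>p\<close> has a separator.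
\<close>

lemma separating_functional:
  fixes U :: "('v::finite, 'k::field) mpolynomial set"
  assumes V: "finite V" and U: "pv.subspace U" and p: "p \<in> V"
    and nosep: "\<not> (\<exists>g\<in>U. eval_poly p g = 1 \<and> (\<forall>q\<in>V - {p}. eval_poly q g = 0))"
  shows "\<exists>\<tau>. \<tau> p \<noteq> 0 \<and> (\<forall>f\<in>U. (\<Sum>q\<in>V. \<tau> q * eval_poly q f) = 0)"
proof -
  obtain Q b where Q: "Q \<subseteq> V" and b: "\<forall>q\<in>Q. b q \<in> U"
    and dual: "\<forall>q\<in>Q. \<forall>q'\<in>Q. eval_poly q' (b q) = (if q = q' then 1 else 0)"
    and ex: "\<forall>f\<in>U. \<forall>z\<in>V. eval_poly z f = (\<Sum>q\<in>Q. eval_poly q f * eval_poly z (b q))"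
    using dual_points[OF V U, of eval_poly] by auto
  have finQ: "finite Q" using Q V finite_subset by blast
  define \<tau> where "\<tau> z q = (if q = z then 1 else if q \<in> Q then - eval_poly z (b q) else 0)" for z q
  have ann: "(\<Sum>q\<in>V. \<tau> z q * eval_poly q f) = 0" if z: "z \<in> V - Q" and f: "f \<in> U" for z f
  proof -
    have "(\<Sum>q\<in>V. \<tau> z q * eval_poly q f) = eval_poly z f + (\<Sum>q\<in>V - {z}. \<tau> z q * eval_poly q f)"
      using z V by (subst sum.remove[of V z]) (auto simp: \<tau>_def)
    also have "(\<Sum>q\<in>V - {z}. \<tau> z q * eval_poly q f) = (\<Sum>q\<in>Q. - (eval_poly q f * eval_poly z (b q)))"
      using z Q V by (intro sum.mono_neutral_cong_right) (auto simp: \<tau>_def)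
    also have "eval_poly z f + \<dots> = 0" using ex[rule_format, OF f, of z] z by (simp add: sum_negf)
    finally show ?thesis .
  qed
  show ?thesis
  proof (cases "p \<in> Q")
    case False
    then show ?thesis using ann[of p] p by (intro exI[of _ "\<tau> p"]) (auto simp: \<tau>_def)
  next
    case True
    have "\<exists>z\<in>V - Q. eval_poly z (b p) \<noteq> 0"
    proof (rule ccontr)
      assume *: "\<not> ?thesis"
      have "eval_poly q (b p) = 0" if "q \<in> V - {p}" for q
        using that * dual True by (cases "q \<in> Q") auto
      moreover have "b p \<in> U" "eval_poly p (b p) = 1" using b dual True by auto
      ultimately show False using nosep by blast
    qed
    then obtain z where z: "z \<in> V - Q" "eval_poly z (b p) \<noteq> 0" by blast
    then have "\<tau> z p \<noteq> 0" using True by (auto simp: \<tau>_def)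
    then show ?thesis using ann[OF z(1)] by blast
  qed
qed

text \<open>
  If elements of the ideal have gradients that form the identity matrix at \<open>u\<close>, then expressing them
  in terms of the \<open>F i\<close> gives a left inverse of the Jacobian matrix.
\<close>

lemma det_nonzero_of_gradients:
  fixes F :: "'i::finite \<Rightarrow> ('v::finite, 'k::field) mpolynomial"
  assumes F: "\<And>i. eval_poly u (F i) = 0"
    and h: "\<And>j. \<exists>h\<in>idl.span (range F). \<forall>k. eval_poly u (partial_deriv (\<kappa> k) h) = (if j = k then 1 else 0)"
  shows "det (\<chi> i j. eval_poly u (partial_deriv (\<kappa> j) (F i)) :: 'k^'i^'i) \<noteq> 0"
proof -
  have "\<forall>j. \<exists>c. \<forall>k. (\<Sum>i\<in>UNIV. eval_poly u (c i) * eval_poly u (partial_deriv (\<kappa> k) (F i))) = (if j = k then 1 else 0)"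
  proof
    fix j
    obtain h where h: "h \<in> idl.span (range F)" "\<And>k. eval_poly u (partial_deriv (\<kappa> k) h) = (if j = k then 1 else 0)"
      using h by blast
    then obtain c where "h = (\<Sum>i\<in>UNIV. c i * F i)" using span_image_finite[of UNIV h F] by auto
    then have "(\<Sum>i\<in>UNIV. eval_poly u (c i) * eval_poly u (partial_deriv (\<kappa> k) (F i))) = (if j = k then 1 else 0)" for k
      using h(2)[of k] by (simp add: partial_deriv_sum partial_deriv_mult F)
    then show "\<exists>c. \<forall>k. (\<Sum>i\<in>UNIV. eval_poly u (c i) * eval_poly u (partial_deriv (\<kappa> k) (F i))) = (if j = k then 1 else 0)"
      by blast
  qed
  then obtain c where c: "\<And>j k. (\<Sum>i\<in>UNIV. eval_poly u (c j i) * eval_poly u (partial_deriv (\<kappa> k) (F i))) = (if j = k then 1 else 0)"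
    by metis
  have "(\<chi> j i. eval_poly u (c j i)) ** (\<chi> i j. eval_poly u (partial_deriv (\<kappa> j) (F i))) = (mat 1 :: 'k^'i^'i)"
    by (simp add: vec_eq_iff matrix_matrix_mult_def mat_def c)
  then have "det (\<chi> j i. eval_poly u (c j i) :: 'k^'i^'i) * det (\<chi> i j. eval_poly u (partial_deriv (\<kappa> j) (F i)) :: 'k^'i^'i) = 1"
    by (metis det_I det_mul)
  then show ?thesis by auto
qed

text \<open>
  A separator of \<open>p\<close> times the linear form in direction \<open>j\<close> through \<open>p\<close> lies in the ideal and has
  gradient \<open>e\<^sub>j\<close> at \<open>p\<close>.
\<close>

lemma ci_jacobian_nonzero:
  fixes V :: "('m::finite option \<Rightarrow> 'k::field_char_0) set" and F :: "'m \<Rightarrow> ('m option, 'k) mpolynomial"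
  assumes finV: "finite V" and V: "\<And>q. q \<in> V \<Longrightarrow> q None = 1"
    and gen: "idl.span (range F) = vanishing V" and F: "\<And>i. F i \<in> hom_part (a i)" and p: "p \<in> V"
  shows "jacobian_at F p \<noteq> 0"
  unfolding jacobian_at_def
proof (rule det_nonzero_of_gradients)
  have "F i \<in> vanishing V" for i unfolding gen[symmetric] by (intro idl.span_base) auto
  then show "eval_poly p (F i) = 0" for i using vanishing_hom_iff[OF F] p by blast
  fix j
  have "\<exists>e g. separator V p e g" by (rule separator_exists[OF finV]) (use V p in auto)
  then obtain e g where g: "separator V p e g" by blast
  have lin: "linear_form p j \<in> part (\<lambda>_. 1) 1"
    using part_Var[of "Some j" "\<lambda>_. 1"] part_Var[of None "\<lambda>_. 1"]
    unfolding linear_form_def by (intro part_diff part_Const_mult) auto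
  have evp: "eval_poly p (linear_form p j) = 0" by (simp add: linear_form_def V[OF p])
  have "g \<in> part (\<lambda>_. 1) e" using g by (simp add: separator_def hom_part_eq)
  from part_mult[OF this lin] have "g * linear_form p j \<in> hom_part (e + 1)" unfolding hom_part_eq .
  moreover have "\<forall>q\<in>V. eval_poly q (g * linear_form p j) = 0"
    using g evp by (auto simp: separator_def)
  ultimately have "g * linear_form p j \<in> vanishing V" by (simp add: vanishing_hom_iff)
  moreover have "eval_poly p (partial_deriv (Some k) (g * linear_form p j)) = (if j = k then 1 else 0)" for k
    using g V[OF p] by (auto simp: partial_deriv_mult separator_def linear_form_def partial_deriv_diff partial_deriv_Var)
  ultimately show "\<exists>h\<in>idl.span (range F). \<forall>k. eval_poly p (partial_deriv (Some k) h) = (if j = k then 1 else 0)"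
    unfolding gen by blast
qed

text \<open>
  Where the coordinate \<open>None\<close> is \<open>1\<close>, these forms have the same values as the forms of all degrees less than \<open>d\<close>, and
  they make up a single vector space, also for \<open>d = 0\<close>.
\<close>

definition divisible_forms :: "nat \<Rightarrow> ('m::finite option, 'k::field) mpolynomial set" where
  "divisible_forms d = {f \<in> hom_part d. \<exists>h. f = h * Var None}"

lemma subspace_divisible_forms: "pv.subspace (divisible_forms d)"
proof -
  have "\<exists>h. f * Var None + g * Var None = h * Var None" for f g :: "('m::finite option, 'k::field) mpolynomial"
    by (intro exI[of _ "f + g"]) (simp add: distrib_right)
  moreover have "\<exists>h. Const c * (f * Var None) = h * Var None" for c and f :: "('m::finite option, 'k::field) mpolynomial"
    by (intro exI[of _ "Const c * f"]) (simp add: mult.assoc)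
  moreover have "\<exists>h. 0 = h * Var None" by (rule exI[of _ 0]) simp
  ultimately show ?thesis
    by (auto simp: divisible_forms_def pv.subspace_def hom_part_eq part_add part_Const_mult)
qed

lemma divisible_forms_lower:
  fixes f :: "('m::finite option, 'k::field) mpolynomial"
  assumes "f \<in> divisible_forms d"
  shows "f = 0 \<or> (\<exists>g\<in>hom_part (d - 1). 1 \<le> d \<and> f = g * Var None)"
proof -
  obtain h where h: "f \<in> hom_part d" "f = h * Var None" using assms by (auto simp: divisible_forms_def)
  have "f = component (\<lambda>_. 1) d (h * Var None)"
    using h component_part[of f "\<lambda>_. 1" d d] by (simp add: hom_part_eq)
  also have "\<dots> = (if 1 \<le> d then component (\<lambda>_. 1) (d - 1) h * Var None else 0)"
    by (rule component_mult_part[OF part_Var[of None "\<lambda>_. 1"]])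
  finally show ?thesis using component_in_part[of "\<lambda>_. 1" "d - 1" h] by (auto simp: hom_part_eq split: if_splits)
qed

lemma lower_divisible_forms:
  fixes g :: "('m::finite option, 'k::field) mpolynomial"
  assumes "g \<in> hom_part e" "e < d"
  shows "g * Var None ^ (d - e) \<in> divisible_forms d"
proof -
  have "(Var None ^ (d - e) :: ('m option, 'k) mpolynomial) \<in> part (\<lambda>_. 1) (d - e)"
    using part_power[OF part_Var[of None "\<lambda>_. 1"], of "d - e"] by simp
  from part_mult[OF assms(1)[unfolded hom_part_eq] this]
  have "g * Var None ^ (d - e) \<in> hom_part (e + (d - e))" unfolding hom_part_eq .
  moreover have "g * Var None ^ (d - e) = (g * Var None ^ (d - e - 1)) * Var None"
    using assms by (cases "d - e") (auto simp: mult_ac)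
  ultimately show ?thesis using assms by (auto simp: divisible_forms_def)
qed

lemma annihilates_lower:
  fixes V :: "('m::finite option \<Rightarrow> 'k::field) set"
  assumes V: "\<forall>q\<in>V. q None = 1"
    and ann: "\<forall>f\<in>divisible_forms d. (\<Sum>q\<in>V. \<tau> q * eval_poly q f) = 0"
  shows "\<forall>e<d. \<forall>g\<in>hom_part e. (\<Sum>q\<in>V. \<tau> q * eval_poly q g) = 0"
proof (intro allI impI ballI)
  fix e and g :: "('m option, 'k) mpolynomial" assume e: "e < d" and g: "g \<in> hom_part e"
  have "(\<Sum>q\<in>V. \<tau> q * eval_poly q (g * Var None ^ (d - e))) = 0"
    using ann lower_divisible_forms[OF g e] by blast
  also have "(\<Sum>q\<in>V. \<tau> q * eval_poly q (g * Var None ^ (d - e))) = (\<Sum>q\<in>V. \<tau> q * eval_poly q g)"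
    by (intro sum.cong refl) (simp add: V)
  finally show "(\<Sum>q\<in>V. \<tau> q * eval_poly q g) = 0" .
qed

text \<open>
  The Bezoutian is a separator in degree \<open>\<rho>\<close>. That there is none in smaller degrees follows once some
  functional \<open>\<tau> \<noteq> 0\<close> annihilates all forms of degree less than \<open>\<rho>\<close>, because then \<open>\<tau>\<^sub>p \<Delta>(p) = \<kappa> \<noteq> 0\<close> for
  every \<open>p\<close>, whereas \<open>\<tau>\<close> maps a separator of \<open>p\<close> to \<open>\<tau>\<^sub>p\<close>. Without such a \<open>\<tau>\<close>, every form of degree \<open>\<rho>\<close>
  would agree on \<open>V\<close> with a multiple of \<open>T\<close>, so the regular sequence \<open>F\<^sub>1, \<dots>, F\<^sub>m, T\<close> would
  generate all forms of degree \<open>\<rho>\<close>; its Hilbert series shows that it does not.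
\<close>

theorem separator_degrees_of_ci:
  fixes V :: "('m::finite option \<Rightarrow> 'k::field_char_0) set" and F :: "'m \<Rightarrow> ('m option, 'k) mpolynomial"
  assumes finV: "finite V" and V: "\<And>q. q \<in> V \<Longrightarrow> q None = 1" and ne: "V \<noteq> {}"
    and F: "\<And>i. F i \<in> hom_part (a i)" and a: "\<And>i. 1 \<le> a i"
    and gen: "idl.span (range F) = vanishing V" and p: "p \<in> V"
  shows "(\<exists>g. separator V p e g) \<longleftrightarrow> sum a UNIV - CARD('m) \<le> e"
proof -
  let ?\<rho> = "sum a UNIV - CARD('m)"
  have jac: "jacobian_at F q \<noteq> 0" if "q \<in> V" for q
  proof (rule ci_jacobian_nonzero[where V = V and F = F and a = a])
    show "q' None = 1" if "q' \<in> V" for q' using that by (rule V)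
  qed (rule finV gen F that)+
  have "F i \<in> vanishing V" for i unfolding gen[symmetric] by (intro idl.span_base) auto
  then have FV: "eval_poly q (F i) = 0" if "q \<in> V" for i q using vanishing_hom_iff[OF F] that by blast
  have V': "\<forall>q\<in>V. q None = 1" and F': "\<forall>i. F i \<in> hom_part (a i)" and FV': "\<forall>i. \<forall>q\<in>V. eval_poly q (F i) = 0"
    using V F FV by blast+
  obtain g0 where g0: "g0 \<in> hom_part ?\<rho>" "eval_poly p g0 = jacobian_at F p" "\<forall>q\<in>V - {p}. eval_poly q g0 = 0"
    using separator_of_jacobian[OF V' F' FV' p] by blast
  then have sep: "\<exists>g. separator V p ?\<rho> g"
    using separator_scaled[OF g0(1) _ g0(3)] jac[OF p] by auto
  have nosep: "\<not> (\<exists>g. separator V p e g)" if e: "e < ?\<rho>"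
  proof
    obtain ms :: "'m list" where ms: "set ms = UNIV" "distinct ms" using finite_distinct_list[OF finite] by blast
    have len: "length ms = CARD('m)" using distinct_card[OF ms(2)] ms(1) by simp
    let ?fs = "map F ms @ [Var None]" and ?ds = "map a ms @ [1]"
    have "(Var None :: ('m option, 'k) mpolynomial) \<in> hom_part 1"
      using part_Var[of None "\<lambda>_. 1"] by (simp add: hom_part_eq)
    then have 1: "list_all2 (\<lambda>f d. f \<in> hom_part d) ?fs ?ds"
      using F by (auto simp: list_all2_conv_all_nth nth_append)
    have setF: "idl.span (set (map F ms)) = vanishing V" using gen ms by simp
    have reg: "regular_list (map F ms)"
    proof (rule regular_of_expansions[where V = V and P = F and a = a])
      show "jacobian_at F p \<noteq> 0" if "p \<in> V" for p using that by (rule jac)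
    qed (rule finV F a gen ms(2))+
    have 2: "regular_list ?fs"
      unfolding regular_list_def
    proof (intro allI impI)
      fix i f assume i: "i < length ?fs" and f: "f * ?fs ! i \<in> idl.span (set (take i ?fs))"
      show "f \<in> idl.span (set (take i ?fs))"
      proof (cases "i < length ms")
        case True
        then have eqs: "?fs ! i = map F ms ! i" "take i ?fs = take i (map F ms)" by (simp_all add: nth_append)
        have i': "i < length (map F ms)" using True by simp
        have "f * map F ms ! i \<in> idl.span (set (take i (map F ms)))" using f unfolding eqs .
        from regular_listD[OF reg i' this] show ?thesis unfolding eqs .
      next
        case False
        then have eqs: "?fs ! i = Var None" "take i ?fs = map F ms" using i by (simp_all add: nth_append)
        have "f * Var None \<in> vanishing V" using f unfolding eqs setF .
        then have *: "\<forall>v\<in>V. \<forall>c. c \<noteq> 0 \<longrightarrow> eval_poly (\<lambda>x. c * v x) (f * Var None) = 0"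
          unfolding vanishing_def by blast
        have "f \<in> vanishing V"
          unfolding vanishing_def
        proof (intro CollectI ballI allI impI)
          fix v and c :: 'k assume "v \<in> V" "c \<noteq> 0"
          with * V' show "eval_poly (\<lambda>x. c * v x) f = 0" by fastforce
        qed
        then show ?thesis unfolding eqs setF .
      qed
    qed
    have \<rho>: "(\<Sum>d\<leftarrow>?ds. d - 1) = ?\<rho>"
    proof -
      have "(\<Sum>d\<leftarrow>?ds. d - 1) = (\<Sum>i\<in>UNIV. a i - 1)"
        using sum_list_distinct_conv_sum_set[OF ms(2), of "\<lambda>i. a i - 1"] by (simp add: ms o_def)
      also have "\<dots> = ?\<rho>" using a by (subst sum_subtractf_nat) auto
      finally show ?thesis .
    qed
    obtain f where f: "f \<in> hom_part ?\<rho>" "f \<notin> idl.span (set ?fs)"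
      using regular_sequence_top_degree[OF 1 2] len a unfolding \<rho> by (auto simp: card_UNIV_option)
    \<comment> \<open>Otherwise multiples of \<open>Var None\<close> would attain all values on \<open>V\<close>, including those of \<open>f\<close>.\<close>
    have "\<exists>q\<in>V. \<not> (\<exists>g\<in>divisible_forms ?\<rho>. eval_poly q g = 1 \<and> (\<forall>q'\<in>V - {q}. eval_poly q' g = 0))"
    proof (rule ccontr)
      assume "\<not> ?thesis"
      then have "\<forall>q\<in>V. \<exists>g. g \<in> divisible_forms ?\<rho> \<and> eval_poly q g = 1 \<and> (\<forall>q'\<in>V - {q}. eval_poly q' g = 0)" by blast
      then obtain G where G: "\<And>q. q \<in> V \<Longrightarrow> G q \<in> divisible_forms ?\<rho>" "\<And>q. q \<in> V \<Longrightarrow> eval_poly q (G q) = 1"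
        "\<And>q q'. q \<in> V \<Longrightarrow> q' \<in> V - {q} \<Longrightarrow> eval_poly q' (G q) = 0" by metis
      let ?g = "\<Sum>q\<in>V. Const (eval_poly q f) * G q"
      have g: "?g \<in> divisible_forms ?\<rho>"
        using G by (intro pv.subspace_sum[OF subspace_divisible_forms] pv.subspace_scale[OF subspace_divisible_forms])
      have "eval_poly z ?g = eval_poly z f" if z: "z \<in> V" for z
      proof -
        have "eval_poly z ?g = (\<Sum>q\<in>V. if q = z then eval_poly q f else 0)"
          using G z by simp (intro sum.cong, auto)
        then show ?thesis using z finV by simp
      qed
      then have "f - ?g \<in> vanishing V"
        using f g by (subst vanishing_hom_iff[of _ ?\<rho>]) (auto simp: divisible_forms_def hom_part_eq part_diff)
      then have "f - ?g \<in> idl.span (set ?fs)"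
        using setF idl.span_mono[of "set (map F ms)" "set ?fs"] by auto
      moreover obtain h where "?g = h * Var None" using g by (auto simp: divisible_forms_def)
      then have "?g \<in> idl.span (set ?fs)" by (simp add: idl.span_scale idl.span_base)
      ultimately have "(f - ?g) + ?g \<in> idl.span (set ?fs)" by (rule idl.span_add)
      with f show False by simp
    qed
    then obtain q where q: "q \<in> V" "\<not> (\<exists>g\<in>divisible_forms ?\<rho>. eval_poly q g = 1 \<and> (\<forall>q'\<in>V - {q}. eval_poly q' g = 0))"
      by blast
    obtain \<tau> where \<tau>: "\<tau> q \<noteq> 0" "\<forall>f\<in>divisible_forms ?\<rho>. (\<Sum>q\<in>V. \<tau> q * eval_poly q f) = 0"
      using separating_functional[OF finV subspace_divisible_forms q] by blast
    note ann = annihilates_lower[OF V' \<tau>(2)]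
    obtain \<kappa> where \<kappa>: "\<forall>p\<in>V. \<tau> p * jacobian_at F p = \<kappa>"
      using residue_functional[OF finV V' F' FV' ann] by blast
    then have "\<kappa> \<noteq> 0" using \<tau>(1) jac[OF q(1)] q(1) by auto
    then have \<tau>p: "\<tau> p \<noteq> 0" using \<kappa> p by auto
    assume "\<exists>g. separator V p e g"
    then obtain g where g: "g \<in> hom_part e" "eval_poly p g = 1" "\<forall>q\<in>V - {p}. eval_poly q g = 0"
      by (auto simp: separator_def)
    have "(\<Sum>q\<in>V. \<tau> q * eval_poly q g) = \<tau> p"
      using g finV p by (subst sum.remove[of V p]) auto
    with ann g e \<tau>p show False by auto
  qed
  show ?thesis
  proof
    assume "\<exists>g. separator V p e g"
    then show "?\<rho> \<le> e" using nosep by (meson not_le)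
  next
    assume "?\<rho> \<le> e"
    obtain g where "separator V p ?\<rho> g" using sep by blast
    from separator_mult_Var[OF this V[OF p], of "e - ?\<rho>"] \<open>?\<rho> \<le> e\<close>
    show "\<exists>g. separator V p e g" by auto
  qed
qed

text \<open>
  The Bezoutian at \<open>p\<close> is a separator of degree \<open>\<rho>\<close>, which forces \<open>\<rho> = r\<close>. As \<open>p\<close> has no separator of smaller degree,
  some functional \<open>\<tau>\<close> that annihilates all forms of degree less than \<open>\<rho>\<close> has \<open>\<tau>\<^sub>p \<noteq> 0\<close>. Hence \<open>\<kappa> = \<tau>\<^sub>p \<Delta>(p)\<close> is a unit.
\<close>

theorem ci_of_separator_degrees:
  fixes V :: "('m::finite option \<Rightarrow> 'k::field_char_0) set" and P :: "'m \<Rightarrow> ('m option, 'k) mpolynomial"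
  assumes finV: "finite V" and V: "\<And>q. q \<in> V \<Longrightarrow> q None = 1"
    and P: "\<And>i. P i \<in> hom_part (a i)" and PV: "\<And>i q. q \<in> V \<Longrightarrow> eval_poly q (P i) = 0"
    and p: "p \<in> V" and jac: "jacobian_at P p \<noteq> 0" and deg: "sum a UNIV - CARD('m) \<le> r"
    and nosep: "\<And>q e g. q \<in> V \<Longrightarrow> e < r \<Longrightarrow> \<not> separator V q e g"
  shows "idl.span (range P) = vanishing V \<and> (\<forall>i. 1 \<le> a i) \<and> (\<forall>q\<in>V. jacobian_at P q \<noteq> 0)"
proof -
  let ?\<rho> = "sum a UNIV - CARD('m)"
  \<comment> \<open>A constant among the \<open>P i\<close> would be a zero row of the Jacobian matrix.\<close>
  have a: "1 \<le> a i" for i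
  proof (rule ccontr)
    assume "\<not> 1 \<le> a i"
    then have "a i = 0" by simp
    then have "P i \<in> hom_part 0" using P[of i] by simp
    then obtain c where "P i = Const c" using hom_part_0_Const by blast
    then have "jacobian_at P p = 0"
      unfolding jacobian_at_def by (intro det_zero_row[of i]) (simp add: row_def vec_eq_iff)
    with jac show False by simp
  qed
  have V': "\<forall>q\<in>V. q None = 1" and P': "\<forall>i. P i \<in> hom_part (a i)" and PV': "\<forall>i. \<forall>q\<in>V. eval_poly q (P i) = 0"
    using V P PV by blast+
  obtain g0 where g0: "g0 \<in> hom_part ?\<rho>" "eval_poly p g0 = jacobian_at P p" "\<forall>q\<in>V - {p}. eval_poly q g0 = 0"
    using separator_of_jacobian[OF V' P' PV' p] by blast
  then have "\<exists>g. separator V p ?\<rho> g"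
    using separator_scaled[OF g0(1) _ g0(3)] jac by auto
  then have \<rho>: "?\<rho> = r" using nosep[OF p, of ?\<rho>] deg by (metis le_neq_implies_less)
  have "\<not> (\<exists>g\<in>divisible_forms ?\<rho>. eval_poly p g = 1 \<and> (\<forall>q\<in>V - {p}. eval_poly q g = 0))"
  proof
    assume "\<exists>g\<in>divisible_forms ?\<rho>. eval_poly p g = 1 \<and> (\<forall>q\<in>V - {p}. eval_poly q g = 0)"
    then obtain f where f: "f \<in> divisible_forms ?\<rho>" "eval_poly p f = 1" "\<forall>q\<in>V - {p}. eval_poly q f = 0" by blast
    then obtain g where g: "g \<in> hom_part (?\<rho> - 1)" "1 \<le> ?\<rho>" "f = g * Var None"
      using divisible_forms_lower[OF f(1)] by auto
    have "eval_poly q f = eval_poly q g" if "q \<in> V" for q using that V' by (simp add: g(3))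
    then have "separator V p (?\<rho> - 1) g" using f g(1) p by (auto simp: separator_def)
    then show False using nosep[OF p, of "?\<rho> - 1" g] g(2) \<rho> by simp
  qed
  then obtain \<tau> where \<tau>: "\<tau> p \<noteq> 0" "\<forall>f\<in>divisible_forms ?\<rho>. (\<Sum>q\<in>V. \<tau> q * eval_poly q f) = 0"
    using separating_functional[OF finV subspace_divisible_forms p] by blast
  obtain \<kappa> where \<kappa>: "\<forall>p\<in>V. \<tau> p * jacobian_at P p = \<kappa>"
    and div: "\<And>e h. h \<in> hom_part e \<Longrightarrow> \<forall>q\<in>V. eval_poly q h = 0 \<Longrightarrow> Const \<kappa> * h \<in> idl.span (range P)"
    using residue_functional[OF finV V' P' PV' annihilates_lower[OF V' \<tau>(2)]] by blast
  have \<kappa>0: "\<kappa> \<noteq> 0" using \<kappa> \<tau>(1) jac p by auto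
  have "vanishing V \<subseteq> idl.span (range P)"
  proof
    fix f assume f: "f \<in> vanishing V"
    have "component (\<lambda>_. 1) e f \<in> idl.span (range P)" for e
    proof -
      have hom: "component (\<lambda>_. 1) e f \<in> hom_part e" by (simp add: hom_part_eq component_in_part)
      then have "\<forall>q\<in>V. eval_poly q (component (\<lambda>_. 1) e f) = 0"
        using vanishing_component[OF f] vanishing_hom_iff by blast
      from div[OF hom this] have "Const (1 / \<kappa>) * (Const \<kappa> * component (\<lambda>_. 1) e f) \<in> idl.span (range P)"
        by (rule idl.span_scale)
      then show ?thesis using \<kappa>0 by (simp flip: mult.assoc Const_mult)
    qed
    then have "(\<Sum>e\<in>wdeg (\<lambda>_. 1) ` keys f. component (\<lambda>_. 1) e f) \<in> idl.span (range P)" by (intro idl.span_sum)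
    then show "f \<in> idl.span (range P)" by (simp add: sum_components)
  qed
  moreover have "P i \<in> vanishing V" for i using vanishing_hom_iff[OF P] PV by blast
  then have "idl.span (range P) \<subseteq> vanishing V" by (intro idl.span_minimal subspace_vanishing) auto
  moreover have "jacobian_at P q \<noteq> 0" if "q \<in> V" for q using \<kappa> \<kappa>0 that by fastforce
  ultimately show ?thesis using a by blast
qed


section \<open>Polynomials in two sets of variables\<close>

lemma part_insertion:
  fixes f :: "('v::finite, 'k::comm_semiring_1) mpolynomial" and b :: "'v \<Rightarrow> ('w::finite, 'k) mpolynomial"
  assumes "\<And>x. b x \<in> part w' (w x)" and "f \<in> part w d"
  shows "insertion Const b f \<in> part w' d"
  unfolding insertion_def
proof (rule part_sum)
  fix t assume "t \<in> keys f"
  then have "wdeg w t = d" using assms(2) by (simp add: part_def)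
  moreover have "(\<Prod>x\<in>UNIV. b x ^ lookup t x) \<in> part w' (\<Sum>x\<in>UNIV. lookup t x * w x)"
    using assms(1) by (intro part_prod part_power)
  ultimately show "Const (lookup f t) * (\<Prod>x\<in>UNIV. b x ^ lookup t x) \<in> part w' d"
    by (intro part_Const_mult) (simp add: wdeg_def)
qed

definition emb :: "('v \<Rightarrow> 'w) \<Rightarrow> ('v::finite, 'k::comm_semiring_1) mpolynomial \<Rightarrow> ('w::finite, 'k) mpolynomial" where
  "emb e = insertion Const (\<lambda>x. Var (e x))"

definition res :: "('v \<Rightarrow> 'w) \<Rightarrow> ('w::finite, 'k::comm_semiring_1) mpolynomial \<Rightarrow> ('v::finite, 'k) mpolynomial" where
  "res e = insertion Const (\<lambda>z. if z \<in> range e then Var (inv_into UNIV e z) else 0)"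

lemma ring_morphism_emb: "ring_morphism (emb e)"
  by (simp add: emb_def ring_morphism_insertion)
lemma ring_morphism_res: "ring_morphism (res e)"
  by (simp add: res_def ring_morphism_insertion)
lemma emb_Const [simp]: "emb e (Const c) = Const c"
  by (simp add: emb_def insertion_Const)
lemma emb_Var [simp]: "emb e (Var x) = Var (e x)"
  by (simp add: emb_def insertion_Var)
lemma res_Const [simp]: "res e (Const c) = Const c"
  by (simp add: res_def insertion_Const)
lemmas emb_simps [simp] = ring_morphismD[OF ring_morphism_emb]
lemmas res_simps [simp] = ring_morphismD[OF ring_morphism_res]
lemma emb_sum: "emb e (sum f A) = (\<Sum>i\<in>A. emb e (f i))"
  by (rule ring_morphism_sum[OF ring_morphism_emb])
lemma emb_diff: "emb e (f - g) = emb e f - emb e (g :: ('v::finite, 'k::comm_ring_1) mpolynomial)"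
  by (rule ring_morphism_diff[OF ring_morphism_emb])

lemma res_emb: "inj e \<Longrightarrow> res e (emb e f) = f"
proof (rule ring_morphism_eqI[of "\<lambda>f. res e (emb e f)" "\<lambda>f. f"])
  show "ring_morphism (\<lambda>f. res e (emb e f))"
    by (rule ring_morphism_comp[OF ring_morphism_res ring_morphism_emb])
  assume "inj e"
  then show "res e (emb e (Var x)) = Var x" for x by (simp add: res_def insertion_Var)
qed simp_all

lemma eval_emb: "eval_poly u (emb e f) = eval_poly (\<lambda>x. u (e x)) f"
  by (simp add: emb_def eval_insertion_Const)

lemma emb_res:
  fixes f :: "('w::finite, 'k::comm_semiring_1) mpolynomial" and e :: "'v::finite \<Rightarrow> 'w"
  assumes "inj e" and "\<And>t z. t \<in> keys f \<Longrightarrow> z \<notin> range e \<Longrightarrow> lookup t z = 0"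
  shows "emb e (res e f) = f"
proof -
  have "emb e (res e f) = insertion Const (\<lambda>z. if z \<in> range e then Var z else 0) f"
  proof (rule ring_morphism_eqI[of "\<lambda>f. emb e (res e f)"])
    show "ring_morphism (\<lambda>f. emb e (res e f))"
      by (rule ring_morphism_comp[OF ring_morphism_emb ring_morphism_res])
    show "emb e (res e (Var z)) = insertion Const (\<lambda>z. if z \<in> range e then Var z else 0) (Var z)" for z
      by (simp add: res_def insertion_Var f_inv_into_f)
  qed (simp_all add: ring_morphism_insertion insertion_Const)
  also have "\<dots> = insertion Const Var f"
    unfolding insertion_def
  proof (intro sum.cong refl arg_cong2[of _ _ _ _ "(*)"] prod.cong)
    fix t z assume "t \<in> keys f"
    then show "(if z \<in> range e then Var z else 0) ^ lookup t z = (Var z ^ lookup t z :: ('w, 'k) mpolynomial)"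
      using assms(2)[of t z] by auto
  qed
  finally show ?thesis by simp
qed

lemma res_eq_0:
  fixes f :: "('w::finite, 'k::comm_semiring_1) mpolynomial" and e :: "'v::finite \<Rightarrow> 'w"
  assumes "\<And>t. t \<in> keys f \<Longrightarrow> \<exists>z. z \<notin> range e \<and> lookup t z \<noteq> 0"
  shows "res e f = 0"
  unfolding res_def insertion_def
proof (rule sum.neutral, rule ballI)
  fix t assume "t \<in> keys f"
  then obtain z where z: "z \<notin> range e" "lookup t z \<noteq> 0" using assms by blast
  have "(\<Prod>x\<in>UNIV. (if x \<in> range e then Var (inv_into UNIV e x) else 0 :: ('v, 'k) mpolynomial) ^ lookup t x) = 0"
    by (rule prod_zero) (use z in \<open>auto intro!: exI[of _ z] simp: power_0_left\<close>)
  then show "Const (lookup f t) * (\<Prod>x\<in>UNIV. (if x \<in> range e then Var (inv_into UNIV e x) else 0 :: ('v, 'k) mpolynomial) ^ lookup t x) = 0"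
    by simp
qed

lemma emb_Inl_bihom: "f \<in> hom_part d \<Longrightarrow> emb Inl f \<in> bihom_part d 0"
  for f :: "('a::finite, 'k::comm_semiring_1) mpolynomial"
proof -
  assume f: "f \<in> hom_part d"
  have 0: "f \<in> part (\<lambda>_. 0) 0" by (simp add: part_def wdeg_def)
  have X: "Var (Inl x) \<in> part wX 1" and Y: "Var (Inl x) \<in> part wY 0" for x :: 'a
    using part_Var[of "Inl x" wX] part_Var[of "Inl x" wY] by simp_all
  show ?thesis
    using part_insertion[of "\<lambda>x. Var (Inl x)" wX "\<lambda>_. 1" f d, OF X] part_insertion[of "\<lambda>x. Var (Inl x)" wY "\<lambda>_. 0" f 0, OF Y 0] f
    by (simp add: emb_def bihom_part_eq hom_part_eq)
qed

lemma emb_Inr_bihom: "f \<in> hom_part d \<Longrightarrow> emb Inr f \<in> bihom_part 0 d"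
  for f :: "('b::finite, 'k::comm_semiring_1) mpolynomial"
proof -
  assume f: "f \<in> hom_part d"
  have 0: "f \<in> part (\<lambda>_. 0) 0" by (simp add: part_def wdeg_def)
  have X: "Var (Inr x) \<in> part wY 1" and Y: "Var (Inr x) \<in> part wX 0" for x :: 'b
    using part_Var[of "Inr x" wX] part_Var[of "Inr x" wY] by simp_all
  show ?thesis
    using part_insertion[of "\<lambda>x. Var (Inr x)" wY "\<lambda>_. 1" f d, OF X] part_insertion[of "\<lambda>x. Var (Inr x)" wX "\<lambda>_. 0" f 0, OF Y 0] f
    by (simp add: emb_def bihom_part_eq hom_part_eq)
qed

lemma bihom_keysD:
  assumes "f \<in> bihom_part i j" "t \<in> keys f"
  shows "(\<Sum>x\<in>UNIV. lookup t (Inl x)) = i" "(\<Sum>y\<in>UNIV. lookup t (Inr y)) = j"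
  using assms by (auto simp: bihom_part_def)

lemma bihom_Inl:
  fixes f :: "('a::finite + 'b::finite, 'k::comm_semiring_1) mpolynomial"
  assumes f: "f \<in> bihom_part d 0"
  shows "emb Inl (res Inl f) = f" "res Inl f \<in> hom_part d"
proof -
  show "emb Inl (res Inl f) = f"
  proof (rule emb_res)
    fix t and z :: "'a + 'b" assume "t \<in> keys f" "z \<notin> range Inl"
    then show "lookup t z = 0" using bihom_keysD(2)[OF f] by (cases z) auto
  qed simp
  have f': "f \<in> part wX d" using f by (simp add: bihom_part_eq)
  have "(if z \<in> range Inl then Var (inv_into UNIV Inl z) else 0 :: ('a, 'k) mpolynomial) \<in> part (\<lambda>_. 1) (wX z)" for z :: "'a + 'b"
    using part_Var[of _ "\<lambda>_. 1"] by (cases z) auto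
  from part_insertion[of _ "\<lambda>_. 1" wX, OF this f'] show "res Inl f \<in> hom_part d"
    by (simp add: res_def hom_part_eq)
qed

lemma bihom_Inr:
  fixes f :: "('a::finite + 'b::finite, 'k::comm_semiring_1) mpolynomial"
  assumes f: "f \<in> bihom_part 0 d"
  shows "emb Inr (res Inr f) = f" "res Inr f \<in> hom_part d"
proof -
  show "emb Inr (res Inr f) = f"
  proof (rule emb_res)
    fix t and z :: "'a + 'b" assume "t \<in> keys f" "z \<notin> range Inr"
    then show "lookup t z = 0" using bihom_keysD(1)[OF f] by (cases z) auto
  qed simp
  have f': "f \<in> part wY d" using f by (simp add: bihom_part_eq)
  have "(if z \<in> range Inr then Var (inv_into UNIV Inr z) else 0 :: ('b, 'k) mpolynomial) \<in> part (\<lambda>_. 1) (wY z)" for z :: "'a + 'b"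
    using part_Var[of _ "\<lambda>_. 1"] by (cases z) auto
  from part_insertion[of _ "\<lambda>_. 1" wY, OF this f'] show "res Inr f \<in> hom_part d"
    by (simp add: res_def hom_part_eq)
qed

lemma res_Inl_bihom_0:
  fixes f :: "('a::finite + 'b::finite, 'k::comm_semiring_1) mpolynomial"
  assumes f: "f \<in> bihom_part 0 d" "1 \<le> d"
  shows "res Inl f = 0"
proof (rule res_eq_0)
  fix t assume "t \<in> keys f"
  then have "(\<Sum>y\<in>UNIV. lookup t (Inr y)) \<noteq> 0" using bihom_keysD(2)[OF f(1)] f(2) by simp
  then obtain y where "lookup t (Inr y) \<noteq> 0" by (meson sum.neutral)
  then show "\<exists>z. z \<notin> range Inl \<and> lookup t z \<noteq> 0" by (intro exI[of _ "Inr y"]) auto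
qed

lemma res_Inr_bihom_0:
  fixes f :: "('a::finite + 'b::finite, 'k::comm_semiring_1) mpolynomial"
  assumes f: "f \<in> bihom_part d 0" "1 \<le> d"
  shows "res Inr f = 0"
proof (rule res_eq_0)
  fix t assume "t \<in> keys f"
  then have "(\<Sum>y\<in>UNIV. lookup t (Inl y)) \<noteq> 0" using bihom_keysD(1)[OF f(1)] f(2) by simp
  then obtain y where "lookup t (Inl y) \<noteq> 0" by (meson sum.neutral)
  then show "\<exists>z. z \<notin> range Inr \<and> lookup t z \<noteq> 0" by (intro exI[of _ "Inl y"]) auto
qed

lemma morphism_span:
  fixes h :: "'a::comm_ring_1 \<Rightarrow> 'b::comm_ring_1"
  assumes h: "ring_morphism h" and f: "f \<in> idl.span G"
  shows "h f \<in> idl.span (h ` G)"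
  using f
proof (induction rule: idl.span_induct_alt)
  case base
  show ?case by (simp add: ring_morphismD[OF h] idl.span_zero)
next
  case (step c x y)
  have "h c * h x \<in> idl.span (h ` G)" using step by (intro idl.span_scale idl.span_base imageI)
  then show ?case using step by (simp add: ring_morphismD[OF h] idl.span_add)
qed


lemma span_emb:
  fixes e1 :: "'a::finite \<Rightarrow> 'c::finite" and e2 :: "'b::finite \<Rightarrow> 'c"
    and A :: "('a, 'k::comm_ring_1) mpolynomial set"
  shows "idl.span (emb e1 ` idl.span A \<union> emb e2 ` idl.span B) = idl.span (emb e1 ` A \<union> emb e2 ` B)"
proof
  have "emb e1 f \<in> idl.span (emb e1 ` A \<union> emb e2 ` B)" if "f \<in> idl.span A" for f
    using morphism_span[OF ring_morphism_emb that, of e1] idl.span_mono[OF Un_upper1] by blast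
  moreover have "emb e2 f \<in> idl.span (emb e1 ` A \<union> emb e2 ` B)" if "f \<in> idl.span B" for f
    using morphism_span[OF ring_morphism_emb that, of e2] idl.span_mono[OF Un_upper2] by blast
  ultimately show "idl.span (emb e1 ` idl.span A \<union> emb e2 ` idl.span B) \<subseteq> idl.span (emb e1 ` A \<union> emb e2 ` B)"
    by (intro idl.span_minimal[OF _ idl.subspace_span]) blast
  have "A \<subseteq> idl.span A" "B \<subseteq> idl.span B" by (rule idl.span_superset)+
  then show "idl.span (emb e1 ` A \<union> emb e2 ` B) \<subseteq> idl.span (emb e1 ` idl.span A \<union> emb e2 ` idl.span B)"
    by (intro idl.span_mono) blast
qed

lemma span_without_zeros:
  assumes "B \<subseteq> {0}"
  shows "idl.span (A \<union> B) = idl.span A"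
proof
  show "idl.span (A \<union> B) \<subseteq> idl.span A"
    using assms idl.span_superset[of A] idl.span_zero[of A] by (intro idl.span_minimal[OF _ idl.subspace_span]) blast
  show "idl.span A \<subseteq> idl.span (A \<union> B)" by (intro idl.span_mono) blast
qed

definition curry_poly ::
  "('a::finite + 'b::finite, 'k::comm_ring_1) mpolynomial \<Rightarrow> ('b, ('a, 'k) mpolynomial) mpolynomial" where
  "curry_poly = insertion (\<lambda>c. Const (Const c)) (case_sum (\<lambda>x. Const (Var x)) Var)"

definition uncurry_poly ::
  "('b::finite, ('a::finite, 'k::comm_ring_1) mpolynomial) mpolynomial \<Rightarrow> ('a + 'b, 'k) mpolynomial" where
  "uncurry_poly = insertion (emb Inl) (\<lambda>y. Var (Inr y))"

lemma ring_morphism_curry: "ring_morphism curry_poly"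
  unfolding curry_poly_def by (rule ring_morphism_insertion) (rule ring_morphism_comp[OF ring_morphism_Const ring_morphism_Const])
lemma ring_morphism_uncurry: "ring_morphism uncurry_poly"
  unfolding uncurry_poly_def by (rule ring_morphism_insertion[OF ring_morphism_emb])
lemmas curry_simps = ring_morphismD[OF ring_morphism_curry]

lemma curry_Const: "curry_poly (Const c) = Const (Const c)"
  unfolding curry_poly_def by (rule insertion_Const) (rule ring_morphism_comp[OF ring_morphism_Const ring_morphism_Const])
lemma curry_Var: "curry_poly (Var z) = case_sum (\<lambda>x. Const (Var x)) Var z"
  unfolding curry_poly_def by (rule insertion_Var) (rule ring_morphism_comp[OF ring_morphism_Const ring_morphism_Const])
lemma uncurry_Const: "uncurry_poly (Const f) = emb Inl f"
  unfolding uncurry_poly_def by (rule insertion_Const[OF ring_morphism_emb])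
lemma uncurry_Var: "uncurry_poly (Var y) = Var (Inr y)"
  unfolding uncurry_poly_def by (rule insertion_Var[OF ring_morphism_emb])

lemma uncurry_curry: "uncurry_poly (curry_poly f) = f"
proof (rule ring_morphism_eqI[of "\<lambda>f. uncurry_poly (curry_poly f)" "\<lambda>f. f"])
  show "ring_morphism (\<lambda>f. uncurry_poly (curry_poly f))"
    by (rule ring_morphism_comp[OF ring_morphism_uncurry ring_morphism_curry])
  show "uncurry_poly (curry_poly (Var z)) = Var z" for z
    by (cases z) (simp_all add: curry_Var uncurry_Const uncurry_Var)
qed (simp_all add: curry_Const uncurry_Const)

lemma curry_emb_Inl: "curry_poly (emb Inl p) = Const p"
  by (rule ring_morphism_eqI[of "\<lambda>p. curry_poly (emb Inl p)" Const])
     (simp_all add: ring_morphism_comp[OF ring_morphism_curry ring_morphism_emb] curry_Const curry_Var)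

lemma curry_emb_Inr: "curry_poly (emb Inr g) = insertion (\<lambda>c. Const (Const c)) Var g"
  by (rule ring_morphism_eqI[of "\<lambda>p. curry_poly (emb Inr p)"])
     (simp_all add: ring_morphism_comp[OF ring_morphism_curry ring_morphism_emb] ring_morphism_insertion
       ring_morphism_comp[OF ring_morphism_Const ring_morphism_Const] insertion_Const insertion_Var curry_Const curry_Var)

lemma uncurry_expand:
  fixes F :: "('b::finite, ('a::finite, 'k::comm_ring_1) mpolynomial) mpolynomial"
  shows "uncurry_poly F = (\<Sum>t\<in>keys F. emb Inl (lookup F t) * emb Inr (single t 1))"
proof -
  have "(emb Inr (single t 1) :: ('a + 'b, 'k) mpolynomial) = (\<Prod>y\<in>UNIV. Var (Inr y) ^ lookup t y)" for t
    by (simp add: emb_def insertion_single)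
  then show ?thesis by (simp add: uncurry_poly_def insertion_def)
qed

text \<open>
  The map \<open>L \<otimes> id\<close> on \<open>K[X] \<otimes> K[Y]\<close>.
\<close>

definition functional_map ::
  "(('a::finite, 'k::comm_ring_1) mpolynomial \<Rightarrow> 'k) \<Rightarrow> ('a + 'b::finite, 'k) mpolynomial \<Rightarrow> ('b, 'k) mpolynomial" where
  "functional_map L f = Poly_Mapping.map L (curry_poly f)"

context
  fixes L :: "('a::finite, 'k::comm_ring_1) mpolynomial \<Rightarrow> 'k"
  assumes L_add: "\<And>f g. L (f + g) = L f + L g" and L_scale: "\<And>c f. L (Const c * f) = c * L f"
begin

lemma L_0: "L 0 = 0" using L_scale[of 0 0] by simp

lemma lookup_functional_map: "lookup (functional_map L f) t = L (lookup (curry_poly f) t)"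
  by (simp add: functional_map_def map.rep_eq when_def L_0)

lemma functional_map_add: "functional_map L (f + g) = functional_map L f + functional_map L g"
  by (rule poly_mapping_eqI) (simp add: lookup_functional_map lookup_add curry_simps L_add)

lemma functional_map_mult_Inr: "functional_map L (f * emb Inr g) = functional_map L f * g"
proof -
  have lookup_map: "lookup (Poly_Mapping.map L F) t = L (lookup F t)" for F :: "('b, ('a, 'k) mpolynomial) mpolynomial" and t
    by (simp add: map.rep_eq when_def L_0)
  have map0: "Poly_Mapping.map L 0 = (0 :: ('b, 'k) mpolynomial)" by (rule poly_mapping_eqI) (simp add: lookup_map L_0)
  have mapadd: "Poly_Mapping.map L (F + G) = Poly_Mapping.map L F + Poly_Mapping.map L G"
    for F G :: "('b, ('a, 'k) mpolynomial) mpolynomial"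
    by (rule poly_mapping_eqI) (simp add: lookup_map lookup_add L_add)
  have mapsingle: "Poly_Mapping.map L (single t x) = single t (L x)" for t :: "'b \<Rightarrow>\<^sub>0 nat" and x
    by (rule poly_mapping_eqI) (simp add: lookup_map lookup_single when_def L_0)
  have ins_single: "insertion (\<lambda>c. Const (Const c)) Var (single s d) = single s (Const d)" for s :: "'b \<Rightarrow>\<^sub>0 nat" and d :: 'k
  proof -
    have "insertion (\<lambda>c. Const (Const c)) Var (single s d) = Const (Const d) * (\<Prod>y\<in>UNIV. Var y ^ lookup s y)"
      by (rule insertion_single) (rule ring_morphism_comp[OF ring_morphism_Const ring_morphism_Const])
    also have "\<dots> = insertion Const Var (single s (Const d))"
      by (rule insertion_single[OF ring_morphism_Const, symmetric])
    finally show ?thesis unfolding insertion_Const_Var .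
  qed
  note hom = ring_morphism_insertion[OF ring_morphism_comp[OF ring_morphism_Const ring_morphism_Const]]
  have "Poly_Mapping.map L (F * insertion (\<lambda>c. Const (Const c)) Var g) = Poly_Mapping.map L F * g" for F
  proof (induction g rule: mpolynomial_induct_terms)
    case zero
    show ?case by (simp add: ring_morphismD[OF hom] map0)
  next
    case (add g1 g2)
    then show ?case by (simp add: ring_morphismD[OF hom] distrib_left mapadd)
  next
    case (single s d)
    show ?case
    proof (induction F rule: mpolynomial_induct_terms)
      case zero
      show ?case by (simp add: map0)
    next
      case (add g1 g2)
      then show ?case by (simp add: distrib_right mapadd)
    next
      case (single t x)
      have "L (x * Const d) = L x * d" using L_scale[of d x] by (simp add: mult.commute)
      then show ?case by (simp add: ins_single mult_single mapsingle)
    qed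
  qed
  then show ?thesis by (simp add: functional_map_def curry_simps curry_emb_Inr)
qed

lemma functional_map_ideal:
  assumes I: "idl.subspace I" and LI: "\<And>p. p \<in> I \<Longrightarrow> L p = 0" and f: "f \<in> idl.span (emb Inl ` I)"
  shows "functional_map L f = 0"
  using f
proof (induction rule: idl.span_induct_alt)
  case base
  show ?case by (rule poly_mapping_eqI) (simp add: lookup_functional_map curry_simps L_0)
next
  case (step c x y)
  then obtain p where p: "p \<in> I" "x = emb Inl p" by blast
  have "functional_map L (c * x) = 0"
  proof (rule poly_mapping_eqI)
    fix t
    have "lookup (curry_poly (c * x)) t = p * lookup (curry_poly c) t"
      by (simp add: p curry_simps curry_emb_Inl mult.commute[of _ "Const p"] lookup_Const_mult)
    then show "lookup (functional_map L (c * x)) t = lookup 0 t"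
      using LI[OF idl.subspace_scale[OF I p(1), of "lookup (curry_poly c) t"]]
      by (simp add: lookup_functional_map mult.commute)
  qed
  then show ?case using step by (simp add: functional_map_add)
qed

lemma eval_functional_map:
  "eval_poly w (functional_map L f) = L (insertion Const (case_sum Var (\<lambda>y. Const (w y))) f)"
proof -
  have Lsum: "L (sum h A) = (\<Sum>i\<in>A. L (h i))" for h :: "'i \<Rightarrow> _" and A
    by (induction A rule: infinite_finite_induct) (auto simp: L_0 L_add)
  let ?F = "curry_poly f"
  have "insertion Const (case_sum Var (\<lambda>y. Const (w y))) f = eval_poly (\<lambda>y. Const (w y)) ?F"
    by (rule ring_morphism_eqI[of _ "\<lambda>f. eval_poly (\<lambda>y. Const (w y)) (curry_poly f)"])
       (simp_all add: ring_morphism_insertion ring_morphism_comp[OF ring_morphism_eval ring_morphism_curry]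
          insertion_Const insertion_Var curry_Const curry_Var split: sum.split)
  also have "L \<dots> = (\<Sum>t\<in>keys ?F. L (lookup ?F t) * (\<Prod>y\<in>UNIV. w y ^ lookup t y))"
  proof -
    have "(\<Prod>y\<in>UNIV. Const (w y) ^ lookup t y) = (Const (\<Prod>y\<in>UNIV. w y ^ lookup t y) :: ('a, 'k) mpolynomial)" for t
      by (simp add: Const_power ring_morphism_prod[OF ring_morphism_Const])
    moreover have "L (x * Const c) = L x * c" for x c using L_scale[of c x] by (simp add: mult.commute)
    ultimately show ?thesis by (simp add: eval_poly_def Lsum)
  qed
  also have "\<dots> = eval_poly w (functional_map L f)"
    unfolding eval_poly_eq_insertion
    by (subst insertion_superset[of _ "keys ?F"]) (auto simp: lookup_functional_map in_keys_iff L_0)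
  finally show ?thesis by simp
qed

end

text \<open>
  Since \<open>S\<close> is free over the first polynomial ring, an extended ideal can be recognized on coefficients.
\<close>

lemma span_Inl_iff:
  assumes I: "idl.subspace I"
  shows "f \<in> idl.span (emb Inl ` I) \<longleftrightarrow> (\<forall>t. lookup (curry_poly f) t \<in> I)"
proof
  assume "f \<in> idl.span (emb Inl ` I)"
  then show "\<forall>t. lookup (curry_poly f) t \<in> I"
  proof (induction rule: idl.span_induct_alt)
    case base
    then show ?case by (simp add: curry_simps idl.subspace_0[OF I])
  next
    case (step c x y)
    then obtain p where p: "p \<in> I" "x = emb Inl p" by blast
    have "lookup (curry_poly (c * x)) t = lookup (curry_poly c) t * p" for t
      by (simp add: p curry_simps curry_emb_Inl mult.commute[of _ "Const p"] lookup_Const_mult)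
    then show ?case
      using step p by (simp add: curry_simps(3) lookup_add idl.subspace_add[OF I] idl.subspace_scale[OF I])
  qed
next
  assume *: "\<forall>t. lookup (curry_poly f) t \<in> I"
  have "f = (\<Sum>t\<in>keys (curry_poly f). emb Inl (lookup (curry_poly f) t) * emb Inr (single t 1))"
    unfolding uncurry_expand[symmetric] by (rule uncurry_curry[symmetric])
  also have "\<dots> \<in> idl.span (emb Inl ` I)"
    using * by (subst mult.commute) (intro idl.span_sum idl.span_scale idl.span_base, auto)
  finally show "f \<in> idl.span (emb Inl ` I)" .
qed

lemma linear_projection_exists:
  fixes I :: "('v, 'k::field) mpolynomial set"
  assumes I: "pv.subspace I"
  shows "\<exists>\<rho>. (\<forall>f g. \<rho> (f + g) = \<rho> f + \<rho> g) \<and> (\<forall>c f. \<rho> (Const c * f) = Const c * \<rho> f) \<and>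
    (\<forall>p\<in>I. \<rho> p = 0) \<and> (\<forall>p. p - \<rho> p \<in> I)"
proof -
  interpret vsp: vector_space_pair "\<lambda>(c::'k) (f::('v, 'k) mpolynomial). Const c * f" "\<lambda>(c::'k) (f::('v, 'k) mpolynomial). Const c * f"
    by standard
  have "Vector_Spaces.linear (\<lambda>(c::'k) (f::('v, 'k) mpolynomial). Const c * f) (\<lambda>(c::'k) (f::('v, 'k) mpolynomial). Const c * f) id"
    by (rule pv.linear_id)
  from vsp.linear_exists_left_inverse_on[OF this I]
  obtain g where g: "g ` UNIV \<subseteq> I" "\<forall>v\<in>I. g v = v"
    and lin: "Vector_Spaces.linear (\<lambda>(c::'k) (f::('v, 'k) mpolynomial). Const c * f) (\<lambda>(c::'k) (f::('v, 'k) mpolynomial). Const c * f) g"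
    by auto
  have add: "g (x + y) = g x + g y" and scale: "g (Const c * x) = Const c * g x" for x y c
    using lin by (simp_all add: vsp.linear_add vsp.linear_scale)
  show ?thesis
    by (rule exI[of _ "\<lambda>p. p - g p"]) (use g in \<open>auto simp: add scale right_diff_distrib\<close>)
qed

context
  fixes I :: "('a::finite, 'k::field) mpolynomial set" and J :: "('b::finite, 'k) mpolynomial set"
  assumes I: "idl.subspace I" and J: "idl.subspace J"
begin

text \<open>
  A linear projection \<open>\<rho>\<close> of \<open>K[X]\<close> along \<open>I\<close>, read off in coordinates, gives enough functionals on \<open>K[X] / I\<close>. An
  element whose images under all of them lie in \<open>J\<close> is in \<open>I S + J S\<close>: subtract the part in \<open>I S\<close> and
  collect the rest by the monomials of \<open>K[X]\<close>.
\<close>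

lemma tensor_ideal_functionals:
  obtains L :: "('a \<Rightarrow>\<^sub>0 nat) \<Rightarrow> ('a, 'k) mpolynomial \<Rightarrow> 'k"
  where "\<And>s f g. L s (f + g) = L s f + L s g" and "\<And>s c f. L s (Const c * f) = c * L s f"
    and "\<And>s p. p \<in> I \<Longrightarrow> L s p = 0"
    and "\<And>f. (\<And>s. functional_map (L s) f \<in> J) \<Longrightarrow> f \<in> idl.span (emb Inl ` I \<union> emb Inr ` J)"
proof -
  obtain \<rho> where \<rho>: "\<And>f g. \<rho> (f + g) = \<rho> f + \<rho> g" "\<And>c f. \<rho> (Const c * f) = Const c * \<rho> f"
    "\<And>p. p \<in> I \<Longrightarrow> \<rho> p = 0" "\<And>p. p - \<rho> p \<in> I"
    using linear_projection_exists[OF idl_subspace_pv[OF I]] by blast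
  define L where "L s p = lookup (\<rho> p) s" for s p
  have L1: "L s (f + g) = L s f + L s g" for s f g by (simp add: L_def \<rho> lookup_add)
  have L2: "L s (Const c * f) = c * L s f" for s c f by (simp add: L_def \<rho> lookup_Const_mult)
  have L3: "L s p = 0" if "p \<in> I" for s p using \<rho>(3)[OF that] by (simp add: L_def)
  have L4: "f \<in> idl.span (emb Inl ` I \<union> emb Inr ` J)" if f: "\<And>s. functional_map (L s) f \<in> J" for f
  proof -
    let ?F = "curry_poly f" and ?G = "emb Inl ` I \<union> emb Inr ` J"
    define A where "A = (\<Union>t\<in>keys ?F. keys (\<rho> (lookup ?F t)))"
    have A: "finite A" by (simp add: A_def)
    have 1: "emb Inr (functional_map (L s) f) = (\<Sum>t\<in>keys ?F. Const (lookup (\<rho> (lookup ?F t)) s) * emb Inr (single t 1))" for s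
    proof -
      have "functional_map (L s) f = (\<Sum>t\<in>keys ?F. Const (L s (lookup ?F t)) * single t 1)"
      proof (rule poly_mapping_eqI)
        fix t
        have "lookup (\<Sum>t\<in>keys ?F. Const (L s (lookup ?F t)) * single t 1) t =
            (\<Sum>t'\<in>keys ?F. if t' = t then L s (lookup ?F t) else 0)"
          unfolding lookup_sum by (intro sum.cong) (auto simp: lookup_Const_mult lookup_single)
        also have "\<dots> = L s (lookup ?F t)"
          using L3[of 0] idl.subspace_0[OF I] by (auto simp: in_keys_iff)
        finally show "lookup (functional_map (L s) f) t = lookup (\<Sum>t\<in>keys ?F. Const (L s (lookup ?F t)) * single t 1) t"
          by (simp add: lookup_functional_map[of "L s", OF L1 L2])
      qed
      then show ?thesis by (simp add: emb_sum L_def)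
    qed
    have 2: "p = (\<Sum>s\<in>A. Const (lookup p s) * single s 1)" if "keys p \<subseteq> A" for p :: "('a, 'k) mpolynomial"
    proof -
      have "(\<Sum>s\<in>A. Const (lookup p s) * single s 1) = (\<Sum>s\<in>A. single s (lookup p s))"
        by (simp add: Const_def mult_single)
      also have "\<dots> = (\<Sum>s\<in>keys p. single s (lookup p s))"
        using A that by (intro sum.mono_neutral_right) (auto simp: in_keys_iff)
      finally show ?thesis by (simp add: sum_of_terms)
    qed
    have "(\<Sum>s\<in>A. emb Inl (single s 1) * emb Inr (functional_map (L s) f)) \<in> idl.span ?G"
      using f by (intro idl.span_sum idl.span_scale idl.span_base) auto
    also have "(\<Sum>s\<in>A. emb Inl (single s 1) * emb Inr (functional_map (L s) f)) =
        (\<Sum>t\<in>keys ?F. \<Sum>s\<in>A. emb Inl (Const (lookup (\<rho> (lookup ?F t)) s) * single s 1) * emb Inr (single t 1))"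
      unfolding 1 by (subst sum.swap) (simp add: sum_distrib_left mult_ac)
    also have "\<dots> = (\<Sum>t\<in>keys ?F. emb Inl (\<rho> (lookup ?F t)) * emb Inr (single t 1))"
    proof (rule sum.cong[OF refl])
      fix t assume "t \<in> keys ?F"
      then have "keys (\<rho> (lookup ?F t)) \<subseteq> A" by (auto simp: A_def)
      from arg_cong[OF 2[OF this], of "emb Inl :: _ \<Rightarrow> ('a + 'b, 'k) mpolynomial"]
      show "(\<Sum>s\<in>A. emb Inl (Const (lookup (\<rho> (lookup ?F t)) s) * single s 1) * emb Inr (single t 1)) =
         emb Inl (\<rho> (lookup ?F t)) * emb Inr (single t 1)"
        by (simp only: emb_sum sum_distrib_right[symmetric])
    qed
    finally have 3: "(\<Sum>t\<in>keys ?F. emb Inl (\<rho> (lookup ?F t)) * emb Inr (single t 1)) \<in> idl.span ?G" .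
    have "(\<Sum>t\<in>keys ?F. emb Inr (single t 1) * emb Inl (lookup ?F t - \<rho> (lookup ?F t))) \<in> idl.span ?G"
      using \<rho>(4) by (intro idl.span_sum idl.span_scale idl.span_base) auto
    from idl.span_add[OF this 3]
    have "(\<Sum>t\<in>keys ?F. emb Inl (lookup ?F t) * emb Inr (single t 1)) \<in> idl.span ?G"
      by (simp add: emb_diff right_diff_distrib sum_subtractf mult.commute)
    then show ?thesis by (simp only: uncurry_expand[symmetric] uncurry_curry)
  qed
  show thesis by (rule that[of L, OF L1 L2 L3 L4])
qed

text \<open>
  The maps \<open>L s \<otimes> id\<close> are linear over \<open>K[Y]\<close> and together detect membership in \<open>I S + J S\<close>, so the cancellation of
  \<open>g\<close> may be done in \<open>K[Y]\<close> after applying them.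
\<close>

lemma nonzerodivisor_Inr:
  assumes g: "\<And>h. h * g \<in> J \<Longrightarrow> h \<in> J" and f: "f * emb Inr g \<in> idl.span (emb Inl ` I \<union> emb Inr ` J)"
  shows "f \<in> idl.span (emb Inl ` I \<union> emb Inr ` J)"
proof -
  obtain L :: "('a \<Rightarrow>\<^sub>0 nat) \<Rightarrow> ('a, 'k) mpolynomial \<Rightarrow> 'k"
  where L1: "\<And>s f g. L s (f + g) = L s f + L s g" and L2: "\<And>s c f. L s (Const c * f) = c * L s f"
    and L3: "\<And>s p. p \<in> I \<Longrightarrow> L s p = 0"
    and L4: "\<And>f. (\<And>s. functional_map (L s) f \<in> J) \<Longrightarrow> f \<in> idl.span (emb Inl ` I \<union> emb Inr ` J)"
    by (rule tensor_ideal_functionals) blast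
  obtain x y where xy: "f * emb Inr g = x + y" "x \<in> idl.span (emb Inl ` I)" "y \<in> idl.span (emb Inr ` J)"
    using f unfolding idl.span_Un by auto
  show ?thesis
  proof (rule L4, rule g)
    fix s
    note add = functional_map_add[of "L s", OF L1 L2] and mult = functional_map_mult_Inr[of "L s", OF L1 L2]
    have "functional_map (L s) y \<in> J"
      using xy(3)
    proof (induction rule: idl.span_induct_alt)
      case base
      have "functional_map (L s) (0 :: ('a + 'b, 'k) mpolynomial) = 0" using add[of 0 0] by simp
      then show ?case by (simp add: idl.subspace_0[OF J])
    next
      case (step c z y)
      then obtain h where h: "h \<in> J" "z = emb Inr h" by blast
      show ?case unfolding add h mult by (intro idl.subspace_add[OF J] idl.subspace_scale[OF J] h step)
    qed
    moreover have "functional_map (L s) x = 0"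
      by (rule functional_map_ideal[of "L s", OF L1 L2 I L3 xy(2)])
    ultimately show "functional_map (L s) f * g \<in> J"
      unfolding mult[symmetric] xy(1) add by simp
  qed
qed

end

lemma nonzerodivisor_Inl:
  assumes I: "idl.subspace I" and g: "\<And>h. h * g \<in> I \<Longrightarrow> h \<in> I" and f: "f * emb Inl g \<in> idl.span (emb Inl ` I)"
  shows "f \<in> idl.span (emb Inl ` I)"
  unfolding span_Inl_iff[OF I]
proof
  fix t
  have "lookup (curry_poly (f * emb Inl g)) t \<in> I" using f span_Inl_iff[OF I] by blast
  also have "lookup (curry_poly (f * emb Inl g)) t = lookup (curry_poly f) t * g"
    by (simp add: curry_simps curry_emb_Inl mult.commute[of _ "Const g"] lookup_Const_mult)
  finally show "lookup (curry_poly f) t \<in> I" by (rule g)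
qed


section \<open>Points and their vanishing ideals\<close>

text \<open>
  The vector of homogeneous coordinates is a function, so that it can be used for evaluation
  directly.
\<close>

definition represents :: "('v::finite \<Rightarrow> 'k::field) \<Rightarrow> ('k, 'v) vec set \<Rightarrow> bool" where
  "represents u P \<longleftrightarrow> (\<exists>x. u x \<noteq> 0) \<and> (\<forall>v. v \<in> P \<longleftrightarrow> (\<exists>c. c \<noteq> 0 \<and> (\<forall>x. v $ x = c * u x)))"

lemma represents_exists:
  assumes "P \<in> projective_space"
  shows "\<exists>u. represents u P"
proof -
  obtain v where v: "v \<noteq> 0" "P = {(v, w). v \<noteq> 0 \<and> (\<exists>c. c \<noteq> 0 \<and> w = c *s v)} `` {v}"
    using assms unfolding projective_space_def by (auto elim!: quotientE)
  then have "w \<in> P \<longleftrightarrow> (\<exists>c. c \<noteq> 0 \<and> (\<forall>x. w $ x = c * v $ x))" for w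
    by (auto simp: vec_eq_iff)
  moreover have "\<exists>x. v $ x \<noteq> 0" using v(1) by (auto simp: vec_eq_iff)
  ultimately show ?thesis unfolding represents_def by (intro exI[of _ "($) v"]) simp
qed

lemma represents_unique: "represents u P \<Longrightarrow> represents u P' \<Longrightarrow> P = P'"
  unfolding represents_def by blast

lemma represents_scale:
  assumes "represents u P" "a \<noteq> 0"
  shows "represents (\<lambda>x. a * u x) P"
proof -
  have "(\<exists>c. c \<noteq> 0 \<and> (\<forall>x. v $ x = c * u x)) \<longleftrightarrow> (\<exists>c. c \<noteq> 0 \<and> (\<forall>x. v $ x = c * (a * u x)))" for v :: "('b, 'a) vec"
  proof
    assume "\<exists>c. c \<noteq> 0 \<and> (\<forall>x. v $ x = c * u x)"
    then obtain c where "c \<noteq> 0" "\<forall>x. v $ x = c * u x" by blast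
    then show "\<exists>c. c \<noteq> 0 \<and> (\<forall>x. v $ x = c * (a * u x))"
      using assms(2) by (intro exI[of _ "c / a"]) auto
  next
    assume "\<exists>c. c \<noteq> 0 \<and> (\<forall>x. v $ x = c * (a * u x))"
    then obtain c where "c \<noteq> 0" "\<forall>x. v $ x = c * (a * u x)" by blast
    then show "\<exists>c. c \<noteq> 0 \<and> (\<forall>x. v $ x = c * u x)"
      using assms(2) by (intro exI[of _ "c * a"]) (auto simp: mult.assoc)
  qed
  then show ?thesis using assms unfolding represents_def by auto
qed

lemma represents_ball:
  assumes "represents u P"
  shows "(\<forall>v\<in>P. \<phi> (($) v)) \<longleftrightarrow> (\<forall>c. c \<noteq> 0 \<longrightarrow> \<phi> (\<lambda>x. c * u x))"
proof
  assume *: "\<forall>v\<in>P. \<phi> (($) v)"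
  show "\<forall>c. c \<noteq> 0 \<longrightarrow> \<phi> (\<lambda>x. c * u x)"
  proof (intro allI impI)
    fix c :: 'b assume "c \<noteq> 0"
    then have "(\<chi> x. c * u x) \<in> P" using assms unfolding represents_def by auto
    with * have "\<phi> (($) (\<chi> x. c * u x))" by blast
    moreover have "($) (\<chi> x. c * u x) = (\<lambda>x. c * u x)" by (rule ext) simp
    ultimately show "\<phi> (\<lambda>x. c * u x)" by simp
  qed
next
  assume *: "\<forall>c. c \<noteq> 0 \<longrightarrow> \<phi> (\<lambda>x. c * u x)"
  show "\<forall>v\<in>P. \<phi> (($) v)"
  proof
    fix v assume "v \<in> P"
    then obtain c where "c \<noteq> 0" "\<And>x. v $ x = c * u x" using assms unfolding represents_def by blast
    moreover from this have "($) v = (\<lambda>x. c * u x)" by (intro ext) simp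
    ultimately show "\<phi> (($) v)" using * by simp
  qed
qed

lemma linear_form_separates:
  fixes u u' :: "'v::finite \<Rightarrow> 'k::field"
  assumes "represents u P" "represents u' P'" "P \<noteq> P'"
  shows "\<exists>l\<in>hom_part 1. eval_poly u l \<noteq> 0 \<and> eval_poly u' l = 0"
proof -
  have "\<exists>x y. u x * u' y \<noteq> u y * u' x"
  proof (rule ccontr)
    assume "\<not> ?thesis"
    then have *: "u x * u' y = u y * u' x" for x y by blast
    obtain y where y: "u' y \<noteq> 0" using assms(2) by (auto simp: represents_def)
    have ux: "u x = (u y / u' y) * u' x" for x
    proof -
      have "(u y / u' y) * u' x = (u y * u' x) / u' y" by simp
      also have "\<dots> = u x" unfolding *[of x y, symmetric] using y by simp
      finally show ?thesis by (rule sym)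
    qed
    obtain x where "u x \<noteq> 0" using assms(1) by (auto simp: represents_def)
    then have "u y / u' y \<noteq> 0" using ux[of x] by (metis mult_zero_left)
    then have "represents (\<lambda>x. (u y / u' y) * u' x) P'" by (rule represents_scale[OF assms(2)])
    moreover have "(\<lambda>x. (u y / u' y) * u' x) = u" by (rule ext, rule ux[symmetric])
    ultimately have "represents u P'" by (simp only:)
    from represents_unique[OF assms(1) this] assms(3) show False by (rule notE[rotated])
  qed
  then obtain x y where xy: "u x * u' y \<noteq> u y * u' x" by blast
  have "Const (u' y) * Var x - Const (u' x) * Var y \<in> hom_part 1"
    using part_Var[of x "\<lambda>_. 1"] part_Var[of y "\<lambda>_. 1"]
    unfolding hom_part_eq by (intro part_diff part_Const_mult) auto
  then show ?thesis
    using xy by (intro bexI[of _ "Const (u' y) * Var x - Const (u' x) * Var y"]) (auto simp: mult.commute)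
qed

text \<open>
  The vanishing ideal is homogeneous because the field is infinite, so the forms in it generate it.
\<close>

lemma proj_vanishing_ideal_eq:
  fixes Z :: "('k::field_char_0, 'v::finite) vec set set"
  assumes u: "\<forall>P\<in>Z. represents (u P) P"
  shows "proj_vanishing_ideal Z = vanishing (u ` Z)"
proof -
  let ?G = "{f. (\<exists>d. f \<in> hom_part d) \<and> (\<forall>P\<in>Z. \<forall>v\<in>P. eval_poly (($) v) f = 0)}"
  have iff: "(\<forall>P\<in>Z. \<forall>v\<in>P. eval_poly (($) v) f = 0) \<longleftrightarrow> f \<in> vanishing (u ` Z)" for f
  proof -
    have "(\<forall>v\<in>P. eval_poly (($) v) f = 0) \<longleftrightarrow> (\<forall>c. c \<noteq> 0 \<longrightarrow> eval_poly (\<lambda>x. c * u P x) f = 0)" if "P \<in> Z" for P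
      using u that by (intro represents_ball[of "u P" P "\<lambda>a. eval_poly a f = 0"]) blast
    then show ?thesis by (simp add: vanishing_def)
  qed
  have G: "?G = {f \<in> vanishing (u ` Z). \<exists>d. f \<in> hom_part d}" unfolding iff by blast
  show ?thesis
    unfolding proj_vanishing_ideal_def genideal_poly_ring G
  proof
    show "idl.span {f \<in> vanishing (u ` Z). \<exists>d. f \<in> hom_part d} \<subseteq> vanishing (u ` Z)"
      by (rule idl.span_minimal[OF _ subspace_vanishing]) blast
    show "vanishing (u ` Z) \<subseteq> idl.span {f \<in> vanishing (u ` Z). \<exists>d. f \<in> hom_part d}"
    proof
      fix f assume f: "f \<in> vanishing (u ` Z)"
      have "component (\<lambda>_. 1) d f \<in> idl.span {f \<in> vanishing (u ` Z). \<exists>d. f \<in> hom_part d}" for d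
        using vanishing_component[OF f, of d] component_in_part[of "\<lambda>_. 1" d f] unfolding hom_part_eq by (intro idl.span_base) blast
      then have "(\<Sum>d\<in>wdeg (\<lambda>_. 1) ` keys f. component (\<lambda>_. 1) d f) \<in> idl.span {f \<in> vanishing (u ` Z). \<exists>d. f \<in> hom_part d}"
        by (intro idl.span_sum)
      then show "f \<in> idl.span {f \<in> vanishing (u ` Z). \<exists>d. f \<in> hom_part d}" by (simp add: sum_components)
    qed
  qed
qed

text \<open>
  The two factors are scaled independently, which makes this ideal bihomogeneous over an infinite field.
\<close>

definition bivanishing :: "(('a::finite \<Rightarrow> 'k::field) \<times> ('b::finite \<Rightarrow> 'k)) set \<Rightarrow> ('a + 'b, 'k) mpolynomial set" where
  "bivanishing W = {f. \<forall>(v, w)\<in>W. \<forall>c c'. c \<noteq> 0 \<longrightarrow> c' \<noteq> 0 \<longrightarrow>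
     eval_poly (case_sum (\<lambda>x. c * v x) (\<lambda>y. c' * w y)) f = 0}"

lemma bivanishingD:
  "f \<in> bivanishing W \<Longrightarrow> (v, w) \<in> W \<Longrightarrow> c \<noteq> 0 \<Longrightarrow> c' \<noteq> 0 \<Longrightarrow>
    eval_poly (case_sum (\<lambda>x. c * v x) (\<lambda>y. c' * w y)) f = 0"
  unfolding bivanishing_def by blast

lemma bivanishingI:
  "(\<And>v w c c'. (v, w) \<in> W \<Longrightarrow> c \<noteq> 0 \<Longrightarrow> c' \<noteq> 0 \<Longrightarrow>
    eval_poly (case_sum (\<lambda>x. c * v x) (\<lambda>y. c' * w y)) f = 0) \<Longrightarrow> f \<in> bivanishing W"
  unfolding bivanishing_def by blast

lemma subspace_bivanishing: "idl.subspace (bivanishing W)"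
  by (rule idl.subspaceI; rule bivanishingI) (simp_all add: bivanishingD)

lemma bivanishing_component_X:
  fixes f :: "('a::finite + 'b::finite, 'k::field_char_0) mpolynomial"
  assumes f: "f \<in> bivanishing W"
  shows "component wX i f \<in> bivanishing W"
proof (rule bivanishingI)
  fix v w and c c' :: 'k assume vw: "(v, w) \<in> W" and c: "c \<noteq> 0" "c' \<noteq> 0"
  show "eval_poly (case_sum (\<lambda>x. c * v x) (\<lambda>y. c' * w y)) (component wX i f) = 0"
  proof (rule eval_component_eq_0)
    fix d :: 'k assume "d \<noteq> 0"
    have "(\<lambda>z. d ^ wX z * case_sum (\<lambda>x. c * v x) (\<lambda>y. c' * w y) z) = case_sum (\<lambda>x. (d * c) * v x) (\<lambda>y. c' * w y)"
      by (rule ext) (simp split: sum.split add: mult.assoc)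
    then show "eval_poly (\<lambda>z. d ^ wX z * case_sum (\<lambda>x. c * v x) (\<lambda>y. c' * w y) z) f = 0"
      using bivanishingD[OF f vw, of "d * c" c'] c \<open>d \<noteq> 0\<close> by simp
  qed
qed

lemma bivanishing_component_Y:
  fixes f :: "('a::finite + 'b::finite, 'k::field_char_0) mpolynomial"
  assumes f: "f \<in> bivanishing W"
  shows "component wY i f \<in> bivanishing W"
proof (rule bivanishingI)
  fix v w and c c' :: 'k assume vw: "(v, w) \<in> W" and c: "c \<noteq> 0" "c' \<noteq> 0"
  show "eval_poly (case_sum (\<lambda>x. c * v x) (\<lambda>y. c' * w y)) (component wY i f) = 0"
  proof (rule eval_component_eq_0)
    fix d :: 'k assume "d \<noteq> 0"
    have "(\<lambda>z. d ^ wY z * case_sum (\<lambda>x. c * v x) (\<lambda>y. c' * w y) z) = case_sum (\<lambda>x. c * v x) (\<lambda>y. (d * c') * w y)"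
      by (rule ext) (simp split: sum.split add: mult.assoc)
    then show "eval_poly (\<lambda>z. d ^ wY z * case_sum (\<lambda>x. c * v x) (\<lambda>y. c' * w y) z) f = 0"
      using bivanishingD[OF f vw, of c "d * c'"] c \<open>d \<noteq> 0\<close> by simp
  qed
qed

lemma eval_scaled_bihom:
  fixes f :: "('a::finite + 'b::finite, 'k::comm_ring_1) mpolynomial"
  assumes f: "f \<in> bihom_part i j"
  shows "eval_poly (case_sum (\<lambda>x. c * v x) (\<lambda>y. c' * w y)) f = c ^ i * c' ^ j * eval_poly (case_sum v w) f"
proof -
  have "case_sum (\<lambda>x. c * v x) (\<lambda>y. c' * w y) = (\<lambda>z. c ^ wX z * (c' ^ wY z * case_sum v w z))"
    by (rule ext) (simp split: sum.split)
  then have "eval_poly (case_sum (\<lambda>x. c * v x) (\<lambda>y. c' * w y)) f = c ^ i * eval_poly (\<lambda>z. c' ^ wY z * case_sum v w z) f"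
    using f eval_scaled_part[of f wX i c "\<lambda>z. c' ^ wY z * case_sum v w z"] by (simp add: bihom_part_eq)
  also have "eval_poly (\<lambda>z. c' ^ wY z * case_sum v w z) f = c' ^ j * eval_poly (case_sum v w) f"
    using f unfolding bihom_part_eq by (intro eval_scaled_part) blast
  finally show ?thesis by (simp add: mult.assoc)
qed

definition eval_pair :: "('a::finite \<Rightarrow> 'k::comm_ring_1) \<times> ('b::finite \<Rightarrow> 'k) \<Rightarrow> ('a + 'b, 'k) mpolynomial \<Rightarrow> 'k" where
  "eval_pair p = eval_poly (case_sum (fst p) (snd p))"

lemma eval_pair_simps [simp]:
  "eval_pair p (f + g) = eval_pair p f + eval_pair p g" "eval_pair p (f * g) = eval_pair p f * eval_pair p g"
  "eval_pair p (f - g) = eval_pair p f - eval_pair p g"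
  "eval_pair p (Const c) = c" "eval_pair p 0 = 0" "eval_pair p 1 = 1"
  "eval_pair p (sum h A) = (\<Sum>i\<in>A. eval_pair p (h i))"
  "eval_pair p (emb Inl f') = eval_poly (fst p) f'" "eval_pair p (emb Inr g') = eval_poly (snd p) g'"
  by (simp_all add: eval_pair_def eval_emb)

lemma bivanishing_bihom_iff:
  fixes f :: "('a::finite + 'b::finite, 'k::field) mpolynomial"
  assumes f: "f \<in> bihom_part i j"
  shows "f \<in> bivanishing W \<longleftrightarrow> (\<forall>p\<in>W. eval_pair p f = 0)"
proof
  assume *: "f \<in> bivanishing W"
  show "\<forall>p\<in>W. eval_pair p f = 0"
  proof
    fix p assume "p \<in> W"
    then have "(fst p, snd p) \<in> W" by simp
    from bivanishingD[OF * this, of 1 1] show "eval_pair p f = 0" by (simp add: eval_pair_def)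
  qed
next
  assume *: "\<forall>p\<in>W. eval_pair p f = 0"
  show "f \<in> bivanishing W"
  proof (rule bivanishingI)
    fix v w and c c' :: 'k assume "(v, w) \<in> W"
    with * have "eval_pair (v, w) f = 0" by blast
    then show "eval_poly (case_sum (\<lambda>x. c * v x) (\<lambda>y. c' * w y)) f = 0"
      by (simp add: eval_scaled_bihom[OF f] eval_pair_def)
  qed
qed

lemma bicomponent_in_bihom: "component wX i (component wY j f) \<in> bihom_part i j"
  for f :: "('a::finite + 'b::finite, 'k::comm_semiring_1) mpolynomial"
  by (simp add: bihom_part_eq component_in_part component_other_part)

lemma sum_bicomponents:
  fixes f :: "('a::finite + 'b::finite, 'k::comm_semiring_1) mpolynomial"
  assumes "finite D" "finite E" "wdeg wX ` keys f \<subseteq> D" "wdeg wY ` keys f \<subseteq> E"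
  shows "(\<Sum>i\<in>D. \<Sum>j\<in>E. component wX i (component wY j f)) = f"
  using sum_components[OF assms(2,4)] sum_components[OF assms(1,3)]
  by (simp flip: component_sum)

lemma ball_pair_cong:
  "(\<And>P Q. (P, Q) \<in> X \<Longrightarrow> A P Q \<longleftrightarrow> B P Q) \<Longrightarrow> (\<forall>(P, Q)\<in>X. A P Q) \<longleftrightarrow> (\<forall>(P, Q)\<in>X. B P Q)"
  by auto

lemma bi_vanishing_ideal_eq:
  fixes X :: "('k::field_char_0, 'a::finite, 'b::finite) bipoint set"
  assumes u: "\<forall>(P, Q)\<in>X. represents (u P) P \<and> represents (u' Q) Q"
  shows "bi_vanishing_ideal X = bivanishing ((\<lambda>(P, Q). (u P, u' Q)) ` X)"
proof -
  let ?W = "(\<lambda>(P, Q). (u P, u' Q)) ` X"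
  let ?G = "{f. (\<exists>i j. f \<in> bihom_part i j) \<and> (\<forall>(P, Q)\<in>X. \<forall>v\<in>P. \<forall>w\<in>Q. eval_poly (case_sum (($) v) (($) w)) f = 0)}"
  have iff: "(\<forall>(P, Q)\<in>X. \<forall>v\<in>P. \<forall>w\<in>Q. eval_poly (case_sum (($) v) (($) w)) f = 0) \<longleftrightarrow> f \<in> bivanishing ?W" for f
  proof -
    have "(\<forall>v\<in>P. \<forall>w\<in>Q. eval_poly (case_sum (($) v) (($) w)) f = 0) \<longleftrightarrow>
        (\<forall>c c'. c \<noteq> 0 \<longrightarrow> c' \<noteq> 0 \<longrightarrow> eval_poly (case_sum (\<lambda>x. c * u P x) (\<lambda>y. c' * u' Q y)) f = 0)"
      if "(P, Q) \<in> X" for P Q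
    proof -
      have rP: "represents (u P) P" and rQ: "represents (u' Q) Q" using u that by auto
      have "(\<forall>v\<in>P. \<forall>w\<in>Q. eval_poly (case_sum (($) v) (($) w)) f = 0) \<longleftrightarrow>
          (\<forall>v\<in>P. \<forall>c'. c' \<noteq> 0 \<longrightarrow> eval_poly (case_sum (($) v) (\<lambda>y. c' * u' Q y)) f = 0)"
        using represents_ball[OF rQ, of "\<lambda>b. eval_poly (case_sum (($) _) b) f = 0"] by simp
      also have "\<dots> \<longleftrightarrow> (\<forall>c. c \<noteq> 0 \<longrightarrow> (\<forall>c'. c' \<noteq> 0 \<longrightarrow> eval_poly (case_sum (\<lambda>x. c * u P x) (\<lambda>y. c' * u' Q y)) f = 0))"
        by (rule represents_ball[OF rP, of "\<lambda>a. \<forall>c'. c' \<noteq> 0 \<longrightarrow> eval_poly (case_sum a (\<lambda>y. c' * u' Q y)) f = 0"])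
      finally show ?thesis by blast
    qed
    then have "(\<forall>(P, Q)\<in>X. \<forall>v\<in>P. \<forall>w\<in>Q. eval_poly (case_sum (($) v) (($) w)) f = 0) \<longleftrightarrow>
        (\<forall>(P, Q)\<in>X. \<forall>c c'. c \<noteq> 0 \<longrightarrow> c' \<noteq> 0 \<longrightarrow> eval_poly (case_sum (\<lambda>x. c * u P x) (\<lambda>y. c' * u' Q y)) f = 0)"
      by (rule ball_pair_cong)
    also have "\<dots> \<longleftrightarrow> f \<in> bivanishing ?W"
      by (simp add: bivanishing_def split_beta)
    finally show ?thesis .
  qed
  have G: "?G = {f \<in> bivanishing ?W. \<exists>i j. f \<in> bihom_part i j}" unfolding iff by blast
  show ?thesis
    unfolding bi_vanishing_ideal_def genideal_poly_ring G
  proof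
    show "idl.span {f \<in> bivanishing ?W. \<exists>i j. f \<in> bihom_part i j} \<subseteq> bivanishing ?W"
      by (rule idl.span_minimal[OF _ subspace_bivanishing]) blast
    show "bivanishing ?W \<subseteq> idl.span {f \<in> bivanishing ?W. \<exists>i j. f \<in> bihom_part i j}"
    proof
      fix f assume f: "f \<in> bivanishing ?W"
      have "component wX i (component wY j f) \<in> idl.span {f \<in> bivanishing ?W. \<exists>i j. f \<in> bihom_part i j}" for i j
        using bivanishing_component_X[OF bivanishing_component_Y[OF f]] bicomponent_in_bihom
        by (intro idl.span_base) blast
      then have "(\<Sum>i\<in>wdeg wX ` keys f. \<Sum>j\<in>wdeg wY ` keys f. component wX i (component wY j f))
          \<in> idl.span {f \<in> bivanishing ?W. \<exists>i j. f \<in> bihom_part i j}"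
        by (intro idl.span_sum)
      then show "f \<in> idl.span {f \<in> bivanishing ?W. \<exists>i j. f \<in> bihom_part i j}"
        by (simp only: sum_bicomponents[OF finite_imageI[OF finite_keys] finite_imageI[OF finite_keys] order_refl order_refl])
    qed
  qed
qed

text \<open>
  Let \<open>f\<close> vanish on the product. For every functional \<open>L\<close> on \<open>K[X]\<close> that kills the ideal of \<open>V1\<close>, the polynomial \<open>(L \<otimes> id) f\<close>
  vanishes on \<open>V2\<close>, because specializing \<open>Y\<close> to a point of \<open>V2\<close> leaves an element of the ideal of \<open>V1\<close>.
\<close>

lemma bivanishing_product:
  fixes V1 :: "('a::finite \<Rightarrow> 'k::field) set" and V2 :: "('b::finite \<Rightarrow> 'k) set"
  shows "bivanishing (V1 \<times> V2) = idl.span (emb Inl ` vanishing V1 \<union> emb Inr ` vanishing V2)"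
proof
  show "idl.span (emb Inl ` vanishing V1 \<union> emb Inr ` vanishing V2) \<subseteq> bivanishing (V1 \<times> V2)"
  proof (rule idl.span_minimal[OF _ subspace_bivanishing], rule subsetI)
    fix f assume "f \<in> emb Inl ` vanishing V1 \<union> (emb Inr ` vanishing V2 :: ('a + 'b, 'k) mpolynomial set)"
    then show "f \<in> bivanishing (V1 \<times> V2)"
      by (intro bivanishingI) (auto simp: eval_emb vanishing_def)
  qed
  show "bivanishing (V1 \<times> V2) \<subseteq> idl.span (emb Inl ` vanishing V1 \<union> emb Inr ` vanishing V2)"
  proof
    fix f assume f: "f \<in> bivanishing (V1 \<times> V2)"
    obtain L :: "('a \<Rightarrow>\<^sub>0 nat) \<Rightarrow> ('a, 'k) mpolynomial \<Rightarrow> 'k"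
      where L1: "\<And>s f g. L s (f + g) = L s f + L s g" and L2: "\<And>s c f. L s (Const c * f) = c * L s f"
        and L3: "\<And>s p. p \<in> vanishing V1 \<Longrightarrow> L s p = 0"
        and L4: "\<And>f. (\<And>s. functional_map (L s) f \<in> vanishing V2) \<Longrightarrow>
          f \<in> idl.span (emb Inl ` vanishing V1 \<union> emb Inr ` vanishing V2)"
      by (rule tensor_ideal_functionals[OF subspace_vanishing[of V1] subspace_vanishing[of V2]]) blast
    show "f \<in> idl.span (emb Inl ` vanishing V1 \<union> emb Inr ` vanishing V2)"
    proof (rule L4)
      fix s
      show "functional_map (L s) f \<in> vanishing V2"
        unfolding vanishing_def
      proof (intro CollectI ballI allI impI)
        fix w and c' :: 'k assume w: "w \<in> V2" "c' \<noteq> 0"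
        let ?h = "insertion Const (case_sum Var (\<lambda>y. Const (c' * w y))) f"
        have "?h \<in> vanishing V1"
          unfolding vanishing_def
        proof (intro CollectI ballI allI impI)
          fix v and c :: 'k assume v: "v \<in> V1" "c \<noteq> 0"
          have "(\<lambda>z. eval_poly (\<lambda>x. c * v x) (case_sum Var (\<lambda>y. Const (c' * w y)) z)) =
              case_sum (\<lambda>x. c * v x) (\<lambda>y. c' * w y)"
            by (rule ext) (simp split: sum.split)
          then show "eval_poly (\<lambda>x. c * v x) ?h = 0"
            using bivanishingD[OF f, of v w c c'] v w by (simp add: eval_insertion_Const)
        qed
        then show "eval_poly (\<lambda>y. c' * w y) (functional_map (L s) f) = 0"
          by (simp add: eval_functional_map[of "L s", OF L1 L2] L3)
      qed
    qed
  qed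
qed


section \<open>Hilbert functions and separators\<close>

definition biseparator ::
  "(('a::finite \<Rightarrow> 'k::field) \<times> ('b::finite \<Rightarrow> 'k)) set \<Rightarrow> ('a \<Rightarrow> 'k) \<times> ('b \<Rightarrow> 'k) \<Rightarrow> nat \<Rightarrow> nat \<Rightarrow> ('a + 'b, 'k) mpolynomial \<Rightarrow> bool" where
  "biseparator W p i j g \<longleftrightarrow> g \<in> bihom_part i j \<and> eval_pair p g = 1 \<and> (\<forall>q\<in>W - {p}. eval_pair q g = 0)"

lemma pv_subspace_bihom: "pv.subspace (bihom_part i j :: ('a::finite + 'b::finite, 'k::field) mpolynomial set)"
  by (simp add: bihom_part_eq pv.subspace_inter pv_subspace_part)

lemma bivanishing_proper:
  fixes W :: "(('b::finite \<Rightarrow> 'a::field) \<times> ('c::finite \<Rightarrow> 'a)) set"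
  shows "W \<noteq> {} \<Longrightarrow> bivanishing W \<noteq> UNIV"
proof
  assume "W \<noteq> {}" "bivanishing W = UNIV"
  then obtain p where "p \<in> W" by blast
  moreover have "1 \<in> bivanishing W" using \<open>bivanishing W = UNIV\<close> by blast
  moreover have "(1 :: ('b + 'c, 'a) mpolynomial) \<in> bihom_part 0 0" by (simp add: bihom_part_eq)
  ultimately have "eval_pair p (1 :: ('b + 'c, 'a) mpolynomial) = 0"
    using bivanishing_bihom_iff[of 1 0 0 W] by blast
  then show False by simp
qed

lemma vanishing_proper:
  fixes V :: "('b::finite \<Rightarrow> 'a::field) set"
  shows "V \<noteq> {} \<Longrightarrow> vanishing V \<noteq> UNIV"
proof
  assume "V \<noteq> {}" "vanishing V = UNIV"
  then obtain p where "p \<in> V" by blast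
  moreover have "1 \<in> vanishing V" using \<open>vanishing V = UNIV\<close> by blast
  ultimately have "eval_poly p (1 :: ('b, 'a) mpolynomial) = 0"
    using vanishing_hom_iff[of 1 0 V] by (simp add: hom_part_eq)
  then show False by simp
qed

text \<open>
  Start from dual points \<open>Q\<close> for \<open>W - {p}\<close>. A separator of \<open>p\<close> extends their dual basis by one element; without a
  separator, a form that vanishes on \<open>W - {p}\<close> also vanishes at \<open>p\<close>, so that \<open>Q\<close> is already enough for \<open>W\<close>.
\<close>

lemma piece_dim_delete:
  fixes W :: "(('a::finite \<Rightarrow> 'k::field) \<times> ('b::finite \<Rightarrow> 'k)) set"
  assumes W: "finite W" "p \<in> W" "W - {p} \<noteq> {}"
  shows "piece_dim (bivanishing W) (carrier (poly_ring Quot bivanishing W)) (bihom_part i j) =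
    piece_dim (bivanishing (W - {p})) (carrier (poly_ring Quot bivanishing (W - {p}))) (bihom_part i j) +
    (if \<exists>g. biseparator W p i j g then 1 else 0)"
proof -
  let ?U = "bihom_part i j :: ('a + 'b, 'k) mpolynomial set"
  have proper: "bivanishing W \<noteq> UNIV" "bivanishing (W - {p}) \<noteq> UNIV"
    using W by (auto intro!: bivanishing_proper simp del: Diff_eq_empty_iff)
  have carr: "carrier (poly_ring Quot bivanishing W') \<inter> residue (bivanishing W') ` ?U = residue (bivanishing W') ` ?U"
    for W' :: "(('a \<Rightarrow> 'k) \<times> ('b \<Rightarrow> 'k)) set"
    unfolding carrier_Quot[OF subspace_bivanishing] by blast
  obtain Q b where Q: "Q \<subseteq> W - {p}" and b: "\<forall>q\<in>Q. b q \<in> ?U"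
    and dual: "\<forall>q\<in>Q. \<forall>q'\<in>Q. eval_pair q' (b q) = (if q = q' then 1 else 0)"
    and ex: "\<forall>f\<in>?U. \<forall>z\<in>W - {p}. eval_pair z f = (\<Sum>q\<in>Q. eval_pair q f * eval_pair z (b q))"
    using dual_points[of "W - {p}" ?U eval_pair, OF _ pv_subspace_bihom] W(1) by auto
  have finQ: "finite Q" using Q W(1) finite_subset by blast
  have small: "piece_dim (bivanishing (W - {p})) (carrier (poly_ring Quot bivanishing (W - {p}))) ?U = card Q"
  proof (rule piece_dim_eq_card[of _ ?U _ _ eval_pair Q b])
    fix f assume f: "f \<in> ?U"
    show "f \<in> bivanishing (W - {p}) \<longleftrightarrow> (\<forall>q\<in>Q. eval_pair q f = 0)"
      unfolding bivanishing_bihom_iff[OF f] using ex f Q by fastforce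
  qed (use b dual finQ W in \<open>auto simp: subspace_bivanishing proper pv_subspace_bihom carr\<close>)
  show ?thesis
  proof (cases "\<exists>g. biseparator W p i j g")
    case True
    then obtain g where g: "g \<in> ?U" "eval_pair p g = 1" "\<And>q. q \<in> W - {p} \<Longrightarrow> eval_pair q g = 0"
      by (auto simp: biseparator_def)
    define b' where "b' q = (if q = p then g else b q - Const (eval_pair p (b q)) * g)" for q
    have "piece_dim (bivanishing W) (carrier (poly_ring Quot bivanishing W)) ?U = card (insert p Q)"
    proof (rule piece_dim_eq_card[of _ ?U _ _ eval_pair "insert p Q" b'])
      fix f assume f: "f \<in> ?U"
      show "f \<in> bivanishing W \<longleftrightarrow> (\<forall>q\<in>insert p Q. eval_pair q f = 0)"
      proof
        assume "f \<in> bivanishing W"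
        then show "\<forall>q\<in>insert p Q. eval_pair q f = 0" unfolding bivanishing_bihom_iff[OF f] using Q W by blast
      next
        assume *: "\<forall>q\<in>insert p Q. eval_pair q f = 0"
        have "eval_pair z f = 0" if "z \<in> W" for z
        proof (cases "z = p")
          case False
          then have "z \<in> W - {p}" using that by blast
          then have "eval_pair z f = (\<Sum>q\<in>Q. eval_pair q f * eval_pair z (b q))" using ex f by blast
          then show ?thesis using * by simp
        qed (use * in simp)
        then show "f \<in> bivanishing W" unfolding bivanishing_bihom_iff[OF f] by blast
      qed
    next
      fix q assume "q \<in> insert p Q"
      then show "b' q \<in> ?U"
        using b g(1) unfolding b'_def
        by (auto intro!: pv.subspace_diff[OF pv_subspace_bihom] pv.subspace_scale[OF pv_subspace_bihom])
    next
      fix q q' assume qq: "q \<in> insert p Q" "q' \<in> insert p Q"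
      show "eval_pair q' (b' q) = (if q = q' then 1 else 0)"
      proof (cases "q = p")
        case True
        then show ?thesis
        proof (cases "q' = p")
          case False
          then have "q' \<in> W - {p}" using qq Q by blast
          then show ?thesis using g(3) True False by (simp add: b'_def)
        qed (use g(2) in \<open>simp add: b'_def\<close>)
      next
        case q: False
        show ?thesis
        proof (cases "q' = p")
          case True
          then show ?thesis using q g by (auto simp: b'_def)
        next
          case False
          then have "q \<in> Q" "q' \<in> Q" using qq q by auto
          then show ?thesis using q dual g(3)[of q'] Q by (auto simp: b'_def)
        qed
      qed
    qed (use finQ W in \<open>auto simp: subspace_bivanishing proper pv_subspace_bihom carr\<close>)
    moreover have "p \<notin> Q" using Q by blast
    ultimately show ?thesis using small True finQ by simp
  next
    case False
    have "piece_dim (bivanishing W) (carrier (poly_ring Quot bivanishing W)) ?U = card Q"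
    proof (rule piece_dim_eq_card[of _ ?U _ _ eval_pair Q b])
      fix f assume f: "f \<in> ?U"
      show "f \<in> bivanishing W \<longleftrightarrow> (\<forall>q\<in>Q. eval_pair q f = 0)"
      proof
        assume "f \<in> bivanishing W"
        then show "\<forall>q\<in>Q. eval_pair q f = 0" unfolding bivanishing_bihom_iff[OF f] using Q W by blast
      next
        assume *: "\<forall>q\<in>Q. eval_pair q f = 0"
        have z: "eval_pair z f = 0" if "z \<in> W - {p}" for z
        proof -
          have "eval_pair z f = (\<Sum>q\<in>Q. eval_pair q f * eval_pair z (b q))" using ex f that by blast
          then show ?thesis using * by simp
        qed
        have "eval_pair p f = 0"
        proof (rule ccontr)
          assume p: "eval_pair p f \<noteq> 0"
          have "biseparator W p i j (Const (1 / eval_pair p f) * f)"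
            unfolding biseparator_def using f p z pv.subspace_scale[OF pv_subspace_bihom f] by simp
          then show False using False by blast
        qed
        then show "f \<in> bivanishing W" unfolding bivanishing_bihom_iff[OF f] using z by blast
      qed
    qed (use b dual finQ W in \<open>auto simp: subspace_bivanishing proper pv_subspace_bihom carr\<close>)
    then show ?thesis using small False by simp
  qed
qed

lemma piece_dim_nonzero_iff:
  fixes W :: "(('a::finite \<Rightarrow> 'k::field) \<times> ('b::finite \<Rightarrow> 'k)) set"
  assumes W: "finite W" "W \<noteq> {}" and J: "idl.subspace J" "bivanishing W \<subseteq> J"
  shows "piece_dim (bivanishing W) (residue (bivanishing W) ` J) (bihom_part i j) \<noteq> 0 \<longleftrightarrow>
    (\<exists>f\<in>bihom_part i j. f \<in> J \<and> f \<notin> bivanishing W)"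
proof -
  let ?I = "bivanishing W"
  let ?U = "bihom_part i j \<inter> J"
  have U: "pv.subspace ?U" by (intro pv.subspace_inter pv_subspace_bihom idl_subspace_pv J)
  have M: "residue ?I ` J \<inter> residue ?I ` bihom_part i j = residue ?I ` ?U"
    using residue_in_image_iff[OF subspace_bivanishing J] by blast
  obtain Q b where Q: "Q \<subseteq> W" and b: "\<forall>q\<in>Q. b q \<in> ?U"
    and dual: "\<forall>q\<in>Q. \<forall>q'\<in>Q. eval_pair q' (b q) = (if q = q' then 1 else 0)"
    and ex: "\<forall>f\<in>?U. \<forall>z\<in>W. eval_pair z f = (\<Sum>q\<in>Q. eval_pair q f * eval_pair z (b q))"
    using dual_points[of W ?U eval_pair, OF W(1) U] by auto
  have finQ: "finite Q" using Q W(1) finite_subset by blast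
  have ker: "f \<in> ?I \<longleftrightarrow> (\<forall>q\<in>Q. eval_pair q f = 0)" if f: "f \<in> ?U" for f
  proof -
    have fb: "f \<in> bihom_part i j" using f by blast
    show ?thesis unfolding bivanishing_bihom_iff[OF fb] using ex f Q by fastforce
  qed
  have "piece_dim ?I (residue ?I ` J) (bihom_part i j) = card Q"
    by (rule piece_dim_eq_card[of _ ?U _ _ eval_pair Q b])
       (use b dual finQ W U M ker in \<open>auto simp: subspace_bivanishing bivanishing_proper\<close>)
  moreover have "Q = {} \<longleftrightarrow> \<not> (\<exists>f\<in>bihom_part i j. f \<in> J \<and> f \<notin> ?I)"
  proof
    assume "Q = {}"
    then show "\<not> (\<exists>f\<in>bihom_part i j. f \<in> J \<and> f \<notin> ?I)" using ker by blast
  next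
    assume *: "\<not> (\<exists>f\<in>bihom_part i j. f \<in> J \<and> f \<notin> ?I)"
    show "Q = {}"
    proof (rule ccontr)
      assume "Q \<noteq> {}"
      then obtain q where q: "q \<in> Q" by blast
      then have "b q \<in> ?I" using * b by blast
      then have "eval_pair q (b q) = 0" using ker b q by blast
      with dual q show False by simp
    qed
  qed
  ultimately show ?thesis using finQ by simp
qed

lemma piece_dim_full_iff:
  fixes V :: "('v::finite \<Rightarrow> 'k::field) set"
  assumes V: "finite V" "V \<noteq> {}"
  shows "piece_dim (vanishing V) (carrier (poly_ring Quot vanishing V)) (hom_part e) = card V \<longleftrightarrow>
    (\<forall>p\<in>V. \<exists>g. separator V p e g)"
proof -
  let ?U = "hom_part e :: ('v, 'k) mpolynomial set"
  have U: "pv.subspace ?U" by (simp add: hom_part_eq pv_subspace_part)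
  have carr: "carrier (poly_ring Quot vanishing V) \<inter> residue (vanishing V) ` ?U = residue (vanishing V) ` ?U"
    unfolding carrier_Quot[OF subspace_vanishing] by blast
  obtain Q b where Q: "Q \<subseteq> V" and b: "\<forall>q\<in>Q. b q \<in> ?U"
    and dual: "\<forall>q\<in>Q. \<forall>q'\<in>Q. eval_poly q' (b q) = (if q = q' then 1 else 0)"
    and ex: "\<forall>f\<in>?U. \<forall>z\<in>V. eval_poly z f = (\<Sum>q\<in>Q. eval_poly q f * eval_poly z (b q))"
    using dual_points[of V ?U eval_poly, OF V(1) U] by auto
  have finQ: "finite Q" using Q V(1) finite_subset by blast
  have ker: "f \<in> vanishing V \<longleftrightarrow> (\<forall>q\<in>Q. eval_poly q f = 0)" if f: "f \<in> ?U" for f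
    unfolding vanishing_hom_iff[OF f] using ex f Q by fastforce
  have "piece_dim (vanishing V) (carrier (poly_ring Quot vanishing V)) ?U = card Q"
    by (rule piece_dim_eq_card[of _ ?U _ _ eval_poly Q b])
       (use b dual finQ V U carr ker in \<open>auto simp: subspace_vanishing vanishing_proper\<close>)
  moreover have "card Q = card V \<longleftrightarrow> Q = V" using Q V(1) card_subset_eq by blast
  moreover have "Q = V \<longleftrightarrow> (\<forall>p\<in>V. \<exists>g. separator V p e g)"
  proof
    assume "Q = V"
    then have "separator V p e (b p)" if "p \<in> V" for p
      using that b dual unfolding separator_def by auto
    then show "\<forall>p\<in>V. \<exists>g. separator V p e g" by blast
  next
    assume *: "\<forall>p\<in>V. \<exists>g. separator V p e g"
    show "Q = V"
    proof (rule ccontr)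
      assume "Q \<noteq> V"
      then obtain p where p: "p \<in> V" "p \<notin> Q" using Q by blast
      then obtain g where g: "g \<in> ?U" "eval_poly p g = 1" "\<forall>q\<in>V - {p}. eval_poly q g = 0"
        using * by (auto simp: separator_def)
      have "eval_poly p g = (\<Sum>q\<in>Q. eval_poly q g * eval_poly p (b q))" using ex g(1) p(1) by blast
      also have "\<dots> = 0" using g(3) p Q by (intro sum.neutral) auto
      finally show False using g(2) by simp
    qed
  qed
  ultimately show ?thesis by simp
qed

text \<open>
  Specializing one group of variables to a point turns a separator on the product into one on the
  other factor; in the other direction, multiply separators of the two components.
\<close>

lemma biseparator_product_iff:
  fixes V1 :: "('a::finite \<Rightarrow> 'k::field) set" and V2 :: "('b::finite \<Rightarrow> 'k) set"
  assumes p: "p \<in> V1" and q: "q \<in> V2"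
  shows "(\<exists>g. biseparator (V1 \<times> V2) (p, q) i j g) \<longleftrightarrow> (\<exists>g. separator V1 p i g) \<and> (\<exists>g. separator V2 q j g)"
proof
  assume "\<exists>g. biseparator (V1 \<times> V2) (p, q) i j g"
  then obtain g where g: "g \<in> bihom_part i j" "eval_pair (p, q) g = 1"
    "\<And>z. z \<in> V1 \<times> V2 - {(p, q)} \<Longrightarrow> eval_pair z g = 0" by (auto simp: biseparator_def)
  have ev1: "eval_poly v (insertion Const (case_sum Var (\<lambda>y. Const (q y))) g) = eval_pair (v, q) g" for v
  proof -
    have "(\<lambda>z. eval_poly v (case_sum Var (\<lambda>y. Const (q y)) z)) = case_sum v q" by (rule ext) (simp split: sum.split)
    then show ?thesis by (simp add: eval_insertion_Const eval_pair_def)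
  qed
  have ev2: "eval_poly w (insertion Const (case_sum (\<lambda>x. Const (p x)) Var) g) = eval_pair (p, w) g" for w
  proof -
    have "(\<lambda>z. eval_poly w (case_sum (\<lambda>x. Const (p x)) Var z)) = case_sum p w" by (rule ext) (simp split: sum.split)
    then show ?thesis by (simp add: eval_insertion_Const eval_pair_def)
  qed
  have gX: "g \<in> part wX i" and gY: "g \<in> part wY j" using g(1) by (simp_all add: bihom_part_eq)
  have "(case_sum Var (\<lambda>y. Const (q y)) z :: ('a, 'k) mpolynomial) \<in> part (\<lambda>_. 1) (wX z)" for z
    using part_Var[of _ "\<lambda>_. 1"] by (cases z) auto
  from part_insertion[of _ "\<lambda>_. 1" wX, OF this gX]
  have "separator V1 p i (insertion Const (case_sum Var (\<lambda>y. Const (q y))) g)"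
    using g q by (auto simp: separator_def hom_part_eq ev1)
  moreover have "(case_sum (\<lambda>x. Const (p x)) Var z :: ('b, 'k) mpolynomial) \<in> part (\<lambda>_. 1) (wY z)" for z
    using part_Var[of _ "\<lambda>_. 1"] by (cases z) auto
  from part_insertion[of _ "\<lambda>_. 1" wY, OF this gY]
  have "separator V2 q j (insertion Const (case_sum (\<lambda>x. Const (p x)) Var) g)"
    using g p by (auto simp: separator_def hom_part_eq ev2)
  ultimately show "(\<exists>g. separator V1 p i g) \<and> (\<exists>g. separator V2 q j g)" by blast
next
  assume "(\<exists>g. separator V1 p i g) \<and> (\<exists>g. separator V2 q j g)"
  then obtain g h where gh: "separator V1 p i g" "separator V2 q j h" by blast
  have "emb Inl g * emb Inr h \<in> bihom_part i j"
    using emb_Inl_bihom[of g i] emb_Inr_bihom[of h j] gh part_mult[of "emb Inl g" wX i "emb Inr h" 0]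
      part_mult[of "emb Inl g" wY 0 "emb Inr h" j]
    by (auto simp: separator_def bihom_part_eq)
  then have "biseparator (V1 \<times> V2) (p, q) i j (emb Inl g * emb Inr h)"
    using gh by (auto simp: biseparator_def separator_def)
  then show "\<exists>g. biseparator (V1 \<times> V2) (p, q) i j g" by blast
qed

lemma regularity_index_eq:
  fixes Z :: "('k::field_char_0, 'v::finite) vec set set"
  assumes Z: "finite Z" "Z \<noteq> {}" and u: "\<forall>P\<in>Z. represents (u P) P"
    and sep: "\<forall>p\<in>u ` Z. \<forall>e. (\<exists>g. separator (u ` Z) p e g) \<longleftrightarrow> s \<le> e"
  shows "regularity_index Z = s"
proof -
  have "inj_on u Z" using u by (intro inj_onI) (metis represents_unique)
  then have card: "card (u ` Z) = card Z" by (rule card_image)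
  have "proj_HF Z e = card Z \<longleftrightarrow> s \<le> e" for e
    unfolding proj_HF_def proj_vanishing_ideal_eq[OF u] card[symmetric]
    using piece_dim_full_iff[of "u ` Z" e] Z sep by auto
  then show ?thesis unfolding regularity_index_def
    by (intro Least_equality) (auto dest: le_trans)
qed


section \<open>Finite systems of generators\<close>

lemma common_separator_degree:
  fixes V :: "('m::finite option \<Rightarrow> 'k::field) set"
  assumes V: "finite V" "\<forall>q\<in>V. q None = 1"
  shows "\<exists>r. \<forall>p\<in>V. \<exists>g. separator V p r g"
proof -
  have "\<forall>p. \<exists>e. p \<in> V \<longrightarrow> (\<exists>g. separator V p e g)" using separator_exists[OF V] V(2) by blast
  then obtain e where e: "\<And>p. p \<in> V \<Longrightarrow> \<exists>g. separator V p (e p) g" by metis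
  have "\<exists>g. separator V p (sum e V) g" if p: "p \<in> V" for p
  proof -
    obtain g where g: "separator V p (e p) g" using e[OF p] by blast
    have "e p \<le> sum e V" by (rule member_le_sum) (use p V in auto)
    then show ?thesis using separator_mult_Var[OF g, of "sum e V - e p"] V(2) p by auto
  qed
  then show ?thesis by blast
qed

text \<open>
  Let \<open>r\<close> be a degree in which all points have separators. The ideal is generated by its elements of degree
  at most \<open>r + 1\<close>: modulo these, every form of degree \<open>r + k\<close> is a combination of the \<open>T\<^sup>k G\<^sub>p\<close> with its values at the points as
  coefficients, since \<open>X\<^sub>x G\<^sub>p - p\<^sub>x T G\<^sub>p\<close> is a form of degree \<open>r + 1\<close> in the ideal. This
  gives finitely many generators without the Hilbert basis theorem.
\<close>

lemma vanishing_finite_generators: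
  fixes V :: "('m::finite option \<Rightarrow> 'k::field_char_0) set"
  assumes V: "finite V" "\<forall>q\<in>V. q None = 1"
  shows "\<exists>B. finite B \<and> (\<forall>b\<in>B. \<exists>d. b \<in> hom_part d) \<and> idl.span B = vanishing V"
proof -
  obtain r where r: "\<forall>p\<in>V. \<exists>g. separator V p r g" using common_separator_degree[OF V] by blast
  then obtain G where G: "\<And>p. p \<in> V \<Longrightarrow> separator V p r (G p)" by metis
  have Ghom: "G p \<in> hom_part r" and Gdual: "eval_poly q (G p) = (if p = q then 1 else 0)" if "p \<in> V" "q \<in> V" for p q
    using G[OF that(1)] that by (auto simp: separator_def)
  obtain N where N: "pv.subspace N" and N0: "\<And>f. f \<in> N \<Longrightarrow> f \<in> vanishing V \<Longrightarrow> f = 0"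
    and dec: "\<And>e f. f \<in> hom_part e \<Longrightarrow> \<exists>n\<in>N. n \<in> hom_part e \<and> f - n \<in> vanishing V"
    using graded_complement_exists[OF V(1)] by blast
  let ?deg = "wdeg (\<lambda>_. 1) :: ('m option \<Rightarrow>\<^sub>0 nat) \<Rightarrow> nat"
  have single_hom: "(single t c :: ('m option, 'k) mpolynomial) \<in> hom_part (?deg t)" for t c
    by (simp add: hom_part_eq part_single)
  have "\<forall>t. \<exists>n. n \<in> N \<and> n \<in> hom_part (?deg t) \<and> single t 1 - n \<in> vanishing V"
    using dec[OF single_hom] by blast
  then obtain n where n: "\<And>t. n t \<in> N" "\<And>t. n t \<in> hom_part (?deg t)" "\<And>t. single t 1 - n t \<in> vanishing V" by metis
  \<comment> \<open>Every form of degree at most \<open>r + 1\<close> in the ideal is a combination of differences of a monomial and its normal form.\<close>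
  define B where "B = (\<lambda>t. single t 1 - n t) ` {t. ?deg t \<le> Suc r}"
  have "{t. ?deg t \<le> Suc r} = (\<Union>e\<le>Suc r. {t. ?deg t = e})" by auto
  then have "finite {t. ?deg t \<le> Suc r}" using finite_monomials[where ?'v = "'m option"] by simp
  then have finB: "finite B" by (simp add: B_def)
  have Bhom: "\<exists>d. b \<in> hom_part d" if "b \<in> B" for b
  proof -
    obtain t where t: "b = single t 1 - n t" using \<open>b \<in> B\<close> B_def by blast
    have "b \<in> part (\<lambda>_. 1) (?deg t)"
      unfolding t using single_hom[of t 1] n(2)[of t] unfolding hom_part_eq by (rule part_diff)
    then show ?thesis unfolding hom_part_eq by blast
  qed
  have BV: "idl.span B \<subseteq> vanishing V"
    by (rule idl.span_minimal[OF _ subspace_vanishing]) (use n(3) in \<open>auto simp: B_def\<close>)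
  have low: "f \<in> idl.span B" if f: "f \<in> hom_part e" "f \<in> vanishing V" and e: "e \<le> Suc r" for e f
  proof -
    have "(\<Sum>t\<in>keys f. Const (lookup f t) * single t 1) = f"
      using sum_of_terms[of f] by (simp add: Const_def mult_single)
    then have split: "f = (\<Sum>t\<in>keys f. Const (lookup f t) * (single t 1 - n t)) + (\<Sum>t\<in>keys f. Const (lookup f t) * n t)"
      by (simp add: right_diff_distrib sum_subtractf)
    have 1: "(\<Sum>t\<in>keys f. Const (lookup f t) * (single t 1 - n t)) \<in> idl.span B"
    proof (intro idl.span_sum idl.span_scale idl.span_base)
      fix t assume "t \<in> keys f"
      then have "?deg t = e" using f(1) by (simp add: hom_part_eq part_def)
      then show "single t 1 - n t \<in> B" using e by (auto simp: B_def)
    qed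
    have "(\<Sum>t\<in>keys f. Const (lookup f t) * n t) = f - (\<Sum>t\<in>keys f. Const (lookup f t) * (single t 1 - n t))"
      by (subst (1) split) simp
    also have "\<dots> \<in> vanishing V" using idl.subspace_diff[OF subspace_vanishing f(2)] 1 BV by blast
    finally have "(\<Sum>t\<in>keys f. Const (lookup f t) * n t) \<in> vanishing V" .
    moreover have "(\<Sum>t\<in>keys f. Const (lookup f t) * n t) \<in> N"
      using n(1) by (intro pv.subspace_sum[OF N] pv.subspace_scale[OF N])
    ultimately have "(\<Sum>t\<in>keys f. Const (lookup f t) * n t) = 0" by (rule N0[rotated])
    with split 1 show ?thesis by simp
  qed
  define R where "R k f = (\<Sum>p\<in>V. Const (eval_poly p f) * (Var None ^ k * G p))" for k :: nat and f
  have R_add: "R k (f + g) = R k f + R k g" for k f g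
    by (simp add: R_def Const_add distrib_right sum.distrib)
  have R_sum: "R k (sum h A) = (\<Sum>t\<in>A. R k (h t))" for k and h :: "('m option \<Rightarrow>\<^sub>0 nat) \<Rightarrow> ('m option, 'k) mpolynomial" and A
    by (induction A rule: infinite_finite_induct) (auto simp: R_add, simp_all add: R_def)
  have high: "\<forall>f\<in>hom_part (r + k). f - R k f \<in> idl.span B" for k
  proof (induction k)
    case 0
    show ?case
    proof
      fix f :: "('m option, 'k) mpolynomial" assume f: "f \<in> hom_part (r + 0)"
      have "R 0 f \<in> hom_part r"
        using Ghom by (auto simp: R_def hom_part_eq intro!: part_sum part_Const_mult)
      then have hom: "f - R 0 f \<in> hom_part r" using f by (simp add: hom_part_eq part_diff)
      have "eval_poly q (R 0 f) = eval_poly q f" if q: "q \<in> V" for q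
      proof -
        have "eval_poly q (R 0 f) = (\<Sum>p\<in>V. if p = q then eval_poly p f else 0)"
          unfolding R_def eval_sum by (intro sum.cong refl) (simp add: Gdual q)
        then show ?thesis using q V(1) by simp
      qed
      then have "f - R 0 f \<in> vanishing V" by (simp add: vanishing_hom_iff[OF hom])
      then show "f - R 0 f \<in> idl.span B" by (rule low[OF hom]) simp
    qed
  next
    case (Suc k)
    have var: "f * Var x - R (Suc k) (f * Var x) \<in> idl.span B" if f: "f \<in> hom_part (r + k)" for f x
    proof -
      have 1: "(f - R k f) * Var x \<in> idl.span B"
        using idl.span_scale[of _ B "Var x"] Suc f by (subst mult.commute) blast
      have 2: "Var None ^ k * (G p * Var x - Const (p x) * (G p * Var None)) \<in> idl.span B" if p: "p \<in> V" for p
      proof (rule idl.span_scale)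
        have Gp: "G p \<in> part (\<lambda>_. 1) r" using Ghom[OF p p] by (simp add: hom_part_eq)
        have "G p * Var x - Const (p x) * (G p * Var None) \<in> part (\<lambda>_. 1) (r + 1)"
          by (rule part_diff[OF part_mult[OF Gp part_Var[of x "\<lambda>_. 1"]] part_Const_mult[OF part_mult[OF Gp part_Var[of None "\<lambda>_. 1"]]]])
        then have hom: "G p * Var x - Const (p x) * (G p * Var None) \<in> hom_part (r + 1)" unfolding hom_part_eq .
        have "G p * Var x - Const (p x) * (G p * Var None) \<in> vanishing V"
          unfolding vanishing_hom_iff[OF hom]
        proof
          fix q assume q: "q \<in> V"
          show "eval_poly q (G p * Var x - Const (p x) * (G p * Var None)) = 0"
            using V(2) q by (cases "p = q") (simp_all add: Gdual[OF p q])
        qed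
        then show "G p * Var x - Const (p x) * (G p * Var None) \<in> idl.span B" by (rule low[OF hom]) simp
      qed
      have "(\<Sum>p\<in>V. Const (eval_poly p f) * (Var None ^ k * (G p * Var x - Const (p x) * (G p * Var None)))) \<in> idl.span B"
        using 2 by (intro idl.span_sum idl.span_scale[where c = "Const _"])
      from idl.span_add[OF 1 this]
      have "(f - R k f) * Var x + (\<Sum>p\<in>V. Const (eval_poly p f) * (Var None ^ k * (G p * Var x - Const (p x) * (G p * Var None)))) \<in> idl.span B" .
      also have "(f - R k f) * Var x + (\<Sum>p\<in>V. Const (eval_poly p f) * (Var None ^ k * (G p * Var x - Const (p x) * (G p * Var None)))) =
          f * Var x - R (Suc k) (f * Var x)"
        by (simp add: R_def right_diff_distrib left_diff_distrib sum_subtractf sum_distrib_left sum_distrib_right Const_mult mult_ac)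
      finally show ?thesis .
    qed
    show ?case
    proof
      fix f :: "('m option, 'k) mpolynomial" assume f: "f \<in> hom_part (r + Suc k)"
      have "single t c - R (Suc k) (single t c) \<in> idl.span B" if t: "t \<in> keys f" for t c
      proof -
        have deg: "(\<Sum>x\<in>UNIV. lookup t x) = r + Suc k" using f t by (simp add: hom_part_def)
        then obtain x where x: "lookup t x \<noteq> 0" by (metis add_Suc_right nat.distinct(1) sum.neutral)
        define s where "s = t - single x 1"
        have ts: "t = s + single x 1"
          using x by (intro poly_mapping_eqI) (auto simp: s_def lookup_add lookup_minus lookup_single when_def)
        have "(\<Sum>x\<in>UNIV. lookup t x) = (\<Sum>x\<in>UNIV. lookup s x) + 1"
          unfolding ts by (simp add: lookup_add lookup_single sum.distrib when_def)
        then have "(single s c :: ('m option, 'k) mpolynomial) \<in> hom_part (r + k)" using deg by (auto simp: hom_part_def)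
        from var[OF this, of x] show ?thesis unfolding ts single_mult_Var .
      qed
      then have "(\<Sum>t\<in>keys f. single t (lookup f t) - R (Suc k) (single t (lookup f t))) \<in> idl.span B"
        by (intro idl.span_sum)
      also have "(\<Sum>t\<in>keys f. single t (lookup f t) - R (Suc k) (single t (lookup f t))) = f - R (Suc k) f"
        by (simp only: sum_subtractf R_sum[symmetric] sum_of_terms)
      finally show "f - R (Suc k) f \<in> idl.span B" .
    qed
  qed
  have "vanishing V \<subseteq> idl.span B"
  proof
    fix f assume f: "f \<in> vanishing V"
    have "component (\<lambda>_. 1) e f \<in> idl.span B" for e
    proof -
      have hom: "component (\<lambda>_. 1) e f \<in> hom_part e" by (simp add: hom_part_eq component_in_part)
      have van: "component (\<lambda>_. 1) e f \<in> vanishing V" by (rule vanishing_component[OF f])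
      show ?thesis
      proof (cases "e \<le> Suc r")
        case True
        then show ?thesis by (rule low[OF hom van])
      next
        case False
        have "R (e - r) (component (\<lambda>_. 1) e f) = 0"
          using van unfolding vanishing_hom_iff[OF hom] by (simp add: R_def)
        moreover have "component (\<lambda>_. 1) e f \<in> hom_part (r + (e - r))" using hom False by simp
        ultimately show ?thesis using high[of "e - r"] by fastforce
      qed
    qed
    then have "(\<Sum>e\<in>wdeg (\<lambda>_. 1) ` keys f. component (\<lambda>_. 1) e f) \<in> idl.span B" by (intro idl.span_sum)
    then show "f \<in> idl.span B" by (simp only: sum_components[OF finite_imageI[OF finite_keys] order_refl])
  qed
  then show ?thesis using finB Bhom BV by blast
qed

lemma bivanishing_product_finite_generators:
  fixes V1 :: "('m::finite option \<Rightarrow> 'k::field_char_0) set" and V2 :: "('n::finite option \<Rightarrow> 'k) set"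
  assumes "finite V1" "\<forall>q\<in>V1. q None = 1" "finite V2" "\<forall>q\<in>V2. q None = 1"
  shows "\<exists>B. finite B \<and> (\<forall>b\<in>B. \<exists>i j. b \<in> bihom_part i j) \<and> idl.span B = bivanishing (V1 \<times> V2)"
proof -
  obtain B1 where B1: "finite B1" "\<forall>b\<in>B1. \<exists>d. b \<in> hom_part d" "idl.span B1 = vanishing V1"
    using vanishing_finite_generators[OF assms(1,2)] by blast
  obtain B2 where B2: "finite B2" "\<forall>b\<in>B2. \<exists>d. b \<in> hom_part d" "idl.span B2 = vanishing V2"
    using vanishing_finite_generators[OF assms(3,4)] by blast
  let ?B = "emb Inl ` B1 \<union> emb Inr ` B2"
  have "idl.span ?B = bivanishing (V1 \<times> V2)"
    unfolding bivanishing_product B1(3)[symmetric] B2(3)[symmetric] by (rule span_emb[symmetric])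
  moreover have "\<exists>i j. b \<in> bihom_part i j" if "b \<in> ?B" for b
  proof -
    consider f where "f \<in> B1" "b = emb Inl f" | f where "f \<in> B2" "b = emb Inr f" using \<open>b \<in> ?B\<close> by blast
    then show ?thesis
    proof cases
      case 1
      then obtain d where "f \<in> hom_part d" using B1(2) by blast
      from emb_Inl_bihom[OF this] show ?thesis unfolding 1 by (intro exI)
    next
      case 2
      then obtain d where "f \<in> hom_part d" using B2(2) by blast
      from emb_Inr_bihom[OF this] show ?thesis unfolding 2 by (intro exI)
    qed
  qed
  moreover have "finite ?B" using B1(1) B2(1) by simp
  ultimately show ?thesis by (intro exI[of _ ?B] conjI ballI)
qed


section \<open>Products of finite sets of points are arithmetically Cohen-Macaulay\<close>

definition bounded_part :: "('v::finite \<Rightarrow> nat) \<Rightarrow> nat \<Rightarrow> ('v, 'k::zero) mpolynomial set" where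
  "bounded_part w M = {f. \<forall>t\<in>keys f. wdeg w t \<le> M}"

lemma bounded_part_mult:
  "f \<in> bounded_part w M \<Longrightarrow> g \<in> bounded_part w M' \<Longrightarrow> f * g \<in> bounded_part w (M + M')"
  for f :: "('v::finite, 'k::comm_semiring_1) mpolynomial"
  using keys_mult[of f g] by (fastforce simp: bounded_part_def wdeg_add intro: add_mono)

lemma bounded_part_power: "f \<in> bounded_part w M \<Longrightarrow> f ^ n \<in> bounded_part w (n * M)"
  for f :: "('v::finite, 'k::comm_semiring_1) mpolynomial"
  proof (induction n)
  case 0
  then show ?case by (simp add: bounded_part_def wdeg_def)
next
  case (Suc n)
  from bounded_part_mult[OF Suc.prems Suc.IH[OF Suc.prems]] show ?case by simp
qed

lemma bounded_part_exists: "\<exists>M. \<forall>f\<in>A. f \<in> bounded_part w M" if "finite A"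
proof -
  have "finite (\<Union>f\<in>A. wdeg w ` keys f)" using that by simp
  then obtain M where "\<forall>d\<in>(\<Union>f\<in>A. wdeg w ` keys f). d \<le> M" using finite_nat_set_iff_bounded_le by blast
  then show ?thesis by (auto simp: bounded_part_def)
qed

lemma bounded_part_mono: "f \<in> bounded_part w M \<Longrightarrow> M \<le> M' \<Longrightarrow> f \<in> bounded_part w M'"
  by (fastforce simp: bounded_part_def)

text \<open>
  Any three polynomials are algebraically dependent modulo the ideal of a finite set of pairs of points. The
  monomials in the three polynomials with exponents at most \<open>N\<close> number \<open>(N + 1)\<^sup>3\<close>, while the bihomogeneous components
  of their combinations have at most \<open>card W (M + 1)\<^sup>2\<close> values, where \<open>M\<close> is linear in \<open>N\<close>.
\<close>

lemma algebraic_dependence: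
  fixes f :: "nat \<Rightarrow> ('a::finite + 'b::finite, 'k::field_char_0) mpolynomial"
  assumes W: "finite W"
  shows "\<exists>N \<phi>. (\<exists>a\<le>N. \<exists>b\<le>N. \<exists>c\<le>N. \<phi> a b c \<noteq> 0) \<and>
    (\<Sum>a\<le>N. f 0 ^ a * (\<Sum>b\<le>N. f 1 ^ b * (\<Sum>c\<le>N. f 2 ^ c * Const (\<phi> a b c)))) \<in> bivanishing W"
proof -
  obtain D1 where D1: "\<forall>g\<in>f ` {0, 1, 2}. g \<in> bounded_part wX D1" using bounded_part_exists[of "f ` {0, 1, 2}" wX] by auto
  obtain D2 where D2: "\<forall>g\<in>f ` {0, 1, 2}. g \<in> bounded_part wY D2" using bounded_part_exists[of "f ` {0, 1, 2}" wY] by auto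
  define D where "D = max D1 D2"
  have D: "f i \<in> bounded_part wX D \<and> f i \<in> bounded_part wY D" if "i \<in> {0, 1, 2}" for i
  proof -
    have "f i \<in> bounded_part wX D1" "f i \<in> bounded_part wY D2" using D1 D2 that by auto
    then show ?thesis
      unfolding D_def using bounded_part_mono[of "f i" _ _ "max D1 D2"] by (meson max.cobounded1 max.cobounded2)
  qed
  define s where "s = card W"
  \<comment> \<open>This bound on the exponents makes \<open>card W (M + 1)\<^sup>2 < (N + 1)\<^sup>3\<close> true.\<close>
  define N where "N = s * (3 * D + 1)\<^sup>2"
  define M where "M = 3 * (N * D)"
  define mon where "mon = (\<lambda>(a, b, c). f 0 ^ a * f 1 ^ b * f 2 ^ c)"
  have mon: "mon z \<in> bounded_part w M" if z: "z \<in> {..N} \<times> {..N} \<times> {..N}" and w: "w = wX \<or> w = wY" for z w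
  proof -
    obtain a b c where abc: "z = (a, b, c)" "a \<le> N" "b \<le> N" "c \<le> N" using z by auto
    have "f i \<in> bounded_part w D" if "i \<in> {0, 1, 2}" for i using D[OF that] w by auto
    then have "f 0 ^ a * f 1 ^ b * f 2 ^ c \<in> bounded_part w (a * D + b * D + c * D)"
      by (intro bounded_part_mult bounded_part_power) auto
    moreover have "a * D + b * D + c * D \<le> M"
    proof -
      have "a * D \<le> N * D" "b * D \<le> N * D" "c * D \<le> N * D" by (intro mult_le_mono1 abc)+
      then show ?thesis unfolding M_def by linarith
    qed
    ultimately show ?thesis using bounded_part_mono by (simp add: mon_def abc)
  qed
  define coef where "coef = (\<lambda>z (p, i, j). eval_pair p (component wX i (component wY j (mon z))))"
  have "card (W \<times> {..M} \<times> {..M}) < card ({..N} \<times> {..N} \<times> {..N})"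
  proof -
    have "M + 1 \<le> (3 * D + 1) * (N + 1)" by (simp add: M_def algebra_simps)
    then have "s * (M + 1)\<^sup>2 \<le> s * ((3 * D + 1) * (N + 1))\<^sup>2" by (intro mult_le_mono2 power_mono) auto
    also have "\<dots> = N * (N + 1)\<^sup>2" unfolding power_mult_distrib by (simp add: N_def)
    also have "\<dots> < (N + 1) * (N + 1)\<^sup>2" by simp
    finally show ?thesis by (simp add: s_def card_cartesian_product power2_eq_square mult_ac)
  qed
  then obtain x where x: "\<exists>z\<in>{..N} \<times> {..N} \<times> {..N}. x z \<noteq> 0"
    "\<forall>y\<in>W \<times> {..M} \<times> {..M}. (\<Sum>z\<in>{..N} \<times> {..N} \<times> {..N}. x z * coef z y) = 0"
    using homogeneous_system_solvable[of "W \<times> {..M} \<times> {..M}" "{..N} \<times> {..N} \<times> {..N}" coef] W by blast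
  define F where "F = (\<Sum>z\<in>{..N} \<times> {..N} \<times> {..N}. Const (x z) * mon z)"
  have "component wX i (component wY j F) \<in> bivanishing W" for i j
  proof (cases "i \<le> M \<and> j \<le> M")
    case True
    have "eval_pair p (component wX i (component wY j F)) = 0" if "p \<in> W" for p
    proof -
      have "eval_pair p (component wX i (component wY j F)) = (\<Sum>z\<in>{..N} \<times> {..N} \<times> {..N}. x z * coef z (p, i, j))"
        by (simp add: F_def component_sum component_Const_mult coef_def)
      then show ?thesis using x(2) that True by simp
    qed
    then show ?thesis using bivanishing_bihom_iff[OF bicomponent_in_bihom] by blast
  next
    case False
    have FM: "t \<in> keys F \<Longrightarrow> wdeg wX t \<le> M \<and> wdeg wY t \<le> M" for t
    proof -
      assume t: "t \<in> keys F"
      have "keys F \<subseteq> (\<Union>z\<in>{..N} \<times> {..N} \<times> {..N}. keys (Const (x z) * mon z))"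
        unfolding F_def by (rule keys_sum)
      then obtain z where z: "z \<in> {..N} \<times> {..N} \<times> {..N}" "t \<in> keys (mon z)" using t keys_Const_mult by blast
      then show ?thesis using mon[OF z(1), of wX] mon[OF z(1), of wY] by (auto simp: bounded_part_def)
    qed
    have "component wX i (component wY j F) = 0"
    proof (rule poly_mapping_eqI)
      fix t
      show "lookup (component wX i (component wY j F)) t = lookup 0 t"
        using FM[of t] False by (auto simp: lookup_component in_keys_iff)
    qed
    then show ?thesis by (simp add: idl.subspace_0[OF subspace_bivanishing])
  qed
  then have "(\<Sum>i\<in>wdeg wX ` keys F. \<Sum>j\<in>wdeg wY ` keys F. component wX i (component wY j F)) \<in> bivanishing W"
    by (intro idl.subspace_sum[OF subspace_bivanishing])
  then have FW: "F \<in> bivanishing W"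
    by (simp only: sum_bicomponents[OF finite_imageI[OF finite_keys] finite_imageI[OF finite_keys] order_refl order_refl])
  have "F = (\<Sum>a\<le>N. f 0 ^ a * (\<Sum>b\<le>N. f 1 ^ b * (\<Sum>c\<le>N. f 2 ^ c * Const (x (a, b, c)))))"
    by (simp add: F_def mon_def sum.cartesian_product sum_distrib_left split_def mult_ac)
  with FW x(1) show ?thesis by (intro exI[of _ N] exI[of _ "\<lambda>a b c. x (a, b, c)"]) auto
qed

text \<open>
  In a relation \<open>\<Sum> x\<^sup>i G\<^sub>i \<in> J\<close> the common power of the nonzerodivisor \<open>x\<close> can be cancelled; what remains is the
  lowest coefficient modulo \<open>x\<close>.
\<close>

lemma lowest_coefficient:
  fixes x :: "'a::comm_ring_1"
  assumes J: "idl.subspace J" and x: "\<And>a. a * x \<in> J \<Longrightarrow> a \<in> J"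
    and sum: "(\<Sum>i\<le>N. x ^ i * G i) \<in> J" and i0: "i0 \<le> N" and low: "\<And>i. i < i0 \<Longrightarrow> G i = 0"
  shows "G i0 \<in> idl.span (insert x J)"
proof -
  have cancel: "a * x ^ n \<in> J \<Longrightarrow> a \<in> J" for a n
  proof (induction n)
    case (Suc n)
    then show ?case using x[of "a * x ^ n"] by (simp add: mult_ac)
  qed simp
  have "(\<Sum>i\<le>N. x ^ i * G i) = (\<Sum>i\<in>{i0..N}. x ^ i * G i)"
    by (rule sum.mono_neutral_right) (use low in auto)
  also have "\<dots> = x ^ i0 * G i0 + (\<Sum>i\<in>{Suc i0..N}. x ^ i * G i)"
    using i0 by (simp add: sum.atLeast_Suc_atMost)
  also have "(\<Sum>i\<in>{Suc i0..N}. x ^ i * G i) = (\<Sum>i\<in>{Suc i0..N}. x ^ Suc i0 * (x ^ (i - Suc i0) * G i))"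
  proof (rule sum.cong[OF refl])
    fix i assume "i \<in> {Suc i0..N}"
    then have "x ^ i = x ^ Suc i0 * x ^ (i - Suc i0)" by (simp flip: power_add del: power_Suc)
    then show "x ^ i * G i = x ^ Suc i0 * (x ^ (i - Suc i0) * G i)" by (simp add: mult.assoc)
  qed
  also have "\<dots> = x ^ Suc i0 * (\<Sum>i\<in>{Suc i0..N}. x ^ (i - Suc i0) * G i)"
    by (rule sum_distrib_left[symmetric])
  finally have "(\<Sum>i\<le>N. x ^ i * G i) = (G i0 + x * (\<Sum>i\<in>{Suc i0..N}. x ^ (i - Suc i0) * G i)) * x ^ i0"
    by (simp only: power_Suc distrib_right distrib_left mult_ac)
  then have "(G i0 + x * (\<Sum>i\<in>{Suc i0..N}. x ^ (i - Suc i0) * G i)) * x ^ i0 \<in> J"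
    using sum by simp
  then have "G i0 + x * (\<Sum>i\<in>{Suc i0..N}. x ^ (i - Suc i0) * G i) \<in> J" by (rule cancel)
  then have 1: "G i0 + x * (\<Sum>i\<in>{Suc i0..N}. x ^ (i - Suc i0) * G i) \<in> idl.span (insert x J)"
    by (intro idl.span_base) blast
  have "(\<Sum>i\<in>{Suc i0..N}. x ^ (i - Suc i0) * G i) * x \<in> idl.span (insert x J)"
    by (intro idl.span_scale idl.span_base) blast
  from idl.span_diff[OF 1 this] show ?thesis by (simp add: mult.commute)
qed

text \<open>
  Peel off the three elements from an algebraic relation between them, one after the other; a nonzero constant
  remains in the ideal that they generate.
\<close>

lemma no_regular_sequence_of_length_3:
  fixes f :: "nat \<Rightarrow> ('a::finite + 'b::finite, 'k::field_char_0) mpolynomial"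
  assumes W: "finite W"
    and r0: "\<And>a. a * f 0 \<in> bivanishing W \<Longrightarrow> a \<in> bivanishing W"
    and r1: "\<And>a. a * f 1 \<in> idl.span (bivanishing W \<union> {f 0}) \<Longrightarrow> a \<in> idl.span (bivanishing W \<union> {f 0})"
    and r2: "\<And>a. a * f 2 \<in> idl.span (bivanishing W \<union> {f 0, f 1}) \<Longrightarrow> a \<in> idl.span (bivanishing W \<union> {f 0, f 1})"
  shows "1 \<in> idl.span (bivanishing W \<union> {f 0, f 1, f 2})"
proof -
  let ?I = "bivanishing W"
  obtain N \<phi> where nz: "\<exists>a\<le>N. \<exists>b\<le>N. \<exists>c\<le>N. \<phi> a b c \<noteq> 0" and
    rel: "(\<Sum>a\<le>N. f 0 ^ a * (\<Sum>b\<le>N. f 1 ^ b * (\<Sum>c\<le>N. f 2 ^ c * Const (\<phi> a b c)))) \<in> ?I"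
    using algebraic_dependence[OF W, of f] by blast
  define a where "a = (LEAST a. \<exists>b\<le>N. \<exists>c\<le>N. \<phi> a b c \<noteq> 0)"
  have a: "\<exists>b\<le>N. \<exists>c\<le>N. \<phi> a b c \<noteq> 0" unfolding a_def by (rule LeastI_ex) (use nz in blast)
  obtain a' where a': "a' \<le> N" "\<exists>b\<le>N. \<exists>c\<le>N. \<phi> a' b c \<noteq> 0" using nz by blast
  have aN: "a \<le> N" unfolding a_def by (rule order_trans[OF Least_le a'(1)]) (rule a'(2))
  have alow: "\<phi> i b c = 0" if "i < a" "b \<le> N" "c \<le> N" for i b c
    using not_less_Least[of i "\<lambda>a. \<exists>b\<le>N. \<exists>c\<le>N. \<phi> a b c \<noteq> 0"] that unfolding a_def by blast
  define b where "b = (LEAST b. \<exists>c\<le>N. \<phi> a b c \<noteq> 0)"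
  have b: "\<exists>c\<le>N. \<phi> a b c \<noteq> 0" unfolding b_def by (rule LeastI_ex) (use a in blast)
  obtain b' where b': "b' \<le> N" "\<exists>c\<le>N. \<phi> a b' c \<noteq> 0" using a by blast
  have bN: "b \<le> N" unfolding b_def by (rule order_trans[OF Least_le b'(1)]) (rule b'(2))
  have blow: "\<phi> a i c = 0" if "i < b" "c \<le> N" for i c
    using not_less_Least[of i "\<lambda>b. \<exists>c\<le>N. \<phi> a b c \<noteq> 0"] that unfolding b_def by blast
  define c where "c = (LEAST c. \<phi> a b c \<noteq> 0)"
  have c: "\<phi> a b c \<noteq> 0" unfolding c_def by (rule LeastI_ex) (use b in blast)
  obtain c' where c': "c' \<le> N" "\<phi> a b c' \<noteq> 0" using b by blast
  have cN: "c \<le> N" unfolding c_def by (rule order_trans[OF Least_le c'(1)]) (rule c'(2))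
  have clow: "\<phi> a b i = 0" if "i < c" for i
    using not_less_Least[of i "\<lambda>c. \<phi> a b c \<noteq> 0"] that unfolding c_def by blast
  have eq: "idl.span (insert x (idl.span S)) = idl.span (insert x S)" for x and S :: "('a + 'b, 'k) mpolynomial set"
    by (simp only: idl.span_insert idl.span_span)
  have "(\<Sum>j\<le>N. f 1 ^ j * (\<Sum>k\<le>N. f 2 ^ k * Const (\<phi> a j k))) \<in> idl.span (insert (f 0) ?I)"
    by (rule lowest_coefficient[OF subspace_bivanishing r0 rel aN]) (use alow in \<open>auto intro!: sum.neutral\<close>)
  then have 1: "(\<Sum>j\<le>N. f 1 ^ j * (\<Sum>k\<le>N. f 2 ^ k * Const (\<phi> a j k))) \<in> idl.span (?I \<union> {f 0})" by simp
  have "(\<Sum>k\<le>N. f 2 ^ k * Const (\<phi> a b k)) \<in> idl.span (insert (f 1) (idl.span (?I \<union> {f 0})))"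
    by (rule lowest_coefficient[OF idl.subspace_span r1 1 bN]) (use blow in \<open>auto intro!: sum.neutral\<close>)
  then have 2: "(\<Sum>k\<le>N. f 2 ^ k * Const (\<phi> a b k)) \<in> idl.span (?I \<union> {f 0, f 1})"
    unfolding eq by (simp add: insert_commute)
  have "Const (\<phi> a b c) \<in> idl.span (insert (f 2) (idl.span (?I \<union> {f 0, f 1})))"
    by (rule lowest_coefficient[OF idl.subspace_span r2 2 cN]) (use clow in auto)
  then have "Const (\<phi> a b c) \<in> idl.span (?I \<union> {f 0, f 1, f 2})"
    unfolding eq by (simp add: insert_commute)
  from idl.span_scale[OF this, of "Const (1 / \<phi> a b c)"] show ?thesis
    using c by (simp flip: Const_mult)
qed

lemma separating_form_exists:
  fixes u :: "('k::field, 'v::finite) vec set \<Rightarrow> 'v \<Rightarrow> 'k"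
  assumes Z: "finite Z" "P \<in> Z" and u: "\<forall>P\<in>Z. represents (u P) P"
  shows "\<exists>g\<in>hom_part (card Z). eval_poly (u P) g \<noteq> 0 \<and> (\<forall>Q\<in>Z - {P}. eval_poly (u Q) g = 0)"
proof -
  have "\<forall>Q\<in>Z - {P}. \<exists>l\<in>hom_part 1. eval_poly (u P) l \<noteq> 0 \<and> eval_poly (u Q) l = 0"
    using linear_form_separates u Z(2) by blast
  from bchoice[OF this[unfolded Bex_def]] obtain l where l: "\<And>Q. Q \<in> Z - {P} \<Longrightarrow> l Q \<in> hom_part 1"
    "\<And>Q. Q \<in> Z - {P} \<Longrightarrow> eval_poly (u P) (l Q) \<noteq> 0" "\<And>Q. Q \<in> Z - {P} \<Longrightarrow> eval_poly (u Q) (l Q) = 0" by blast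
  obtain x where x: "u P x \<noteq> 0" using u Z(2) unfolding represents_def by blast
  let ?g = "Var x * (\<Prod>Q\<in>Z - {P}. l Q)"
  have "?g \<in> hom_part (card Z)"
  proof -
    have "(\<Prod>Q\<in>Z - {P}. l Q) \<in> part (\<lambda>_. 1) (\<Sum>Q\<in>Z - {P}. 1)"
      using l(1) unfolding hom_part_eq by (intro part_prod)
    from part_mult[OF part_Var[of x "\<lambda>_. 1"] this] have "?g \<in> part (\<lambda>_. 1) (1 + card (Z - {P}))"
      by simp
    also have "1 + card (Z - {P}) = card Z" using card.remove[OF Z] by simp
    finally show ?thesis unfolding hom_part_eq .
  qed
  moreover have "eval_poly (u P) ?g \<noteq> 0" using x l(2) Z(1) by simp
  moreover have "eval_poly (u Q) ?g = 0" if "Q \<in> Z - {P}" for Q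
  proof -
    have "(\<Prod>R\<in>Z - {P}. eval_poly (u Q) (l R)) = 0"
      using that l(3)[OF that] Z(1) by (intro prod_zero) auto
    then show ?thesis by simp
  qed
  ultimately show ?thesis by blast
qed

text \<open>
  The sum of forms of one degree, each nonzero at just one of the points.
\<close>

lemma nonvanishing_form_exists:
  fixes u :: "('k::field, 'v::finite) vec set \<Rightarrow> 'v \<Rightarrow> 'k"
  assumes Z: "finite Z" "Z \<noteq> {}" and u: "\<forall>P\<in>Z. represents (u P) P"
  shows "\<exists>d\<ge>1. \<exists>h\<in>hom_part d. \<forall>P\<in>Z. eval_poly (u P) h \<noteq> 0"
proof -
  have "\<forall>P\<in>Z. \<exists>g. g \<in> hom_part (card Z) \<and> eval_poly (u P) g \<noteq> 0 \<and> (\<forall>Q\<in>Z - {P}. eval_poly (u Q) g = 0)"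
    using separating_form_exists[OF Z(1) _ u] by blast
  from bchoice[OF this] obtain g where ghom: "\<And>P. P \<in> Z \<Longrightarrow> g P \<in> hom_part (card Z)"
    and g1: "\<And>P. P \<in> Z \<Longrightarrow> eval_poly (u P) (g P) \<noteq> 0"
    and g0: "\<And>P Q. P \<in> Z \<Longrightarrow> Q \<in> Z - {P} \<Longrightarrow> eval_poly (u Q) (g P) = 0" by blast
  have "(\<Sum>P\<in>Z. g P) \<in> hom_part (card Z)" using ghom unfolding hom_part_eq by (intro part_sum)
  moreover have "eval_poly (u Q) (\<Sum>P\<in>Z. g P) \<noteq> 0" if Q: "Q \<in> Z" for Q
  proof -
    have "eval_poly (u Q) (\<Sum>P\<in>Z. g P) = eval_poly (u Q) (g Q) + (\<Sum>P\<in>Z - {Q}. eval_poly (u Q) (g P))"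
      using sum.remove[OF Z(1) Q, of "\<lambda>P. eval_poly (u Q) (g P)"] by simp
    also have "(\<Sum>P\<in>Z - {Q}. eval_poly (u Q) (g P)) = 0" using g0 Q by (intro sum.neutral) auto
    finally show ?thesis using g1[OF Q] by simp
  qed
  moreover have "1 \<le> card Z" using Z by (simp add: Suc_le_eq card_gt_0_iff)
  ultimately show ?thesis by blast
qed

lemma vanishing_eval_0:
  fixes f :: "('v::finite, 'k::field_char_0) mpolynomial"
  assumes "f \<in> vanishing V" "V \<noteq> {}"
  shows "eval_poly (\<lambda>_. 0) f = 0"
proof -
  have hom: "component (\<lambda>_. 1) 0 f \<in> hom_part 0" by (simp add: hom_part_eq component_in_part)
  obtain p where p: "p \<in> V" using assms(2) by blast
  obtain c where c: "component (\<lambda>_. 1) 0 f = Const c" using hom_part_0_Const[OF hom] by blast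
  have "\<forall>v\<in>V. eval_poly v (component (\<lambda>_. 1) 0 f) = 0"
    using vanishing_component[OF assms(1), of 0] unfolding vanishing_hom_iff[OF hom] .
  then have "eval_poly p (Const c) = 0" using p unfolding c by blast
  then have c0: "c = 0" by simp
  have "eval_poly (\<lambda>_. 0) (component (\<lambda>_. 1) d f) = 0" for d
  proof (cases "d = 0")
    case True
    then show ?thesis using c c0 by simp
  next
    case False
    have "component (\<lambda>_. 1) d f \<in> hom_part d" by (simp add: hom_part_eq component_in_part)
    from eval_scaled_hom[OF this, of 0 "\<lambda>_. 0"] False show ?thesis by (auto simp: zero_power)
  qed
  then have "eval_poly (\<lambda>_. 0) (\<Sum>d\<in>wdeg (\<lambda>_. 1) ` keys f. component (\<lambda>_. 1) d f) = 0" by simp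
  then show ?thesis by (simp only: sum_components[OF finite_imageI[OF finite_keys] order_refl])
qed

text \<open>
  Forms without zeros on the two factors are a regular sequence of length two, and there is none of length three.
\<close>

theorem product_ACM:
  fixes X :: "('k::field_char_0, 'a::finite, 'b::finite) bipoint set"
  assumes Z: "finite Z1" "Z1 \<noteq> {}" "finite Z2" "Z2 \<noteq> {}" and X: "X = Z1 \<times> Z2"
    and u: "\<forall>P\<in>Z1. represents (u P) P" and u': "\<forall>Q\<in>Z2. represents (u' Q) Q"
  shows "ACM X"
proof -
  let ?V1 = "u ` Z1" and ?V2 = "u' ` Z2"
  let ?W = "?V1 \<times> ?V2"
  let ?I = "bivanishing ?W"
  have "(\<lambda>(P, Q). (u P, u' Q)) ` X = ?W" unfolding X by auto
  then have IX: "bi_vanishing_ideal X = ?I"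
    using bi_vanishing_ideal_eq[of X u u'] u u' X by auto
  have I: "idl.subspace ?I" by (rule subspace_bivanishing)
  have finW: "finite ?W" using Z by simp
  obtain d1 h1 where h1: "1 \<le> d1" "h1 \<in> hom_part d1" "\<And>P. P \<in> Z1 \<Longrightarrow> eval_poly (u P) h1 \<noteq> 0"
    using nonvanishing_form_exists[OF Z(1,2) u] by blast
  obtain d2 h2 where h2: "1 \<le> d2" "h2 \<in> hom_part d2" "\<And>Q. Q \<in> Z2 \<Longrightarrow> eval_poly (u' Q) h2 \<noteq> 0"
    using nonvanishing_form_exists[OF Z(3,4) u'] by blast
  let ?g1 = "emb Inl h1 :: ('a + 'b, 'k) mpolynomial" and ?g2 = "emb Inr h2 :: ('a + 'b, 'k) mpolynomial"
  let ?m = "genideal (coord_ring X) (range (\<lambda>z. coord_residue X (Var z)))"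
  have R: "coord_ring X = poly_ring Quot ?I" "coord_residue X = residue ?I"
    by (simp_all add: coord_ring_def coord_residue_def IX)
  have m: "?m = residue ?I ` idl.span (?I \<union> range Var)"
  proof -
    have "range (\<lambda>z. residue ?I (Var z)) = residue ?I ` range Var" by auto
    then show ?thesis unfolding R by (simp only: genideal_Quot[OF I])
  qed
  have reg1: "a \<in> ?I" if a: "a * ?g1 \<in> ?I" for a
  proof (rule bivanishingI)
    fix v w and c c' :: 'k assume vw: "(v, w) \<in> ?W" and c: "c \<noteq> 0" "c' \<noteq> 0"
    have "eval_poly (\<lambda>x. c * v x) h1 \<noteq> 0" using h1(2,3) vw c by (auto simp: eval_scaled_hom)
    then have "eval_poly (case_sum (\<lambda>x. c * v x) (\<lambda>y. c' * w y)) ?g1 \<noteq> 0" by (simp add: eval_emb)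
    then show "eval_poly (case_sum (\<lambda>x. c * v x) (\<lambda>y. c' * w y)) a = 0"
      using bivanishingD[OF a vw c] by simp
  qed
  let ?J1 = "idl.span (insert h1 (vanishing ?V1))"
  have span1: "idl.span (?I \<union> {?g1}) = idl.span (emb Inl ` ?J1 \<union> emb Inr ` vanishing ?V2)"
  proof -
    let ?A = "emb Inl ` vanishing ?V1 \<union> emb Inr ` vanishing ?V2"
    have V2: "idl.span (vanishing ?V2) = vanishing ?V2" using subspace_vanishing by (simp add: idl.span_eq_iff)
    have "idl.span (emb Inl ` ?J1 \<union> emb Inr ` vanishing ?V2) = idl.span (insert ?g1 ?A)"
      using span_emb[of Inl "insert h1 (vanishing ?V1)" Inr "vanishing ?V2", unfolded V2] by simp
    also have "\<dots> = idl.span (?A \<union> {?g1})" by simp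
    also have "\<dots> = idl.span (?I \<union> {?g1})" unfolding bivanishing_product
      by (simp only: idl.span_Un[of ?A "{?g1}"] idl.span_Un[of "idl.span ?A" "{?g1}"] idl.span_span)
    finally show ?thesis by (rule sym)
  qed
  have h2reg: "a \<in> vanishing ?V2" if a: "a * h2 \<in> vanishing ?V2" for a
    unfolding vanishing_def
  proof (intro CollectI ballI allI impI)
    fix v and c :: 'k assume v: "v \<in> ?V2" and c: "c \<noteq> 0"
    have "eval_poly (\<lambda>x. c * v x) h2 \<noteq> 0" using h2(2,3) v c by (auto simp: eval_scaled_hom)
    moreover have "eval_poly (\<lambda>x. c * v x) (a * h2) = 0" using a v c unfolding vanishing_def by blast
    ultimately show "eval_poly (\<lambda>x. c * v x) a = 0" by simp
  qed
  have reg2: "a \<in> idl.span (?I \<union> {?g1})" if "a * ?g2 \<in> idl.span (?I \<union> {?g1})" for a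
    unfolding span1
  proof (rule nonzerodivisor_Inr[OF idl.subspace_span subspace_vanishing])
    show "b \<in> vanishing ?V2" if "b * h2 \<in> vanishing ?V2" for b using that by (rule h2reg)
    show "a * ?g2 \<in> idl.span (emb Inl ` ?J1 \<union> emb Inr ` vanishing ?V2)" using that unfolding span1 .
  qed
  have form0: "eval_poly (\<lambda>_. 0) h = 0" if "h \<in> hom_part d" "1 \<le> d" for h :: "('c::finite, 'k) mpolynomial" and d
    using eval_scaled_hom[OF that(1), of 0 "\<lambda>_. 0"] that(2) by (auto simp: zero_power)
  have proper: "idl.span (?I \<union> {?g1, ?g2}) \<noteq> UNIV"
  proof
    assume "idl.span (?I \<union> {?g1, ?g2}) = UNIV"
    let ?O = "{f :: ('a + 'b, 'k) mpolynomial. eval_poly (\<lambda>_. 0) f = 0}"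
    have O: "idl.subspace ?O" by (simp add: idl.subspace_def)
    have "?I \<subseteq> ?O"
      unfolding bivanishing_product using Z
      by (intro idl.span_minimal[OF _ O]) (auto simp: eval_emb dest: vanishing_eval_0)
    moreover have "{?g1, ?g2} \<subseteq> ?O" using form0[OF h1(2,1)] form0[OF h2(2,1)] by (simp add: eval_emb)
    ultimately have "idl.span (?I \<union> {?g1, ?g2}) \<subseteq> ?O" by (intro idl.span_minimal[OF _ O]) blast
    then have "(1 :: ('a + 'b, 'k) mpolynomial) \<in> ?O" using \<open>idl.span (?I \<union> {?g1, ?g2}) = UNIV\<close> by blast
    then show False by simp
  qed
  have "regular_sequence (coord_ring X) (map (residue ?I) [?g1, ?g2])"
    unfolding R regular_sequence_Quot[OF I]
  proof (intro conjI allI impI)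
    fix i a assume i: "i < length [?g1, ?g2]" and a: "a * [?g1, ?g2] ! i \<in> idl.span (?I \<union> set (take i [?g1, ?g2]))"
    have "idl.span ?I = ?I" using I by (simp add: idl.span_eq_iff)
    then show "a \<in> idl.span (?I \<union> set (take i [?g1, ?g2]))"
    proof (cases i)
      case 0
      show ?thesis
        using a reg1[of a] unfolding 0 take_0 list.set Un_empty_right \<open>idl.span ?I = ?I\<close> nth_Cons_0 by blast
    next
      case (Suc j)
      then have "i = 1" using i by simp
      then show ?thesis using a reg2[of a] by simp
    qed
  next
    show "idl.span (?I \<union> set [?g1, ?g2]) \<noteq> UNIV" using proper by simp
  qed
  moreover have "set (map (residue ?I) [?g1, ?g2]) \<subseteq> ?m"
  proof -
    have var: "h \<in> idl.span (range Var)" if "h \<in> bihom_part i j" "1 \<le> i + j" for h :: "('a + 'b, 'k) mpolynomial" and i j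
      unfolding span_variables_iff
    proof
      fix t assume t: "t \<in> keys h"
      have "t \<noteq> 0" using bihom_keysD[OF that(1) t] that(2) by auto
      then have "\<exists>y. lookup t y \<noteq> 0" by (auto simp: poly_mapping_eq_iff fun_eq_iff)
      then show "\<exists>y\<in>UNIV. lookup t y \<noteq> 0" by blast
    qed
    have "?g1 \<in> idl.span (range Var)" "?g2 \<in> idl.span (range Var)"
      using var[OF emb_Inl_bihom[OF h1(2)]] var[OF emb_Inr_bihom[OF h2(2)]] h1(1) h2(1) by simp_all
    then show ?thesis unfolding m using idl.span_mono[of "range Var" "?I \<union> range Var"] by auto
  qed
  ultimately have two: "\<exists>fs. length fs = 2 \<and> set fs \<subseteq> ?m \<and> regular_sequence (coord_ring X) fs"
    by (intro exI[of _ "map (residue ?I) [?g1, ?g2]"]) simp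
  have le: "k \<le> 2" if k: "\<exists>fs. length fs = k \<and> set fs \<subseteq> ?m \<and> regular_sequence (coord_ring X) fs" for k
  proof (rule ccontr)
    assume "\<not> k \<le> 2"
    obtain fs where fs: "length fs = k" "set fs \<subseteq> ?m" "regular_sequence (coord_ring X) fs" using k by blast
    have "\<forall>x\<in>set fs. \<exists>f. x = residue ?I f" using fs(2) unfolding m by blast
    then obtain gs where gs: "fs = map (residue ?I) gs"
      by (metis (no_types, lifting) ex_map_conv)
    have len: "3 \<le> length gs" using fs(1) \<open>\<not> k \<le> 2\<close> gs by simp
    have reg: "\<And>i a. i < length gs \<Longrightarrow> a * gs ! i \<in> idl.span (?I \<union> set (take i gs)) \<Longrightarrow> a \<in> idl.span (?I \<union> set (take i gs))"
      and not_top: "idl.span (?I \<union> set gs) \<noteq> UNIV"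
      using fs(3) unfolding gs R regular_sequence_Quot[OF I] by blast+
    have spI: "idl.span ?I = ?I" using I by (simp add: idl.span_eq_iff)
    have t1: "set (take 1 gs) = {gs ! 0}" and t2: "set (take 2 gs) = {gs ! 0, gs ! 1}"
    proof -
      obtain x y zs where "gs = x # y # zs" using len by (auto simp: numeral_3_eq_3 Suc_le_length_iff)
      then show "set (take 1 gs) = {gs ! 0}" "set (take 2 gs) = {gs ! 0, gs ! 1}" by simp_all
    qed
    have "1 \<in> idl.span (?I \<union> {gs ! 0, gs ! 1, gs ! 2})"
    proof (rule no_regular_sequence_of_length_3[where f = "\<lambda>i. gs ! i", OF finW])
      fix a
      show "a * gs ! 0 \<in> ?I \<Longrightarrow> a \<in> ?I" using reg[of 0 a] len spI by force
      show "a * gs ! 1 \<in> idl.span (?I \<union> {gs ! 0}) \<Longrightarrow> a \<in> idl.span (?I \<union> {gs ! 0})"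
        using reg[of 1 a] len unfolding t1 by linarith
      show "a * gs ! 2 \<in> idl.span (?I \<union> {gs ! 0, gs ! 1}) \<Longrightarrow> a \<in> idl.span (?I \<union> {gs ! 0, gs ! 1})"
        using reg[of 2 a] len unfolding t2 by linarith
    qed
    moreover have "idl.span (?I \<union> {gs ! 0, gs ! 1, gs ! 2}) \<subseteq> idl.span (?I \<union> set gs)"
    proof (rule idl.span_mono)
      have "gs ! 0 \<in> set gs" "gs ! 1 \<in> set gs" "gs ! 2 \<in> set gs" using len by (auto intro!: nth_mem)
      then show "?I \<union> {gs ! 0, gs ! 1, gs ! 2} \<subseteq> ?I \<union> set gs" by blast
    qed
    ultimately have "1 \<in> idl.span (?I \<union> set gs)" by blast
    then have "f \<in> idl.span (?I \<union> set gs)" for f using idl.span_scale[of 1 "?I \<union> set gs" f] by simp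
    then show False using not_top by blast
  qed
  show ?thesis
    unfolding ACM_def depth_def by (rule Greatest_equality, rule two, rule le)
qed


section \<open>Bihomogeneous complete intersections are products\<close>

lemma representatives:
  assumes "Z \<subseteq> projective_space"
  shows "\<exists>u. \<forall>P\<in>Z. represents (u P) P"
proof -
  have "\<forall>P\<in>Z. \<exists>v. represents v P" using represents_exists assms by blast
  then show ?thesis by (rule bchoice)
qed

text \<open>
  Let \<open>(P, Q')\<close> and \<open>(P', Q)\<close> be points of \<open>X\<close> but not \<open>(P, Q)\<close>. For each point of \<open>X\<close> there is a linear form in one group of variables
  that vanishes at it but not at \<open>(P, Q)\<close>; the product of these forms is in the ideal. But all generators vanish at
  \<open>(P, Q)\<close>, since each involves only one of the two points.
\<close>

lemma product_of_split_generators: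
  fixes X :: "('k::field_char_0, 'a::finite, 'b::finite) bipoint set"
  assumes X: "finite X"
    and u: "\<forall>P\<in>fst ` X. represents (u P) P" and u': "\<forall>Q\<in>snd ` X. represents (u' Q) Q"
    and gen: "bivanishing ((\<lambda>(P, Q). (u P, u' Q)) ` X) = idl.span (A \<union> B)"
    and A: "\<forall>f\<in>A. \<exists>d. f \<in> bihom_part d 0" and B: "\<forall>f\<in>B. \<exists>d. f \<in> bihom_part 0 d"
  shows "X = fst ` X \<times> snd ` X"
proof
  show "X \<subseteq> fst ` X \<times> snd ` X" by force
  let ?W = "(\<lambda>(P, Q). (u P, u' Q)) ` X"
  show "fst ` X \<times> snd ` X \<subseteq> X"
  proof
    fix z assume "z \<in> fst ` X \<times> snd ` X"
    then obtain P Q P' Q' where z: "z = (P, Q)" "(P, Q') \<in> X" "(P', Q) \<in> X" by auto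
    show "z \<in> X"
    proof (rule ccontr)
      assume "z \<notin> X"
      have P: "represents (u P) P" by (rule bspec[OF u]) (use z(2) in force)
      have Q: "represents (u' Q) Q" by (rule bspec[OF u']) (use z(3) in force)
      have "\<exists>f. f \<in> bivanishing {(u R, u' S)} \<and> eval_pair (u P, u' Q) f \<noteq> 0" if RS: "(R, S) \<in> X" for R S
      proof -
        have R: "represents (u R) R" by (rule bspec[OF u]) (use RS in force)
        have S: "represents (u' S) S" by (rule bspec[OF u']) (use RS in force)
        consider "P \<noteq> R" | "Q \<noteq> S" using RS z(1) \<open>z \<notin> X\<close> by blast
        then show ?thesis
        proof cases
          case 1
          obtain l where l: "l \<in> hom_part 1" "eval_poly (u P) l \<noteq> 0" "eval_poly (u R) l = 0"
            using linear_form_separates[OF P R 1] by blast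
          show ?thesis
            using l bivanishing_bihom_iff[OF emb_Inl_bihom[OF l(1)], of "{(u R, u' S)}"]
            by (intro exI[of _ "emb Inl l"]) simp
        next
          case 2
          obtain l where l: "l \<in> hom_part 1" "eval_poly (u' Q) l \<noteq> 0" "eval_poly (u' S) l = 0"
            using linear_form_separates[OF Q S 2] by blast
          show ?thesis
            using l bivanishing_bihom_iff[OF emb_Inr_bihom[OF l(1)], of "{(u R, u' S)}"]
            by (intro exI[of _ "emb Inr l"]) simp
        qed
      qed
      then have "\<forall>p\<in>X. \<exists>f. f \<in> bivanishing {(u (fst p), u' (snd p))} \<and> eval_pair (u P, u' Q) f \<noteq> 0"
        by (metis prod.collapse)
      then obtain f where f: "\<And>p. p \<in> X \<Longrightarrow> f p \<in> bivanishing {(u (fst p), u' (snd p))}"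
        and f0: "\<And>p. p \<in> X \<Longrightarrow> eval_pair (u P, u' Q) (f p) \<noteq> 0"
        by (metis (no_types, lifting) bchoice)
      have "(\<Prod>p\<in>X. f p) \<in> bivanishing ?W"
      proof (rule bivanishingI)
        fix v w and c c' :: 'k assume "(v, w) \<in> ?W" and c: "c \<noteq> 0" "c' \<noteq> 0"
        then obtain p where p: "p \<in> X" "v = u (fst p)" "w = u' (snd p)" by auto
        have "eval_poly (case_sum (\<lambda>x. c * v x) (\<lambda>y. c' * w y)) (f p) = 0"
          by (rule bivanishingD[OF f[OF p(1)] _ c]) (simp add: p)
        then show "eval_poly (case_sum (\<lambda>x. c * v x) (\<lambda>y. c' * w y)) (\<Prod>p\<in>X. f p) = 0"
          using p(1) X by auto
      qed
      moreover have "idl.span (A \<union> B) \<subseteq> {f. eval_pair (u P, u' Q) f = 0}"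
      proof (rule idl.span_minimal)
        show "idl.subspace {f. eval_pair (u P, u' Q) f = 0}" by (simp add: idl.subspace_def)
        have W: "(u P, u' Q') \<in> ?W" "(u P', u' Q) \<in> ?W" using z by force+
        have zero: "eval_pair p f = 0" if "f \<in> A \<union> B" "f \<in> bihom_part i j" "p \<in> ?W" for f p i j
          using idl.span_base[OF that(1)] that(3) unfolding gen[symmetric] bivanishing_bihom_iff[OF that(2)] by blast
        show "A \<union> B \<subseteq> {f. eval_pair (u P, u' Q) f = 0}"
        proof
          fix f assume f: "f \<in> A \<union> B"
          then consider d where "f \<in> bihom_part d 0" | d where "f \<in> bihom_part 0 d" using A B by blast
          then have "eval_pair (u P, u' Q) f = 0"
          proof cases
            case 1
            have "eval_pair (u P, w) f = eval_poly (u P) (res Inl f)" for w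
              by (subst bihom_Inl(1)[OF 1, symmetric]) simp
            then show ?thesis using zero[OF f 1 W(1)] by simp
          next
            case 2
            have "eval_pair (v, u' Q) f = eval_poly (u' Q) (res Inr f)" for v
              by (subst bihom_Inr(1)[OF 2, symmetric]) simp
            then show ?thesis using zero[OF f 2 W(2)] by simp
          qed
          then show "f \<in> {f. eval_pair (u P, u' Q) f = 0}" by simp
        qed
      qed
      ultimately have "eval_pair (u P, u' Q) (\<Prod>p\<in>X. f p) = 0" using gen by blast
      then show False using f0 X by (simp add: eval_pair_def)
    qed
  qed
qed

lemma bivanishing_restrict_Inl:
  fixes V1 :: "('a::finite \<Rightarrow> 'k::field) set" and V2 :: "('b::finite \<Rightarrow> 'k) set"
  assumes gen: "bivanishing (V1 \<times> V2) = idl.span (A \<union> B)" and "V2 \<noteq> {}"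
    and A: "\<forall>f\<in>A. \<exists>d. f \<in> bihom_part d 0" and B: "\<forall>f\<in>B. res Inl f = 0"
  shows "vanishing V1 = idl.span (res Inl ` A)"
proof
  show "vanishing V1 \<subseteq> idl.span (res Inl ` A)"
  proof
    fix f assume "f \<in> vanishing V1"
    then have "emb Inl f \<in> idl.span (A \<union> B)"
      unfolding gen[symmetric] bivanishing_product by (intro idl.span_base) blast
    from morphism_span[OF ring_morphism_res this, of Inl] have "f \<in> idl.span (res Inl ` A \<union> res Inl ` B)"
      by (simp add: res_emb image_Un)
    moreover have "res Inl ` B \<subseteq> {0}" using B by blast
    ultimately show "f \<in> idl.span (res Inl ` A)" using span_without_zeros by blast
  qed
  show "idl.span (res Inl ` A) \<subseteq> vanishing V1"
  proof (rule idl.span_minimal[OF _ subspace_vanishing], rule image_subsetI)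
    fix f assume f: "f \<in> A"
    obtain d where d: "f \<in> bihom_part d 0" using A f by blast
    obtain w where w: "w \<in> V2" using assms(2) by blast
    have "f \<in> bivanishing (V1 \<times> V2)" unfolding gen using f by (intro idl.span_base) blast
    then have 0: "eval_pair (v, w) f = 0" if "v \<in> V1" for v using that w unfolding bivanishing_bihom_iff[OF d] by blast
    have "eval_pair (v, w) f = eval_poly v (res Inl f)" for v
      by (subst bihom_Inl(1)[OF d, symmetric]) simp
    then show "res Inl f \<in> vanishing V1" unfolding vanishing_hom_iff[OF bihom_Inl(2)[OF d]] using 0 by simp
  qed
qed

lemma bivanishing_restrict_Inr:
  fixes V1 :: "('a::finite \<Rightarrow> 'k::field) set" and V2 :: "('b::finite \<Rightarrow> 'k) set"
  assumes gen: "bivanishing (V1 \<times> V2) = idl.span (A \<union> B)" and "V1 \<noteq> {}"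
    and A: "\<forall>f\<in>A. res Inr f = 0" and B: "\<forall>f\<in>B. \<exists>d. f \<in> bihom_part 0 d"
  shows "vanishing V2 = idl.span (res Inr ` B)"
proof
  show "vanishing V2 \<subseteq> idl.span (res Inr ` B)"
  proof
    fix f assume "f \<in> vanishing V2"
    then have "emb Inr f \<in> idl.span (B \<union> A)"
      unfolding Un_commute[of B A] gen[symmetric] bivanishing_product by (intro idl.span_base) blast
    from morphism_span[OF ring_morphism_res this, of Inr] have "f \<in> idl.span (res Inr ` B \<union> res Inr ` A)"
      by (simp add: res_emb image_Un)
    moreover have "res Inr ` A \<subseteq> {0}" using A by blast
    ultimately show "f \<in> idl.span (res Inr ` B)" using span_without_zeros by blast
  qed
  show "idl.span (res Inr ` B) \<subseteq> vanishing V2"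
  proof (rule idl.span_minimal[OF _ subspace_vanishing], rule image_subsetI)
    fix f assume f: "f \<in> B"
    obtain d where d: "f \<in> bihom_part 0 d" using B f by blast
    obtain v where v: "v \<in> V1" using assms(2) by blast
    have "f \<in> bivanishing (V1 \<times> V2)" unfolding gen using f by (intro idl.span_base) blast
    then have 0: "eval_pair (v, w) f = 0" if "w \<in> V2" for w using that v unfolding bivanishing_bihom_iff[OF d] by blast
    have "eval_pair (v, w) f = eval_poly w (res Inr f)" for w
      by (subst bihom_Inr(1)[OF d, symmetric]) simp
    then show "res Inr f \<in> vanishing V2" unfolding vanishing_hom_iff[OF bihom_Inr(2)[OF d]] using 0 by simp
  qed
qed

text \<open>
  Apply the embedding, use regularity in the larger ring, and apply the retraction, which kills the elements of
  \<open>hs\<close>.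
\<close>

lemma regular_list_restrict:
  fixes e :: "'v::finite \<Rightarrow> 'w::finite" and fs hs :: "('w, 'k::comm_ring_1) mpolynomial list"
  assumes e: "inj e" and reg: "regular_list (hs @ fs)"
    and fs: "\<forall>f\<in>set fs. emb e (res e f) = f" and hs: "\<forall>f\<in>set hs. res e f = 0"
  shows "regular_list (map (res e) fs)"
  unfolding regular_list_def
proof (intro allI impI)
  fix i a assume "i < length (map (res e) fs)"
    and a: "a * map (res e) fs ! i \<in> idl.span (set (take i (map (res e) fs)))"
  then have i: "i < length fs" by simp
  have set_eq: "set (take i (map (res e) fs)) = res e ` set (take i fs)" by (simp add: take_map)
  have take_eq: "set (take (length hs + i) (hs @ fs)) = set (take i fs) \<union> set hs" by auto
  have "emb e ` res e ` set (take i fs) = set (take i fs)"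
    using fs set_take_subset[of i fs] by (force simp: image_image)
  with morphism_span[OF ring_morphism_emb a[unfolded set_eq], of e]
  have "emb e (a * res e (fs ! i)) \<in> idl.span (set (take i fs))" using i by simp
  then have "emb e a * fs ! i \<in> idl.span (set (take i fs))" using fs i by simp
  then have "emb e a * (hs @ fs) ! (length hs + i) \<in> idl.span (set (take (length hs + i) (hs @ fs)))"
    unfolding take_eq using idl.span_mono[OF Un_upper1] by (auto simp: nth_append)
  then have "emb e a \<in> idl.span (set (take i fs) \<union> set hs)"
    using regular_listD[OF reg, of "length hs + i" "emb e a"] i unfolding take_eq by simp
  from morphism_span[OF ring_morphism_res this, of e]
  have "a \<in> idl.span (res e ` set (take i fs) \<union> res e ` set hs)" by (simp add: res_emb[OF e] image_Un)
  moreover have "res e ` set hs \<subseteq> {0}" using hs by blast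
  ultimately show "a \<in> idl.span (set (take i (map (res e) fs)))"
    unfolding set_eq using span_without_zeros by blast
qed

lemma regular_list_product:
  fixes fs :: "('a::finite, 'k::field) mpolynomial list" and gs :: "('b::finite, 'k) mpolynomial list"
  assumes fs: "regular_list fs" and gs: "regular_list gs"
  shows "regular_list (map (emb Inl) fs @ map (emb Inr) gs :: ('a + 'b, 'k) mpolynomial list)"
  unfolding regular_list_def
proof (intro allI impI)
  let ?l = "map (emb Inl) fs @ map (emb Inr) gs :: ('a + 'b, 'k) mpolynomial list"
  fix i a assume i: "i < length ?l" and a: "a * ?l ! i \<in> idl.span (set (take i ?l))"
  show "a \<in> idl.span (set (take i ?l))"
  proof (cases "i < length fs")
    case True
    have "set (take i ?l) = emb Inl ` set (take i fs)" using True by (simp add: take_map)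
    then have eq: "idl.span (set (take i ?l)) = idl.span (emb Inl ` idl.span (set (take i fs)))"
      using span_emb[of "Inl :: 'a \<Rightarrow> 'a + 'b" "set (take i fs)" Inl "set (take i fs)"] by simp
    have "a * emb Inl (fs ! i) \<in> idl.span (emb Inl ` idl.span (set (take i fs)))"
      using a True unfolding eq by (simp add: nth_append)
    from nonzerodivisor_Inl[OF idl.subspace_span regular_listD[OF fs True] this]
    show ?thesis unfolding eq .
  next
    case False
    define j where "j = i - length fs"
    have j: "i = length fs + j" "j < length gs" using False i by (auto simp: j_def)
    have "set (take i ?l) = emb Inl ` set fs \<union> emb Inr ` set (take j gs)" by (simp add: j take_map)
    then have eq: "idl.span (set (take i ?l)) = idl.span (emb Inl ` idl.span (set fs) \<union> emb Inr ` idl.span (set (take j gs)))"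
      by (simp add: span_emb)
    have a': "a * emb Inr (gs ! j) \<in> idl.span (emb Inl ` idl.span (set fs) \<union> emb Inr ` idl.span (set (take j gs)))"
      using a j unfolding eq by (simp add: nth_append)
    show ?thesis
      unfolding eq
    proof (rule nonzerodivisor_Inr[OF idl.subspace_span idl.subspace_span _ a'])
      show "h \<in> idl.span (set (take j gs))" if "h * gs ! j \<in> idl.span (set (take j gs))" for h
        using regular_listD[OF gs j(2) that] .
    qed
  qed
qed

lemma bi_complete_intersection_imp_product:
  fixes X :: "('k::field_char_0, 'm::finite option, 'n::finite option) bipoint set"
  assumes X: "X \<subseteq> projective_space \<times> projective_space" "finite X" "X \<noteq> {}"
    and ds: "\<forall>d\<in>set ds. d \<ge> 1" "\<forall>d\<in>set ds'. d \<ge> 1" and ci: "bi_complete_intersection X ds ds'"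
  shows "X = fst ` X \<times> snd ` X \<and> complete_intersection (fst ` X) ds \<and> complete_intersection (snd ` X) ds'"
proof -
  obtain u where u: "\<forall>P\<in>fst ` X. represents (u P) P" using representatives[of "fst ` X"] X(1) by force
  obtain u' where u': "\<forall>Q\<in>snd ` X. represents (u' Q) Q" using representatives[of "snd ` X"] X(1) by force
  let ?W = "(\<lambda>(P, Q). (u P, u' Q)) ` X"
  obtain Fs Gs where F: "list_all2 (\<lambda>F d. F \<in> bihom_part d 0) Fs ds"
    and G: "list_all2 (\<lambda>G d. G \<in> bihom_part 0 d) Gs ds'"
    and reg: "regular_list (Fs @ Gs)" and I: "bi_vanishing_ideal X = idl.span (set Fs \<union> set Gs)"
    and len: "length ds = CARD('m)" "length ds' = CARD('n)"
    using ci unfolding bi_complete_intersection_def regular_sequence_iff genideal_poly_ring set_append by blast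
  have "bi_vanishing_ideal X = bivanishing ?W" by (rule bi_vanishing_ideal_eq) (use u u' in force)
  with I have gen: "bivanishing ?W = idl.span (set Fs \<union> set Gs)" by simp
  have F': "\<exists>d\<ge>1. f \<in> bihom_part d 0" if "f \<in> set Fs" for f
    using that F ds(1) by (metis in_set_conv_nth list_all2_conv_all_nth nth_mem)
  have G': "\<exists>d\<ge>1. f \<in> bihom_part 0 d" if "f \<in> set Gs" for f
    using that G ds(2) by (metis in_set_conv_nth list_all2_conv_all_nth nth_mem)
  have prod: "X = fst ` X \<times> snd ` X"
    by (rule product_of_split_generators[OF X(2) u u' gen]) (use F' G' in blast)+
  have "?W = u ` fst ` X \<times> u' ` snd ` X" by (subst (1) prod) auto
  with gen have gen': "bivanishing (u ` fst ` X \<times> u' ` snd ` X) = idl.span (set Fs \<union> set Gs)" by simp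
  have F0: "res Inr f = 0" if "f \<in> set Fs" for f using F'[OF that] res_Inr_bihom_0 by blast
  have G0: "res Inl f = 0" if "f \<in> set Gs" for f using G'[OF that] res_Inl_bihom_0 by blast
  have I1: "vanishing (u ` fst ` X) = idl.span (set (map (res Inl) Fs))"
    unfolding set_map by (rule bivanishing_restrict_Inl[OF gen']) (use X(3) F' G0 in blast)+
  have I2: "vanishing (u' ` snd ` X) = idl.span (set (map (res Inr) Gs))"
    unfolding set_map by (rule bivanishing_restrict_Inr[OF gen']) (use X(3) G' F0 in blast)+
  have ne: "u ` fst ` X \<noteq> {}" "u' ` snd ` X \<noteq> {}" using X(3) by auto
  have "complete_intersection (fst ` X) ds"
    unfolding complete_intersection_def regular_sequence_iff genideal_poly_ring
  proof (intro conjI exI[of _ "map (res Inl) Fs"])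
    show "list_all2 (\<lambda>F d. F \<in> hom_part d) (map (res Inl) Fs) ds"
      using F by (auto simp: list_all2_conv_all_nth intro: bihom_Inl(2))
    show "regular_list (map (res Inl) Fs)"
    proof (rule regular_list_restrict[where hs = "[]"])
      show "regular_list ([] @ Fs)" using regular_list_append1[OF reg] by simp
      show "\<forall>f\<in>set Fs. emb Inl (res Inl f) = f" using F' bihom_Inl(1) by blast
    qed simp_all
    show "idl.span (set (map (res Inl) Fs)) \<noteq> UNIV" using vanishing_proper[OF ne(1)] I1 by simp
    show "proj_vanishing_ideal (fst ` X) = idl.span (set (map (res Inl) Fs))"
      using proj_vanishing_ideal_eq[OF u] I1 by simp
  qed (rule len)
  moreover have "complete_intersection (snd ` X) ds'"
    unfolding complete_intersection_def regular_sequence_iff genideal_poly_ring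
  proof (intro conjI exI[of _ "map (res Inr) Gs"])
    show "list_all2 (\<lambda>F d. F \<in> hom_part d) (map (res Inr) Gs) ds'"
      using G by (auto simp: list_all2_conv_all_nth intro: bihom_Inr(2))
    show "regular_list (map (res Inr) Gs)"
    proof (rule regular_list_restrict[OF _ reg])
      show "\<forall>f\<in>set Gs. emb Inr (res Inr f) = f" using G' bihom_Inr(1) by blast
      show "\<forall>f\<in>set Fs. res Inr f = 0" using F0 by blast
    qed simp
    show "idl.span (set (map (res Inr) Gs)) \<noteq> UNIV" using vanishing_proper[OF ne(2)] I2 by simp
    show "proj_vanishing_ideal (snd ` X) = idl.span (set (map (res Inr) Gs))"
      using proj_vanishing_ideal_eq[OF u'] I2 by simp
  qed (rule len)
  ultimately show ?thesis using prod by blast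
qed

lemma product_imp_bi_complete_intersection:
  fixes X :: "('k::field_char_0, 'm::finite option, 'n::finite option) bipoint set"
  assumes X: "X \<subseteq> projective_space \<times> projective_space" "X \<noteq> {}"
    and prod: "X = fst ` X \<times> snd ` X"
    and ci: "complete_intersection (fst ` X) ds" "complete_intersection (snd ` X) ds'"
  shows "bi_complete_intersection X ds ds'"
proof -
  obtain u where u: "\<forall>P\<in>fst ` X. represents (u P) P" using representatives[of "fst ` X"] X(1) by force
  obtain u' where u': "\<forall>Q\<in>snd ` X. represents (u' Q) Q" using representatives[of "snd ` X"] X(1) by force
  let ?W = "(\<lambda>(P, Q). (u P, u' Q)) ` X"
  let ?V1 = "u ` fst ` X" and ?V2 = "u' ` snd ` X"
  have W: "?W = ?V1 \<times> ?V2" by (subst (1) prod) auto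
  have "bi_vanishing_ideal X = bivanishing ?W" by (rule bi_vanishing_ideal_eq) (use u u' in force)
  then have IX: "bi_vanishing_ideal X = bivanishing (?V1 \<times> ?V2)" unfolding W .
  obtain Fs where F: "list_all2 (\<lambda>F d. F \<in> hom_part d) Fs ds" "regular_list Fs"
    "proj_vanishing_ideal (fst ` X) = idl.span (set Fs)" and len: "length ds = CARD('m)"
    using ci(1) unfolding complete_intersection_def regular_sequence_iff genideal_poly_ring by blast
  obtain Gs where G: "list_all2 (\<lambda>F d. F \<in> hom_part d) Gs ds'" "regular_list Gs"
    "proj_vanishing_ideal (snd ` X) = idl.span (set Gs)" and len': "length ds' = CARD('n)"
    using ci(2) unfolding complete_intersection_def regular_sequence_iff genideal_poly_ring by blast
  let ?Fs = "map (emb Inl) Fs :: ('m option + 'n option, 'k) mpolynomial list"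
  let ?Gs = "map (emb Inr) Gs :: ('m option + 'n option, 'k) mpolynomial list"
  have I: "bi_vanishing_ideal X = idl.span (set (?Fs @ ?Gs))"
    unfolding IX bivanishing_product proj_vanishing_ideal_eq[OF u, symmetric] proj_vanishing_ideal_eq[OF u', symmetric] F(3) G(3)
    by (simp add: span_emb)
  show ?thesis
    unfolding bi_complete_intersection_def regular_sequence_iff genideal_poly_ring
  proof (rule conjI[OF len], rule conjI[OF len'], rule exI[of _ ?Fs], rule exI[of _ ?Gs], intro conjI)
    show "list_all2 (\<lambda>F d. F \<in> bihom_part d 0) ?Fs ds"
      using F(1) by (auto simp: list_all2_conv_all_nth intro: emb_Inl_bihom)
    show "list_all2 (\<lambda>F d. F \<in> bihom_part 0 d) ?Gs ds'"
      using G(1) by (auto simp: list_all2_conv_all_nth intro: emb_Inr_bihom)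
    show "regular_list (?Fs @ ?Gs)" by (rule regular_list_product[OF F(2) G(2)])
    show "idl.span (set (?Fs @ ?Gs)) \<noteq> UNIV"
      unfolding I[symmetric] IX by (rule bivanishing_proper) (use X(2) in auto)
    show "bi_vanishing_ideal X = idl.span (set (?Fs @ ?Gs))" by (rule I)
  qed
qed


section \<open>Maximal minors\<close>

text \<open>
  The Cauchy-Binet expansion before equal terms are collected: rows that are combinations of given rows, multiplied out.
\<close>

lemma det_combinations:
  fixes c :: "'i::finite \<Rightarrow> 'b \<Rightarrow> 'a::comm_ring_1" and M :: "'b \<Rightarrow> 'i \<Rightarrow> 'a"
  assumes S: "finite S"
  shows "det (\<chi> i j. \<Sum>k\<in>S. c i k * M k j) =
    (\<Sum>f\<in>(UNIV :: 'i set) \<rightarrow>\<^sub>E S. (\<Prod>i\<in>UNIV. c i (f i)) * det (\<chi> i j. M (f i) j))"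
proof -
  have "(\<Prod>i\<in>UNIV. \<Sum>k\<in>S. c i k * M k (p i)) =
      (\<Sum>f\<in>(UNIV :: 'i set) \<rightarrow>\<^sub>E S. (\<Prod>i\<in>UNIV. c i (f i)) * (\<Prod>i\<in>UNIV. M (f i) (p i)))" for p
    using S by (simp add: prod_sum_PiE prod.distrib)
  then show ?thesis
    by (simp add: det_def sum_distrib_left sum.swap[of _ "_ \<rightarrow>\<^sub>E _"] mult_ac)
qed

lemma det_0_if_not_inj:
  fixes M :: "'b \<Rightarrow> 'i::finite \<Rightarrow> 'a::comm_ring_1"
  assumes "\<not> inj f"
  shows "det (\<chi> i j. M (f i) j) = 0"
proof -
  obtain i i' where "i \<noteq> i'" "f i = f i'" using assms unfolding inj_def by blast
  then show ?thesis by (intro det_identical_rows[of i i']) (simp_all add: row_def)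
qed

text \<open>
  Some rows of an inverse of \<open>L\<close> show that the chosen columns of \<open>L\<close> have a left inverse, so the expansion of \<open>det 1 = 1\<close>
  contains a nonzero minor of these columns.
\<close>

lemma select_rows:
  fixes L :: "'k::field^'i::finite^'i" and c :: "'l::finite \<Rightarrow> 'i"
  assumes L: "det L \<noteq> 0" and c: "inj c"
  shows "\<exists>f :: 'l \<Rightarrow> 'i. inj f \<and> det (\<chi> i j. L $ f i $ c j) \<noteq> 0"
proof -
  have "invertible L" using L by (simp add: invertible_det_nz)
  then obtain U where U: "U ** L = mat 1" unfolding invertible_left_inverse by blast
  have "(\<Sum>k\<in>UNIV. U $ c i $ k * L $ k $ c j) = (if i = j then 1 else 0)" for i j
  proof -
    have "(U ** L) $ c i $ c j = (mat 1 :: 'k^'i^'i) $ c i $ c j" by (simp only: U)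
    then show ?thesis using c by (simp add: matrix_matrix_mult_def mat_def inj_eq)
  qed
  then have "(\<chi> i j. \<Sum>k\<in>UNIV. U $ c i $ k * L $ k $ c j) = (mat 1 :: 'k^'l^'l)"
    by (simp add: vec_eq_iff mat_def)
  then have "det (\<chi> i j. \<Sum>k\<in>UNIV. U $ c i $ k * L $ k $ c j :: 'k^'l^'l) \<noteq> 0" by simp
  then have "\<exists>f\<in>(UNIV :: 'l set) \<rightarrow>\<^sub>E (UNIV :: 'i set). (\<Prod>i\<in>UNIV. U $ c i $ f i) * det (\<chi> i j. L $ f i $ c j) \<noteq> 0"
    unfolding det_combinations[OF finite, where M = "\<lambda>k j. L $ k $ c j"] by (meson sum.neutral)
  then obtain f :: "'l \<Rightarrow> 'i" where f: "det (\<chi> i j. L $ f i $ c j) \<noteq> 0" by auto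
  have "inj f"
  proof (rule ccontr)
    assume "\<not> inj f"
    from det_0_if_not_inj[OF this, of "\<lambda>k j. L $ k $ c j"] f show False by simp
  qed
  with f show ?thesis by blast
qed

lemma prod_cong_ideal:
  fixes f g :: "'i \<Rightarrow> 'a::comm_ring_1"
  assumes J: "idl.subspace J" and fg: "\<And>i. i \<in> A \<Longrightarrow> f i - g i \<in> J"
  shows "prod f A - prod g A \<in> J"
  using fg
proof (induction A rule: infinite_finite_induct)
  case (insert x A)
  have "prod f (insert x A) - prod g (insert x A) = prod f A * (f x - g x) + g x * (prod f A - prod g A)"
    using insert by (simp add: algebra_simps)
  also have "\<dots> \<in> J" using insert by (intro idl.subspace_add[OF J] idl.subspace_scale[OF J]) auto
  finally show ?case .
qed (simp_all add: idl.subspace_0[OF J])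

lemma det_cong_ideal:
  fixes A B :: "'a::comm_ring_1^'i::finite^'i"
  assumes J: "idl.subspace J" and AB: "\<And>i j. A $ i $ j - B $ i $ j \<in> J"
  shows "det A - det B \<in> J"
proof -
  have "det A - det B = (\<Sum>p\<in>{p. p permutes UNIV}. of_int (sign p) * ((\<Prod>i\<in>UNIV. A $ i $ p i) - (\<Prod>i\<in>UNIV. B $ i $ p i)))"
    by (simp add: det_def sum_subtractf right_diff_distrib)
  also have "\<dots> \<in> J" by (intro idl.subspace_sum[OF J] idl.subspace_scale[OF J] prod_cong_ideal[OF J] AB)
  finally show ?thesis .
qed

text \<open>
  The product rule makes the rows of the Jacobian matrix of \<open>H\<close> congruent to combinations of the rows for the
  generators, modulo the ideal that these generate.
\<close>

lemma jacobian_in_minor_ideal: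
  fixes B :: "('m::finite option + 'n::finite option, 'k::comm_ring_1) mpolynomial set"
  assumes J: "idl.subspace J" and B: "finite B" "B \<subseteq> J" "jacobian_minors B \<subseteq> J"
    and H: "\<And>k :: 'm + 'n. H k \<in> idl.span B"
  shows "det (\<chi> k c. partial_deriv (map_sum Some Some c) (H k)) \<in> J"
proof -
  have "\<forall>k. \<exists>c. H k = (\<Sum>b\<in>B. c b * b)"
    by (rule allI, rule span_image_finite[OF B(1), of _ "\<lambda>b. b", unfolded image_ident, OF H])
  from choice[OF this] obtain c where c: "\<forall>k. H k = (\<Sum>b\<in>B. c k b * b)" by (rule exE)
  let ?d = "\<lambda>x b. partial_deriv (map_sum Some Some x) b"
  have "?d x (H k) - (\<Sum>b\<in>B. c k b * ?d x b) = (\<Sum>b\<in>B. ?d x (c k b) * b)" for x and k :: "'m + 'n"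
    by (subst c[rule_format]) (simp add: partial_deriv_sum partial_deriv_mult sum.distrib)
  also have "(\<Sum>b\<in>B. ?d x (c k b) * b) \<in> J" for x and k :: "'m + 'n"
    using B(2) by (intro idl.subspace_sum[OF J] idl.subspace_scale[OF J]) blast
  finally have "det (\<chi> k x. ?d x (H k)) - det (\<chi> k x. \<Sum>b\<in>B. c k b * ?d x b) \<in> J"
    by (intro det_cong_ideal[OF J]) simp
  moreover have "det (\<chi> k x. \<Sum>b\<in>B. c k b * ?d x b) \<in> J"
    unfolding det_combinations[OF B(1), where M = "\<lambda>b x. ?d x b"]
  proof (intro idl.subspace_sum[OF J] idl.subspace_scale[OF J])
    fix f assume f: "f \<in> (UNIV :: ('m + 'n) set) \<rightarrow>\<^sub>E B"
    show "det (\<chi> k x. ?d x (f k)) \<in> J"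
    proof (cases "inj f")
      case True
      have "range f \<subseteq> B" using f by (auto simp: PiE_def Pi_def)
      then have "det (\<chi> k x. ?d x (f k)) \<in> jacobian_minors B"
        unfolding jacobian_minors_def using True by blast
      then show ?thesis using B(3) by blast
    next
      case False
      from det_0_if_not_inj[OF this, of "\<lambda>b x. ?d x b"] show ?thesis by (simp add: idl.subspace_0[OF J])
    qed
  qed
  ultimately have "(det (\<chi> k x. ?d x (H k)) - det (\<chi> k x. \<Sum>b\<in>B. c k b * ?d x b)) + det (\<chi> k x. \<Sum>b\<in>B. c k b * ?d x b) \<in> J"
    by (rule idl.subspace_add[OF J])
  then show ?thesis by simp
qed

lemma bigraded_det:
  fixes H :: "'m::finite + 'n::finite \<Rightarrow> ('m option + 'n option, 'k::comm_ring_1) mpolynomial"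
  assumes H: "\<And>k. H k \<in> bihom_part (\<alpha> k) (\<beta> k)"
  shows "det (\<chi> k c. partial_deriv (map_sum Some Some c) (H k)) \<in>
    bihom_part (sum \<alpha> UNIV - CARD('m)) (sum \<beta> UNIV - CARD('n))"
proof -
  let ?A = "\<chi> k c. partial_deriv (map_sum Some Some c) (H k)"
  have *: "det ?A \<in> part w (sum \<gamma> UNIV - (\<Sum>c\<in>UNIV. w (map_sum Some Some c)))" if "\<And>k. H k \<in> part w (\<gamma> k)" for w \<gamma>
  proof (rule det_part)
    show "?A $ k $ c \<in> part w (\<gamma> k - w (map_sum Some Some c))" for k c
      using partial_deriv_part(1)[OF that] by simp
    show "?A $ k $ c = 0" if "\<gamma> k < w (map_sum Some Some c)" for k c
      using partial_deriv_part(2)[OF \<open>\<And>k. H k \<in> part w (\<gamma> k)\<close> that] by simp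
  qed
  have "det ?A \<in> part wX (sum \<alpha> UNIV - (\<Sum>c\<in>(UNIV :: ('m + 'n) set). wX (map_sum Some Some c)))"
    by (rule *) (use H in \<open>simp add: bihom_part_eq\<close>)
  moreover have "det ?A \<in> part wY (sum \<beta> UNIV - (\<Sum>c\<in>(UNIV :: ('m + 'n) set). wY (map_sum Some Some c)))"
    by (rule *) (use H in \<open>simp add: bihom_part_eq\<close>)
  ultimately show ?thesis by (simp add: bihom_part_eq sum_UNIV_Plus)
qed

lemma partial_deriv_emb:
  fixes e :: "'v::finite \<Rightarrow> 'w::finite" and f :: "('v, 'k::comm_semiring_1) mpolynomial"
  assumes "inj e"
  shows "partial_deriv z (emb e f) = (if z \<in> range e then emb e (partial_deriv (inv_into UNIV e z) f) else 0)"
proof (induction f rule: mpolynomial_induct)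
  case (Var f x)
  then show ?case
    using assms by (auto simp: partial_deriv_mult_Var inj_eq)
qed (auto simp: partial_deriv_add)

text \<open>
  The matrix is block diagonal, so its kernel is trivial if the kernels of both blocks are.
\<close>

lemma jacobian_of_product_nonzero:
  fixes F :: "'m::finite \<Rightarrow> ('m option, 'k::field) mpolynomial" and G :: "'n::finite \<Rightarrow> ('n option, 'k) mpolynomial"
  assumes F: "jacobian_at F p \<noteq> 0" and G: "jacobian_at G q \<noteq> 0"
  shows "eval_pair (p, q) (det (\<chi> k c. partial_deriv (map_sum Some Some c) (case_sum (\<lambda>i. emb Inl (F i)) (\<lambda>j. emb Inr (G j)) k))) \<noteq> 0"
proof -
  let ?N1 = "\<chi> i j. eval_poly p (partial_deriv (Some j) (F i))"
  let ?N2 = "\<chi> i j. eval_poly q (partial_deriv (Some j) (G i))"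
  let ?H = "case_sum (\<lambda>i. emb Inl (F i)) (\<lambda>j. emb Inr (G j)) :: 'm + 'n \<Rightarrow> ('m option + 'n option, 'k) mpolynomial"
  let ?N = "\<chi> k c. eval_pair (p, q) (partial_deriv (map_sum Some Some c) (?H k))"
  have ent: "?N $ Inl i $ Inl j = ?N1 $ i $ j" "?N $ Inl i $ Inr j' = 0" "?N $ Inr i' $ Inl j = 0" "?N $ Inr i' $ Inr j' = ?N2 $ i' $ j'"
    for i j i' j'
    by (auto simp: partial_deriv_emb)
  have "x = 0" if x: "?N *v x = 0" for x
  proof -
    have "?N1 *v (\<chi> j. x $ Inl j) = 0"
    proof (rule vec_eq_iff[THEN iffD2], rule allI)
      fix i
      have "(?N *v x) $ Inl i = (?N1 *v (\<chi> j. x $ Inl j)) $ i"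
        unfolding matrix_vector_mult_def vec_lambda_beta sum_UNIV_Plus
        using ent(1,2)[of i] by simp
      then show "(?N1 *v (\<chi> j. x $ Inl j)) $ i = 0 $ i" using x by simp
    qed
    then have 1: "(\<chi> j. x $ Inl j) = 0" using det_eq_0_if_kernel F unfolding jacobian_at_def by blast
    have "?N2 *v (\<chi> j. x $ Inr j) = 0"
    proof (rule vec_eq_iff[THEN iffD2], rule allI)
      fix i
      have "(?N *v x) $ Inr i = (?N2 *v (\<chi> j. x $ Inr j)) $ i"
        unfolding matrix_vector_mult_def vec_lambda_beta sum_UNIV_Plus
        using ent(3,4)[of i] by simp
      then show "(?N2 *v (\<chi> j. x $ Inr j)) $ i = 0 $ i" using x by simp
    qed
    then have 2: "(\<chi> j. x $ Inr j) = 0" using det_eq_0_if_kernel G unfolding jacobian_at_def by blast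
    have "x $ c = 0" for c
      using 1 2 by (cases c) (simp_all add: vec_eq_iff)
    then show ?thesis by (simp add: vec_eq_iff)
  qed
  then have "invertible ?N" unfolding invertible_left_inverse matrix_left_invertible_ker by blast
  then have "det ?N \<noteq> 0" by (simp add: invertible_det_nz)
  moreover have "eval_pair (p, q) (det (\<chi> k c. partial_deriv (map_sum Some Some c) (?H k))) = det ?N"
    unfolding eval_pair_def by (subst ring_morphism_det[OF ring_morphism_eval]) simp
  ultimately show ?thesis by simp
qed

text \<open>
  Take the component of bidegree \<open>(i, j)\<close> in an expression of \<open>f\<close> by the generators: generators of larger bidegree do not contribute.
\<close>

lemma small_bidegree_generator:
  fixes A :: "('a::finite + 'b::finite, 'k::field) mpolynomial set"
  assumes A: "\<And>x. x \<in> A \<Longrightarrow> x \<in> bihom_part (\<alpha> x) (\<beta> x)"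
    and f: "f \<in> idl.span A" "f \<in> bihom_part i j" "eval_pair p f \<noteq> 0"
  shows "\<exists>x\<in>A. \<alpha> x \<le> i \<and> \<beta> x \<le> j \<and> eval_pair p x \<noteq> 0"
proof (rule ccontr)
  assume no: "\<not> ?thesis"
  have "eval_pair p (component wX i (component wY j f)) = 0"
    using f(1)
  proof (induction f rule: idl.span_induct_alt)
    case base
    then show ?case by simp
  next
    case (step c x y)
    have x: "x \<in> part wX (\<alpha> x)" "x \<in> part wY (\<beta> x)" using A[OF step(1)] by (simp_all add: bihom_part_eq)
    have "component wX i (component wY j (c * x)) =
        (if \<beta> x \<le> j then if \<alpha> x \<le> i then component wX (i - \<alpha> x) (component wY (j - \<beta> x) c) * x else 0 else 0)"
      by (cases "\<beta> x \<le> j"; cases "\<alpha> x \<le> i")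
        (simp_all only: component_mult_part[OF x(2)] component_mult_part[OF x(1)] component_0 if_True if_False)
    then have "eval_pair p (component wX i (component wY j (c * x))) = 0" using no step(1) by auto
    with step(2) show ?case by (simp only: component_add eval_pair_simps(1) add_0)
  qed
  moreover have "component wX i (component wY j f) = f"
  proof -
    have "f \<in> part wX i" "f \<in> part wY j" using f(2) by (simp_all add: bihom_part_eq)
    then show ?thesis by (simp only: component_part refl if_True)
  qed
  ultimately show False using f(3) by simp
qed


section \<open>Specializing one group of variables\<close>

text \<open>
  For \<open>e = Inl\<close> this restricts a polynomial to the fibre over a point of the second factor, for
  \<open>e = Inr\<close> to the fibre over a point of the first.
\<close>

definition specialize ::
  "('v \<Rightarrow> 'w) \<Rightarrow> ('w \<Rightarrow> 'k) \<Rightarrow> ('w::finite, 'k::comm_semiring_1) mpolynomial \<Rightarrow> ('v::finite, 'k) mpolynomial" where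
  "specialize e s = insertion Const (\<lambda>z. if z \<in> range e then Var (inv_into UNIV e z) else Const (s z))"

lemma ring_morphism_specialize: "ring_morphism (specialize e s)"
  unfolding specialize_def by (rule ring_morphism_insertion) simp

lemmas specialize_simps = ring_morphismD[OF ring_morphism_specialize]

lemma specialize_Const [simp]: "specialize e s (Const c) = Const c"
  by (simp add: specialize_def insertion_Const)

lemma specialize_Var [simp]:
  "specialize e s (Var z) = (if z \<in> range e then Var (inv_into UNIV e z) else Const (s z))"
  by (simp add: specialize_def insertion_Var)

lemma eval_specialize:
  "eval_poly v (specialize e s f) = eval_poly (\<lambda>z. if z \<in> range e then v (inv_into UNIV e z) else s z) f"
  unfolding specialize_def eval_insertion_Const
  by (rule arg_cong[where f = "\<lambda>a. eval_poly a f"]) auto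

lemma specialize_hom:
  "f \<in> part (\<lambda>z. if z \<in> range e then 1 else 0) d \<Longrightarrow> specialize e s f \<in> hom_part d"
  for f :: "('w::finite, 'k::comm_semiring_1) mpolynomial" and e :: "'v::finite \<Rightarrow> 'w"
  unfolding specialize_def hom_part_eq
  by (rule part_insertion) (use part_Var[of _ "\<lambda>_. 1"] in auto)

lemma partial_deriv_specialize:
  fixes e :: "'v::finite \<Rightarrow> 'w::finite"
  assumes e: "inj e"
  shows "partial_deriv x (specialize e s f) = specialize e s (partial_deriv (e x) f)"
proof (induction f rule: mpolynomial_induct)
  case (Var f z)
  show ?case
  proof (cases "z \<in> range e")
    case True
    then obtain y where y: "z = e y" by blast
    then show ?thesis using e Var by (simp add: specialize_simps partial_deriv_mult_Var inj_eq)
  next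
    case False
    then have "e x \<noteq> z" by blast
    then show ?thesis using False Var by (simp add: specialize_simps partial_deriv_mult partial_deriv_Var)
  qed
qed (simp_all add: partial_deriv_add specialize_simps)

text \<open>
  Among the rows of a nonvanishing minor, select as many as there are variables in one group so that their gradients in this
  group are independent. Their degrees add up to at most those of all rows, so that the specialized rows satisfy
  the degree bound.
\<close>

lemma ci_of_specialized_rows:
  fixes V :: "('l::finite option \<Rightarrow> 'k::field_char_0) set" and e :: "'l option \<Rightarrow> 'w::finite"
    and R :: "'i::finite \<Rightarrow> ('w, 'k) mpolynomial"
  assumes V: "finite V" "\<forall>q\<in>V. q None = 1" and e: "inj e"
    and p: "(\<lambda>x. s (e x)) \<in> V" and c: "inj c" "\<And>j. \<kappa> (c j) = e (Some j)"
    and det: "det (\<chi> k j. eval_poly s (partial_deriv (\<kappa> j) (R k)) :: 'k^'i^'i) \<noteq> 0"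
    and R: "\<And>k. R k \<in> part (\<lambda>z. if z \<in> range e then 1 else 0) (\<alpha> k)"
    and zero: "\<And>v k. v \<in> V \<Longrightarrow> eval_poly (\<lambda>z. if z \<in> range e then v (inv_into UNIV e z) else s z) (R k) = 0"
    and deg: "sum \<alpha> UNIV - CARD('l) \<le> r" and nosep: "\<And>q d g. q \<in> V \<Longrightarrow> d < r \<Longrightarrow> \<not> separator V q d g"
  shows "\<exists>P a. (\<forall>i :: 'l. P i \<in> hom_part (a i) \<and> 1 \<le> a i) \<and> idl.span (range P) = vanishing V \<and>
    (\<forall>q\<in>V. jacobian_at P q \<noteq> 0)"
proof -
  let ?L = "\<chi> k j. eval_poly s (partial_deriv (\<kappa> j) (R k)) :: 'k^'i^'i"
  obtain f :: "'l \<Rightarrow> 'i" where f: "inj f" "det (\<chi> i j. ?L $ f i $ c j) \<noteq> 0" using select_rows[OF det c(1)] by blast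
  define P where "P i = specialize e s (R (f i))" for i
  have "eval_poly (\<lambda>x. s (e x)) (partial_deriv (Some j) (P i)) = ?L $ f i $ c j" for i j
  proof -
    have "(\<lambda>z. if z \<in> range e then s (e (inv_into UNIV e z)) else s z) = s"
      by (auto simp: fun_eq_iff f_inv_into_f)
    then show ?thesis by (simp add: P_def partial_deriv_specialize[OF e] eval_specialize c(2))
  qed
  then have jac: "jacobian_at P (\<lambda>x. s (e x)) \<noteq> 0" using f(2) by (simp add: jacobian_at_def)
  have P: "P i \<in> hom_part (\<alpha> (f i))" for i unfolding P_def by (rule specialize_hom[OF R])
  have "(\<Sum>i\<in>UNIV. \<alpha> (f i)) = sum \<alpha> (range f)" by (simp add: sum.reindex[OF f(1)] comp_def)
  also have "\<dots> \<le> sum \<alpha> UNIV" by (rule sum_mono2) auto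
  finally have deg': "(\<Sum>i\<in>UNIV. \<alpha> (f i)) - CARD('l) \<le> r" using deg by linarith
  have "idl.span (range P) = vanishing V \<and> (\<forall>i. 1 \<le> \<alpha> (f i)) \<and> (\<forall>q\<in>V. jacobian_at P q \<noteq> 0)"
  proof (rule ci_of_separator_degrees[OF V(1) _ P _ p jac deg'])
    show "q None = 1" if "q \<in> V" for q using V(2) that by blast
    show "eval_poly q (P i) = 0" if "q \<in> V" for q i using zero[OF that] by (simp add: P_def eval_specialize)
    show "\<not> separator V q d g" if "q \<in> V" "d < r" for q d g using nosep[OF that] .
  qed
  then show ?thesis using P by (intro exI[of _ P] exI[of _ "\<lambda>i. \<alpha> (f i)"]) simp
qed


section \<open>Points with normalized coordinates\<close>

lemma represents_normalize:
  assumes "represents u P" "u x \<noteq> 0"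
  shows "represents (\<lambda>y. 1 / u x * u y) P" "1 / u x * u x = 1"
  using represents_scale[OF assms(1), of "1 / u x"] assms(2) by simp_all

text \<open>
  If \<open>X\<^sub>0\<close> vanished at a point \<open>P\<close> of the first factor, then \<open>X\<^sub>0\<close> times a form that is nonzero only at \<open>P\<close> would be in the ideal,
  so \<open>X\<^sub>0\<close> would be a zero divisor. The same argument for \<open>Y\<^sub>0\<close> takes place modulo \<open>X\<^sub>0\<close>.
\<close>

lemma normalized_representatives:
  fixes X :: "('k::field_char_0, 'm::finite option, 'n::finite option) bipoint set"
  assumes X: "X \<subseteq> projective_space \<times> projective_space" "finite X" "X \<noteq> {}" and prod: "X = fst ` X \<times> snd ` X"
    and coordinates: "ACM X \<Longrightarrow>
      regular_sequence (coord_ring X) [coord_residue X (Var (Inl None)), coord_residue X (Var (Inr None))]"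
  obtains u u' where "\<forall>P\<in>fst ` X. represents (u P) P \<and> u P None = 1"
    and "\<forall>Q\<in>snd ` X. represents (u' Q) Q \<and> u' Q None = 1"
proof -
  let ?Z1 = "fst ` X" and ?Z2 = "snd ` X"
  obtain u where u: "\<forall>P\<in>?Z1. represents (u P) P" using representatives[of ?Z1] X(1) by force
  obtain u' where u': "\<forall>Q\<in>?Z2. represents (u' Q) Q" using representatives[of ?Z2] X(1) by force
  let ?V1 = "u ` ?Z1" and ?V2 = "u' ` ?Z2"
  let ?W = "(\<lambda>(P, Q). (u P, u' Q)) ` X"
  let ?I = "bivanishing (?V1 \<times> ?V2)"
  have W: "?W = ?V1 \<times> ?V2" by (subst (1) prod) auto
  have "bi_vanishing_ideal X = bivanishing ?W" by (rule bi_vanishing_ideal_eq) (use u u' in force)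
  then have IX: "bi_vanishing_ideal X = ?I" unfolding W .
  have I: "idl.subspace ?I" by (rule subspace_bivanishing)
  have fin: "finite ?Z1" "finite ?Z2" using X(2) by simp_all
  have ne: "?Z1 \<noteq> {}" "?Z2 \<noteq> {}" using X(3) by simp_all
  have "ACM X" by (rule product_ACM[OF fin(1) ne(1) fin(2) ne(2) prod u u'])
  from coordinates[OF this]
  have "regular_sequence (poly_ring Quot ?I) (map (residue ?I) [Var (Inl None), Var (Inr None)])"
    unfolding coord_ring_def coord_residue_def IX by simp
  then have reg: "\<forall>i<2. \<forall>a. a * [Var (Inl None), Var (Inr None)] ! i \<in> idl.span (?I \<union> set (take i [Var (Inl None), Var (Inr None)])) \<longrightarrow>
      a \<in> idl.span (?I \<union> set (take i [Var (Inl None), Var (Inr None)]))"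
    unfolding regular_sequence_Quot[OF I] by (simp add: numeral_2_eq_2)
  have spI: "idl.span ?I = ?I" using I by (simp add: idl.span_eq_iff)
  have reg0: "a \<in> ?I" if "a * Var (Inl None) \<in> ?I" for a
    using reg[rule_format, of 0 a] that spI by simp
  have reg1: "a \<in> idl.span (?I \<union> {Var (Inl None)})" if "a * Var (Inr None) \<in> ?I" for a
  proof -
    have "a * Var (Inr None) \<in> idl.span (?I \<union> {Var (Inl None)})" using that by (intro idl.span_base) blast
    then show ?thesis using reg[rule_format, of 1 a] by simp
  qed
  have x0: "u P None \<noteq> 0" if P: "P \<in> ?Z1" for P
  proof
    assume 0: "u P None = 0"
    obtain g where g: "g \<in> hom_part (card ?Z1)" "eval_poly (u P) g \<noteq> 0" "\<forall>R\<in>?Z1 - {P}. eval_poly (u R) g = 0"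
      using separating_form_exists[OF fin(1) P u] by blast
    have gp: "g \<in> part (\<lambda>_. 1) (card ?Z1)" using g(1) by (simp add: hom_part_eq)
    have deg: "g * Var None \<in> hom_part (card ?Z1 + 1)"
      using part_mult[OF gp part_Var[of None "\<lambda>_. 1"]] unfolding hom_part_eq .
    have "eval_poly (u R) (g * Var None) = 0" if "R \<in> ?Z1" for R
      using g(3) 0 that by (cases "R = P") simp_all
    then have "emb Inl (g * Var None) \<in> ?I"
      unfolding bivanishing_bihom_iff[OF emb_Inl_bihom[OF deg]] by (auto simp del: emb_simps eval_mult)
    then have "emb Inl g \<in> ?I" using reg0[of "emb Inl g"] by simp
    moreover obtain Q where "Q \<in> ?Z2" using ne(2) by blast
    ultimately have "eval_pair (u P, u' Q) (emb Inl g) = 0"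
      using P unfolding bivanishing_bihom_iff[OF emb_Inl_bihom[OF g(1)]] by blast
    then show False using g(2) by simp
  qed
  have y0: "u' Q None \<noteq> 0" if Q: "Q \<in> ?Z2" for Q
  proof
    assume 0: "u' Q None = 0"
    obtain g where g: "g \<in> hom_part (card ?Z2)" "eval_poly (u' Q) g \<noteq> 0" "\<forall>R\<in>?Z2 - {Q}. eval_poly (u' R) g = 0"
      using separating_form_exists[OF fin(2) Q u'] by blast
    have gp: "g \<in> part (\<lambda>_. 1) (card ?Z2)" using g(1) by (simp add: hom_part_eq)
    have deg: "g * Var None \<in> hom_part (card ?Z2 + 1)"
      using part_mult[OF gp part_Var[of None "\<lambda>_. 1"]] unfolding hom_part_eq .
    have "eval_poly (u' R) (g * Var None) = 0" if "R \<in> ?Z2" for R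
      using g(3) 0 that by (cases "R = Q") simp_all
    then have "emb Inr (g * Var None) \<in> ?I"
      unfolding bivanishing_bihom_iff[OF emb_Inr_bihom[OF deg]] by (auto simp del: emb_simps eval_mult)
    then have a: "emb Inr g \<in> idl.span (?I \<union> {Var (Inl None)})" using reg1[of "emb Inr g"] by simp
    \<comment> \<open>Evaluation at \<open>(0, Q)\<close> kills the ideal and \<open>X\<^sub>0\<close>, but not \<open>g\<close>.\<close>
    let ?e = "eval_poly (case_sum (\<lambda>_. 0) (u' Q)) :: ('m option + 'n option, 'k) mpolynomial \<Rightarrow> 'k"
    have sub: "idl.subspace {f. ?e f = 0}" by (simp add: idl.subspace_def)
    have "eval_poly (u' Q) f = 0" if "f \<in> vanishing ?V2" for f
    proof -
      have "\<forall>c. c \<noteq> 0 \<longrightarrow> eval_poly (\<lambda>x. c * u' Q x) f = 0" using that Q unfolding vanishing_def by blast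
      from this[rule_format, of 1] show ?thesis by simp
    qed
    moreover have "eval_poly (\<lambda>_. 0) f = 0" if "f \<in> vanishing ?V1" for f
      using vanishing_eval_0[OF that] ne(1) by blast
    ultimately have "?I \<subseteq> {f. ?e f = 0}"
      unfolding bivanishing_product by (intro idl.span_minimal[OF _ sub]) (auto simp: eval_emb)
    then have "idl.span (?I \<union> {Var (Inl None)}) \<subseteq> {f. ?e f = 0}" by (intro idl.span_minimal[OF _ sub]) simp
    then have "?e (emb Inr g) = 0" using a by blast
    then show False using g(2) by (simp add: eval_emb)
  qed
  show ?thesis
  proof
    show "\<forall>P\<in>?Z1. represents (\<lambda>y. 1 / u P None * u P y) P \<and> 1 / u P None * u P None = 1"
    proof
      fix P assume "P \<in> ?Z1"
      then show "represents (\<lambda>y. 1 / u P None * u P y) P \<and> 1 / u P None * u P None = 1"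
        using represents_normalize[of "u P" P None] u x0[of P] by (intro conjI) blast+
    qed
    show "\<forall>Q\<in>?Z2. represents (\<lambda>y. 1 / u' Q None * u' Q y) Q \<and> 1 / u' Q None * u' Q None = 1"
    proof
      fix Q assume "Q \<in> ?Z2"
      then show "represents (\<lambda>y. 1 / u' Q None * u' Q y) Q \<and> 1 / u' Q None * u' Q None = 1"
        using represents_normalize[of "u' Q" Q None] u' y0[of Q] by (intro conjI) blast+
    qed
  qed
qed

lemma complete_intersection_family:
  fixes Z :: "('k::field_char_0, 'm::finite option) vec set set"
  assumes u: "\<forall>P\<in>Z. represents (u P) P" and ci: "complete_intersection Z ds" and ds: "\<forall>d\<in>set ds. 1 \<le> d"
  shows "\<exists>F a. (\<forall>i :: 'm. F i \<in> hom_part (a i) \<and> 1 \<le> a i) \<and> idl.span (range F) = vanishing (u ` Z)"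
proof -
  obtain Fs where F: "list_all2 (\<lambda>F d. F \<in> hom_part d) Fs ds" "proj_vanishing_ideal Z = idl.span (set Fs)"
    and len: "length ds = CARD('m)"
    using ci unfolding complete_intersection_def genideal_poly_ring by blast
  have lenF: "length Fs = CARD('m)" using F(1) len by (simp add: list_all2_lengthD)
  obtain h where h: "bij_betw h (UNIV :: 'm set) {0..<CARD('m)}" using ex_bij_betw_finite_nat[OF finite] by blast
  have hlt: "h i < CARD('m)" for i using bij_betwE[OF h] by simp
  have "range (\<lambda>i. Fs ! h i) = (!) Fs ` {0..<length Fs}"
    using bij_betw_imp_surj_on[OF h] lenF by (metis image_image)
  also have "\<dots> = set Fs" by (auto simp: set_conv_nth)
  finally have "idl.span (range (\<lambda>i. Fs ! h i)) = vanishing (u ` Z)" using F(2) proj_vanishing_ideal_eq[OF u] by simp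
  moreover have "Fs ! h i \<in> hom_part (ds ! h i) \<and> 1 \<le> ds ! h i" for i
    using list_all2_nthD[OF F(1), of "h i"] hlt[of i] lenF len ds by simp
  ultimately show ?thesis by (intro exI[of _ "\<lambda>i. Fs ! h i"] exI[of _ "\<lambda>i. ds ! h i"]) simp
qed

lemma family_complete_intersection:
  fixes Z :: "('k::field_char_0, 'm::finite option) vec set set"
  assumes u: "\<forall>P\<in>Z. represents (u P) P" and Z: "finite Z" "Z \<noteq> {}"
    and P: "\<forall>i :: 'm. P i \<in> hom_part (a i) \<and> 1 \<le> a i" and gen: "idl.span (range P) = vanishing (u ` Z)"
    and jac: "\<forall>q\<in>u ` Z. jacobian_at P q \<noteq> 0"
  shows "\<exists>ds. (\<forall>d\<in>set ds. d \<ge> 1) \<and> complete_intersection Z ds"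
proof -
  obtain ms :: "'m list" where ms: "set ms = UNIV" "distinct ms" using finite_distinct_list[OF finite] by blast
  have len: "length ms = CARD('m)" using distinct_card[OF ms(2)] ms(1) by simp
  have set_eq: "set (map P ms) = range P" using ms(1) by simp
  have "complete_intersection Z (map a ms)"
    unfolding complete_intersection_def regular_sequence_iff genideal_poly_ring
  proof (intro conjI exI[of _ "map P ms"])
    show "length (map a ms) = CARD('m)" using len by simp
    show "list_all2 (\<lambda>F d. F \<in> hom_part d) (map P ms) (map a ms)" using P by (simp add: list_all2_conv_all_nth)
    show "regular_list (map P ms)"
    proof (rule regular_of_expansions[OF _ _ _ gen _ ms(2)])
      show "finite (u ` Z)" using Z(1) by simp
    qed (use P jac in auto)
    show "idl.span (set (map P ms)) \<noteq> UNIV" unfolding set_eq gen by (rule vanishing_proper) (use Z(2) in auto)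
    show "proj_vanishing_ideal Z = idl.span (set (map P ms))" unfolding set_eq gen by (rule proj_vanishing_ideal_eq[OF u])
  qed
  then show ?thesis using P by (intro exI[of _ "map a ms"]) auto
qed


section \<open>The Cayley-Bacharach property of a product\<close>

lemma HF_delete:
  fixes X :: "('k::field_char_0, 'a::finite, 'b::finite) bipoint set"
  assumes X: "finite X" and u: "\<forall>(P, Q)\<in>X. represents (u P) P \<and> represents (u' Q) Q"
    and p: "p \<in> X" "X - {p} \<noteq> {}"
  defines "\<phi> \<equiv> \<lambda>(P, Q). (u P, u' Q)"
  shows "HF X i j = HF (X - {p}) i j + (if \<exists>g. biseparator (\<phi> ` X) (\<phi> p) i j g then 1 else 0)"
proof -
  have HF: "HF Y i j = piece_dim (bivanishing (\<phi> ` Y)) (carrier (poly_ring Quot bivanishing (\<phi> ` Y))) (bihom_part i j)"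
    if "Y \<subseteq> X" for Y
  proof -
    have "bi_vanishing_ideal Y = bivanishing (\<phi> ` Y)"
      unfolding \<phi>_def by (rule bi_vanishing_ideal_eq) (use u that in blast)
    then show ?thesis by (simp add: HF_def ideal_HF_def coord_ring_def)
  qed
  have "inj_on \<phi> X"
  proof (rule inj_onI)
    fix y z assume yz: "y \<in> X" "z \<in> X" "\<phi> y = \<phi> z"
    obtain P Q P' Q' where eq: "y = (P, Q)" "z = (P', Q')" by (cases y, cases z)
    have "represents (u P) P" "represents (u' Q) Q" "represents (u P') P'" "represents (u' Q') Q'"
      using u yz(1,2) unfolding eq by blast+
    moreover have "u P = u P'" "u' Q = u' Q'" using yz(3) unfolding eq \<phi>_def by simp_all
    ultimately show "y = z" unfolding eq using represents_unique by (metis (no_types))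
  qed
  then have img: "\<phi> ` (X - {p}) = \<phi> ` X - {\<phi> p}" using p(1) by (simp add: inj_on_image_set_diff)
  have "\<phi> ` X - {\<phi> p} \<noteq> {}" using p(2) unfolding img[symmetric] by simp
  then show ?thesis
    unfolding HF[OF order_refl] HF[OF Diff_subset] img
    by (rule piece_dim_delete[OF finite_imageI[OF X] imageI[OF p(1)]])
qed

text \<open>
  For a single point both sides hold trivially; this case is separate because deleting the point leaves the empty set, whose
  ideal is the whole ring.
\<close>

lemma Cayley_Bacharach_iff:
  fixes X :: "('k::field_char_0, 'a::finite, 'b::finite) bipoint set"
  assumes X: "finite X" and u: "\<forall>(P, Q)\<in>X. represents (u P) P \<and> represents (u' Q) Q"
  defines "W \<equiv> (\<lambda>(P, Q). (u P, u' Q)) ` X"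
  shows "Cayley_Bacharach X \<longleftrightarrow>
    (\<forall>p\<in>W. \<forall>q\<in>W. \<forall>i j. (\<exists>g. biseparator W p i j g) \<longleftrightarrow> (\<exists>g. biseparator W q i j g))"
proof (cases "\<exists>p. X = {p}")
  case True
  then show ?thesis by (auto simp: Cayley_Bacharach_def W_def)
next
  case False
  let ?\<phi> = "\<lambda>(P, Q). (u P, u' Q)"
  have del: "HF X i j = HF (X - {p}) i j + (if \<exists>g. biseparator W (?\<phi> p) i j g then 1 else 0)" if "p \<in> X" for p i j
    unfolding W_def by (rule HF_delete[OF X u that]) (use that False in blast)
  have "HF (X - {p}) = HF (X - {q}) \<longleftrightarrow>
      (\<forall>i j. (\<exists>g. biseparator W (?\<phi> p) i j g) \<longleftrightarrow> (\<exists>g. biseparator W (?\<phi> q) i j g))" if "p \<in> X" "q \<in> X" for p q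
  proof -
    have aux: "a = b + (if A then 1 else 0) \<Longrightarrow> a = c + (if B then 1 else 0) \<Longrightarrow> b = c \<longleftrightarrow> (A \<longleftrightarrow> B)"
      for a b c :: nat and A B by (auto split: if_splits)
    have "HF (X - {p}) i j = HF (X - {q}) i j \<longleftrightarrow>
        ((\<exists>g. biseparator W (?\<phi> p) i j g) \<longleftrightarrow> (\<exists>g. biseparator W (?\<phi> q) i j g))" for i j
      by (rule aux[OF del[OF that(1)] del[OF that(2)]])
    then show ?thesis by (simp add: fun_eq_iff)
  qed
  then show ?thesis unfolding Cayley_Bacharach_def W_def by (simp only: ball_simps image_iff cong: ball_cong)
qed

lemma separator_threshold:
  fixes V :: "('m::finite option \<Rightarrow> 'k::field) set"
  assumes V: "finite V" "\<forall>q\<in>V. q None = 1" and p: "p \<in> V"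
  shows "\<exists>r. \<forall>e. (\<exists>g. separator V p e g) \<longleftrightarrow> r \<le> e"
proof -
  let ?E = "\<lambda>e. \<exists>g. separator V p e g"
  have p1: "p None = 1" using V(2) p by blast
  have ex: "\<exists>e. ?E e" by (rule separator_exists[of V p, OF V p1])
  have "?E e \<longleftrightarrow> (LEAST e. ?E e) \<le> e" for e
  proof
    assume "?E e"
    then show "(LEAST e. ?E e) \<le> e" by (rule Least_le)
  next
    assume le: "(LEAST e. ?E e) \<le> e"
    obtain g where "separator V p (LEAST e. ?E e) g" using LeastI_ex[OF ex] by blast
    from separator_mult_Var[OF this p1, of "e - (LEAST e. ?E e)"] show "?E e" using le by auto
  qed
  then show ?thesis by (intro exI[of _ "LEAST e. ?E e"]) blast
qed

definition uniform_separator_degree :: "('v::finite \<Rightarrow> 'k::field) set \<Rightarrow> nat \<Rightarrow> bool" where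
  "uniform_separator_degree V r \<longleftrightarrow> (\<forall>p\<in>V. \<forall>e. (\<exists>g. separator V p e g) \<longleftrightarrow> r \<le> e)"

text \<open>
  In a bidegree whose second component is large enough, only the first factor decides about the existence of a separator on
  the product, and vice versa.
\<close>

lemma Cayley_Bacharach_product_iff:
  fixes V1 :: "('m::finite option \<Rightarrow> 'k::field) set" and V2 :: "('n::finite option \<Rightarrow> 'k) set"
  assumes V1: "finite V1" "V1 \<noteq> {}" "\<forall>q\<in>V1. q None = 1" and V2: "finite V2" "V2 \<noteq> {}" "\<forall>q\<in>V2. q None = 1"
  defines "W \<equiv> V1 \<times> V2"
  shows "(\<forall>p\<in>W. \<forall>q\<in>W. \<forall>i j. (\<exists>g. biseparator W p i j g) \<longleftrightarrow> (\<exists>g. biseparator W q i j g)) \<longleftrightarrow>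
    (\<exists>r. uniform_separator_degree V1 r) \<and> (\<exists>r. uniform_separator_degree V2 r)"
proof
  assume L: "\<forall>p\<in>W. \<forall>q\<in>W. \<forall>i j. (\<exists>g. biseparator W p i j g) \<longleftrightarrow> (\<exists>g. biseparator W q i j g)"
  obtain p0 where p0: "p0 \<in> V1" using V1(2) by blast
  obtain q0 where q0: "q0 \<in> V2" using V2(2) by blast
  obtain r1 where r1: "\<And>e. (\<exists>g. separator V1 p0 e g) \<longleftrightarrow> r1 \<le> e" using separator_threshold[OF V1(1,3) p0] by blast
  obtain r2 where r2: "\<And>e. (\<exists>g. separator V2 q0 e g) \<longleftrightarrow> r2 \<le> e" using separator_threshold[OF V2(1,3) q0] by blast
  have *: "(\<exists>g. separator V1 p i g) \<and> (\<exists>g. separator V2 q j g) \<longleftrightarrow> r1 \<le> i \<and> r2 \<le> j" if "p \<in> V1" "q \<in> V2" for p q i j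
  proof -
    have "(p, q) \<in> W" "(p0, q0) \<in> W" using that p0 q0 by (simp_all add: W_def)
    then have "(\<exists>g. biseparator W (p, q) i j g) \<longleftrightarrow> (\<exists>g. biseparator W (p0, q0) i j g)" using L by blast
    then show ?thesis unfolding W_def biseparator_product_iff[OF that] biseparator_product_iff[OF p0 q0] r1 r2 .
  qed
  have "uniform_separator_degree V1 r1"
    using *[OF _ q0, of _ _ r2] r2[of r2] unfolding uniform_separator_degree_def by simp
  moreover have "uniform_separator_degree V2 r2"
    using *[OF p0, of _ r1] r1[of r1] unfolding uniform_separator_degree_def by simp
  ultimately show "(\<exists>r. uniform_separator_degree V1 r) \<and> (\<exists>r. uniform_separator_degree V2 r)" by blast
next
  assume "(\<exists>r. uniform_separator_degree V1 r) \<and> (\<exists>r. uniform_separator_degree V2 r)"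
  then obtain r1 r2 where r: "uniform_separator_degree V1 r1" "uniform_separator_degree V2 r2" by blast
  have "(\<exists>g. biseparator W (p, q) i j g) \<longleftrightarrow> r1 \<le> i \<and> r2 \<le> j" if "p \<in> V1" "q \<in> V2" for p q i j
    using r that unfolding uniform_separator_degree_def W_def biseparator_product_iff[OF that] by simp
  then show "\<forall>p\<in>W. \<forall>q\<in>W. \<forall>i j. (\<exists>g. biseparator W p i j g) \<longleftrightarrow> (\<exists>g. biseparator W q i j g)"
    unfolding W_def by auto
qed


section \<open>The Kaehler different of a product\<close>

text \<open>
  The Kaehler different is defined with some system of generators \<open>B\<close>. For a product there is one, so
  \<open>B\<close> may be taken as given from here on.
\<close>

lemma kaehler_different_nonzero:
  fixes X :: "('k::field_char_0, 'm::finite option, 'n::finite option) bipoint set"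
  assumes V1: "finite V1" "V1 \<noteq> {}" "\<forall>q\<in>V1. q None = 1" and V2: "finite V2" "V2 \<noteq> {}" "\<forall>q\<in>V2. q None = 1"
    and IX: "bi_vanishing_ideal X = bivanishing (V1 \<times> V2)"
  obtains B where "finite B" and "\<forall>f\<in>B. \<exists>i j. f \<in> bihom_part i j" and "idl.span B = bivanishing (V1 \<times> V2)"
    and "\<And>i j. ideal_HF X (kaehler_different X) i j \<noteq> 0 \<longleftrightarrow>
      (\<exists>f\<in>bihom_part i j. f \<in> idl.span (B \<union> jacobian_minors B) \<and> f \<notin> bivanishing (V1 \<times> V2))"
proof -
  let ?W = "V1 \<times> V2"
  let ?I = "bivanishing ?W"
  define B where "B = (SOME B. bihom_generators X B)"
  have iff: "bihom_generators X B \<longleftrightarrow> finite B \<and> (\<forall>f\<in>B. \<exists>i j. f \<in> bihom_part i j) \<and> idl.span B = ?I" for B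
    unfolding bihom_generators_def IX genideal_poly_ring ..
  have "\<exists>B. bihom_generators X B"
    unfolding iff by (rule bivanishing_product_finite_generators[OF V1(1,3) V2(1,3)])
  then have "bihom_generators X B" unfolding B_def by (rule someI_ex)
  then have B: "finite B" "\<forall>f\<in>B. \<exists>i j. f \<in> bihom_part i j" "idl.span B = ?I" unfolding iff by blast+
  have I: "idl.subspace ?I" by (rule subspace_bivanishing)
  have J: "idl.span (?I \<union> jacobian_minors B) = idl.span (B \<union> jacobian_minors B)"
    unfolding B(3)[symmetric] by (simp only: idl.span_Un idl.span_span)
  have K: "kaehler_different X = residue ?I ` idl.span (B \<union> jacobian_minors B)"
    unfolding kaehler_different_def coord_ring_def coord_residue_def IX B_def[symmetric] genideal_Quot[OF I] J ..
  have sub: "?I \<subseteq> idl.span (B \<union> jacobian_minors B)" unfolding B(3)[symmetric] by (rule idl.span_mono) blast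
  have "ideal_HF X (kaehler_different X) i j \<noteq> 0 \<longleftrightarrow>
      (\<exists>f\<in>bihom_part i j. f \<in> idl.span (B \<union> jacobian_minors B) \<and> f \<notin> ?I)" for i j
    unfolding ideal_HF_def IX K
    by (rule piece_dim_nonzero_iff[OF _ _ idl.subspace_span sub]) (use V1 V2 in auto)
  then show ?thesis using that[OF B] by blast
qed

text \<open>
  The witness is the Jacobian determinant of the generators of the complete intersection.
\<close>

lemma kaehler_different_of_ci:
  fixes F :: "'m::finite \<Rightarrow> ('m option, 'k::field_char_0) mpolynomial" and G :: "'n::finite \<Rightarrow> ('n option, 'k) mpolynomial"
  assumes V1: "finite V1" "V1 \<noteq> {}" "\<forall>q\<in>V1. q None = 1" and V2: "finite V2" "V2 \<noteq> {}" "\<forall>q\<in>V2. q None = 1"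
    and F: "\<forall>i. F i \<in> hom_part (a i)" "idl.span (range F) = vanishing V1"
    and G: "\<forall>i. G i \<in> hom_part (b i)" "idl.span (range G) = vanishing V2"
    and B: "finite B" "idl.span B = bivanishing (V1 \<times> V2)"
  shows "\<exists>f\<in>bihom_part (sum a UNIV - CARD('m)) (sum b UNIV - CARD('n)).
    f \<in> idl.span (B \<union> jacobian_minors B) \<and> f \<notin> bivanishing (V1 \<times> V2)"
proof -
  let ?H = "case_sum (\<lambda>i. emb Inl (F i)) (\<lambda>j. emb Inr (G j)) :: 'm + 'n \<Rightarrow> ('m option + 'n option, 'k) mpolynomial"
  let ?D = "det (\<chi> k c. partial_deriv (map_sum Some Some c) (?H k))"
  have "?H k \<in> bihom_part (case_sum a (\<lambda>_. 0) k) (case_sum (\<lambda>_. 0) b k)" for k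
    using F(1) G(1) by (cases k) (simp_all add: emb_Inl_bihom emb_Inr_bihom)
  then have "?D \<in> bihom_part (sum (case_sum a (\<lambda>_. 0)) (UNIV :: ('m + 'n) set) - CARD('m)) (sum (case_sum (\<lambda>_. 0) b) (UNIV :: ('m + 'n) set) - CARD('n))"
    by (rule bigraded_det)
  then have D: "?D \<in> bihom_part (sum a UNIV - CARD('m)) (sum b UNIV - CARD('n))" by (simp add: sum_UNIV_Plus)
  have H: "?H k \<in> idl.span B" for k
  proof (cases k)
    case (Inl i)
    have "F i \<in> vanishing V1" unfolding F(2)[symmetric] by (intro idl.span_base) blast
    then have "emb Inl (F i) \<in> idl.span (emb Inl ` vanishing V1 \<union> emb Inr ` vanishing V2)" by (intro idl.span_base) blast
    then show ?thesis unfolding B(2) bivanishing_product Inl by simp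
  next
    case (Inr i)
    have "G i \<in> vanishing V2" unfolding G(2)[symmetric] by (intro idl.span_base) blast
    then have "emb Inr (G i) \<in> idl.span (emb Inl ` vanishing V1 \<union> emb Inr ` vanishing V2)" by (intro idl.span_base) blast
    then show ?thesis unfolding B(2) bivanishing_product Inr by simp
  qed
  have "?D \<in> idl.span (B \<union> jacobian_minors B)"
    by (rule jacobian_in_minor_ideal[OF idl.subspace_span B(1) _ _ H])
      (use idl.span_superset[of "B \<union> jacobian_minors B"] in blast)+
  moreover have "?D \<notin> bivanishing (V1 \<times> V2)"
  proof -
    obtain p q where pq: "p \<in> V1" "q \<in> V2" using V1(2) V2(2) by blast
    have "jacobian_at F p \<noteq> 0" by (rule ci_jacobian_nonzero[OF V1(1) _ F(2) _ pq(1)]) (use V1(3) F(1) in blast)+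
    moreover have "jacobian_at G q \<noteq> 0" by (rule ci_jacobian_nonzero[OF V2(1) _ G(2) _ pq(2)]) (use V2(3) G(1) in blast)+
    ultimately have "eval_pair (p, q) ?D \<noteq> 0" by (rule jacobian_of_product_nonzero)
    then show ?thesis unfolding bivanishing_bihom_iff[OF D] using pq by blast
  qed
  ultimately show ?thesis using D by blast
qed

text \<open>
  All generators in \<open>B\<close> vanish on \<open>W\<close>, so a nonzero value of \<open>f\<close> must come from a minor. The bidegree of a minor is that
  of the product of its rows, lowered by one for each column.
\<close>

lemma minor_of_small_bidegree:
  fixes B :: "('m::finite option + 'n::finite option, 'k::field) mpolynomial set"
  assumes B: "\<forall>f\<in>B. \<exists>i j. f \<in> bihom_part i j" "B \<subseteq> bivanishing W"
    and f: "f \<in> bihom_part r1 r2" "f \<in> idl.span (B \<union> jacobian_minors B)" "f \<notin> bivanishing W"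
  obtains p R \<alpha> \<beta> where "p \<in> W" and "\<And>k :: 'm + 'n. R k \<in> B" and "\<And>k. R k \<in> bihom_part (\<alpha> k) (\<beta> k)"
    and "eval_pair p (det (\<chi> k c. partial_deriv (map_sum Some Some c) (R k))) \<noteq> 0"
    and "sum \<alpha> UNIV - CARD('m) \<le> r1" and "sum \<beta> UNIV - CARD('n) \<le> r2"
proof -
  obtain p where p: "p \<in> W" "eval_pair p f \<noteq> 0" using f(3) unfolding bivanishing_bihom_iff[OF f(1)] by blast
  have "\<forall>f\<in>B. \<exists>d. f \<in> bihom_part (fst d) (snd d)" using B(1) by force
  from bchoice[OF this] obtain d where d: "\<And>f. f \<in> B \<Longrightarrow> f \<in> bihom_part (fst (d f)) (snd (d f))" by blast
  have zero: "eval_pair p f = 0" if "f \<in> B" for f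
    using B(2) that p(1) unfolding bivanishing_bihom_iff[OF d[OF that], symmetric] by (auto simp: bivanishing_bihom_iff[OF d[OF that]])
  let ?det = "\<lambda>R :: 'm + 'n \<Rightarrow> _. det (\<chi> k c. partial_deriv (map_sum Some Some c) (R k))"
  let ?deg1 = "\<lambda>R :: 'm + 'n \<Rightarrow> _. (\<Sum>k\<in>UNIV. fst (d (R k))) - CARD('m)"
  let ?deg2 = "\<lambda>R :: 'm + 'n \<Rightarrow> _. (\<Sum>k\<in>UNIV. snd (d (R k))) - CARD('n)"
  have "\<forall>x\<in>B \<union> jacobian_minors B. \<exists>i j. x \<in> bihom_part i j \<and>
      (eval_pair p x \<noteq> 0 \<longrightarrow> (\<exists>R. (\<forall>k. R k \<in> B) \<and> x = ?det R \<and> i = ?deg1 R \<and> j = ?deg2 R))"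
  proof
    fix x assume "x \<in> B \<union> jacobian_minors B"
    then consider "x \<in> B" | R where "inj R" "range R \<subseteq> B" "x = ?det R" unfolding jacobian_minors_def by blast
    then show "\<exists>i j. x \<in> bihom_part i j \<and>
      (eval_pair p x \<noteq> 0 \<longrightarrow> (\<exists>R. (\<forall>k. R k \<in> B) \<and> x = ?det R \<and> i = ?deg1 R \<and> j = ?deg2 R))"
    proof cases
      case 1
      then show ?thesis using d[OF 1] zero[OF 1] by blast
    next
      case 2
      have R: "\<forall>k. R k \<in> B" using 2(2) by blast
      have "?det R \<in> bihom_part (?deg1 R) (?deg2 R)" using R by (intro bigraded_det d) blast
      then show ?thesis unfolding 2(3) using R by blast
    qed
  qed
  from bchoice[OF this] obtain i where "\<forall>x\<in>B \<union> jacobian_minors B. \<exists>j. x \<in> bihom_part (i x) j \<and>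
      (eval_pair p x \<noteq> 0 \<longrightarrow> (\<exists>R. (\<forall>k. R k \<in> B) \<and> x = ?det R \<and> i x = ?deg1 R \<and> j = ?deg2 R))" by blast
  from bchoice[OF this] obtain j where ij: "\<forall>x\<in>B \<union> jacobian_minors B. x \<in> bihom_part (i x) (j x) \<and>
      (eval_pair p x \<noteq> 0 \<longrightarrow> (\<exists>R. (\<forall>k. R k \<in> B) \<and> x = ?det R \<and> i x = ?deg1 R \<and> j x = ?deg2 R))" by blast
  have "\<exists>x\<in>B \<union> jacobian_minors B. i x \<le> r1 \<and> j x \<le> r2 \<and> eval_pair p x \<noteq> 0"
    by (rule small_bidegree_generator[OF _ f(2,1) p(2)]) (use ij in blast)
  then obtain x where x: "x \<in> B \<union> jacobian_minors B" "i x \<le> r1" "j x \<le> r2" "eval_pair p x \<noteq> 0" by blast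
  obtain R where R: "\<forall>k. R k \<in> B" "x = ?det R" "i x = ?deg1 R" "j x = ?deg2 R" using ij x(1,4) by blast
  show ?thesis
  proof
    show "p \<in> W" by (rule p(1))
    show "R k \<in> B" for k using R(1) by blast
    show "R k \<in> bihom_part (fst (d (R k))) (snd (d (R k)))" for k using d R(1) by blast
    show "eval_pair p (?det R) \<noteq> 0" using x(4) R(2) by simp
    show "?deg1 R \<le> r1" "?deg2 R \<le> r2" using x(2,3) R(3,4) by simp_all
  qed
qed

lemma ci_of_kaehler_different:
  fixes V1 :: "('m::finite option \<Rightarrow> 'k::field_char_0) set" and V2 :: "('n::finite option \<Rightarrow> 'k) set"
  assumes V1: "finite V1" "\<forall>q\<in>V1. q None = 1" and V2: "finite V2" "\<forall>q\<in>V2. q None = 1"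
    and r: "uniform_separator_degree V1 r1" "uniform_separator_degree V2 r2"
    and B: "\<forall>f\<in>B. \<exists>i j. f \<in> bihom_part i j" "idl.span B = bivanishing (V1 \<times> V2)"
    and f: "f \<in> bihom_part r1 r2" "f \<in> idl.span (B \<union> jacobian_minors B)" "f \<notin> bivanishing (V1 \<times> V2)"
  shows "(\<exists>P a. (\<forall>i :: 'm. P i \<in> hom_part (a i) \<and> 1 \<le> a i) \<and> idl.span (range P) = vanishing V1 \<and> (\<forall>q\<in>V1. jacobian_at P q \<noteq> 0)) \<and>
    (\<exists>P a. (\<forall>i :: 'n. P i \<in> hom_part (a i) \<and> 1 \<le> a i) \<and> idl.span (range P) = vanishing V2 \<and> (\<forall>q\<in>V2. jacobian_at P q \<noteq> 0))"
proof -
  have BI: "B \<subseteq> bivanishing (V1 \<times> V2)" unfolding B(2)[symmetric] by (rule idl.span_superset)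
  obtain p R \<alpha> \<beta> where p: "p \<in> V1 \<times> V2" and RB: "\<And>k :: 'm + 'n. R k \<in> B" and R: "\<And>k. R k \<in> bihom_part (\<alpha> k) (\<beta> k)"
    and det: "eval_pair p (det (\<chi> k c. partial_deriv (map_sum Some Some c) (R k))) \<noteq> 0"
    and deg: "sum \<alpha> UNIV - CARD('m) \<le> r1" "sum \<beta> UNIV - CARD('n) \<le> r2"
    by (rule minor_of_small_bidegree[OF B(1) BI f]) blast
  let ?s = "case_sum (fst p) (snd p)"
  have fst_p: "fst p \<in> V1" and snd_p: "snd p \<in> V2" using p by auto
  have det': "det (\<chi> k c. eval_poly ?s (partial_deriv (map_sum Some Some c) (R k))) \<noteq> 0"
    using det unfolding eval_pair_def by (subst (asm) ring_morphism_det[OF ring_morphism_eval]) simp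
  have zero: "eval_poly (case_sum v w) (R k) = 0" if "v \<in> V1" "w \<in> V2" for v w k
  proof -
    have "R k \<in> bivanishing (V1 \<times> V2)" using RB BI by blast
    then have "\<forall>z\<in>V1 \<times> V2. eval_pair z (R k) = 0" unfolding bivanishing_bihom_iff[OF R] .
    then have "eval_pair (v, w) (R k) = 0" using that by blast
    then show ?thesis by (simp add: eval_pair_def)
  qed
  have "\<exists>P a. (\<forall>i :: 'm. P i \<in> hom_part (a i) \<and> 1 \<le> a i) \<and> idl.span (range P) = vanishing V1 \<and> (\<forall>q\<in>V1. jacobian_at P q \<noteq> 0)"
  proof (rule ci_of_specialized_rows[OF V1 inj_Inl, where c = Inl, OF _ inj_Inl _ det' _ _ deg(1)])
    show "(\<lambda>x. ?s (Inl x)) \<in> V1" using fst_p by simp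
    show "map_sum Some Some (Inl j) = Inl (Some j)" for j by simp
    have w: "(\<lambda>z. if z \<in> range Inl then 1 else 0) = wX"
      by (auto simp: fun_eq_iff split: sum.split)
    show "R k \<in> part (\<lambda>z. if z \<in> range Inl then 1 else 0) (\<alpha> k)" for k
      unfolding w using R[of k] by (simp add: bihom_part_eq)
    show "eval_poly (\<lambda>z. if z \<in> range Inl then v (inv_into UNIV Inl z) else ?s z) (R k) = 0" if "v \<in> V1" for v k
    proof -
      have "(\<lambda>z. if z \<in> range Inl then v (inv_into UNIV Inl z) else ?s z) = case_sum v (snd p)"
        by (auto simp: fun_eq_iff split: sum.split)
      then show ?thesis using zero[OF that snd_p] by simp
    qed
    show "\<not> separator V1 q d g" if "q \<in> V1" "d < r1" for q d g
      using r(1) that unfolding uniform_separator_degree_def by (meson not_le)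
  qed
  moreover have "\<exists>P a. (\<forall>i :: 'n. P i \<in> hom_part (a i) \<and> 1 \<le> a i) \<and> idl.span (range P) = vanishing V2 \<and> (\<forall>q\<in>V2. jacobian_at P q \<noteq> 0)"
  proof (rule ci_of_specialized_rows[OF V2 inj_Inr, where c = Inr, OF _ inj_Inr _ det' _ _ deg(2)])
    show "(\<lambda>x. ?s (Inr x)) \<in> V2" using snd_p by simp
    show "map_sum Some Some (Inr j) = Inr (Some j)" for j by simp
    have w: "(\<lambda>z. if z \<in> range Inr then 1 else 0) = wY"
      by (auto simp: fun_eq_iff split: sum.split)
    show "R k \<in> part (\<lambda>z. if z \<in> range Inr then 1 else 0) (\<beta> k)" for k
      unfolding w using R[of k] by (simp add: bihom_part_eq)
    show "eval_poly (\<lambda>z. if z \<in> range Inr then v (inv_into UNIV Inr z) else ?s z) (R k) = 0" if "v \<in> V2" for v k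
    proof -
      have "(\<lambda>z. if z \<in> range Inr then v (inv_into UNIV Inr z) else ?s z) = case_sum (fst p) v"
        by (auto simp: fun_eq_iff split: sum.split)
      then show ?thesis using zero[OF fst_p that] by simp
    qed
    show "\<not> separator V2 q d g" if "q \<in> V2" "d < r2" for q d g
      using r(2) that unfolding uniform_separator_degree_def by (meson not_le)
  qed
  ultimately show ?thesis by blast
qed


section \<open>The characterization\<close>

text \<open>
  Under either condition the separators of each factor start in one common degree, the regularity index: for complete
  intersections by \<open>separator_degrees_of_ci\<close>, otherwise by the Cayley-Bacharach property.
\<close>

lemma product_complete_intersection_iff:
  fixes X :: "('k::field_char_0, 'm::finite option, 'n::finite option) bipoint set"
  assumes X: "finite X" "X \<noteq> {}" and X_prod: "X = fst ` X \<times> snd ` X"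
    and u: "\<forall>P\<in>fst ` X. represents (u P) P \<and> u P None = 1" and u': "\<forall>Q\<in>snd ` X. represents (u' Q) Q \<and> u' Q None = 1"
  shows "(\<exists>ds ds'. (\<forall>d\<in>set ds. d \<ge> 1) \<and> (\<forall>d\<in>set ds'. d \<ge> 1) \<and>
      complete_intersection (fst ` X) ds \<and> complete_intersection (snd ` X) ds') \<longleftrightarrow>
    Cayley_Bacharach X \<and>
    ideal_HF X (kaehler_different X) (regularity_index (fst ` X)) (regularity_index (snd ` X)) \<noteq> 0"
proof -
  let ?Z1 = "fst ` X" and ?Z2 = "snd ` X"
  let ?V1 = "u ` ?Z1" and ?V2 = "u' ` ?Z2"
  have Z: "finite ?Z1" "?Z1 \<noteq> {}" "finite ?Z2" "?Z2 \<noteq> {}" using X by simp_all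
  have V1: "finite ?V1" "?V1 \<noteq> {}" "\<forall>q\<in>?V1. q None = 1" using Z u by auto
  have V2: "finite ?V2" "?V2 \<noteq> {}" "\<forall>q\<in>?V2. q None = 1" using Z u' by auto
  have u_rep: "\<forall>P\<in>?Z1. represents (u P) P" and u'_rep: "\<forall>Q\<in>?Z2. represents (u' Q) Q" using u u' by blast+
  have rep: "\<forall>(P, Q)\<in>X. represents (u P) P \<and> represents (u' Q) Q" using u u' by force
  have W: "(\<lambda>(P, Q). (u P, u' Q)) ` X = ?V1 \<times> ?V2" by (subst (1) X_prod) auto
  have IX: "bi_vanishing_ideal X = bivanishing (?V1 \<times> ?V2)" using bi_vanishing_ideal_eq[OF rep] unfolding W .
  have CB: "Cayley_Bacharach X \<longleftrightarrow> (\<exists>r. uniform_separator_degree ?V1 r) \<and> (\<exists>r. uniform_separator_degree ?V2 r)"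
    unfolding Cayley_Bacharach_iff[OF X(1) rep] W by (rule Cayley_Bacharach_product_iff[OF V1 V2])
  have reg1: "regularity_index ?Z1 = r" if "uniform_separator_degree ?V1 r" for r
    using regularity_index_eq[OF Z(1,2) u_rep] that unfolding uniform_separator_degree_def by blast
  have reg2: "regularity_index ?Z2 = r" if "uniform_separator_degree ?V2 r" for r
    using regularity_index_eq[OF Z(3,4) u'_rep] that unfolding uniform_separator_degree_def by blast
  obtain B where B: "finite B" "\<forall>f\<in>B. \<exists>i j. f \<in> bihom_part i j" "idl.span B = bivanishing (?V1 \<times> ?V2)"
    and K: "\<And>i j. ideal_HF X (kaehler_different X) i j \<noteq> 0 \<longleftrightarrow>
      (\<exists>f\<in>bihom_part i j. f \<in> idl.span (B \<union> jacobian_minors B) \<and> f \<notin> bivanishing (?V1 \<times> ?V2))"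
    by (rule kaehler_different_nonzero[OF V1 V2 IX]) blast
  show ?thesis
  proof
    assume "\<exists>ds ds'. (\<forall>d\<in>set ds. d \<ge> 1) \<and> (\<forall>d\<in>set ds'. d \<ge> 1) \<and> complete_intersection ?Z1 ds \<and> complete_intersection ?Z2 ds'"
    then obtain ds ds' where ds: "\<forall>d\<in>set ds. 1 \<le> d" "\<forall>d\<in>set ds'. 1 \<le> d" "complete_intersection ?Z1 ds" "complete_intersection ?Z2 ds'"
      by blast
    obtain F :: "'m \<Rightarrow> _" and a where F: "\<forall>i. F i \<in> hom_part (a i) \<and> 1 \<le> a i" "idl.span (range F) = vanishing ?V1"
      using complete_intersection_family[OF u_rep ds(3,1)] by blast
    obtain G :: "'n \<Rightarrow> _" and b where G: "\<forall>i. G i \<in> hom_part (b i) \<and> 1 \<le> b i" "idl.span (range G) = vanishing ?V2"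
      using complete_intersection_family[OF u'_rep ds(4,2)] by blast
    have s1: "uniform_separator_degree ?V1 (sum a UNIV - CARD('m))"
      unfolding uniform_separator_degree_def
    proof (intro ballI allI)
      fix p e assume p: "p \<in> ?V1"
      show "(\<exists>g. separator ?V1 p e g) \<longleftrightarrow> sum a UNIV - CARD('m) \<le> e"
        by (rule separator_degrees_of_ci[OF V1(1) _ V1(2) _ _ F(2) p]) (use V1(3) F(1) in blast)+
    qed
    have s2: "uniform_separator_degree ?V2 (sum b UNIV - CARD('n))"
      unfolding uniform_separator_degree_def
    proof (intro ballI allI)
      fix p e assume p: "p \<in> ?V2"
      show "(\<exists>g. separator ?V2 p e g) \<longleftrightarrow> sum b UNIV - CARD('n) \<le> e"
        by (rule separator_degrees_of_ci[OF V2(1) _ V2(2) _ _ G(2) p]) (use V2(3) G(1) in blast)+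
    qed
    have "\<forall>i. F i \<in> hom_part (a i)" "\<forall>i. G i \<in> hom_part (b i)" using F(1) G(1) by blast+
    then have "ideal_HF X (kaehler_different X) (sum a UNIV - CARD('m)) (sum b UNIV - CARD('n)) \<noteq> 0"
      unfolding K by (intro kaehler_different_of_ci[OF V1 V2 _ F(2) _ G(2) B(1,3)])
    then show "Cayley_Bacharach X \<and> ideal_HF X (kaehler_different X) (regularity_index ?Z1) (regularity_index ?Z2) \<noteq> 0"
      unfolding CB reg1[OF s1] reg2[OF s2] using s1 s2 by blast
  next
    assume R: "Cayley_Bacharach X \<and> ideal_HF X (kaehler_different X) (regularity_index ?Z1) (regularity_index ?Z2) \<noteq> 0"
    then obtain r1 r2 where r: "uniform_separator_degree ?V1 r1" "uniform_separator_degree ?V2 r2" unfolding CB by blast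
    have "ideal_HF X (kaehler_different X) r1 r2 \<noteq> 0" using R unfolding reg1[OF r(1)] reg2[OF r(2)] by blast
    then obtain f where f: "f \<in> bihom_part r1 r2" "f \<in> idl.span (B \<union> jacobian_minors B)" "f \<notin> bivanishing (?V1 \<times> ?V2)"
      unfolding K by blast
    note ci = ci_of_kaehler_different[OF V1(1,3) V2(1,3) r B(2,3) f]
    obtain P :: "'m \<Rightarrow> _" and a where P: "\<forall>i. P i \<in> hom_part (a i) \<and> 1 \<le> a i" "idl.span (range P) = vanishing ?V1"
      "\<forall>q\<in>?V1. jacobian_at P q \<noteq> 0" using conjunct1[OF ci] by (elim exE conjE) (rule that)
    obtain Q :: "'n \<Rightarrow> _" and b where Q: "\<forall>i. Q i \<in> hom_part (b i) \<and> 1 \<le> b i" "idl.span (range Q) = vanishing ?V2"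
      "\<forall>q\<in>?V2. jacobian_at Q q \<noteq> 0" using conjunct2[OF ci] by (elim exE conjE) (rule that)
    show "\<exists>ds ds'. (\<forall>d\<in>set ds. d \<ge> 1) \<and> (\<forall>d\<in>set ds'. d \<ge> 1) \<and> complete_intersection ?Z1 ds \<and> complete_intersection ?Z2 ds'"
      using family_complete_intersection[OF u_rep Z(1,2) P] family_complete_intersection[OF u'_rep Z(3,4) Q] by blast
  qed
qed

theorem theorem4p10:
  fixes X :: "('k::field_char_0, 'm::finite option, 'n::finite option) bipoint set"
  assumes "X \<subseteq> projective_space \<times> projective_space" and "finite X" and "X \<noteq> {}"
    and coordinates: "ACM X \<Longrightarrow>
      regular_sequence (coord_ring X)
        [coord_residue X (Var (Inl None)), coord_residue X (Var (Inr None))]"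
  shows
    "((\<exists>ds ds'. (\<forall>d\<in>set ds. d \<ge> 1) \<and> (\<forall>d\<in>set ds'. d \<ge> 1) \<and> bi_complete_intersection X ds ds')
      \<longleftrightarrow>
      X = fst ` X \<times> snd ` X \<and>
      (\<exists>ds ds'. (\<forall>d\<in>set ds. d \<ge> 1) \<and> (\<forall>d\<in>set ds'. d \<ge> 1) \<and>
         complete_intersection (fst ` X) ds \<and> complete_intersection (snd ` X) ds'))
     \<and>
     (X = fst ` X \<times> snd ` X \<and>
      (\<exists>ds ds'. (\<forall>d\<in>set ds. d \<ge> 1) \<and> (\<forall>d\<in>set ds'. d \<ge> 1) \<and>
         complete_intersection (fst ` X) ds \<and> complete_intersection (snd ` X) ds')
      \<longleftrightarrow>
      X = fst ` X \<times> snd ` X \<and> Cayley_Bacharach X \<and>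
      ideal_HF X (kaehler_different X) (regularity_index (fst ` X)) (regularity_index (snd ` X)) \<noteq> 0)"
    (is "(?a \<longleftrightarrow> ?prod \<and> ?ci) \<and> (?prod \<and> ?ci \<longleftrightarrow> ?prod \<and> ?CB \<and> ?K)")
proof
  show "?a \<longleftrightarrow> ?prod \<and> ?ci"
  proof
    assume ?a
    then obtain ds ds' where ds: "\<forall>d\<in>set ds. d \<ge> 1" "\<forall>d\<in>set ds'. d \<ge> 1" "bi_complete_intersection X ds ds'" by blast
    from bi_complete_intersection_imp_product[OF assms(1,2,3) this] ds(1,2) show "?prod \<and> ?ci" by blast
  next
    assume b: "?prod \<and> ?ci"
    then obtain ds ds' where ds: "\<forall>d\<in>set ds. d \<ge> 1" "\<forall>d\<in>set ds'. d \<ge> 1"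
      "complete_intersection (fst ` X) ds" "complete_intersection (snd ` X) ds'" by blast
    from product_imp_bi_complete_intersection[OF assms(1,3) conjunct1[OF b] ds(3,4)] ds(1,2) show ?a by blast
  qed
  have "?ci \<longleftrightarrow> ?CB \<and> ?K" if prod: ?prod
  proof -
    obtain u u' where u: "\<forall>P\<in>fst ` X. represents (u P) P \<and> u P None = 1"
      and u': "\<forall>Q\<in>snd ` X. represents (u' Q) Q \<and> u' Q None = 1"
      by (rule normalized_representatives[OF assms(1,2,3) prod coordinates])
    show ?thesis by (rule product_complete_intersection_iff[OF assms(2,3) prod u u'])
  qed
  then show "?prod \<and> ?ci \<longleftrightarrow> ?prod \<and> ?CB \<and> ?K" by blast
qed


end
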